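(* Let $(N,M)\in\mathbb Z_{\ge0}^2\setminus\{(0,0)\}$ and let $\lambda$ be a partition. For $L=0$ the quantum corner polynomial equals the super Macdonald polynomial: $$\mathfrak{QC}_\lambda(x_1,\dots,x_N;y_1,\dots,y_M;q,t)=\overline{SP}_\lambda(x_1,\dots,x_N;y_1,\dots,y_M;q,t).$$
   Context: $q,t$ are nonzero complex numbers such that $q^at^b=1$ with $a,b\in\mathbb Z$ only if $a=b=0$. Empty products are $1$. **Partitions.** A partition $\lambda$ is identified with its Young diagram ($\lambda_i$ boxes in row $i$); $\ell(\lambda)$ is the number of nonzero parts; $\lambda'$ is the transpose; for a box $s=(i,j)$, $a_\lambda(s)=\lambda_i-j$, $\ell_\lambda(s)=\lambda'_j-i$. **Quantum corner polynomial for $L=0$.** $\mathrm{RSSYTT}(N,M,0;\lambda)$ is the set of fillings $T$ of the boxes of $\lambda$ by elements of $\{1,\dots,N+M\}$ (ordinary numbers $1,\dots,N$; super numbers $N+1,\dots,N+M$) whose entries weakly decrease left to right in rows and top to bottom in columns, with ordinary numbers strictly decreasing down each column and super numbers strictly decreasing along each row. $T_0$, $T_1$ are the subdiagrams of ordinary and super entries, and $\mathrm{sh}(T_1)$ is the shape (a partition) of $T_1$. Let $\nu^{(k)}$ be the partition formed by the boxes with entry $\ge k$. Let $f_{q,t}(u)=(tu;q)_\infty/(qu;q)_\infty$, $(x;q)_\infty=\prod_{i\ge0}(1-xq^i)$ (only ratios $f_{q,t}(q^nu)/f_{q,t}(u)=\prod_{i=0}^{n-1}\frac{1-q^{i+1}u}{1-tq^iu}$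 occur and are read as these finite products), and for $\mu\subseteq\lambda$ $$\psi_{\lambda/\mu}(q,t)=\prod_{1\le i\le j\le\ell(\mu)}\frac{f_{q,t}(q^{\mu_i-\mu_j}t^{j-i})f_{q,t}(q^{\lambda_i-\lambda_{j+1}}t^{j-i})}{f_{q,t}(q^{\lambda_i-\mu_j}t^{j-i})f_{q,t}(q^{\mu_i-\lambda_{j+1}}t^{j-i})}.$$ Put $\psi_{T_0}(q,t)=\prod_{k=1}^N\psi_{\nu^{(k)}/\nu^{(k+1)}}(q,t)$, $\psi_{T_1'}(t,q)=\prod_{k=N+1}^{N+M}\psi_{(\nu^{(k)})'/(\nu^{(k+1)})'}(t,q)$ (with $q,t$ interchanged), and $H(\mu,q,t)=\prod_{s\in\mu}(q^{a_\mu(s)+1}-t^{\ell_\mu(s)})$. For $L=0$ the definition of the quantum corner polynomial reads $$\mathfrak{QC}_\lambda=\sum_{T\in\mathrm{RSSYTT}(N,M,0;\lambda)}\psi_{T_1'}(t,q)\,\psi_{T_0}(q,t)\,\frac{H(\mathrm{sh}(T_1),q,t^{-1})}{H(\mathrm{sh}(T_1)',t^{-1},q)}\,x_T,$$ where $x_T$ is the product over boxes of $x_{\text{entry}}$, with $x_{N+i}=y_i$. **Super Macdonald polynomial (Sergeev–Veselov).** Let $P_\lambda(q,t)$ be the Macdonald symmetric function and let $\phi$ be the algebra homomorphism from symmetric functions to polynomials in $x_1,\dots,x_N,y_1,\dots,y_M$ given on power sums by $\phi(p_r)=\sum_{i=1}^Nx_i^r+\frac{1-q^r}{1-t^{-r}}\sum_{j=1}^My_j^r$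 ($r\ge1$). Then $\overline{SP}_\lambda(x_1,\dots,x_N;y_1,\dots,y_M;q,t)=\phi(P_\lambda(q,t))$. *)

theory Defs
  imports Complex_Main "HOL-Library.Poly_Mapping" "HOL-Library.FuncSet" "HOL-Library.Multiset"
begin

definition generic_parameters :: "complex \<Rightarrow> complex \<Rightarrow> bool" where
  "generic_parameters q t \<longleftrightarrow> q \<noteq> 0 \<and> t \<noteq> 0 \<and>
     (\<forall>a b :: int. q powi a * t powi b = 1 \<longrightarrow> a = 0 \<and> b = 0)"


section \<open>Partitions\<close>

text \<open>A partition is the list of its nonzero parts, so its length is the number of nonzero parts.
  Rows and columns are numbered from 1.\<close>

definition is_partition :: "nat list \<Rightarrow> bool" where
  "is_partition lam \<longleftrightarrow> sorted_wrt (\<ge>) lam \<and> 0 \<notin> set lam"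

definition part :: "nat list \<Rightarrow> nat \<Rightarrow> nat" where
  "part lam i = (if 1 \<le> i \<and> i \<le> length lam then lam ! (i - 1) else 0)"

definition diagram :: "nat list \<Rightarrow> (nat \<times> nat) set" where
  "diagram lam = {(i, j). 1 \<le> i \<and> i \<le> length lam \<and> 1 \<le> j \<and> j \<le> part lam i}"

definition shape :: "(nat \<times> nat) set \<Rightarrow> nat list" where
  "shape S = (THE mu. is_partition mu \<and> diagram mu = S)"

definition transpose_partition :: "nat list \<Rightarrow> nat list" where
  "transpose_partition lam =
     map (\<lambda>j. card {i \<in> {1..length lam}. j \<le> part lam i}) [1..<Suc (part lam 1)]"

text \<open>Truncated subtraction is exact in the next two definitions for boxes of the diagram.\<close>

definition arm :: "nat list \<Rightarrow> nat \<times> nat \<Rightarrow> nat" where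
  "arm lam s = part lam (fst s) - snd s"

definition leg :: "nat list \<Rightarrow> nat \<times> nat \<Rightarrow> nat" where
  "leg lam s = part (transpose_partition lam) (snd s) - fst s"

definition dominated :: "nat list \<Rightarrow> nat list \<Rightarrow> bool" where
  "dominated mu lam \<longleftrightarrow> sum_list mu = sum_list lam \<and>
     (\<forall>k. (\<Sum>i=1..k. part mu i) \<le> (\<Sum>i=1..k. part lam i))"


section \<open>Symmetric functions over the complex numbers\<close>

text \<open>A formal power series in countably many variables is given by its coefficients; an exponent
  vector is a finitely supported function. The series below form the ring of symmetric functions
  if they are of bounded degree and invariant under permutation of the variables.\<close>

type_synonym series = "(nat \<Rightarrow>\<^sub>0 nat) \<Rightarrow> complex"

definition total_degree :: "(nat \<Rightarrow>\<^sub>0 nat) \<Rightarrow> nat" where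
  "total_degree m = (\<Sum>i\<in>Poly_Mapping.keys m. Poly_Mapping.lookup m i)"

definition symmetric_functions :: "series set" where
  "symmetric_functions = {f.
     (\<exists>d. \<forall>m. f m \<noteq> 0 \<longrightarrow> total_degree m \<le> d) \<and>
     (\<forall>\<pi> m. bij \<pi> \<longrightarrow> f (Poly_Mapping.map_key \<pi> m) = f m)}"

definition series_add :: "series \<Rightarrow> series \<Rightarrow> series" where
  "series_add f g = (\<lambda>m. f m + g m)"

definition series_scale :: "complex \<Rightarrow> series \<Rightarrow> series" where
  "series_scale c f = (\<lambda>m. c * f m)"

definition series_one :: series where
  "series_one = (\<lambda>m. if m = 0 then 1 else 0)"

definition series_mult :: "series \<Rightarrow> series \<Rightarrow> series" where
  "series_mult f g = (\<lambda>m. \<Sum>(a, b)\<in>{(a, b). a + b = m}. f a * g b)"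

lemma finite_series_mult_index: "finite {(a, b :: nat \<Rightarrow>\<^sub>0 nat). a + b = m}"
proof -
  let ?F = "{f. \<forall>i. f i \<in> {..Poly_Mapping.lookup m i} \<and> (i \<notin> Poly_Mapping.keys m \<longrightarrow> f i = 0)}"
  have "?F \<subseteq> {f. \<forall>i. (i \<in> Poly_Mapping.keys m \<longrightarrow> f i \<in> {..\<Sum>k\<in>Poly_Mapping.keys m. Poly_Mapping.lookup m k})
                 \<and> (i \<notin> Poly_Mapping.keys m \<longrightarrow> f i = 0)}"
    by (force intro: order_trans[OF _ member_le_sum])
  then have fin: "finite ?F"
    by (rule finite_subset) (rule finite_set_of_finite_funs, auto)
  have "finite (Poly_Mapping.lookup -` ?F)"
    by (rule finite_vimageI[OF fin]) (auto intro: injI simp: lookup_inject)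
  moreover have "{(a, b :: nat \<Rightarrow>\<^sub>0 nat). a + b = m}
      \<subseteq> (Poly_Mapping.lookup -` ?F) \<times> (Poly_Mapping.lookup -` ?F)"
    by (auto simp: lookup_add in_keys_iff)
  ultimately show ?thesis
    by (meson finite_SigmaI finite_subset)
qed

definition power_sum :: "nat \<Rightarrow> series" where
  "power_sum r = (\<lambda>m. if \<exists>i. m = Poly_Mapping.single i r then 1 else 0)"

definition power_sum_partition :: "nat list \<Rightarrow> series" where
  "power_sum_partition lam = foldr (\<lambda>r f. series_mult (power_sum r) f) lam series_one"

definition monomial_symmetric :: "nat list \<Rightarrow> series" where
  "monomial_symmetric lam = (\<lambda>m.
     if image_mset (Poly_Mapping.lookup m) (mset_set (Poly_Mapping.keys m)) = mset lam
     then 1 else 0)"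


section \<open>Macdonald symmetric functions\<close>

definition macdonald_norm :: "complex \<Rightarrow> complex \<Rightarrow> nat list \<Rightarrow> complex" where
  "macdonald_norm q t lam =
     (\<Prod>r\<in>set lam. of_nat (r ^ count_list lam r * fact (count_list lam r))) *
     (\<Prod>r\<leftarrow>lam. (1 - q ^ r) / (1 - t ^ r))"

text \<open>The bilinear form making the power sums indexed by partitions orthogonal, with the squared
  norms above. Functions with a domain are taken extensional so that they are determined by their
  defining properties.\<close>

definition macdonald_form :: "complex \<Rightarrow> complex \<Rightarrow> series \<times> series \<Rightarrow> complex" where
  "macdonald_form q t = (THE B. B \<in> extensional (symmetric_functions \<times> symmetric_functions) \<and>
     (\<forall>f\<in>symmetric_functions. \<forall>g\<in>symmetric_functions. \<forall>h\<in>symmetric_functions. \<forall>c.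
        B (series_add f g, h) = B (f, h) + B (g, h) \<and>
        B (h, series_add f g) = B (h, f) + B (h, g) \<and>
        B (series_scale c f, h) = c * B (f, h) \<and>
        B (h, series_scale c f) = c * B (h, f)) \<and>
     (\<forall>lam mu. is_partition lam \<longrightarrow> is_partition mu \<longrightarrow>
        B (power_sum_partition lam, power_sum_partition mu) =
          (if lam = mu then macdonald_norm q t lam else 0)))"

text \<open>The family of Macdonald functions is characterised, as usual, by unitriangularity with
  respect to the monomial symmetric functions in dominance order, and orthogonality.\<close>

definition macdonald_P :: "complex \<Rightarrow> complex \<Rightarrow> nat list \<Rightarrow> series" where
  "macdonald_P q t = (THE P. P \<in> extensional {lam. is_partition lam} \<and>
     (\<forall>lam. is_partition lam \<longrightarrow>
        (\<exists>u :: nat list \<Rightarrow> complex. P lam = (\<lambda>m. monomial_symmetric lam m +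
           (\<Sum>mu\<in>{mu. is_partition mu \<and> dominated mu lam \<and> mu \<noteq> lam}.
              u mu * monomial_symmetric mu m)))) \<and>
     (\<forall>lam mu. is_partition lam \<longrightarrow> is_partition mu \<longrightarrow> lam \<noteq> mu \<longrightarrow>
        macdonald_form q t (P lam, P mu) = 0))"

lemma finite_dominated: "finite {mu. is_partition mu \<and> dominated mu lam \<and> mu \<noteq> lam}"
proof -
  have len: "length mu \<le> sum_list mu" if "0 \<notin> set mu" for mu :: "nat list"
    using that by (induction mu) auto
  have "{mu. is_partition mu \<and> dominated mu lam \<and> mu \<noteq> lam}
      \<subseteq> {mu. set mu \<subseteq> {..sum_list lam} \<and> length mu \<le> sum_list lam}"
    using len by (auto simp: is_partition_def dominated_def dest: member_le_sum_list) (metis len)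
  then show ?thesis
    by (rule finite_subset) (rule finite_lists_length_le, simp)
qed


section \<open>Super Macdonald polynomials\<close>

text \<open>Polynomials in the variables with index \<open>1, \<dots>, N + M\<close>, the variable with index \<open>N + j\<close> being
  \<open>y\<^sub>j\<close>. They live in the polynomial ring with countably many variables.\<close>

type_synonym polynomial = "(nat \<Rightarrow>\<^sub>0 nat) \<Rightarrow>\<^sub>0 complex"

definition polyconst :: "complex \<Rightarrow> polynomial" where
  "polyconst c = Poly_Mapping.single 0 c"

definition polyvar :: "nat \<Rightarrow> polynomial" where
  "polyvar i = Poly_Mapping.single (Poly_Mapping.single i 1) 1"

definition sv_hom :: "nat \<Rightarrow> nat \<Rightarrow> complex \<Rightarrow> complex \<Rightarrow> series \<Rightarrow> polynomial" where
  "sv_hom N M q t = (THE \<phi>. \<phi> \<in> extensional symmetric_functions \<and>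
     (\<forall>f\<in>symmetric_functions. \<forall>g\<in>symmetric_functions.
        \<phi> (series_add f g) = \<phi> f + \<phi> g \<and> \<phi> (series_mult f g) = \<phi> f * \<phi> g) \<and>
     (\<forall>c. \<forall>f\<in>symmetric_functions. \<phi> (series_scale c f) = polyconst c * \<phi> f) \<and>
     \<phi> series_one = 1 \<and>
     (\<forall>r\<ge>1. \<phi> (power_sum r) = (\<Sum>i=1..N. polyvar i ^ r) +
        polyconst ((1 - q ^ r) / (1 - inverse t ^ r)) * (\<Sum>j=1..M. polyvar (N + j) ^ r)))"

definition super_macdonald ::
    "nat \<Rightarrow> nat \<Rightarrow> complex \<Rightarrow> complex \<Rightarrow> nat list \<Rightarrow> polynomial" where
  "super_macdonald N M q t lam = sv_hom N M q t (macdonald_P q t lam)"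


section \<open>Quantum corner polynomials for \<open>L = 0\<close>\<close>

text \<open>Functions from the diagram to the entries are extensional, so each filling is counted once.\<close>

definition RSSYTT :: "nat \<Rightarrow> nat \<Rightarrow> nat list \<Rightarrow> (nat \<times> nat \<Rightarrow> nat) set" where
  "RSSYTT N M lam = {T \<in> diagram lam \<rightarrow>\<^sub>E {1..N + M}.
     (\<forall>i j j'. (i, j) \<in> diagram lam \<longrightarrow> (i, j') \<in> diagram lam \<longrightarrow> j < j' \<longrightarrow>
        T (i, j) \<ge> T (i, j') \<and>
        (N < T (i, j) \<longrightarrow> N < T (i, j') \<longrightarrow> T (i, j) > T (i, j'))) \<and>
     (\<forall>i i' j. (i, j) \<in> diagram lam \<longrightarrow> (i', j) \<in> diagram lam \<longrightarrow> i < i' \<longrightarrow>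
        T (i, j) \<ge> T (i', j) \<and>
        (T (i, j) \<le> N \<longrightarrow> T (i', j) \<le> N \<longrightarrow> T (i, j) > T (i', j)))}"

lemma finite_diagram: "finite (diagram lam)"
proof -
  have "diagram lam \<subseteq> (SIGMA i:{1..length lam}. {1..part lam i})"
    by (auto simp: diagram_def)
  then show ?thesis
    by (rule finite_subset) simp
qed

lemma finite_RSSYTT: "finite (RSSYTT N M lam)"
  unfolding RSSYTT_def
  by (rule finite_subset[of _ "diagram lam \<rightarrow>\<^sub>E {1..N + M}"]) (auto intro: finite_PiE finite_diagram)

text \<open>The partition formed by the boxes with entry at least \<open>k\<close>. As the entries decrease, the
  boxes with super entries are those with entry at least \<open>N + 1\<close>.\<close>

definition nu :: "nat list \<Rightarrow> (nat \<times> nat \<Rightarrow> nat) \<Rightarrow> nat \<Rightarrow> nat list" where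
  "nu lam T k = shape {s \<in> diagram lam. k \<le> T s}"

definition super_shape :: "nat \<Rightarrow> nat list \<Rightarrow> (nat \<times> nat \<Rightarrow> nat) \<Rightarrow> nat list" where
  "super_shape N lam T = shape {s \<in> diagram lam. N < T s}"

text \<open>\<open>f_ratio q t n u\<close> is the quotient of \<open>f\<^bsub>q,t\<^esub>(q\<^sup>n u)\<close> by \<open>f\<^bsub>q,t\<^esub>(u)\<close>, where \<open>f\<^bsub>q,t\<^esub>(u)\<close> is the quotient
  of the infinite products \<open>(tu; q)\<close> and \<open>(qu; q)\<close>, which themselves need not converge.\<close>

definition f_ratio :: "complex \<Rightarrow> complex \<Rightarrow> nat \<Rightarrow> complex \<Rightarrow> complex" where
  "f_ratio q t n u = (\<Prod>k<n. (1 - q ^ (k + 1) * u) / (1 - t * q ^ k * u))"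

text \<open>The factor for \<open>i \<le> j\<close> in the formula for \<open>\<psi>\<close> is the product of
  \<open>f(q^(\<lambda>\<^sub>i - \<lambda>\<^sub>j\<^sub>+\<^sub>1) t^(j-i)) / f(q^(\<mu>\<^sub>i - \<lambda>\<^sub>j\<^sub>+\<^sub>1) t^(j-i))\<close> and of the inverse of
  \<open>f(q^(\<lambda>\<^sub>i - \<mu>\<^sub>j) t^(j-i)) / f(q^(\<mu>\<^sub>i - \<mu>\<^sub>j) t^(j-i))\<close>; both are ratios
  with \<open>n = \<lambda>\<^sub>i - \<mu>\<^sub>i\<close>, a natural number if \<open>\<mu> \<subseteq> \<lambda>\<close>.\<close>

definition psi :: "complex \<Rightarrow> complex \<Rightarrow> nat list \<Rightarrow> nat list \<Rightarrow> complex" where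
  "psi q t lam mu = (\<Prod>(i, j)\<in>{(i, j). 1 \<le> i \<and> i \<le> j \<and> j \<le> length mu}.
     f_ratio q t (part lam i - part mu i)
       (q powi (int (part mu i) - int (part lam (j + 1))) * t ^ (j - i)) /
     f_ratio q t (part lam i - part mu i)
       (q powi (int (part mu i) - int (part mu j)) * t ^ (j - i)))"

definition psi_ordinary ::
    "nat \<Rightarrow> complex \<Rightarrow> complex \<Rightarrow> nat list \<Rightarrow> (nat \<times> nat \<Rightarrow> nat) \<Rightarrow> complex" where
  "psi_ordinary N q t lam T = (\<Prod>k=1..N. psi q t (nu lam T k) (nu lam T (k + 1)))"

text \<open>The first parameter below is the one in the role of \<open>q\<close>: the quantity written
  \<open>\<psi>(t, q)\<close>, with the parameters interchanged, is obtained by passing \<open>t q\<close>.\<close>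

definition psi_super ::
    "nat \<Rightarrow> nat \<Rightarrow> complex \<Rightarrow> complex \<Rightarrow> nat list \<Rightarrow> (nat \<times> nat \<Rightarrow> nat) \<Rightarrow> complex" where
  "psi_super N M a b lam T = (\<Prod>k=N+1..N+M.
     psi a b (transpose_partition (nu lam T k)) (transpose_partition (nu lam T (k + 1))))"

definition H :: "nat list \<Rightarrow> complex \<Rightarrow> complex \<Rightarrow> complex" where
  "H mu q t = (\<Prod>s\<in>diagram mu. q ^ (arm mu s + 1) - t ^ leg mu s)"

definition quantum_corner ::
    "nat \<Rightarrow> nat \<Rightarrow> complex \<Rightarrow> complex \<Rightarrow> nat list \<Rightarrow> polynomial" where
  "quantum_corner N M q t lam = (\<Sum>T\<in>RSSYTT N M lam.
     polyconst (psi_super N M t q lam T * psi_ordinary N q t lam T *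
       (H (super_shape N lam T) q (inverse t) /
        H (transpose_partition (super_shape N lam T)) (inverse t) q)) *
     (\<Prod>s\<in>diagram lam. polyvar (T s)))"

end

theory Submission
  imports Defs "Jordan_Normal_Form.Determinant" "HOL-Computational_Algebra.Formal_Power_Series"
    "HOL-Library.Countable_Set"
begin

text \<open>Multiplication by the elementary symmetric functions expands in a family \<open>Q\<close> indexed by
  partitions by the Pieri rule with the coefficients \<open>\<psi>'\<close> of vertical strips. As a partition is
  obtained from the one without its first column by the longest strip, this rule determines \<open>Q\<close>
  recursively. So a homomorphism carries one such Pieri family to another as soon as it is right on the
  elementary functions, equivalently on the power sums.

  Adding an ordinary variable to a Pieri family (summing over horizontal strips with weight \<open>\<psi>\<close>), or a
  super variable (summing over vertical strips with weight \<open>\<psi>'\<close> and a ratio of norms), gives a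
  Pieri family again, and changes the power sums as in the definition of \<open>\<phi>\<close>. This amounts to
  commutation relations between the branching matrices; they come from two expansions of
  determinants of Cauchy type, in the points \<open>q^(\<lambda>\<^sub>i) t^(-i)\<close>.

  Adding ordinary variables only, one obtains symmetric functions that are triangular by the branching
  rule. They are orthogonal because the adjoint of multiplication by the elementary functions is the
  addition of a super variable. So they are the Macdonald functions. The quantum corner
  polynomial arises from the empty filling by adding \<open>M\<close> super variables and then \<open>N\<close> ordinary
  ones; hence it is the image of the Macdonald function under \<open>\<phi>\<close>.\<close>

section \<open>Cauchy determinants\<close>

text \<open>Shapes enter only through the nodes \<open>q ^ r i / t ^ i\<close>. For two shapes close
  enough to admit any intermediate shape, a violated interlacing condition makes a linear factor in
  two nodes vanish; so a sum over strips is a sum over all subsets of rows, which is what a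
  determinant expansion produces. The commutation of \<open>emat\<close> with \<open>cmat\<close> is
  not read off from a determinant. Determinants relate an ordinary variable to each of the two
  vertical-strip matrices. Adding the ordinary variable \<open>-q/t\<close> and the super variable
  \<open>1\<close> (normalised as in \<open>cstep\<close>) gives the same power sums as adding
  \<open>-1/t\<close> and \<open>1/t\<close>; this relation, together with triangularity and
  genericity, carries the commutation over from \<open>bmat\<close> to \<open>cmat\<close>. The
  bilinear form, the Macdonald family and the homomorphism are specified as unique objects, so each
  must be constructed and shown unique. This happens in the polynomial ring in the power sums, where
  a homomorphism is given by free choice of its values on the variables. The ratio of the two
  \<open>H\<close>-products is a power of \<open>-t\<close> over an inverse norm; hence the super
  weights telescope and a super variable \<open>y\<close> enters as \<open>-t y\<close>.\<close>

lemma det_mat_scale: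
  fixes A :: "nat \<Rightarrow> nat \<Rightarrow> complex"
  shows "det (mat n n (\<lambda>(i, j). r i * c j * A i j)) =
    (\<Prod>i<n. r i) * (\<Prod>j<n. c j) * det (mat n n (\<lambda>(i, j). A i j))"
proof -
  have "det (mat n n (\<lambda>(i, j). r i * c j * A i j)) =
      (\<Sum>p\<in>{p. p permutes {0..<n}}. signof p * (\<Prod>i = 0..<n. r i * c (p i) * A i (p i)))"
    by (subst det_def'[of _ n]) (auto intro!: sum.cong prod.cong simp: permutes_in_image)
  also have "\<dots> = (\<Sum>p\<in>{p. p permutes {0..<n}}.
      (\<Prod>i<n. r i) * (\<Prod>j<n. c j) * (signof p * (\<Prod>i = 0..<n. A i (p i))))"
  proof (rule sum.cong[OF refl])
    fix p assume "p \<in> {p. p permutes {0..<n}}"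
    then have "(\<Prod>i = 0..<n. c (p i)) = (\<Prod>j = 0..<n. c j)"
      using prod.permute[of p "{0..<n}" c] by (simp add: o_def)
    then show "signof p * (\<Prod>i = 0..<n. r i * c (p i) * A i (p i)) =
        (\<Prod>i<n. r i) * (\<Prod>j<n. c j) * (signof p * (\<Prod>i = 0..<n. A i (p i)))"
      by (simp add: prod.distrib atLeast0LessThan)
  qed
  also have "\<dots> = (\<Prod>i<n. r i) * (\<Prod>j<n. c j) * det (mat n n (\<lambda>(i, j). A i j))"
    by (subst det_def'[of _ n])
       (auto simp: sum_distrib_left permutes_in_image intro!: sum.cong prod.cong)
  finally show ?thesis .
qed

text \<open>Multilinearity: each term of the Leibniz formula is a product over rows, and expanding
  its binomials selects the set \<open>I\<close> of rows in which the second summand is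
  taken.\<close>

lemma det_mat_rows_add:
  fixes f g :: "nat \<Rightarrow> nat \<Rightarrow> complex"
  shows "det (mat n n (\<lambda>(i, j). f i j + w * g i j)) =
    (\<Sum>I\<in>Pow {..<n}. w ^ card I * det (mat n n (\<lambda>(i, j). if i \<in> I then g i j else f i j)))"
proof -
  have "det (mat n n (\<lambda>(i, j). f i j + w * g i j)) =
      (\<Sum>p\<in>{p. p permutes {0..<n}}. signof p * (\<Prod>i\<in>{..<n}. w * g i (p i) + f i (p i)))"
    by (subst det_def'[of _ n])
       (auto intro!: sum.cong prod.cong simp: permutes_in_image atLeast0LessThan add.commute)
  also have "\<dots> = (\<Sum>p\<in>{p. p permutes {0..<n}}. \<Sum>I\<in>Pow {..<n}.
      w ^ card I * (signof p * (\<Prod>i = 0..<n. if i \<in> I then g i (p i) else f i (p i))))"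
  proof (rule sum.cong[OF refl])
    fix p
    show "signof p * (\<Prod>i\<in>{..<n}. w * g i (p i) + f i (p i)) = (\<Sum>I\<in>Pow {..<n}.
      w ^ card I * (signof p * (\<Prod>i = 0..<n. if i \<in> I then g i (p i) else f i (p i))))"
      unfolding prod_add[OF finite_lessThan] sum_distrib_left
    proof (rule sum.cong[OF refl])
      fix I assume "I \<in> Pow {..<n}"
      then have I: "I \<subseteq> {..<n}" by simp
      then have fin: "finite I" by (rule finite_subset) simp
      have "(\<Prod>i<n. if i \<in> I then g i (p i) else f i (p i)) =
          (\<Prod>i\<in>I. g i (p i)) * (\<Prod>i\<in>{..<n} - I. f i (p i))"
      proof -
        have "{..<n} = I \<union> ({..<n} - I)" using I by auto
        then have "(\<Prod>i<n. if i \<in> I then g i (p i) else f i (p i)) =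
          (\<Prod>i\<in>I. if i \<in> I then g i (p i) else f i (p i)) *
          (\<Prod>i\<in>{..<n} - I. if i \<in> I then g i (p i) else f i (p i))"
          using fin by (metis (no_types, lifting) Diff_disjoint finite_Diff finite_lessThan prod.union_disjoint)
        moreover have "(\<Prod>i\<in>{..<n} - I. if i \<in> I then g i (p i) else f i (p i)) =
          (\<Prod>i\<in>{..<n} - I. f i (p i))"
          by (rule prod.cong) auto
        ultimately show ?thesis by simp
      qed
      then show "signof p * ((\<Prod>x\<in>I. w * g x (p x)) * (\<Prod>x\<in>{..<n} - I. f x (p x))) =
         w ^ card I * (signof p * (\<Prod>i = 0..<n. if i \<in> I then g i (p i) else f i (p i)))"
        by (simp add: prod.distrib atLeast0LessThan)
    qed
  qed
  also have "\<dots> = (\<Sum>I\<in>Pow {..<n}. w ^ card I *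
      det (mat n n (\<lambda>(i, j). if i \<in> I then g i j else f i j)))"
    by (subst sum.swap, rule sum.cong[OF refl], subst det_def'[of _ n])
       (auto simp: sum_distrib_left permutes_in_image intro!: sum.cong prod.cong)
  finally show ?thesis .
qed

lemma det_mat_transpose:
  fixes A :: "nat \<Rightarrow> nat \<Rightarrow> complex"
  shows "det (mat n n (\<lambda>(i, j). A i j)) = det (mat n n (\<lambda>(i, j). A j i))"
proof -
  have "mat n n (\<lambda>(i, j). A j i) = transpose_mat (mat n n (\<lambda>(i, j). A i j))"
    by (rule eq_matI) auto
  then show ?thesis by (simp add: det_transpose[of _ n])
qed

lemma det_mat_cols_add:
  fixes f g :: "nat \<Rightarrow> nat \<Rightarrow> complex"
  shows "det (mat n n (\<lambda>(i, j). f i j + w * g i j)) =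
    (\<Sum>J\<in>Pow {..<n}. w ^ card J * det (mat n n (\<lambda>(i, j). if j \<in> J then g i j else f i j)))"
  using det_mat_rows_add[of n "\<lambda>i j. f j i" w "\<lambda>i j. g j i"]
  by (subst det_mat_transpose) (subst (2) det_mat_transpose, simp)

text \<open>Block factorization with pivot \<open>A n n\<close>: the Schur complement is the top
  left block of the upper triangular factor, and the lower triangular factor has determinant
  1.\<close>

lemma det_schur:
  fixes A :: "nat \<Rightarrow> nat \<Rightarrow> complex"
  assumes d: "A n n \<noteq> 0"
  shows "det (mat (Suc n) (Suc n) (\<lambda>(i, j). A i j)) =
    A n n * det (mat n n (\<lambda>(i, j). A i j - A i n * A n j / A n n))"
proof -
  let ?S = "mat n n (\<lambda>(i, j). A i j - A i n * A n j / A n n)"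
  let ?B = "mat n 1 (\<lambda>(i, j). A i n)"
  let ?D = "mat 1 1 (\<lambda>(i, j). A n n)"
  let ?E = "mat 1 n (\<lambda>(i, j). A n j / A n n)"
  let ?U = "four_block_mat ?S ?B (0\<^sub>m 1 n) ?D"
  let ?V = "four_block_mat (1\<^sub>m n) (0\<^sub>m n 1) ?E (1\<^sub>m 1)"
  have "?U * ?V = four_block_mat (?S * 1\<^sub>m n + ?B * ?E) (?S * 0\<^sub>m n 1 + ?B * 1\<^sub>m 1)
      (0\<^sub>m 1 n * 1\<^sub>m n + ?D * ?E) (0\<^sub>m 1 n * 0\<^sub>m n 1 + ?D * 1\<^sub>m 1)"
    by (rule mult_four_block_mat) auto
  also have "\<dots> = mat (Suc n) (Suc n) (\<lambda>(i, j). A i j)"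
    using d by (intro eq_matI) (auto simp: scalar_prod_def less_Suc_eq)
  finally have "det (mat (Suc n) (Suc n) (\<lambda>(i, j). A i j)) = det (?U * ?V)" by simp
  also have "\<dots> = det ?U * det ?V"
    by (rule det_mult[of _ "n + 1"]) auto
  also have "det ?U = det ?S * A n n"
    by (subst det_four_block_mat_lower_left_zero[of _ n _ 1]) (auto simp: det_single)
  also have "det ?V = 1"
    by (subst det_four_block_mat_upper_right_zero[of _ n _ 1]) auto
  finally show ?thesis by simp
qed

text \<open>The nodes of the columns are points of the projective line: for \<open>b j = 0\<close> the column is constant.\<close>

lemma cauchy_det:
  fixes u a b :: "nat \<Rightarrow> complex"
  assumes "\<And>i j. i < n \<Longrightarrow> j < n \<Longrightarrow> a j - b j * u i \<noteq> 0"
  shows "det (mat n n (\<lambda>(i, j). 1 / (a j - b j * u i))) * (\<Prod>i<n. \<Prod>j<n. a j - b j * u i) =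
    (\<Prod>k<n. \<Prod>i<k. (u i - u k) * (a k * b i - a i * b k))"
  using assms
proof (induction n)
  case 0
  then show ?case by simp
next
  case (Suc n)
  let ?z = "\<lambda>i j. a j - b j * u i"
  let ?r = "\<lambda>i. (u i - u n) / ?z i n"
  let ?c = "\<lambda>j. (a n * b j - a j * b n) / ?z n j"
  have nz: "?z i j \<noteq> 0" if "i \<le> n" "j \<le> n" for i j
    using Suc.prems that by auto
  have ent: "1 / ?z i j - 1 / ?z i n * (1 / ?z n j) / (1 / ?z n n) = ?r i * ?c j * (1 / ?z i j)"
    if "i < n" "j < n" for i j
  proof -
    \<comment> \<open>This relation makes the Schur complement of a Cauchy matrix a Cauchy matrix
      again, up to one factor for each row and one for each column.\<close>
    have "?z i n * ?z n j - ?z n n * ?z i j = (u i - u n) * (a n * b j - a j * b n)"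
      by (simp add: algebra_simps)
    moreover have "1 / ?z i j - 1 / ?z i n * (1 / ?z n j) / (1 / ?z n n) =
       (?z i n * ?z n j - ?z n n * ?z i j) / (?z i j * ?z i n * ?z n j)"
      using nz[of i j] nz[of i n] nz[of n j] nz[of n n] that by (simp add: divide_simps)
    ultimately show ?thesis by simp
  qed
  have "det (mat (Suc n) (Suc n) (\<lambda>(i, j). 1 / ?z i j)) =
      1 / ?z n n * det (mat n n (\<lambda>(i, j). 1 / ?z i j - 1 / ?z i n * (1 / ?z n j) / (1 / ?z n n)))"
    using nz[of n n] by (subst det_schur) auto
  also have "mat n n (\<lambda>(i, j). 1 / ?z i j - 1 / ?z i n * (1 / ?z n j) / (1 / ?z n n)) =
      mat n n (\<lambda>(i, j). ?r i * ?c j * (1 / ?z i j))"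
    by (rule eq_matI) (simp_all only: dim_row_mat dim_col_mat index_mat split ent)
  also have "det \<dots> = (\<Prod>i<n. ?r i) * (\<Prod>j<n. ?c j) * det (mat n n (\<lambda>(i, j). 1 / ?z i j))"
    by (rule det_mat_scale)
  finally have D: "det (mat (Suc n) (Suc n) (\<lambda>(i, j). 1 / ?z i j)) =
    1 / ?z n n * ((\<Prod>i<n. ?r i) * (\<Prod>j<n. ?c j) * det (mat n n (\<lambda>(i, j). 1 / ?z i j)))" .
  have R: "(\<Prod>i<n. ?r i) * (\<Prod>i<n. ?z i n) = (\<Prod>i<n. u i - u n)"
    unfolding prod.distrib[symmetric] using nz by (intro prod.cong) auto
  have C: "(\<Prod>j<n. ?c j) * (\<Prod>j<n. ?z n j) = (\<Prod>j<n. a n * b j - a j * b n)"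
    unfolding prod.distrib[symmetric] using nz by (intro prod.cong) auto
  have P: "(\<Prod>i<Suc n. \<Prod>j<Suc n. ?z i j) =
      (\<Prod>i<n. \<Prod>j<n. ?z i j) * (\<Prod>i<n. ?z i n) * (\<Prod>j<n. ?z n j) * ?z n n"
    by (simp add: prod.distrib mult_ac)
  have IH: "det (mat n n (\<lambda>(i, j). 1 / ?z i j)) * (\<Prod>i<n. \<Prod>j<n. ?z i j) =
      (\<Prod>k<n. \<Prod>i<k. (u i - u k) * (a k * b i - a i * b k))"
    by (rule Suc.IH) (use Suc.prems in auto)
  have "det (mat (Suc n) (Suc n) (\<lambda>(i, j). 1 / ?z i j)) * (\<Prod>i<Suc n. \<Prod>j<Suc n. ?z i j) =
     ((\<Prod>i<n. ?r i) * (\<Prod>i<n. ?z i n)) * ((\<Prod>j<n. ?c j) * (\<Prod>j<n. ?z n j)) *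
     (det (mat n n (\<lambda>(i, j). 1 / ?z i j)) * (\<Prod>i<n. \<Prod>j<n. ?z i j))"
    unfolding D P using nz[of n n] by (simp add: mult_ac)
  also have "\<dots> = (\<Prod>k<Suc n. \<Prod>i<k. (u i - u k) * (a k * b i - a i * b k))"
    unfolding R C IH by (simp add: prod.distrib)
  finally show ?case .
qed

section \<open>Perturbation arguments for coinciding nodes\<close>

lemma isCont_eq_at:
  fixes f g :: "complex \<Rightarrow> complex"
  assumes "isCont f a" "isCont g a" "\<forall>\<^sub>F x in at a. f x = g x"
  shows "f a = g a"
proof -
  have "(f \<longlongrightarrow> f a) (at a)" "(g \<longlongrightarrow> g a) (at a)"
    using assms(1,2) by (auto simp: isCont_def)
  then have "(g \<longlongrightarrow> f a) (at a)"
    using assms(3) by (simp add: tendsto_cong)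
  then show ?thesis
    using \<open>(g \<longlongrightarrow> g a) (at a)\<close> by (rule tendsto_unique[OF at_neq_bot])
qed

lemma eventually_at_notin_finite:
  fixes a :: complex
  assumes "finite B"
  shows "\<forall>\<^sub>F x in at a. x \<notin> B"
proof -
  have "open (- (B - {a}))" using assms by (intro open_Compl finite_imp_closed) auto
  then show ?thesis
    unfolding eventually_at_topological by (intro exI[of _ "- (B - {a})"]) auto
qed

text \<open>Each coincidence determines \<open>s\<close>, so only finitely many values of
  \<open>s\<close> are excluded. Scaling nonzero nodes by \<open>1 + s\<close> thus makes a
  determinant identity applicable near \<open>s = 0\<close>, and continuity gives it at
  \<open>s = 0\<close>.\<close>

lemma eventually_scaled_neq:
  fixes x y :: "nat \<Rightarrow> complex"
  assumes "\<And>i. i < n \<Longrightarrow> x i \<noteq> 0"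
  shows "\<forall>\<^sub>F s in at 0. \<forall>i<n. \<forall>j<m. (1 + s) * x i \<noteq> y j"
proof -
  let ?B = "(\<lambda>(i, j). y j / x i - 1) ` ({..<n} \<times> {..<m})"
  have "\<forall>\<^sub>F s in at 0. s \<notin> ?B" by (rule eventually_at_notin_finite) simp
  then show ?thesis
  proof (rule eventually_mono, safe)
    fix s i j assume *: "s \<notin> ?B" "i < n" "j < m" "(1 + s) * x i = y j"
    then have "s = y j / x i - 1" using assms[of i] by (auto simp: field_simps)
    then show False using * by auto
  qed
qed

section \<open>The kernel identity and the Wronski identity\<close>

lemma sum_Pow_lessThan_Suc:
  fixes F :: "nat set \<Rightarrow> 'a::comm_monoid_add"
  shows "(\<Sum>J\<in>Pow {..<Suc m}. F J) = (\<Sum>J\<in>Pow {..<m}. F J + F (insert m J))"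
proof -
  have "Pow {..<Suc m} = Pow {..<m} \<union> insert m ` Pow {..<m}"
    by (simp add: lessThan_Suc Pow_insert)
  moreover have "inj_on (insert m) (Pow {..<m})"
    by (rule inj_onI) (metis PowD insert_ident lessThan_iff less_irrefl subsetD)
  moreover have "Pow {..<m} \<inter> insert m ` Pow {..<m} = {}" by auto
  ultimately show ?thesis
    by (simp add: sum.union_disjoint sum.reindex sum.distrib)
qed

text \<open>The kernel function identity for Macdonald's difference operators, with one variable less on
  the right: both sides are expansions of the determinant with entries
  \<open>1 / (N j - t X i) + w / (N j - q X i)\<close> and last column \<open>1 + w\<close>, along rows and along columns.\<close>

lemma kernel_identity_generic:
  fixes X N :: "nat \<Rightarrow> complex" and q t w :: complex
  assumes nt: "\<And>i j. i < Suc m \<Longrightarrow> j < m \<Longrightarrow> N j - t * X i \<noteq> 0"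
    and nq: "\<And>i j. i < Suc m \<Longrightarrow> j < m \<Longrightarrow> N j - q * X i \<noteq> 0"
  shows "(\<Sum>I\<in>Pow {..<Suc m}. w ^ card I *
      ((\<Prod>k<Suc m. \<Prod>i<k. (if i \<in> I then q else t) * X i - (if k \<in> I then q else t) * X k) *
       (\<Prod>k<m. \<Prod>i<k. N k - N i) *
       (\<Prod>i<Suc m. \<Prod>j<m. N j - (if i \<in> I then t else q) * X i))) =
    (1 + w) * (\<Sum>J\<in>Pow {..<m}. w ^ card J *
      ((\<Prod>k<Suc m. \<Prod>i<k. X i - X k) *
       (\<Prod>k<m. \<Prod>i<k. N k * (if i \<in> J then q else t) - N i * (if k \<in> J then q else t)) *
       (\<Prod>j<m. if j \<in> J then q else t) *
       (\<Prod>i<Suc m. \<Prod>j<m. N j - (if j \<in> J then t else q) * X i)))"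
proof -
  let ?n = "Suc m"
  let ?f = "\<lambda>i j. if j < m then 1 / (N j - t * X i) else 1"
  let ?g = "\<lambda>i j. if j < m then 1 / (N j - q * X i) else 1"
  let ?D = "det (mat ?n ?n (\<lambda>(i, j). ?f i j + w * ?g i j))"
  let ?P = "(\<Prod>i<?n. \<Prod>j<m. (N j - t * X i) * (N j - q * X i))"
  \<comment> \<open>Column \<open>m\<close> has its node at infinity: \<open>a = 1\<close> and
    \<open>b = 0\<close> give a constant column. This is how there can be one node \<open>N\<close>
    less than there are nodes \<open>X\<close>.\<close>
  let ?a = "\<lambda>j. if j < m then N j else 1"
  let ?c = "\<lambda>S i. if i \<in> S then q else t"
  let ?d = "\<lambda>S i. if i \<in> S then t else q"
  have rows: "det (mat ?n ?n (\<lambda>(i, j). if i \<in> I then ?g i j else ?f i j)) * ?P =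
      (\<Prod>k<?n. \<Prod>i<k. ?c I i * X i - ?c I k * X k) * (\<Prod>k<m. \<Prod>i<k. N k - N i) *
      (\<Prod>i<?n. \<Prod>j<m. N j - ?d I i * X i)" for I
  proof -
    let ?b = "\<lambda>j. if j < m then 1 else 0"
    let ?u = "\<lambda>i. ?c I i * X i"
    have M: "mat ?n ?n (\<lambda>(i, j). if i \<in> I then ?g i j else ?f i j) =
        mat ?n ?n (\<lambda>(i, j). 1 / (?a j - ?b j * ?u i))"
      by (rule eq_matI) auto
    have "det (mat ?n ?n (\<lambda>(i, j). 1 / (?a j - ?b j * ?u i))) * (\<Prod>i<?n. \<Prod>j<?n. ?a j - ?b j * ?u i) =
        (\<Prod>k<?n. \<Prod>i<k. (?u i - ?u k) * (?a k * ?b i - ?a i * ?b k))"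
      by (rule cauchy_det) (use nt nq in \<open>auto simp: less_Suc_eq\<close>)
    moreover have "(\<Prod>i<?n. \<Prod>j<?n. ?a j - ?b j * ?u i) = (\<Prod>i<?n. \<Prod>j<m. N j - ?u i)"
      by simp
    moreover have "(\<Prod>k<?n. \<Prod>i<k. (?u i - ?u k) * (?a k * ?b i - ?a i * ?b k)) =
        (\<Prod>k<?n. \<Prod>i<k. ?u i - ?u k) * (\<Prod>k<m. \<Prod>i<k. N k - N i)"
      by (simp add: prod.distrib)
    moreover have "?P = (\<Prod>i<?n. \<Prod>j<m. N j - ?u i) * (\<Prod>i<?n. \<Prod>j<m. N j - ?d I i * X i)"
      unfolding prod.distrib[symmetric] by (intro prod.cong refl) auto
    ultimately show ?thesis unfolding M by simp
  qed
  have cols: "det (mat ?n ?n (\<lambda>(i, j). if j \<in> J then ?g i j else ?f i j)) * ?P =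
      (\<Prod>k<?n. \<Prod>i<k. X i - X k) * (\<Prod>k<m. \<Prod>i<k. N k * ?c J i - N i * ?c J k) * (\<Prod>j<m. ?c J j) *
      (\<Prod>i<?n. \<Prod>j<m. N j - ?d J j * X i)" for J
  proof -
    let ?b = "\<lambda>j. if j < m then ?c J j else 0"
    have M: "mat ?n ?n (\<lambda>(i, j). if j \<in> J then ?g i j else ?f i j) =
        mat ?n ?n (\<lambda>(i, j). 1 / (?a j - ?b j * X i))"
      by (rule eq_matI) auto
    have "det (mat ?n ?n (\<lambda>(i, j). 1 / (?a j - ?b j * X i))) * (\<Prod>i<?n. \<Prod>j<?n. ?a j - ?b j * X i) =
        (\<Prod>k<?n. \<Prod>i<k. (X i - X k) * (?a k * ?b i - ?a i * ?b k))"
      by (rule cauchy_det) (use nt nq in \<open>auto simp: less_Suc_eq\<close>)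
    moreover have "(\<Prod>i<?n. \<Prod>j<?n. ?a j - ?b j * X i) = (\<Prod>i<?n. \<Prod>j<m. N j - ?c J j * X i)"
      by simp
    moreover have "(\<Prod>k<?n. \<Prod>i<k. (X i - X k) * (?a k * ?b i - ?a i * ?b k)) =
        (\<Prod>k<?n. \<Prod>i<k. X i - X k) * (\<Prod>k<m. \<Prod>i<k. N k * ?c J i - N i * ?c J k) * (\<Prod>j<m. ?c J j)"
      by (simp add: prod.distrib)
    moreover have "?P = (\<Prod>i<?n. \<Prod>j<m. N j - ?c J j * X i) * (\<Prod>i<?n. \<Prod>j<m. N j - ?d J j * X i)"
      unfolding prod.distrib[symmetric] by (intro prod.cong refl) auto
    ultimately show ?thesis unfolding M by simp
  qed
  \<comment> \<open>In the constant column both summands are 1, so membership of \<open>m\<close> in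
    the set of columns does not change the determinant. Pairing \<open>J\<close> with
    \<open>insert m J\<close> produces the factor \<open>1 + w\<close>.\<close>
  have last: "det (mat ?n ?n (\<lambda>(i, j). if j \<in> insert m J then ?g i j else ?f i j)) =
      det (mat ?n ?n (\<lambda>(i, j). if j \<in> J then ?g i j else ?f i j))" if "J \<in> Pow {..<m}" for J
    by (rule arg_cong[of _ _ det], rule eq_matI) auto
  have card: "card (insert m J) = Suc (card J)" if "J \<in> Pow {..<m}" for J
    using that by (subst card_insert_disjoint) (auto intro: finite_subset[of _ "{..<m}"])
  have "?D * ?P = (\<Sum>I\<in>Pow {..<?n}. w ^ card I *
      (det (mat ?n ?n (\<lambda>(i, j). if i \<in> I then ?g i j else ?f i j)) * ?P))"
    unfolding det_mat_rows_add by (simp add: sum_distrib_right mult.assoc)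
  moreover have "?D * ?P = (\<Sum>J\<in>Pow {..<?n}. w ^ card J *
      (det (mat ?n ?n (\<lambda>(i, j). if j \<in> J then ?g i j else ?f i j)) * ?P))"
    unfolding det_mat_cols_add by (simp add: sum_distrib_right mult.assoc)
  moreover have "\<dots> = (1 + w) * (\<Sum>J\<in>Pow {..<m}. w ^ card J *
      (det (mat ?n ?n (\<lambda>(i, j). if j \<in> J then ?g i j else ?f i j)) * ?P))"
    unfolding sum_Pow_lessThan_Suc sum_distrib_left
    by (rule sum.cong[OF refl], simp only: last card, simp add: algebra_simps)
  ultimately show ?thesis unfolding rows cols by simp
qed

text \<open>Both sides are continuous in \<open>s\<close> when the generic identity is applied to
  \<open>(1 + s) * N j\<close>. Passing to \<open>s = 0\<close> admits the coincidences of nodes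
  that adjacent shapes produce.\<close>

lemma kernel_identity:
  fixes X N :: "nat \<Rightarrow> complex" and q t w :: complex
  assumes N: "\<And>j. j < m \<Longrightarrow> N j \<noteq> 0"
  shows "(\<Sum>I\<in>Pow {..<Suc m}. w ^ card I *
      ((\<Prod>k<Suc m. \<Prod>i<k. (if i \<in> I then q else t) * X i - (if k \<in> I then q else t) * X k) *
       (\<Prod>k<m. \<Prod>i<k. N k - N i) *
       (\<Prod>i<Suc m. \<Prod>j<m. N j - (if i \<in> I then t else q) * X i))) =
    (1 + w) * (\<Sum>J\<in>Pow {..<m}. w ^ card J *
      ((\<Prod>k<Suc m. \<Prod>i<k. X i - X k) *
       (\<Prod>k<m. \<Prod>i<k. N k * (if i \<in> J then q else t) - N i * (if k \<in> J then q else t)) *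
       (\<Prod>j<m. if j \<in> J then q else t) *
       (\<Prod>i<Suc m. \<Prod>j<m. N j - (if j \<in> J then t else q) * X i)))"
    (is "?L N = ?R N")
proof -
  let ?N = "\<lambda>s j. (1 + s) * N j"
  have ev: "\<forall>\<^sub>F s in at 0. ?L (?N s) = ?R (?N s)"
    using eventually_scaled_neq[where n = m and x = N and m = "Suc m" and y = "\<lambda>i. t * X i", OF N, simplified]
      eventually_scaled_neq[where n = m and x = N and m = "Suc m" and y = "\<lambda>i. q * X i", OF N, simplified]
  proof eventually_elim
    case (elim s)
    show ?case by (rule kernel_identity_generic) (use elim in auto)
  qed
  have "?L (?N 0) = ?R (?N 0)"
    by (rule isCont_eq_at[OF _ _ ev]) (intro continuous_intros)+
  then show ?thesis by simp
qed

text \<open>The matrix with entries \<open>1 / (t N - t L) + w / (q N - t L)\<close> is, for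
  \<open>w = -1\<close> and for \<open>w = -q/t\<close>, the same matrix
  \<open>1 / ((t N - t L) (q N - t L))\<close> scaled by \<open>(q - t) N\<close> along rows or by
  \<open>(q - t) L\<close> along columns. Its two determinants therefore differ only by the products
  of the \<open>N\<close> and of the \<open>L\<close>.\<close>

lemma wronski_identity_generic:
  fixes L N :: "nat \<Rightarrow> complex" and q t :: complex
  assumes nt: "\<And>i j. i < n \<Longrightarrow> j < n \<Longrightarrow> t * N j - t * L i \<noteq> 0"
    and nq: "\<And>i j. i < n \<Longrightarrow> j < n \<Longrightarrow> q * N j - t * L i \<noteq> 0"
    and t: "t \<noteq> 0" and qt: "q \<noteq> t" and inj: "inj_on L {..<n}"
  defines "A \<equiv> \<lambda>I. (\<Prod>k<n. \<Prod>i<k. (if i \<in> I then q else t) * N i - (if k \<in> I then q else t) * N k) *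
       (\<Prod>i<n. \<Prod>j<n. (if j \<in> I then t else q) * N j - t * L i)"
  shows "(\<Prod>i<n. L i) * (\<Sum>I\<in>Pow {..<n}. (- 1) ^ card I * A I) =
    (\<Prod>i<n. N i) * (\<Sum>I\<in>Pow {..<n}. (- (q / t)) ^ card I * A I)"
proof -
  let ?c = "\<lambda>S i. if i \<in> S then q else t"
  let ?d = "\<lambda>S i. if i \<in> S then t else q"
  let ?P = "(\<Prod>i<n. \<Prod>j<n. (t * N j - t * L i) * (q * N j - t * L i))"
  let ?f = "\<lambda>j i. 1 / (t * N j - t * L i)"
  let ?g = "\<lambda>j i. 1 / (q * N j - t * L i)"
  let ?\<kappa> = "\<Prod>k<n. \<Prod>i<k. t * (L k - L i)"
  let ?W = "det (mat n n (\<lambda>(j, i). 1 / ((t * N j - t * L i) * (q * N j - t * L i))))"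
  \<comment> \<open>The Vandermonde factor of the \<open>L\<close> is common to all subsets and is
    cancelled at the end; injectivity of \<open>L\<close> makes that possible.\<close>
  have "?\<kappa> \<noteq> 0"
    using inj_onD[OF inj] t by (auto simp: prod_zero_iff) (metis lessThan_iff less_irrefl less_trans)
  have rows: "det (mat n n (\<lambda>(j, i). if j \<in> I then ?g j i else ?f j i)) * ?P = ?\<kappa> * A I" for I
  proof -
    have M: "mat n n (\<lambda>(j, i). if j \<in> I then ?g j i else ?f j i) =
        mat n n (\<lambda>(j, i). 1 / (- t * L i - (- 1) * (?c I j * N j)))"
      by (rule eq_matI) auto
    have "det (mat n n (\<lambda>(j, i). 1 / (- t * L i - (- 1) * (?c I j * N j)))) *
        (\<Prod>j<n. \<Prod>i<n. - t * L i - (- 1) * (?c I j * N j)) =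
        (\<Prod>k<n. \<Prod>i<k. (?c I i * N i - ?c I k * N k) * (- t * L k * (- 1) - (- t * L i) * (- 1)))"
      by (rule cauchy_det) (use nt nq in auto)
    also have "\<dots> = (\<Prod>k<n. \<Prod>i<k. ?c I i * N i - ?c I k * N k) * ?\<kappa>"
      unfolding prod.distrib[symmetric] by (intro prod.cong refl) (simp add: algebra_simps)
    also have "(\<Prod>j<n. \<Prod>i<n. - t * L i - (- 1) * (?c I j * N j)) = (\<Prod>i<n. \<Prod>j<n. ?c I j * N j - t * L i)"
      by (subst prod.swap) (simp add: algebra_simps)
    finally have *: "det (mat n n (\<lambda>(j, i). if j \<in> I then ?g j i else ?f j i)) *
      (\<Prod>i<n. \<Prod>j<n. ?c I j * N j - t * L i) = (\<Prod>k<n. \<Prod>i<k. ?c I i * N i - ?c I k * N k) * ?\<kappa>"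
      unfolding M .
    have P: "?P = (\<Prod>i<n. \<Prod>j<n. ?c I j * N j - t * L i) * (\<Prod>i<n. \<Prod>j<n. ?d I j * N j - t * L i)"
      unfolding prod.distrib[symmetric] by (intro prod.cong refl) auto
    show ?thesis unfolding P mult.assoc[symmetric] * A_def by (simp add: mult_ac)
  qed
  have expand: "(\<Sum>I\<in>Pow {..<n}. w ^ card I * (?\<kappa> * A I)) =
     det (mat n n (\<lambda>(j, i). ?f j i + w * ?g j i)) * ?P" for w
    unfolding rows[symmetric] det_mat_rows_add by (simp add: sum_distrib_right mult.assoc)
  have "det (mat n n (\<lambda>(j, i). ?f j i + (- 1) * ?g j i)) = (\<Prod>j<n. (q - t) * N j) * ?W"
  proof -
    have "mat n n (\<lambda>(j, i). ?f j i + (- 1) * ?g j i) = mat n n (\<lambda>(j, i). ((q - t) * N j) * 1 *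
        (1 / ((t * N j - t * L i) * (q * N j - t * L i))))"
    proof (rule eq_matI, simp_all, goal_cases)
      case (1 i j)
      then show ?case using nt[of j i] nq[of j i] by (simp add: divide_simps) (simp add: algebra_simps)
    qed
    then show ?thesis by (simp only: det_mat_scale) simp
  qed
  moreover have "det (mat n n (\<lambda>(j, i). ?f j i + (- (q / t)) * ?g j i)) = (\<Prod>i<n. (q - t) * L i) * ?W"
  proof -
    have "mat n n (\<lambda>(j, i). ?f j i + (- (q / t)) * ?g j i) = mat n n (\<lambda>(j, i). 1 * ((q - t) * L i) *
        (1 / ((t * N j - t * L i) * (q * N j - t * L i))))"
    proof (rule eq_matI, simp_all, goal_cases)
      case (1 i j)
      have "1 / x - q / (t * y) = (q - t) * l / (x * y)" if "x \<noteq> 0" "y \<noteq> 0" "t * y - q * x = t * ((q - t) * l)"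
        for x y l :: complex
      proof -
        have "1 / x - q / (t * y) = (t * y - q * x) / (t * (x * y))"
          using that t by (simp add: divide_simps)
        also have "\<dots> = (q - t) * l / (x * y)" unfolding that(3) using t by simp
        finally show ?thesis .
      qed
      from this[of "t * N i - t * L j" "q * N i - t * L j" "L j"] show ?case
        using nt[of j i] nq[of j i] 1 by (simp add: algebra_simps)
    qed
    then show ?thesis by (simp only: det_mat_scale) simp
  qed
  ultimately have "(\<Prod>i<n. L i) * (\<Sum>I\<in>Pow {..<n}. (- 1) ^ card I * (?\<kappa> * A I)) =
     (\<Prod>i<n. N i) * (\<Sum>I\<in>Pow {..<n}. (- (q / t)) ^ card I * (?\<kappa> * A I))"
    unfolding expand by (simp add: prod.distrib)
  then have "?\<kappa> * ((\<Prod>i<n. L i) * (\<Sum>I\<in>Pow {..<n}. (- 1) ^ card I * A I)) =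
     ?\<kappa> * ((\<Prod>i<n. N i) * (\<Sum>I\<in>Pow {..<n}. (- (q / t)) ^ card I * A I))"
    by (simp only: sum_distrib_left mult.left_commute[of _ ?\<kappa>])
  with \<open>?\<kappa> \<noteq> 0\<close> show ?thesis by (simp only: mult_cancel_left) simp
qed

lemma wronski_identity:
  fixes L N :: "nat \<Rightarrow> complex" and q t :: complex
  assumes N: "\<And>j. j < n \<Longrightarrow> N j \<noteq> 0"
    and t: "t \<noteq> 0" and q: "q \<noteq> 0" and qt: "q \<noteq> t" and inj: "inj_on L {..<n}"
  shows "(\<Prod>i<n. L i) * (\<Sum>I\<in>Pow {..<n}. (- 1) ^ card I *
      ((\<Prod>k<n. \<Prod>i<k. (if i \<in> I then q else t) * N i - (if k \<in> I then q else t) * N k) *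
       (\<Prod>i<n. \<Prod>j<n. (if j \<in> I then t else q) * N j - t * L i))) =
    (\<Prod>i<n. N i) * (\<Sum>I\<in>Pow {..<n}. (- (q / t)) ^ card I *
      ((\<Prod>k<n. \<Prod>i<k. (if i \<in> I then q else t) * N i - (if k \<in> I then q else t) * N k) *
       (\<Prod>i<n. \<Prod>j<n. (if j \<in> I then t else q) * N j - t * L i)))"
    (is "?L N = ?R N")
proof -
  let ?N = "\<lambda>s j. (1 + s) * N j"
  have ev1: "\<forall>\<^sub>F s in at 0. \<forall>i<n. \<forall>j<n. (1 + s) * N i \<noteq> L j"
    by (rule eventually_scaled_neq) (rule N)
  have ev2: "\<forall>\<^sub>F s in at 0. \<forall>i<n. \<forall>j<n. (1 + s) * N i \<noteq> t * L j / q"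
    by (rule eventually_scaled_neq) (rule N)
  have ev: "\<forall>\<^sub>F s in at 0. ?L (?N s) = ?R (?N s)"
    using ev1 ev2
  proof eventually_elim
    case (elim s)
    show ?case
    proof (rule wronski_identity_generic[OF _ _ t qt inj])
      fix i j assume ij: "i < n" "j < n"
      show "t * ((1 + s) * N j) - t * L i \<noteq> 0"
        using elim(1) ij t by simp
      have "(1 + s) * N j \<noteq> t * L i / q" using elim(2) ij by blast
      then show "q * ((1 + s) * N j) - t * L i \<noteq> 0" using q by (simp add: field_simps)
    qed
  qed
  have "?L (?N 0) = ?R (?N 0)"
    by (rule isCont_eq_at[OF _ _ ev]) (intro continuous_intros)+
  then show ?thesis by simp
qed

section \<open>Branching coefficients in terms of rows\<close>

locale macdonald_parameters =
  fixes q t :: complex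
  assumes generic: "generic_parameters q t"
begin

lemma q_nonzero [simp]: "q \<noteq> 0" and t_nonzero [simp]: "t \<noteq> 0"
  using generic by (auto simp: generic_parameters_def)

lemma generic_eqD:
  assumes "q ^ a * t ^ b = q ^ c * t ^ d"
  shows "a = c \<and> b = d"
proof -
  have "q powi (int a - int c) * t powi (int b - int d) = 1"
    using assms by (simp add: power_int_diff field_simps)
  then have "int a - int c = 0 \<and> int b - int d = 0"
    using generic unfolding generic_parameters_def by blast
  then show ?thesis by simp
qed

lemma generic_neq: "(a, b) \<noteq> (c, d) \<Longrightarrow> q ^ a * t ^ b \<noteq> q ^ c * t ^ d"
  using generic_eqD by blast

lemma generic_neq_one: "a > 0 \<or> b > 0 \<Longrightarrow> q ^ a * t ^ b \<noteq> 1"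
  using generic_neq[of a b 0 0] by auto

lemma q_neq_t: "q \<noteq> t"
  using generic_neq[of 1 0 0 1] by auto

text \<open>\<open>g m k\<close> is \<open>f(q\<^sup>m t\<^sup>k) / f(t\<^sup>k)\<close>.\<close>

definition g :: "nat \<Rightarrow> nat \<Rightarrow> complex" where
  "g m k = (\<Prod>a<m. (1 - q ^ Suc a * t ^ k) / (1 - q ^ a * t ^ Suc k))"

lemma g_0 [simp]: "g 0 k = 1"
  by (simp add: g_def)

lemma g_nonzero [simp]: "g m k \<noteq> 0"
  using generic_neq_one by (simp add: g_def del: power_Suc)

lemma g_Suc: "g (Suc m) k = g m k * (1 - q ^ Suc m * t ^ k) / (1 - q ^ m * t ^ Suc k)"
  by (simp add: g_def)

text \<open>The part of \<open>1 / g (A - \<delta>) k\<close> that is common to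
  \<open>\<delta> = 0\<close> and \<open>\<delta> = 1\<close>. What is left is a single linear
  factor with coefficient \<open>t\<close> or \<open>q\<close>, the form of the factors in the
  determinant expansions.\<close>

definition g_inv :: "nat \<Rightarrow> nat \<Rightarrow> complex" where
  "g_inv A k = 1 / (g A k * (1 - q ^ A * t ^ Suc k / q))"

lemma g_inv_shift:
  assumes "\<delta> \<le> A" "\<delta> = 0 \<or> \<delta> = 1"
  shows "1 / g (A - \<delta>) k = g_inv A k * (1 - (if \<delta> = 1 then q else t) * (q ^ A * t ^ k / q))"
proof (cases "\<delta> = 0")
  case True
  have "q ^ A * t ^ Suc k \<noteq> q"
    using generic_neq[of A "Suc k" 1 0] by auto
  with True show ?thesis by (simp add: g_inv_def field_simps)
next
  case False
  then obtain B where [simp]: "\<delta> = 1" "A = Suc B" using assms by (cases A) auto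
  have "q ^ B * t ^ Suc k \<noteq> 1" "q ^ Suc B * t ^ k \<noteq> 1"
    using generic_neq_one by blast+
  then show ?thesis
    by (simp add: g_inv_def g_Suc divide_simps)
qed

definition node :: "(nat \<Rightarrow> nat) \<Rightarrow> nat \<Rightarrow> complex" where
  "node r i = q ^ r i / t ^ i"

lemma node_nonzero [simp]: "node r i \<noteq> 0"
  by (simp add: node_def)

lemma node_eq_iff [simp]: "node r i = node r k \<longleftrightarrow> i = k"
proof
  assume "node r i = node r k"
  then have "q ^ r i * t ^ k = q ^ r k * t ^ i" by (simp add: node_def field_simps)
  then show "i = k" using generic_eqD by blast
qed simp

lemma node_quotient:
  assumes "i \<le> k" "s k \<le> r i"
  shows "node r i = node s k * (q ^ (r i - s k) * t ^ (k - i))"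
proof -
  obtain D where D: "r i = s k + D" using assms le_Suc_ex by blast
  obtain d where d: "k = i + d" using assms le_Suc_ex by blast
  show ?thesis by (simp add: node_def D d power_add)
qed

lemma node_quotient_Suc:
  assumes "i \<le> k" "s k \<le> Suc (r i)"
  shows "q * node r i = node s k * (q ^ (Suc (r i) - s k) * t ^ (k - i))"
  using node_quotient[of i k s "\<lambda>i. Suc (r i)"] assms by (simp add: node_def)

definition raise :: "nat set \<Rightarrow> (nat \<Rightarrow> nat) \<Rightarrow> nat \<Rightarrow> nat" where
  "raise I r i = r i + (if i \<in> I then 1 else 0)"

definition lower :: "nat set \<Rightarrow> (nat \<Rightarrow> nat) \<Rightarrow> nat \<Rightarrow> nat" where
  "lower I r i = r i - (if i \<in> I then 1 else 0)"

text \<open>\<open>vrow\<close> is \<open>\<psi>(t, q)\<close> for the transposed vertical strip \<open>l / m\<close>, \<open>hrow\<close> is \<open>\<psi>(q, t)\<close> for the horizontal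
  strip \<open>l / m\<close>, and \<open>brow\<close> is the inverse of the squared norm, each as a product over pairs of rows.\<close>

definition vpair :: "(nat \<Rightarrow> nat) \<Rightarrow> (nat \<Rightarrow> nat) \<Rightarrow> nat \<Rightarrow> nat \<Rightarrow> complex" where
  "vpair m l i k = (if l i = m i \<and> l k = Suc (m k) then
     (1 - q ^ (m i - m k) * t ^ (k - Suc i)) * (1 - q ^ (m i - m k - 1) * t ^ (Suc k - i)) /
     ((1 - q ^ (m i - m k) * t ^ (k - i)) * (1 - q ^ (m i - m k - 1) * t ^ (k - i))) else 1)"

definition vrow :: "nat \<Rightarrow> (nat \<Rightarrow> nat) \<Rightarrow> (nat \<Rightarrow> nat) \<Rightarrow> complex" where
  "vrow n m l = (\<Prod>k<n. \<Prod>i<k. vpair m l i k)"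

definition hrow :: "nat \<Rightarrow> (nat \<Rightarrow> nat) \<Rightarrow> (nat \<Rightarrow> nat) \<Rightarrow> complex" where
  "hrow n l m = (\<Prod>j<n. \<Prod>i\<le>j. g (m i - m j) (j - i) * g (l i - l (Suc j)) (j - i) /
     (g (l i - m j) (j - i) * g (m i - l (Suc j)) (j - i)))"

definition brow :: "nat \<Rightarrow> (nat \<Rightarrow> nat) \<Rightarrow> complex" where
  "brow n l = (\<Prod>j<n. \<Prod>i\<le>j. g (l i - l j) (j - i) / g (l i - l (Suc j)) (j - i))"

abbreviation qt :: "nat set \<Rightarrow> nat \<Rightarrow> complex" where
  "qt I i \<equiv> (if i \<in> I then q else t)"

abbreviation tq :: "nat set \<Rightarrow> nat \<Rightarrow> complex" where
  "tq I i \<equiv> (if i \<in> I then t else q)"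

text \<open>In all four cases for \<open>i\<close> and \<open>k\<close> the change of the pair
  weight is a deformed Vandermonde factor over an ordinary one, as in the row expansion of the
  kernel identity. The last hypothesis excludes raising only the lower of two equal rows.\<close>

lemma pair_raise:
  assumes "i < k" "m k \<le> m i" "raise I m k \<le> raise I m i"
  shows "g (raise I m i - raise I m k) (k - Suc i) * vpair m (raise I m) i k =
    g (m i - m k) (k - Suc i) * ((qt I i * node m i - qt I k * node m k) /
      (qt I k * (node m i - node m k)))"
proof -
  obtain D where D: "m i = m k + D" using assms le_Suc_ex by blast
  obtain d where d: "k = Suc (i + d)" using assms less_imp_Suc_add by blast
  let ?x = "q ^ D * t ^ Suc d"
  have X: "node m i = node m k * ?x"
    using node_quotient[of i k m m] assms D d by simp
  have x: "?x \<noteq> 1" using generic_neq_one by blast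
  have R: "(a * node m i - c * node m k) / (c * (node m i - node m k)) = (a * ?x - c) / (c * (?x - 1))" for a c
  proof -
    have "a * node m i - c * node m k = node m k * (a * ?x - c)"
      unfolding X by (simp add: algebra_simps)
    moreover have "c * (node m i - node m k) = node m k * (c * (?x - 1))"
      unfolding X by (simp add: algebra_simps)
    ultimately show ?thesis by (simp only: mult_divide_mult_cancel_left[OF node_nonzero])
  qed
  show ?thesis
  proof (cases "i \<in> I")
    case True
    show ?thesis
    proof (cases "k \<in> I")
      case True
      with \<open>i \<in> I\<close> show ?thesis unfolding R using x by (simp add: raise_def vpair_def D divide_simps) (simp add: algebra_simps)
    next
      case False
      have "q ^ D * t ^ Suc d \<noteq> 1" by (rule x)
      with \<open>i \<in> I\<close> False show ?thesis unfolding R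
        by (simp add: raise_def vpair_def D d Suc_diff_le g_Suc divide_simps) (simp add: algebra_simps)
    qed
  next
    case iI: False
    show ?thesis
    proof (cases "k \<in> I")
      case False
      with iI show ?thesis unfolding R using x by (simp add: raise_def vpair_def D divide_simps) (simp add: algebra_simps)
    next
      case True
      with iI assms(3) D have "D > 0" by (simp add: raise_def)
      then obtain E where E: "D = Suc E" by (cases D) auto
      have neq: "q ^ Suc E * t ^ d \<noteq> 1" "q ^ E * t ^ Suc d \<noteq> 1" using generic_neq_one by blast+
      have "g (raise I m i - raise I m k) (k - Suc i) * vpair m (raise I m) i k =
          g E d * ((1 - q ^ Suc E * t ^ d) * (1 - q ^ E * t ^ Suc (Suc d)) / ((1 - ?x) * (1 - q ^ E * t ^ Suc d)))"
        using iI True by (simp add: raise_def vpair_def D d E)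
      moreover have "g (m i - m k) (k - Suc i) = g E d * (1 - q ^ Suc E * t ^ d) / (1 - q ^ E * t ^ Suc d)"
        by (simp add: D d E g_Suc)
      moreover have "(t * ?x - q) / (q * (?x - 1)) = (1 - q ^ E * t ^ Suc (Suc d)) / (1 - ?x)"
      proof -
        have "t * ?x - q = - (q * (1 - q ^ E * t ^ Suc (Suc d)))" by (simp add: E algebra_simps)
        moreover have "q * (?x - 1) = - (q * (1 - ?x))" by (simp add: algebra_simps)
        ultimately show ?thesis by simp
      qed
      ultimately show ?thesis unfolding R using iI True by (simp add: mult_ac)
    qed
  qed
qed

text \<open>The counterpart of \<open>pair_raise\<close> for the column expansion. Positivity of the
  lowered rows keeps the truncated subtraction in \<open>lower\<close> exact.\<close>

lemma pair_lower:
  assumes "i < k" "n k \<le> n i" "lower J n k \<le> lower J n i" "\<And>x. x \<in> J \<Longrightarrow> n x > 0"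
  shows "g (lower J n i - lower J n k) (k - i) * vpair (lower J n) n i k =
    g (n i - n k) (k - i) * ((node n k * qt J i - node n i * qt J k) /
      (qt J i * (node n k - node n i)))"
proof -
  obtain D where D: "n i = n k + D" using assms le_Suc_ex by blast
  obtain d where d: "k = Suc (i + d)" using assms less_imp_Suc_add by blast
  let ?x = "q ^ D * t ^ Suc d"
  have X: "node n i = node n k * ?x"
    using node_quotient[of i k n n] assms D d by simp
  have x: "?x \<noteq> 1" using generic_neq_one by blast
  have R: "(node n k * a - node n i * c) / (a * (node n k - node n i)) = (a - c * ?x) / (a * (1 - ?x))" for a c
  proof -
    have "node n k * a - node n i * c = node n k * (a - c * ?x)"
      unfolding X by (simp add: algebra_simps)
    moreover have "a * (node n k - node n i) = node n k * (a * (1 - ?x))"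
      unfolding X by (simp add: algebra_simps)
    ultimately show ?thesis by (simp only: mult_divide_mult_cancel_left[OF node_nonzero])
  qed
  show ?thesis
  proof (cases "i \<in> J")
    case iJ: True
    show ?thesis
    proof (cases "k \<in> J")
      case True
      have "n k > 0" using True assms(4) by blast
      with \<open>i \<in> J\<close> True show ?thesis unfolding R using x
        by (simp add: lower_def vpair_def D divide_simps) (simp add: algebra_simps)
    next
      case False
      with iJ assms(3) D assms(4)[of i] have "D > 0" by (auto simp: lower_def)
      then obtain E where E: "D = Suc E" by (cases D) auto
      have neq: "q ^ Suc D * t ^ d \<noteq> 1" "q ^ E * t ^ Suc (Suc d) \<noteq> 1" using generic_neq_one by blast+
      have "g (lower J n i - lower J n k) (k - i) * vpair (lower J n) n i k = g E (Suc d)"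
        using iJ False by (simp add: lower_def vpair_def D d E)
      moreover have "g (n i - n k) (k - i) = g E (Suc d) * (1 - ?x) / (1 - q ^ E * t ^ Suc (Suc d))"
        by (simp add: D d E g_Suc)
      moreover have "(q - t * ?x) / (q * (1 - ?x)) = (1 - q ^ E * t ^ Suc (Suc d)) / (1 - ?x)"
      proof -
        have "q - t * ?x = q * (1 - q ^ E * t ^ Suc (Suc d))" by (simp add: E algebra_simps)
        then show ?thesis by simp
      qed
      ultimately show ?thesis unfolding R using iJ False x neq by simp
    qed
  next
    case iJ: False
    show ?thesis
    proof (cases "k \<in> J")
      case False
      with iJ show ?thesis unfolding R using x by (simp add: lower_def vpair_def D divide_simps) (simp add: algebra_simps)
    next
      case True
      have nk: "n k > 0" using True assms(4) by blast
      have neq: "q ^ Suc D * t ^ Suc d \<noteq> 1" "q ^ D * t ^ Suc (Suc d) \<noteq> 1" using generic_neq_one by blast+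
      have D': "n k + D - (n k - Suc 0) = Suc D" using nk by simp
      have "g (lower J n i - lower J n k) (k - i) * vpair (lower J n) n i k =
         g (Suc D) (Suc d) * ((1 - q ^ Suc D * t ^ d) * (1 - q ^ D * t ^ Suc (Suc d)) /
           ((1 - q ^ Suc D * t ^ Suc d) * (1 - ?x)))"
        using iJ True nk by (simp add: lower_def vpair_def D d D')
      moreover have "g (Suc D) (Suc d) = g D (Suc d) * (1 - q ^ Suc D * t ^ Suc d) / (1 - q ^ D * t ^ Suc (Suc d))"
        by (simp add: g_Suc)
      moreover have "(t - q * ?x) / (t * (1 - ?x)) = (1 - q ^ Suc D * t ^ d) / (1 - ?x)"
      proof -
        have "t - q * ?x = t * (1 - q ^ Suc D * t ^ d)" by (simp add: algebra_simps)
        then show ?thesis by simp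
      qed
      moreover have "g (n i - n k) (k - i) = g D (Suc d)" by (simp add: D d)
      ultimately show ?thesis unfolding R using iJ True x neq by simp
    qed
  qed
qed

end

section \<open>Bringing products over pairs of rows to a common index set\<close>

lemma prod_pairs_shift:
  fixes F :: "nat \<Rightarrow> nat \<Rightarrow> 'a::comm_monoid_mult"
  shows "(\<Prod>k<Suc M. \<Prod>i<k. F i k) = (\<Prod>j<M. \<Prod>i\<le>j. F i (Suc j))"
  by (subst prod.lessThan_Suc_shift) (simp add: lessThan_Suc_atMost)

lemma prod_pairs_diagonal:
  fixes F :: "nat \<Rightarrow> nat \<Rightarrow> 'a::comm_monoid_mult"
  shows "(\<Prod>j<M. \<Prod>i<j. F i j) * (\<Prod>j<M. G j) = (\<Prod>j<M. \<Prod>i\<le>j. if i < j then F i j else G j)"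
  unfolding prod.distrib[symmetric]
  by (intro prod.cong refl) (simp only: lessThan_Suc_atMost[symmetric] prod.lessThan_Suc, simp)

text \<open>The entry at \<open>(i, j)\<close> on or above the diagonal is grouped with the one at
  \<open>(Suc j, i)\<close> below it. With every product indexed by \<open>i \<le> j\<close>,
  identities of large products can be checked factor by factor.\<close>

lemma prod_rectangle_split:
  fixes F :: "nat \<Rightarrow> nat \<Rightarrow> 'a::comm_monoid_mult"
  shows "(\<Prod>i<Suc M. \<Prod>j<M. F i j) = (\<Prod>j<M. \<Prod>i\<le>j. F i j * F (Suc j) i)"
proof (induction M)
  case (Suc M)
  have "(\<Prod>i<Suc (Suc M). \<Prod>j<Suc M. F i j) =
     (\<Prod>i<Suc M. \<Prod>j<M. F i j) * ((\<Prod>i<Suc M. F i M) * (\<Prod>j<Suc M. F (Suc M) j))"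
    by (simp add: prod.distrib mult_ac)
  also have "\<dots> = (\<Prod>j<Suc M. \<Prod>i\<le>j. F i j * F (Suc j) i)"
    unfolding Suc.IH by (simp add: lessThan_Suc_atMost[symmetric] prod.distrib mult_ac)
  finally show ?case .
qed simp

lemma prod_square_split:
  fixes F :: "nat \<Rightarrow> nat \<Rightarrow> 'a::comm_monoid_mult"
  shows "(\<Prod>i<n. \<Prod>j<n. F i j) = (\<Prod>j<n. \<Prod>i\<le>j. F i j) * (\<Prod>k<n. \<Prod>i<k. F k i)"
proof (induction n)
  case (Suc n)
  have "(\<Prod>i<Suc n. \<Prod>j<Suc n. F i j) =
     (\<Prod>i<n. \<Prod>j<n. F i j) * ((\<Prod>i<Suc n. F i n) * (\<Prod>j<n. F n j))"
    by (simp add: prod.distrib mult_ac)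
  then show ?case unfolding Suc.IH by (simp add: lessThan_Suc_atMost[symmetric] mult_ac)
qed simp

text \<open>Both sides are polynomials in \<open>w\<close> that agree at every complex number, so
  their coefficients at \<open>w ^ r\<close> may be compared.\<close>

lemma sum_Pow_card_eqI:
  fixes f g :: "nat set \<Rightarrow> complex"
  assumes A: "finite A" and B: "finite B"
    and eq: "\<And>w. (\<Sum>I\<in>A. w ^ card I * f I) = (1 + w) * (\<Sum>J\<in>B. w ^ card J * g J)"
  shows "(\<Sum>I | I \<in> A \<and> card I = r. f I) =
    (\<Sum>J | J \<in> B \<and> card J = r. g J) + (\<Sum>J | J \<in> B \<and> Suc (card J) = r. g J)"
proof -
  let ?p = "\<Sum>I\<in>A. monom (f I) (card I)"
  let ?s = "(\<Sum>J\<in>B. monom (g J) (card J)) + (\<Sum>J\<in>B. monom (g J) (Suc (card J)))"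
  have "poly ?p w = poly ?s w" for w
  proof -
    have "poly ?p w = (\<Sum>I\<in>A. w ^ card I * f I)" by (simp add: poly_sum poly_monom mult.commute)
    also have "\<dots> = (\<Sum>J\<in>B. w ^ card J * g J) + w * (\<Sum>J\<in>B. w ^ card J * g J)"
      unfolding eq by (simp only: distrib_right mult_1)
    also have "\<dots> = poly ?s w"
      by (simp add: poly_sum poly_monom sum_distrib_left mult_ac)
    finally show ?thesis .
  qed
  then have "poly ?p = poly ?s" by (rule ext)
  then have "?p = ?s" by (simp add: poly_eq_poly_eq_iff)
  then have "coeff ?p r = coeff ?s r" by simp
  then show ?thesis using A B by (simp add: coeff_sum sum.inter_filter)
qed

section \<open>Branching weights as terms of the kernel identity\<close>

context macdonald_parameters
begin

text \<open>With \<open>inverse_g_right\<close> this covers the two triangles of the rectangle of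
  linear factors in the kernel identity: here \<open>y\<close> is the node of the same row as
  \<open>x\<close> or a lower one, there \<open>x\<close> lies strictly below
  \<open>y\<close>.\<close>

lemma inverse_g_left:
  assumes "q * x = y * (q ^ A * t ^ k)" "y \<noteq> 0" "\<delta> \<le> A" "\<delta> = 0 \<or> \<delta> = 1"
  shows "1 / g (A - \<delta>) k = g_inv A k * ((y - (if \<delta> = 1 then q else t) * x) / y)"
proof -
  have "q ^ A * t ^ k / q = x / y" using assms(1,2) by (simp add: field_simps)
  then show ?thesis
    using g_inv_shift[OF assms(3,4), of k] assms(2) by (simp add: diff_divide_distrib)
qed

lemma inverse_g_right:
  assumes "y = x * (q ^ A * t ^ Suc k)" "x \<noteq> 0" "\<delta> \<le> A" "\<delta> = 0 \<or> \<delta> = 1"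
  shows "1 / g (A - \<delta>) k = g_inv A k *
    (- (y - (if \<delta> = 1 then t else q) * x) / ((if \<delta> = 1 then t else q) * x))"
proof -
  have "(if \<delta> = 1 then q else t) * (q ^ A * t ^ k / q) = y / ((if \<delta> = 1 then t else q) * x)"
    using assms(2) unfolding assms(1) by (simp add: field_simps)
  then have "1 / g (A - \<delta>) k = g_inv A k * (1 - y / ((if \<delta> = 1 then t else q) * x))"
    using g_inv_shift[OF assms(3,4), of k] by simp
  also have "1 - y / ((if \<delta> = 1 then t else q) * x) =
      - (y - (if \<delta> = 1 then t else q) * x) / ((if \<delta> = 1 then t else q) * x)"
    using assms(2) by (simp add: diff_divide_distrib)
  finally show ?thesis .
qed

lemma inverse_g_raise_left:
  assumes "i \<le> j" "n j \<le> raise I m i"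
  shows "1 / g (raise I m i - n j) (j - i) =
    g_inv (Suc (m i) - n j) (j - i) * ((node n j - tq I i * node m i) / node n j)"
proof -
  let ?\<delta> = "if i \<in> I then 0 else 1 :: nat"
  have "n j \<le> Suc (m i)" "?\<delta> \<le> Suc (m i) - n j" "raise I m i - n j = Suc (m i) - n j - ?\<delta>"
    using assms(2) by (auto simp: raise_def split: if_splits)
  with inverse_g_left[of "node m i" "node n j" "Suc (m i) - n j" "j - i" ?\<delta>]
    node_quotient_Suc[of i j n m] assms(1)
  show ?thesis by simp
qed

lemma inverse_g_raise_right:
  assumes "i \<le> j" "raise I m (Suc j) \<le> n i"
  shows "1 / g (n i - raise I m (Suc j)) (j - i) = g_inv (n i - m (Suc j)) (j - i) *
    (- (node n i - tq I (Suc j) * node m (Suc j)) / (tq I (Suc j) * node m (Suc j)))"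
proof -
  let ?\<delta> = "if Suc j \<in> I then 1 else 0 :: nat"
  have "m (Suc j) \<le> n i" "?\<delta> \<le> n i - m (Suc j)" "n i - raise I m (Suc j) = n i - m (Suc j) - ?\<delta>"
    using assms(2) by (auto simp: raise_def split: if_splits)
  with inverse_g_right[of "node n i" "node m (Suc j)" "n i - m (Suc j)" "j - i" ?\<delta>]
    node_quotient[of i "Suc j" m n] assms(1)
  show ?thesis by (simp add: Suc_diff_le)
qed

lemma inverse_g_lower_left:
  assumes "i \<le> j" "lower J n j \<le> m i" "j \<in> J \<Longrightarrow> n j > 0"
  shows "1 / g (m i - lower J n j) (j - i) =
    g_inv (Suc (m i) - n j) (j - i) * ((node n j - tq J j * node m i) / node n j)"
proof -
  let ?\<delta> = "if j \<in> J then 0 else 1 :: nat"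
  have "n j \<le> Suc (m i)" "?\<delta> \<le> Suc (m i) - n j" "m i - lower J n j = Suc (m i) - n j - ?\<delta>"
    using assms(2,3) by (auto simp: lower_def split: if_splits)
  with inverse_g_left[of "node m i" "node n j" "Suc (m i) - n j" "j - i" ?\<delta>]
    node_quotient_Suc[of i j n m] assms(1)
  show ?thesis by simp
qed

lemma inverse_g_lower_right:
  assumes "i \<le> j" "m (Suc j) \<le> lower J n i" "i \<in> J \<Longrightarrow> n i > 0"
  shows "1 / g (lower J n i - m (Suc j)) (j - i) = g_inv (n i - m (Suc j)) (j - i) *
    (- (node n i - tq J i * node m (Suc j)) / (tq J i * node m (Suc j)))"
proof -
  let ?\<delta> = "if i \<in> J then 1 else 0 :: nat"
  have "m (Suc j) \<le> n i" "?\<delta> \<le> n i - m (Suc j)" "lower J n i - m (Suc j) = n i - m (Suc j) - ?\<delta>"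
    using assms(2,3) by (auto simp: lower_def split: if_splits)
  with inverse_g_right[of "node n i" "node m (Suc j)" "n i - m (Suc j)" "j - i" ?\<delta>]
    node_quotient[of i "Suc j" m n] assms(1)
  show ?thesis by (simp add: Suc_diff_le)
qed

text \<open>This and the next rearrangements are stated with opaque letters, so that nodes and
  values of \<open>g\<close> are not expanded when the large quotients are regrouped.\<close>

lemma regroup_fraction:
  fixes a b c d v x :: complex
  shows "a * b / (c * d) * v * x = a * (b * v) * (1 / c) * (1 / d) * x"
  by simp

lemma regroup_fraction':
  fixes a b c d v x :: complex
  shows "a * b / (c * d) * v * x = (a * v * x) * b * (1 / c) * (1 / d)"
  by simp

lemma regroup_raise:
  fixes a b w c d x e f n h y z :: complex
  assumes "z \<noteq> 0" "c \<noteq> 0" "d \<noteq> 0" "n \<noteq> 0" "x \<noteq> 0"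
  shows "a * (b * (w / (c * z))) * (e * (f / n)) * (h * (- y / (d * x))) * z =
    a * e / n * (b * h / (- (c * d) * x)) * (w * (f * y))"
  using assms by (simp add: field_simps)

lemma regroup_lower:
  fixes a b w c d x e f n h y :: complex
  assumes "c \<noteq> 0" "d \<noteq> 0" "n \<noteq> 0" "x \<noteq> 0"
  shows "a * w / c * b * (e * (f / n)) * (h * (- y / (d * x))) =
    a * e / n * (b * h / (- (c * d) * x)) * (w * (f * y))"
  using assms by (simp add: field_simps)

text \<open>The common part of all raised and all lowered terms; neither \<open>I\<close> nor
  \<open>J\<close> occurs in it. The product \<open>q * t\<close> arises because the coefficients
  \<open>qt\<close> and \<open>tq\<close> of a row are complementary.\<close>

definition kernel_const :: "nat \<Rightarrow> (nat \<Rightarrow> nat) \<Rightarrow> (nat \<Rightarrow> nat) \<Rightarrow> complex" where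
  "kernel_const M m n = (\<Prod>j<M. \<Prod>i\<le>j.
     (g (n i - n j) (j - i) * g_inv (Suc (m i) - n j) (j - i) / node n j) *
     (g (m i - m (Suc j)) (j - i) * g_inv (n i - m (Suc j)) (j - i) / (- (q * t) * node m (Suc j))))"

text \<open>For each pair of rows, \<open>pair_raise\<close> supplies the deformed Vandermonde
  factor and the two reciprocals of \<open>g\<close> supply one linear factor each. Together they
  form the term of \<open>I\<close> in the row expansion, up to \<open>kernel_const\<close>.\<close>

lemma raise_term:
  assumes m: "antimono m"
    and valid: "\<And>i. i < M \<Longrightarrow> n i \<le> raise I m i \<and> raise I m (Suc i) \<le> n i"
    and n: "antimono n"
  shows "hrow M (raise I m) n * vrow (Suc M) m (raise I m) *
      (\<Prod>k<Suc M. \<Prod>i<k. node m i - node m k) =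
    kernel_const M m n * ((\<Prod>k<Suc M. \<Prod>i<k. qt I i * node m i - qt I k * node m k) *
      (\<Prod>i<Suc M. \<Prod>j<M. node n j - tq I i * node m i))"
  unfolding prod_pairs_shift prod_rectangle_split vrow_def hrow_def kernel_const_def
    prod.distrib[symmetric]
proof (intro prod.cong refl)
  fix j i assume "j \<in> {..<M}" "i \<in> {..j}"
  then have ij: "i \<le> j" "j < M" by auto
  let ?l = "raise I m"
  have 1: "n j \<le> ?l i" using valid[of i] antimonoD[OF n, of i j] ij by fastforce
  have 2: "?l (Suc j) \<le> n i" using valid[of j] antimonoD[OF n, of i j] ij by fastforce
  have "raise I m (Suc j) \<le> raise I m i"
    using 1 valid[of j] ij by linarith
  then have P: "g (?l i - ?l (Suc j)) (j - i) * vpair m ?l i (Suc j) =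
    g (m i - m (Suc j)) (j - i) * ((qt I i * node m i - qt I (Suc j) * node m (Suc j)) /
      (qt I (Suc j) * (node m i - node m (Suc j))))"
    using pair_raise[of i "Suc j" m I] ij antimonoD[OF m, of i "Suc j"] by simp
  have X: "node m i - node m (Suc j) \<noteq> 0" using ij by simp
  have c: "qt I (Suc j) * tq I (Suc j) = q * t" by simp
  have "g (n i - n j) (j - i) * g (?l i - ?l (Suc j)) (j - i) /
      (g (?l i - n j) (j - i) * g (n i - ?l (Suc j)) (j - i)) * vpair m ?l i (Suc j) *
      (node m i - node m (Suc j)) =
     g (n i - n j) (j - i) * (g (?l i - ?l (Suc j)) (j - i) * vpair m ?l i (Suc j)) *
       (1 / g (?l i - n j) (j - i)) * (1 / g (n i - ?l (Suc j)) (j - i)) *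
       (node m i - node m (Suc j))" by (rule regroup_fraction)
  also have "\<dots> = g (n i - n j) (j - i) * g_inv (Suc (m i) - n j) (j - i) / node n j *
      (g (m i - m (Suc j)) (j - i) * g_inv (n i - m (Suc j)) (j - i) / (- ((qt I (Suc j) * tq I (Suc j))) * node m (Suc j))) *
     ((qt I i * node m i - qt I (Suc j) * node m (Suc j)) *
      ((node n j - tq I i * node m i) * (node n i - tq I (Suc j) * node m (Suc j))))"
    unfolding P inverse_g_raise_left[of i j n I m, OF ij(1) 1] inverse_g_raise_right[of i j I m n, OF ij(1) 2]
    using X by (intro regroup_raise) simp_all
  finally show "g (n i - n j) (j - i) * g (?l i - ?l (Suc j)) (j - i) /
      (g (?l i - n j) (j - i) * g (n i - ?l (Suc j)) (j - i)) * vpair m ?l i (Suc j) *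
      (node m i - node m (Suc j)) =
     g (n i - n j) (j - i) * g_inv (Suc (m i) - n j) (j - i) / node n j *
      (g (m i - m (Suc j)) (j - i) * g_inv (n i - m (Suc j)) (j - i) / (- (q * t) * node m (Suc j))) *
     ((qt I i * node m i - qt I (Suc j) * node m (Suc j)) *
      ((node n j - tq I i * node m i) * (node n i - tq I (Suc j) * node m (Suc j))))"
    unfolding c .
qed

text \<open>As for \<open>raise_term\<close>, with the column expansion. On the diagonal there is no
  pair weight, and the factor \<open>qt J j\<close> of that expansion takes its place.\<close>

lemma lower_term:
  assumes m: "antimono m"
    and valid: "\<And>i. i < M \<Longrightarrow> lower J n i \<le> m i \<and> m (Suc i) \<le> lower J n i"
    and pos: "\<And>i. i \<in> J \<Longrightarrow> n i > 0"
    and n: "antimono n"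
  shows "hrow M m (lower J n) * vrow M (lower J n) n *
      (\<Prod>k<M. \<Prod>i<k. node n k - node n i) =
    kernel_const M m n * (((\<Prod>k<M. \<Prod>i<k. node n k * qt J i - node n i * qt J k) * (\<Prod>j<M. qt J j)) *
      (\<Prod>i<Suc M. \<Prod>j<M. node n j - tq J j * node m i))"
proof -
  let ?k = "lower J n"
  have V: "vrow M ?k n = (\<Prod>j<M. \<Prod>i\<le>j. if i < j then vpair ?k n i j else 1)"
    using prod_pairs_diagonal[where M = M and F = "vpair ?k n" and G = "\<lambda>_. 1"] by (simp add: vrow_def)
  have D: "(\<Prod>k<M. \<Prod>i<k. node n k - node n i) = (\<Prod>j<M. \<Prod>i\<le>j. if i < j then node n j - node n i else 1)"
    using prod_pairs_diagonal[where M = M and F = "\<lambda>i k. node n k - node n i" and G = "\<lambda>_. 1"] by simp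
  have W: "(\<Prod>k<M. \<Prod>i<k. node n k * qt J i - node n i * qt J k) * (\<Prod>j<M. qt J j) =
      (\<Prod>j<M. \<Prod>i\<le>j. if i < j then node n j * qt J i - node n i * qt J j else qt J j)"
    by (rule prod_pairs_diagonal)
  show ?thesis
    unfolding V D W
    unfolding prod_rectangle_split hrow_def kernel_const_def
      prod.distrib[symmetric]
  proof (intro prod.cong refl)
    fix j i assume "j \<in> {..<M}" "i \<in> {..j}"
    then have ij: "i \<le> j" "j < M" by auto
    have k: "?k b \<le> ?k a" if "a \<le> b" "b \<le> j" for a b
    proof (cases "a = b")
      case False
      then have "Suc a \<le> b" using that by simp
      then have "m b \<le> m (Suc a)" using m by (rule antimonoD[rotated])
      then show ?thesis using valid[of a] valid[of b] that ij by fastforce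
    qed simp
    have 1: "?k j \<le> m i" using valid[of i] k[of i j] ij by fastforce
    have 2: "m (Suc j) \<le> ?k i" using valid[of j] k[of i j] ij by fastforce
    have 3: "1 / g (m i - ?k j) (j - i) =
        g_inv (Suc (m i) - n j) (j - i) * ((node n j - tq J j * node m i) / node n j)"
      by (rule inverse_g_lower_left[of i j J n m, OF ij(1) 1 pos])
    have 4: "1 / g (?k i - m (Suc j)) (j - i) = g_inv (n i - m (Suc j)) (j - i) *
        (- (node n i - tq J i * node m (Suc j)) / (tq J i * node m (Suc j)))"
      by (rule inverse_g_lower_right[of i j m J n, OF ij(1) 2 pos])
    let ?V = "node n j * qt J i - node n i * qt J j"
    let ?W = "if i < j then node n j * qt J i - node n i * qt J j else qt J j"
    have P: "g (?k i - ?k j) (j - i) * (if i < j then vpair ?k n i j else 1) *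
        (if i < j then node n j - node n i else 1) =
      g (n i - n j) (j - i) * ?W / qt J i"
    proof (cases "i < j")
      case True
      then have X: "node n j - node n i \<noteq> 0" by simp
      have "g (?k i - ?k j) (j - i) * vpair ?k n i j =
          g (n i - n j) (j - i) * (?V / (qt J i * (node n j - node n i)))"
        using pair_lower[of i j n J] True antimonoD[OF n, of i j] k[of i j] pos ij by auto
      moreover have "g (n i - n j) (j - i) * (?V / (qt J i * (node n j - node n i))) * (node n j - node n i) =
          g (n i - n j) (j - i) * ?V / qt J i" using X by simp
      ultimately have "g (?k i - ?k j) (j - i) * vpair ?k n i j * (node n j - node n i) =
          g (n i - n j) (j - i) * ?V / qt J i" by metis
      then show ?thesis using True by simp
    next
      case False
      then have "i = j" using ij by simp
      then show ?thesis by simp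
    qed
    have c: "qt J i * tq J i = q * t" by simp
    have "g (?k i - ?k j) (j - i) * g (m i - m (Suc j)) (j - i) /
        (g (m i - ?k j) (j - i) * g (?k i - m (Suc j)) (j - i)) *
        (if i < j then vpair ?k n i j else 1) * (if i < j then node n j - node n i else 1) =
       (g (?k i - ?k j) (j - i) * (if i < j then vpair ?k n i j else 1) *
        (if i < j then node n j - node n i else 1)) * g (m i - m (Suc j)) (j - i) *
         (1 / g (m i - ?k j) (j - i)) * (1 / g (?k i - m (Suc j)) (j - i))"
      by (rule regroup_fraction')
    also have "\<dots> = g (n i - n j) (j - i) * g_inv (Suc (m i) - n j) (j - i) / node n j *
        (g (m i - m (Suc j)) (j - i) * g_inv (n i - m (Suc j)) (j - i) / (- (qt J i * tq J i) * node m (Suc j))) *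
       (?W * ((node n j - tq J j * node m i) * (node n i - tq J i * node m (Suc j))))"
      unfolding P 3 4
      by (intro regroup_lower) simp_all
    finally show "g (?k i - ?k j) (j - i) * g (m i - m (Suc j)) (j - i) /
        (g (m i - ?k j) (j - i) * g (?k i - m (Suc j)) (j - i)) *
        (if i < j then vpair ?k n i j else 1) * (if i < j then node n j - node n i else 1) =
       g (n i - n j) (j - i) * g_inv (Suc (m i) - n j) (j - i) / node n j *
        (g (m i - m (Suc j)) (j - i) * g_inv (n i - m (Suc j)) (j - i) / (- (q * t) * node m (Suc j))) *
       (?W * ((node n j - tq J j * node m i) * (node n i - tq J i * node m (Suc j))))"
      by (simp only: c)
  qed
qed

end

section \<open>The commutation relation in terms of row lengths\<close>

context macdonald_parameters
begin

definition raise_sets :: "nat \<Rightarrow> (nat \<Rightarrow> nat) \<Rightarrow> (nat \<Rightarrow> nat) \<Rightarrow> nat set set" where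
  "raise_sets M m n = {I \<in> Pow {..<Suc M}. \<forall>i<M. n i \<le> raise I m i \<and> raise I m (Suc i) \<le> n i}"

definition lower_sets :: "nat \<Rightarrow> (nat \<Rightarrow> nat) \<Rightarrow> (nat \<Rightarrow> nat) \<Rightarrow> nat set set" where
  "lower_sets M m n = {J \<in> Pow {..<M}. (\<forall>i\<in>J. n i > 0) \<and>
     (\<forall>i<M. lower J n i \<le> m i \<and> m (Suc i) \<le> lower J n i)}"

lemma prod_prod_zero:
  fixes F :: "nat \<Rightarrow> nat \<Rightarrow> complex"
  assumes "F i j = 0" "i < a" "j < b"
  shows "(\<Prod>i<a. \<Prod>j<b. F i j) = 0"
  using assms by (intro prod_zero bexI[of _ i] bexI[of _ j]) auto

text \<open>Within the given bounds an interlacing inequality can fail only by one box. Then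
  \<open>node n i\<close> equals \<open>q * node m i\<close> or \<open>t * node m (Suc i)\<close>,
  so a factor is zero. This extends the sum over admissible sets to all subsets.\<close>

lemma kernel_poly_zero:
  assumes "\<And>i. i < M \<Longrightarrow> n i \<le> Suc (m i) \<and> m (Suc i) \<le> n i"
    and "I \<in> Pow {..<Suc M}" "I \<notin> raise_sets M m n"
  shows "(\<Prod>i<Suc M. \<Prod>j<M. node n j - tq I i * node m i) = 0"
proof -
  obtain i where i: "i < M" "\<not> (n i \<le> raise I m i \<and> raise I m (Suc i) \<le> n i)"
    using assms(2,3) by (auto simp: raise_sets_def)
  consider "i \<notin> I" "n i = Suc (m i)" | "Suc i \<in> I" "m (Suc i) = n i"
    using i assms(1)[of i] by (fastforce simp: raise_def split: if_splits)
  then show ?thesis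
  proof cases
    case 1
    then have "node n i - tq I i * node m i = 0" by (simp add: node_def)
    then show ?thesis by (rule prod_prod_zero) (use i in auto)
  next
    case 2
    then have "node n i - tq I (Suc i) * node m (Suc i) = 0" by (simp add: node_def)
    then show ?thesis by (rule prod_prod_zero) (use i in auto)
  qed
qed

lemma kernel_poly_zero':
  assumes "\<And>i. i < M \<Longrightarrow> n i \<le> Suc (m i) \<and> m (Suc i) \<le> n i"
    and "J \<in> Pow {..<M}" "J \<notin> lower_sets M m n"
  shows "(\<Prod>i<Suc M. \<Prod>j<M. node n j - tq J j * node m i) = 0"
proof -
  consider i where "i < M" "i \<notin> J" "n i = Suc (m i)" | i where "i < M" "i \<in> J" "m (Suc i) = n i"
  proof (cases "\<forall>i\<in>J. n i > 0")
    case False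
    then obtain i where i: "i \<in> J" "n i = 0" by auto
    then have "i < M" using assms(2) by auto
    \<comment> \<open>Lowering an empty row falls under the second alternative, as
      \<open>m (Suc i) \<le> n i = 0\<close>.\<close>
    with i assms(1)[of i] that show ?thesis by auto
  next
    case True
    with assms(2,3) obtain i where i: "i < M" "\<not> (lower J n i \<le> m i \<and> m (Suc i) \<le> lower J n i)"
      by (auto simp: lower_sets_def)
    then have "(i \<notin> J \<and> n i = Suc (m i)) \<or> (i \<in> J \<and> m (Suc i) = n i)"
      using assms(1)[of i] by (auto simp: lower_def split: if_splits)
    with i that show ?thesis by blast
  qed
  then show ?thesis
  proof cases
    case 1
    then have "node n i - tq J i * node m i = 0" by (simp add: node_def)
    then show ?thesis by (rule prod_prod_zero) (use 1 in auto)
  next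
    case 2
    then have "node n i - tq J i * node m (Suc i) = 0" by (simp add: node_def)
    then show ?thesis by (rule prod_prod_zero) (use 2 in auto)
  qed
qed

lemma vandermonde_node_nonzero [simp]:
  "(\<Prod>k<n. \<Prod>i<k. node r i - node r k) \<noteq> 0" "(\<Prod>k<n. \<Prod>i<k. node r k - node r i) \<noteq> 0"
  by auto

text \<open>Coefficients of the kernel identity at the nodes of \<open>m\<close> and
  \<open>n\<close>: the factor \<open>1 + w\<close> becomes the two sums over sets of size
  \<open>r\<close> and \<open>r - 1\<close>. The Vandermonde products are cancelled, being nonzero
  because nodes of different rows differ.\<close>

lemma commutation_rows:
  assumes m: "antimono m" and n: "antimono n"
    and compat: "\<And>i. i < M \<Longrightarrow> n i \<le> Suc (m i) \<and> m (Suc i) \<le> n i"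
  shows "(\<Sum>I | I \<in> raise_sets M m n \<and> card I = r.
      hrow M (raise I m) n * vrow (Suc M) m (raise I m)) =
    (\<Sum>J | J \<in> lower_sets M m n \<and> card J = r.
      hrow M m (lower J n) * vrow M (lower J n) n) +
    (\<Sum>J | J \<in> lower_sets M m n \<and> Suc (card J) = r.
      hrow M m (lower J n) * vrow M (lower J n) n)"
proof (rule sum_Pow_card_eqI)
  show "finite (raise_sets M m n)" "finite (lower_sets M m n)"
    by (auto simp: raise_sets_def lower_sets_def)
  fix w
  let ?X = "\<Prod>k<Suc M. \<Prod>i<k. node m i - node m k"
  let ?N = "\<Prod>k<M. \<Prod>i<k. node n k - node n i"
  let ?T = "\<lambda>I. hrow M (raise I m) n * vrow (Suc M) m (raise I m)"
  let ?S = "\<lambda>J. hrow M m (lower J n) * vrow M (lower J n) n"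
  let ?K = "kernel_const M m n"
  let ?P = "\<lambda>I. \<Prod>i<Suc M. \<Prod>j<M. node n j - tq I i * node m i"
  let ?Q = "\<lambda>J. \<Prod>i<Suc M. \<Prod>j<M. node n j - tq J j * node m i"
  let ?U = "\<lambda>I. \<Prod>k<Suc M. \<Prod>i<k. qt I i * node m i - qt I k * node m k"
  let ?V = "\<lambda>J. (\<Prod>k<M. \<Prod>i<k. node n k * qt J i - node n i * qt J k) * (\<Prod>j<M. qt J j)"
  have T: "?T I * ?X = ?K * (?U I * ?P I)" if "I \<in> raise_sets M m n" for I
    by (rule raise_term[OF m _ n]) (use that in \<open>auto simp: raise_sets_def\<close>)
  have S: "?S J * ?N = ?K * (?V J * ?Q J)" if "J \<in> lower_sets M m n" for J
    by (rule lower_term[OF m _ _ n]) (use that in \<open>auto simp: lower_sets_def\<close>)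
  have sub: "raise_sets M m n \<subseteq> Pow {..<Suc M}" "lower_sets M m n \<subseteq> Pow {..<M}"
    by (auto simp: raise_sets_def lower_sets_def)
  have "(\<Sum>I\<in>raise_sets M m n. w ^ card I * ?T I) * (?X * ?N) =
      (\<Sum>I\<in>raise_sets M m n. w ^ card I * (?T I * ?X)) * ?N"
    by (simp only: sum_distrib_left sum_distrib_right mult_ac)
  also have "(\<Sum>I\<in>raise_sets M m n. w ^ card I * (?T I * ?X)) =
      (\<Sum>I\<in>raise_sets M m n. w ^ card I * (?K * (?U I * ?P I)))"
    by (intro sum.cong refl) (simp only: T)
  also have "\<dots> = (\<Sum>I\<in>Pow {..<Suc M}. w ^ card I * (?K * (?U I * ?P I)))"
    by (rule sum.mono_neutral_left) (use sub kernel_poly_zero[where M = M and n = n and m = m, OF compat] in auto)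
  also have "\<dots> * ?N = ?K * (\<Sum>I\<in>Pow {..<Suc M}. w ^ card I * (?U I * ?N * ?P I))"
    by (simp only: sum_distrib_left sum_distrib_right mult_ac)
  also have "\<dots> = ?K * ((1 + w) * (\<Sum>J\<in>Pow {..<M}. w ^ card J * (?X *
      (\<Prod>k<M. \<Prod>i<k. node n k * qt J i - node n i * qt J k) * (\<Prod>j<M. qt J j) * ?Q J)))"
    by (subst kernel_identity) simp_all
  also have "\<dots> = (1 + w) * (\<Sum>J\<in>Pow {..<M}. w ^ card J * (?K * (?V J * ?Q J))) * ?X"
    by (simp only: sum_distrib_left sum_distrib_right mult_ac)
  also have "(\<Sum>J\<in>Pow {..<M}. w ^ card J * (?K * (?V J * ?Q J))) =
      (\<Sum>J\<in>lower_sets M m n. w ^ card J * (?K * (?V J * ?Q J)))"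
    by (rule sum.mono_neutral_right) (use sub kernel_poly_zero'[where M = M and n = n and m = m, OF compat] in auto)
  also have "\<dots> = (\<Sum>J\<in>lower_sets M m n. w ^ card J * (?S J * ?N))"
    by (intro sum.cong refl) (simp only: S)
  also have "(1 + w) * \<dots> * ?X = (1 + w) * (\<Sum>J\<in>lower_sets M m n. w ^ card J * ?S J) * (?X * ?N)"
    by (simp only: sum_distrib_left sum_distrib_right mult_ac)
  finally show "(\<Sum>I\<in>raise_sets M m n. w ^ card I * ?T I) =
      (1 + w) * (\<Sum>J\<in>lower_sets M m n. w ^ card J * ?S J)"
    by (simp only: mult_cancel_right) simp
qed

section \<open>The Wronski relation in terms of row lengths\<close>

definition wronski_sets :: "nat \<Rightarrow> (nat \<Rightarrow> nat) \<Rightarrow> (nat \<Rightarrow> nat) \<Rightarrow> nat set set" where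
  "wronski_sets n l v = {I \<in> Pow {..<n}. \<forall>i<n. raise I v i \<le> l i \<and> l (Suc i) \<le> raise I v i}"

definition wronski_const :: "nat \<Rightarrow> (nat \<Rightarrow> nat) \<Rightarrow> (nat \<Rightarrow> nat) \<Rightarrow> complex" where
  "wronski_const n l v = (\<Prod>j<n. \<Prod>i\<le>j.
     g (l i - l (Suc j)) (j - i) * g_inv (l i - v j) (j - i) / node v j) *
    (\<Prod>k<n. \<Prod>i<k. g (v i - v k) (k - Suc i) * g_inv (Suc (v i) - l k) (k - Suc i) /
       (- t * node l k * (q * t))) / q ^ n"

text \<open>Division by \<open>brow\<close> turns the pairs \<open>k i - k j\<close> into
  \<open>k i - k (Suc j)\<close>. Row \<open>n\<close> being empty in both shapes, the factors at
  the last index cancel and the product can be re-indexed by \<open>i < j\<close>.\<close>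

lemma hrow_div_brow:
  assumes "k n = 0" "l n = 0"
  shows "hrow n l k / brow n k =
    (\<Prod>j<n. \<Prod>i\<le>j. g (l i - l (Suc j)) (j - i) * (1 / g (l i - k j) (j - i))) *
    (\<Prod>j<n. \<Prod>i<j. g (k i - k j) (j - Suc i) * (1 / g (k i - l j) (j - Suc i)))"
proof (cases n)
  case 0
  then show ?thesis by (simp add: hrow_def brow_def)
next
  case (Suc M)
  have "hrow n l k / brow n k = (\<Prod>j<n. \<Prod>i\<le>j.
     (g (l i - l (Suc j)) (j - i) * (1 / g (l i - k j) (j - i))) *
     (g (k i - k (Suc j)) (j - i) * (1 / g (k i - l (Suc j)) (j - i))))"
    unfolding hrow_def brow_def prod_dividef[symmetric]
    by (intro prod.cong refl) simp
  also have "\<dots> = (\<Prod>j<n. \<Prod>i\<le>j. g (l i - l (Suc j)) (j - i) * (1 / g (l i - k j) (j - i))) *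
     (\<Prod>j<n. \<Prod>i\<le>j. g (k i - k (Suc j)) (j - i) * (1 / g (k i - l (Suc j)) (j - i)))"
    unfolding prod.distrib ..
  also have "(\<Prod>j<n. \<Prod>i\<le>j. g (k i - k (Suc j)) (j - i) * (1 / g (k i - l (Suc j)) (j - i))) =
     (\<Prod>j<M. \<Prod>i\<le>j. g (k i - k (Suc j)) (j - i) * (1 / g (k i - l (Suc j)) (j - i)))"
    using assms Suc by simp
  also have "\<dots> = (\<Prod>j<n. \<Prod>i<j. g (k i - k j) (j - Suc i) * (1 / g (k i - l j) (j - Suc i)))"
    unfolding Suc prod_pairs_shift by simp
  finally show ?thesis .
qed

lemma wronski_term:
  assumes v: "antimono v" and l: "antimono l" and zero: "v n = 0" "l n = 0"
    and I: "I \<in> wronski_sets n l v"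
  shows "hrow n l (raise I v) / brow n (raise I v) * vrow n v (raise I v) *
      (\<Prod>k<n. \<Prod>i<k. node v i - node v k) =
    wronski_const n l v * ((q / t) ^ card I *
      ((\<Prod>k<n. \<Prod>i<k. qt I i * node v i - qt I k * node v k) *
       (\<Prod>i<n. \<Prod>j<n. tq I j * node v j - t * node l i)))"
proof -
  let ?k = "raise I v"
  have I': "I \<subseteq> {..<n}" and valid: "\<And>i. i < n \<Longrightarrow> ?k i \<le> l i \<and> l (Suc i) \<le> ?k i"
    using I by (auto simp: wronski_sets_def)
  have kn: "?k n = 0" using I' zero by (auto simp: raise_def)
  have k: "?k b \<le> ?k a" if "a \<le> b" "b < n" for a b
  proof (cases "a = b")
    case False
    then have "Suc a \<le> b" using that by simp
    then have "l b \<le> l (Suc a)" using l by (rule antimonoD[rotated])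
    then show ?thesis using valid[of a] valid[of b] that by fastforce
  qed simp
  have A: "1 / g (l i - ?k j) (j - i) =
      g_inv (l i - v j) (j - i) / node v j * ((tq I j * node v j - t * node l i) / tq I j)"
    if ij: "i \<le> j" "j < n" for i j
  proof -
    let ?\<delta> = "if j \<in> I then 1 else 0 :: nat"
    have "?k j \<le> l i" using valid[of i] k[of i j] ij by fastforce
    then have *: "v j \<le> l i" "?\<delta> \<le> l i - v j" "l i - ?k j = l i - v j - ?\<delta>"
      by (auto simp: raise_def split: if_splits)
    have "1 / g (l i - v j - ?\<delta>) (j - i) = g_inv (l i - v j) (j - i) *
      (- (t * node l i - (if ?\<delta> = 1 then t else q) * node v j) / ((if ?\<delta> = 1 then t else q) * node v j))"
      by (rule inverse_g_right) (use * node_quotient[of i j v l] ij in auto)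
    also have "(if ?\<delta> = 1 then t else q) = tq I j" by simp
    also have "g_inv (l i - v j) (j - i) * (- (t * node l i - tq I j * node v j) / (tq I j * node v j)) =
       g_inv (l i - v j) (j - i) / node v j * ((tq I j * node v j - t * node l i) / tq I j)"
      by (simp add: mult.commute)
    finally show ?thesis by (simp only: *(3))
  qed
  have B: "1 / g (?k i - l j) (j - Suc i) =
      g_inv (Suc (v i) - l j) (j - Suc i) / (- t * node l j) * (tq I i * node v i - t * node l j)"
    if ij: "i < j" "j < n" for i j
  proof -
    let ?\<delta> = "if i \<in> I then 0 else 1 :: nat"
    have "l j \<le> ?k i" using valid[of "i"] antimonoD[OF l, of "Suc i" j] ij by fastforce
    then have *: "l j \<le> Suc (v i)" "?\<delta> \<le> Suc (v i) - l j" "?k i - l j = Suc (v i) - l j - ?\<delta>"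
      by (auto simp: raise_def split: if_splits)
    have "t ^ (j - i) = t * t ^ (j - Suc i)" using ij by (simp add: Suc_diff_Suc[symmetric])
    then have "1 / g (Suc (v i) - l j - ?\<delta>) (j - Suc i) = g_inv (Suc (v i) - l j) (j - Suc i) *
      ((t * node l j - (if ?\<delta> = 1 then q else t) * node v i) / (t * node l j))"
      by (intro inverse_g_left) (use * node_quotient_Suc[of i j l v] ij in auto)
    also have "(if ?\<delta> = 1 then q else t) = tq I i" by simp
    also have "g_inv (Suc (v i) - l j) (j - Suc i) * ((t * node l j - tq I i * node v i) / (t * node l j)) =
      g_inv (Suc (v i) - l j) (j - Suc i) / (- t * node l j) * (tq I i * node v i - t * node l j)"
      by (simp add: field_simps)
    finally show ?thesis by (simp only: *(3))
  qed
  have C: "g (?k i - ?k j) (j - Suc i) * vpair v ?k i j * (node v i - node v j) =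
      g (v i - v j) (j - Suc i) * ((qt I i * node v i - qt I j * node v j) / qt I j)"
    if ij: "i < j" "j < n" for i j
  proof -
    have "node v i - node v j \<noteq> 0" using ij by simp
    moreover have "g (?k i - ?k j) (j - Suc i) * vpair v ?k i j = g (v i - v j) (j - Suc i) *
       ((qt I i * node v i - qt I j * node v j) / (qt I j * (node v i - node v j)))"
      by (rule pair_raise) (use ij k[of i j] antimonoD[OF v, of i j] in auto)
    ultimately show ?thesis by simp
  qed
  \<comment> \<open>The coefficients \<open>1 / tq\<close> and \<open>1 / qt\<close> are
    complementary off the diagonal. The diagonal leaves one \<open>1 / tq I j\<close> for each row,
    the origin of \<open>(q / t) ^ card I / q ^ n\<close>.\<close>
  have D: "(\<Prod>j<n. \<Prod>i\<le>j. 1 / tq I j) * (\<Prod>j<n. \<Prod>i<j. 1 / qt I j) =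
     (\<Prod>j<n. \<Prod>i<j. 1 / (q * t)) * ((q / t) ^ card I / q ^ n)"
  proof -
    have "(\<Prod>j<n. \<Prod>i\<le>j. 1 / tq I j) * (\<Prod>j<n. \<Prod>i<j. 1 / qt I j) =
       (\<Prod>j<n. (\<Prod>i<j. 1 / (q * t)) * (1 / tq I j))"
      unfolding prod.distrib[symmetric]
      by (intro prod.cong refl) (simp add: lessThan_Suc_atMost[symmetric] power_mult_distrib divide_simps)
    also have "\<dots> = (\<Prod>j<n. \<Prod>i<j. 1 / (q * t)) * (\<Prod>j<n. 1 / tq I j)"
      by (rule prod.distrib)
    also have "(\<Prod>j<n. 1 / tq I j) = (\<Prod>j<n. (if j \<in> I then q / t else 1) * (1 / q))"
      by (intro prod.cong refl) simp
    also have "\<dots> = (\<Prod>j<n. if j \<in> I then q / t else 1) / q ^ n"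
      by (simp add: prod_dividef)
    also have "(\<Prod>j<n. if j \<in> I then q / t else 1) = (q / t) ^ card I"
      using I' by (simp add: prod.If_cases Int_absorb1)
    finally show ?thesis .
  qed
  have "hrow n l ?k / brow n ?k * vrow n v ?k * (\<Prod>j<n. \<Prod>i<j. node v i - node v j) =
     (\<Prod>j<n. \<Prod>i\<le>j. g (l i - l (Suc j)) (j - i) * (1 / g (l i - ?k j) (j - i))) *
     (\<Prod>j<n. \<Prod>i<j. (g (?k i - ?k j) (j - Suc i) * vpair v ?k i j * (node v i - node v j)) *
        (1 / g (?k i - l j) (j - Suc i)))"
    unfolding hrow_div_brow[where k = ?k and n = n and l = l, OF kn zero(2)] vrow_def
    by (simp add: prod.distrib prod_dividef)
  also have "(\<Prod>j<n. \<Prod>i\<le>j. g (l i - l (Suc j)) (j - i) * (1 / g (l i - ?k j) (j - i))) =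
     (\<Prod>j<n. \<Prod>i\<le>j. (g (l i - l (Suc j)) (j - i) * g_inv (l i - v j) (j - i) / node v j) *
       (1 / tq I j) * (tq I j * node v j - t * node l i))"
    by (intro prod.cong refl) (simp add: A)
  also have "(\<Prod>j<n. \<Prod>i<j. (g (?k i - ?k j) (j - Suc i) * vpair v ?k i j * (node v i - node v j)) *
        (1 / g (?k i - l j) (j - Suc i))) =
     (\<Prod>j<n. \<Prod>i<j. (g (v i - v j) (j - Suc i) * g_inv (Suc (v i) - l j) (j - Suc i) /
       (- t * node l j)) * (1 / qt I j) *
       ((qt I i * node v i - qt I j * node v j) * (tq I i * node v i - t * node l j)))"
  proof (intro prod.cong refl)
    fix j i assume "j \<in> {..<n}" "i \<in> {..<j}"
    then show "(g (?k i - ?k j) (j - Suc i) * vpair v ?k i j * (node v i - node v j)) *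
        (1 / g (?k i - l j) (j - Suc i)) =
      (g (v i - v j) (j - Suc i) * g_inv (Suc (v i) - l j) (j - Suc i) /
       (- t * node l j)) * (1 / qt I j) *
       ((qt I i * node v i - qt I j * node v j) * (tq I i * node v i - t * node l j))"
      by (simp only: B C lessThan_iff) (simp only: divide_inverse mult_ac mult_1_left)
  qed
  also have "(\<Prod>j<n. \<Prod>i\<le>j. (g (l i - l (Suc j)) (j - i) * g_inv (l i - v j) (j - i) / node v j) *
       (1 / tq I j) * (tq I j * node v j - t * node l i)) * \<dots> =
     ((\<Prod>j<n. \<Prod>i\<le>j. g (l i - l (Suc j)) (j - i) * g_inv (l i - v j) (j - i) / node v j) *
      (\<Prod>j<n. \<Prod>i<j. g (v i - v j) (j - Suc i) * g_inv (Suc (v i) - l j) (j - Suc i) / (- t * node l j))) *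
     ((\<Prod>j<n. \<Prod>i\<le>j. 1 / tq I j) * (\<Prod>j<n. \<Prod>i<j. 1 / qt I j)) *
     ((\<Prod>k<n. \<Prod>i<k. qt I i * node v i - qt I k * node v k) *
       ((\<Prod>j<n. \<Prod>i\<le>j. tq I j * node v j - t * node l i) *
        (\<Prod>j<n. \<Prod>i<j. tq I i * node v i - t * node l j)))"
    by (simp only: prod.distrib mult_ac)
  also have "\<dots> = wronski_const n l v * ((q / t) ^ card I *
      ((\<Prod>k<n. \<Prod>i<k. qt I i * node v i - qt I k * node v k) *
       (\<Prod>i<n. \<Prod>j<n. tq I j * node v j - t * node l i)))"
  proof -
    have E: "(\<Prod>k<n. \<Prod>i<k. g (v i - v k) (k - Suc i) * g_inv (Suc (v i) - l k) (k - Suc i) /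
       (- t * node l k * (q * t))) =
      (\<Prod>j<n. \<Prod>i<j. g (v i - v j) (j - Suc i) * g_inv (Suc (v i) - l j) (j - Suc i) / (- t * node l j)) *
      (\<Prod>j<n. \<Prod>i<j. 1 / (q * t))"
      unfolding prod.distrib[symmetric] by (intro prod.cong refl) simp
    show ?thesis unfolding D wronski_const_def prod_square_split[of _ n] E by (simp only: divide_inverse mult_ac)
  qed
  finally show ?thesis .
qed

lemma wronski_poly_zero:
  assumes "\<And>i. i < n \<Longrightarrow> v i \<le> l i \<and> l (Suc i) \<le> Suc (v i)" and zero: "l n = 0"
    and "I \<in> Pow {..<n}" "I \<notin> wronski_sets n l v"
  shows "(\<Prod>i<n. \<Prod>j<n. tq I j * node v j - t * node l i) = 0"
proof -
  obtain i where i: "i < n" "\<not> (raise I v i \<le> l i \<and> l (Suc i) \<le> raise I v i)"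
    using assms(3,4) by (auto simp: wronski_sets_def)
  consider "i \<in> I" "v i = l i" | "i \<notin> I" "l (Suc i) = Suc (v i)"
    using i assms(1)[of i] by (fastforce simp: raise_def split: if_splits)
  then show ?thesis
  proof cases
    case 1
    then have "tq I i * node v i - t * node l i = 0" by (simp add: node_def)
    then show ?thesis
      by (intro prod_prod_zero[of "\<lambda>i j. tq I j * node v j - t * node l i" i i]) (use i in auto)
  next
    case 2
    \<comment> \<open>The square of factors has no row \<open>n\<close>; \<open>l n = 0\<close>
      guarantees that the vanishing factor lies inside it.\<close>
    have "Suc i \<noteq> n" using 2 zero by auto
    with i have "Suc i < n" by simp
    have "tq I i * node v i - t * node l (Suc i) = 0" using 2 by (simp add: node_def)
    then show ?thesis
      by (intro prod_prod_zero[of "\<lambda>i j. tq I j * node v j - t * node l i" "Suc i" i])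
        (use i \<open>Suc i < n\<close> in auto)
  qed
qed

text \<open>The Wronski identity at the nodes of \<open>l\<close> and \<open>v\<close>. Their
  products differ by \<open>q ^ d\<close>, as the powers of \<open>t\<close> agree, and the two
  values of \<open>w\<close> give the two terms of the last factor.\<close>

lemma wronski_rows:
  assumes v: "antimono v" and l: "antimono l" and zero: "v n = 0" "l n = 0"
    and compat: "\<And>i. i < n \<Longrightarrow> v i \<le> l i \<and> l (Suc i) \<le> Suc (v i)"
    and d: "(\<Sum>i<n. l i) = (\<Sum>i<n. v i) + d"
  shows "(\<Sum>I\<in>wronski_sets n l v. (- 1) ^ card I *
      (hrow n l (raise I v) / brow n (raise I v) * vrow n v (raise I v)) *
      (q ^ d * (t / q) ^ card I - 1)) = 0"
proof -
  let ?N = "\<Prod>k<n. \<Prod>i<k. node v i - node v k"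
  let ?T = "\<lambda>I. hrow n l (raise I v) / brow n (raise I v) * vrow n v (raise I v)"
  let ?A = "\<lambda>I. (\<Prod>k<n. \<Prod>i<k. qt I i * node v i - qt I k * node v k) *
       (\<Prod>i<n. \<Prod>j<n. tq I j * node v j - t * node l i)"
  let ?K = "wronski_const n l v"
  have "(\<Prod>i<n. node l i) = (\<Prod>i<n. node v i) * q ^ d"
    by (simp add: node_def prod_dividef power_sum[symmetric] d power_add)
  moreover have "(\<Prod>i<n. node l i) * (\<Sum>I\<in>Pow {..<n}. (- 1) ^ card I * ?A I) =
    (\<Prod>i<n. node v i) * (\<Sum>I\<in>Pow {..<n}. (- (q / t)) ^ card I * ?A I)"
    by (rule wronski_identity) (auto simp: q_neq_t inj_on_def)
  moreover have "(\<Prod>i<n. node v i) \<noteq> 0" by simp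
  ultimately have W: "q ^ d * (\<Sum>I\<in>Pow {..<n}. (- 1) ^ card I * ?A I) =
     (\<Sum>I\<in>Pow {..<n}. (- (q / t)) ^ card I * ?A I)"
    by (metis (no_types, lifting) mult.assoc mult_left_cancel)
  have c: "(q / t) ^ c * ((- 1) ^ c * (q ^ d * (t / q) ^ c - 1)) =
      q ^ d * (- 1) ^ c - (- (q / t)) ^ c" for c
  proof -
    have "(q / t) ^ c * (t / q) ^ c = 1" by (simp add: power_divide)
    moreover have "(- (q / t)) ^ c = (- 1) ^ c * (q / t) ^ c" by (rule power_minus)
    ultimately show ?thesis by (simp add: algebra_simps)
  qed
  have "(\<Sum>I\<in>wronski_sets n l v. (- 1) ^ card I * ?T I * (q ^ d * (t / q) ^ card I - 1)) * ?N =
     (\<Sum>I\<in>wronski_sets n l v. (- 1) ^ card I * (q ^ d * (t / q) ^ card I - 1) * (?T I * ?N))"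
    by (simp only: sum_distrib_left sum_distrib_right mult_ac)
  also have "\<dots> = (\<Sum>I\<in>wronski_sets n l v. (- 1) ^ card I * (q ^ d * (t / q) ^ card I - 1) *
     (?K * ((q / t) ^ card I * ?A I)))"
    by (intro sum.cong refl) (simp only: wronski_term[OF v l zero])
  also have "\<dots> = (\<Sum>I\<in>Pow {..<n}. (- 1) ^ card I * (q ^ d * (t / q) ^ card I - 1) *
     (?K * ((q / t) ^ card I * ?A I)))"
    by (rule sum.mono_neutral_left)
       (use wronski_poly_zero[where n = n and v = v and l = l, OF compat zero(2)] in \<open>auto simp: wronski_sets_def\<close>)
  also have "\<dots> = (\<Sum>I\<in>Pow {..<n}. ?K * (q ^ d * ((- 1) ^ card I * ?A I) - (- (q / t)) ^ card I * ?A I))"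
  proof (intro sum.cong refl)
    fix I
    have "(- 1) ^ card I * (q ^ d * (t / q) ^ card I - 1) * (?K * ((q / t) ^ card I * ?A I)) =
      ?K * (((q / t) ^ card I * ((- 1) ^ card I * (q ^ d * (t / q) ^ card I - 1))) * ?A I)"
      by (simp only: mult_ac)
    also have "\<dots> = ?K * (q ^ d * ((- 1) ^ card I * ?A I) - (- (q / t)) ^ card I * ?A I)"
      unfolding c by (simp only: left_diff_distrib mult.assoc)
    finally show "(- 1) ^ card I * (q ^ d * (t / q) ^ card I - 1) * (?K * ((q / t) ^ card I * ?A I)) =
      ?K * (q ^ d * ((- 1) ^ card I * ?A I) - (- (q / t)) ^ card I * ?A I)" .
  qed
  also have "\<dots> = ?K * (q ^ d * (\<Sum>I\<in>Pow {..<n}. (- 1) ^ card I * ?A I) -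
      (\<Sum>I\<in>Pow {..<n}. (- (q / t)) ^ card I * ?A I))"
    by (simp only: sum_distrib_left[symmetric] sum_subtractf)
  also have "\<dots> = 0" unfolding W by simp
  finally show ?thesis by (simp only: mult_eq_0_iff) simp
qed

end

section \<open>Partitions and strips\<close>

text \<open>Rows and columns are numbered from \<open>0\<close> here.\<close>

definition rlen :: "nat list \<Rightarrow> nat \<Rightarrow> nat" where
  "rlen lam i = part lam (Suc i)"

abbreviation clen :: "nat list \<Rightarrow> nat \<Rightarrow> nat" where
  "clen lam \<equiv> rlen (transpose_partition lam)"

lemma rlen_nth: "rlen lam i = (if i < length lam then lam ! i else 0)"
  by (simp add: rlen_def part_def)

lemma part_Suc [simp]: "part lam (Suc i) = rlen lam i"
  by (simp add: rlen_def)

lemma rlen_Nil [simp]: "rlen [] i = 0"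
  by (simp add: rlen_nth)

lemma is_partition_Nil [simp]: "is_partition []"
  by (simp add: is_partition_def)

lemma rlen_eq_0 [simp]: "length lam \<le> i \<Longrightarrow> rlen lam i = 0"
  by (simp add: rlen_nth)

lemma rlen_pos_iff: "is_partition lam \<Longrightarrow> 0 < rlen lam i \<longleftrightarrow> i < length lam"
  by (auto simp: rlen_nth is_partition_def) (metis nth_mem neq0_conv)

lemma antimono_rlen: "is_partition lam \<Longrightarrow> antimono (rlen lam)"
  by (intro antimonoI) (auto simp: rlen_nth is_partition_def sorted_wrt_iff_nth_less le_less)

lemma rlen_le_rlen: "is_partition lam \<Longrightarrow> i \<le> j \<Longrightarrow> rlen lam j \<le> rlen lam i"
  by (rule antimonoD[OF antimono_rlen])

lemma partition_eqI:
  assumes "is_partition lam" "is_partition mu" "\<And>i. rlen lam i = rlen mu i"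
  shows "lam = mu"
proof (rule nth_equalityI)
  show len: "length lam = length mu"
    using assms rlen_pos_iff by (metis linorder_neqE_nat less_irrefl)
  fix i assume "i < length lam"
  then show "lam ! i = mu ! i" using assms(3)[of i] len by (simp add: rlen_nth)
qed

lemma ex_partition:
  assumes "antimono f" "f n = (0 :: nat)"
  shows "\<exists>lam. is_partition lam \<and> rlen lam = f"
proof -
  define k where "k = (LEAST i. f i = 0)"
  have k: "f k = 0" unfolding k_def using assms(2) by (rule LeastI)
  have pos: "f i \<noteq> 0" if "i < k" for i using not_less_Least that unfolding k_def by blast
  have "0 \<notin> f ` {..<k}" using pos by force
  then have "is_partition (map f [0..<k])"
    using antimonoD[OF assms(1)]
    by (auto simp: is_partition_def sorted_wrt_iff_nth_less atLeast0LessThan)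
  moreover have "rlen (map f [0..<k]) = f"
    using antimonoD[OF assms(1), of k] k by (auto simp: fun_eq_iff rlen_nth)
  ultimately show ?thesis by blast
qed

lemma sum_list_rlen: "length lam \<le> n \<Longrightarrow> sum_list lam = (\<Sum>i<n. rlen lam i)"
proof -
  assume n: "length lam \<le> n"
  have "sum_list lam = (\<Sum>i<length lam. rlen lam i)"
    by (simp add: sum_list_sum_nth atLeast0LessThan rlen_nth)
  also have "\<dots> = (\<Sum>i<n. rlen lam i)"
    using n by (intro sum.mono_neutral_left) auto
  finally show ?thesis .
qed

lemma rlen_transpose: "rlen (transpose_partition lam) j = card {i. j < rlen lam i}"
  if "is_partition lam"
proof -
  have C: "card {i \<in> {1..length lam}. Suc j \<le> part lam i} = card {i. j < rlen lam i}"
  proof -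
    have "{i \<in> {1..length lam}. Suc j \<le> part lam i} = Suc ` {i. j < rlen lam i}"
    proof (intro subset_antisym subsetI)
      fix x assume "x \<in> {i \<in> {1..length lam}. Suc j \<le> part lam i}"
      then show "x \<in> Suc ` {i. j < rlen lam i}" by (cases x) auto
    next
      fix x assume "x \<in> Suc ` {i. j < rlen lam i}"
      then obtain i where "x = Suc i" "j < rlen lam i" by auto
      then show "x \<in> {i \<in> {1..length lam}. Suc j \<le> part lam i}"
        by (auto simp: rlen_nth split: if_splits)
    qed
    then show ?thesis by (simp add: card_image)
  qed
  show ?thesis
  proof (cases "j < rlen lam 0")
    case True
    then show ?thesis using C
      by (simp add: rlen_nth[of "map f xs" for f xs] transpose_partition_def del: upt_Suc)
  next
    case False
    then have "{i. j < rlen lam i} = {}" using rlen_le_rlen[OF that, of 0] by (auto simp: not_less intro: order_trans)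
    with False show ?thesis
      by (simp add: rlen_nth[of "map f xs" for f xs] transpose_partition_def del: upt_Suc)
  qed
qed

text \<open>The rows longer than \<open>j\<close> form an initial segment, so their number is the
  first index that is missing. Facts about columns are read off from this equivalence.\<close>

lemma less_clen_iff: "i < clen lam j \<longleftrightarrow> j < rlen lam i" if lam: "is_partition lam"
proof -
  let ?S = "{i. j < rlen lam i}"
  have fin: "finite ?S"
    by (rule finite_subset[of _ "{..<length lam}"]) (auto simp: rlen_nth split: if_splits)
  have down: "b \<in> ?S" if "a \<in> ?S" "b \<le> a" for a b
    using rlen_le_rlen[OF lam that(2)] that(1) by auto
  have "i < card ?S" if "i \<in> ?S"
  proof -
    have "{..i} \<subseteq> ?S" using down that by auto
    from card_mono[OF fin this] show ?thesis by simp
  qed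
  moreover have "i \<in> ?S" if "i < card ?S"
  proof (rule ccontr)
    assume "i \<notin> ?S"
    then have "?S \<subseteq> {..<i}" using down by (meson lessThan_iff not_less subsetI)
    from card_mono[OF _ this] that show False by simp
  qed
  ultimately show ?thesis using rlen_transpose[OF lam] by auto
qed

lemma is_partition_transpose: "is_partition lam \<Longrightarrow> is_partition (transpose_partition lam)"
proof -
  assume lam: "is_partition lam"
  have len: "length (transpose_partition lam) = rlen lam 0"
    by (simp add: transpose_partition_def del: upt_Suc)
  have "antimono (clen lam)"
  proof (rule antimonoI, rule ccontr)
    fix x y :: nat assume "x \<le> y" "\<not> clen lam y \<le> clen lam x"
    then have "clen lam x < clen lam y" by simp
    with \<open>x \<le> y\<close> show False using less_clen_iff[OF lam] by (metis less_irrefl order_le_less_trans)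
  qed
  moreover have "0 < clen lam i" if "i < rlen lam 0" for i
    using that less_clen_iff[OF lam, of 0 i] by simp
  ultimately have mono: "clen lam j \<le> clen lam i" and pos: "k < rlen lam 0 \<Longrightarrow> 0 < clen lam k"
    if "i \<le> j" for i j k
    using that by (auto dest: antimonoD)
  have nth: "transpose_partition lam ! i = clen lam i" if "i < rlen lam 0" for i
    using that len by (simp add: rlen_nth)
  show ?thesis
    unfolding is_partition_def sorted_wrt_iff_nth_less in_set_conv_nth len
    using mono pos nth by (metis less_imp_le_nat less_irrefl order.strict_trans order_refl)
qed

lemma clen_transpose: "is_partition lam \<Longrightarrow> clen (transpose_partition lam) i = rlen lam i"
  by (metis is_partition_transpose less_clen_iff linorder_neqE_nat less_irrefl)

lemma transpose_transpose [simp]: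
  "is_partition lam \<Longrightarrow> transpose_partition (transpose_partition lam) = lam"
  by (rule partition_eqI) (simp_all add: is_partition_transpose clen_transpose)

lemma sum_list_transpose:
  assumes "is_partition lam"
  shows "sum_list (transpose_partition lam) = sum_list lam"
proof -
  let ?L = "length lam" and ?C = "rlen lam 0"
  have r: "rlen lam i \<le> ?C" for i using rlen_le_rlen[OF assms] by simp
  have c: "clen lam j \<le> ?L" for j
    using less_clen_iff[OF assms, of ?L j] by (simp add: not_less)
  have "sum_list (transpose_partition lam) = (\<Sum>j<?C. clen lam j)"
    by (rule sum_list_rlen) (simp add: transpose_partition_def del: upt_Suc)
  also have "\<dots> = (\<Sum>j<?C. \<Sum>i<?L. if j < rlen lam i then 1 else 0)"
  proof (rule sum.cong[OF refl])
    fix j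
    have "(\<Sum>i<?L. if j < rlen lam i then 1 else 0) = card {i\<in>{..<?L}. j < rlen lam i}"
      by (simp add: sum.If_cases Int_def)
    also have "{i\<in>{..<?L}. j < rlen lam i} = {..<clen lam j}"
      using less_clen_iff[OF assms] c by (auto intro: order.strict_trans2)
    finally show "clen lam j = (\<Sum>i<?L. if j < rlen lam i then 1 else 0)" by simp
  qed
  also have "\<dots> = (\<Sum>i<?L. \<Sum>j<?C. if j < rlen lam i then 1 else 0)"
    by (rule sum.swap)
  also have "\<dots> = (\<Sum>i<?L. rlen lam i)"
  proof (rule sum.cong[OF refl])
    fix i
    have "(\<Sum>j<?C. if j < rlen lam i then 1 else 0) = card {j\<in>{..<?C}. j < rlen lam i}"
      by (simp add: sum.If_cases Int_def)
    also have "{j\<in>{..<?C}. j < rlen lam i} = {..<rlen lam i}"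
      using r by (auto intro: order.strict_trans2)
    finally show "(\<Sum>j<?C. if j < rlen lam i then 1 else 0) = rlen lam i" by simp
  qed
  also have "\<dots> = sum_list lam" by (rule sum_list_rlen[symmetric]) simp
  finally show ?thesis .
qed

section \<open>Horizontal and vertical strips\<close>

definition hstrip :: "nat list \<Rightarrow> nat list \<Rightarrow> bool" where
  "hstrip lam mu \<longleftrightarrow> (\<forall>i. rlen mu i \<le> rlen lam i \<and> rlen lam (Suc i) \<le> rlen mu i)"

definition vstrip :: "nat list \<Rightarrow> nat list \<Rightarrow> bool" where
  "vstrip lam mu \<longleftrightarrow> (\<forall>i. rlen mu i \<le> rlen lam i \<and> rlen lam i \<le> Suc (rlen mu i))"

text \<open>Inequalities between lengths are rewritten as implications between memberships of boxes;
  there, passing from columns to rows only exchanges two universal quantifiers.\<close>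

lemma hstrip_transpose:
  assumes "is_partition lam" "is_partition mu"
  shows "hstrip (transpose_partition lam) (transpose_partition mu) \<longleftrightarrow> vstrip lam mu"
proof -
  have A: "(\<forall>c. c < a \<longrightarrow> c < b) \<longleftrightarrow> a \<le> b" for a b :: nat
    by (meson less_le_trans not_less order_refl)
  have B: "(\<forall>c. Suc c < b \<longrightarrow> c < a) \<longleftrightarrow> b \<le> Suc a" for a b :: nat
    by (meson Suc_less_eq less_le_trans not_less order_refl)
  have "clen mu c \<le> clen lam c \<longleftrightarrow> (\<forall>i. c < rlen mu i \<longrightarrow> c < rlen lam i)" for c
    using less_clen_iff[OF assms(1)] less_clen_iff[OF assms(2)] by (metis less_le_trans not_less order_refl)
  moreover have "clen lam (Suc c) \<le> clen mu c \<longleftrightarrow> (\<forall>i. Suc c < rlen lam i \<longrightarrow> c < rlen mu i)" for c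
    using less_clen_iff[OF assms(1)] less_clen_iff[OF assms(2)] by (metis less_le_trans not_less order_refl)
  ultimately have "hstrip (transpose_partition lam) (transpose_partition mu) \<longleftrightarrow>
     (\<forall>i. (\<forall>c. c < rlen mu i \<longrightarrow> c < rlen lam i) \<and> (\<forall>c. Suc c < rlen lam i \<longrightarrow> c < rlen mu i))"
    unfolding hstrip_def by blast
  then show ?thesis unfolding A B vstrip_def .
qed

lemma hstrip_length: "hstrip lam mu \<Longrightarrow> is_partition lam \<Longrightarrow> is_partition mu \<Longrightarrow>
    length mu \<le> length lam \<and> length lam \<le> Suc (length mu)"
proof -
  assume a: "hstrip lam mu" "is_partition lam" "is_partition mu"
  have "rlen lam (Suc (length mu)) = 0" using a(1) by (metis hstrip_def le_zero_eq order_refl rlen_eq_0)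
  moreover have "rlen mu (length lam) = 0" using a(1) by (metis hstrip_def le_zero_eq order_refl rlen_eq_0)
  ultimately show ?thesis using rlen_pos_iff[OF a(2)] rlen_pos_iff[OF a(3)] by (metis less_irrefl not_less)
qed

lemma vstrip_length: "vstrip lam mu \<Longrightarrow> is_partition lam \<Longrightarrow> is_partition mu \<Longrightarrow> length mu \<le> length lam"
  by (metis vstrip_def le_zero_eq less_irrefl not_less order_refl rlen_eq_0 rlen_pos_iff)

lemma hstrip_refl: "is_partition lam \<Longrightarrow> hstrip lam lam"
  using rlen_le_rlen[of lam] by (simp add: hstrip_def)

lemma vstrip_refl: "vstrip lam lam"
  by (simp add: vstrip_def)

lemma sum_list_mono_rlen:
  assumes "\<And>i. rlen mu i \<le> rlen lam i"
  shows "sum_list mu \<le> sum_list lam"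
proof -
  let ?n = "max (length lam) (length mu)"
  show ?thesis
    using assms by (subst (1 2) sum_list_rlen[where n = ?n]) (auto intro: sum_mono)
qed

lemma partition_eq_of_sum_list:
  assumes "\<And>i. rlen mu i \<le> rlen lam i" "sum_list mu = sum_list lam"
    "is_partition mu" "is_partition lam"
  shows "mu = lam"
proof (rule partition_eqI)
  fix i
  let ?n = "Suc (max i (max (length lam) (length mu)))"
  have "(\<Sum>j<?n. rlen mu j) = (\<Sum>j<?n. rlen lam j)"
    using assms(2) by (subst (asm) (1 2) sum_list_rlen[where n = ?n]) auto
  then show "rlen mu i = rlen lam i"
    using sum_mono_inv[of "rlen mu" "{..<?n}" "rlen lam" i] assms(1) by auto
qed (use assms in auto)

lemma hstrip_sum_list: "hstrip lam mu \<Longrightarrow> sum_list mu \<le> sum_list lam"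
  by (rule sum_list_mono_rlen) (simp add: hstrip_def)

lemma vstrip_sum_list: "vstrip lam mu \<Longrightarrow> sum_list mu \<le> sum_list lam"
  by (rule sum_list_mono_rlen) (simp add: vstrip_def)

lemma finite_partitions: "finite {lam. is_partition lam \<and> sum_list lam \<le> n}"
proof -
  have len: "length mu \<le> sum_list mu" if "0 \<notin> set mu" for mu :: "nat list"
    using that by (induction mu) auto
  have "{lam. is_partition lam \<and> sum_list lam \<le> n} \<subseteq> {mu. set mu \<subseteq> {..n} \<and> length mu \<le> n}"
    using len by (auto simp: is_partition_def dest: member_le_sum_list) (metis len le_trans)
  then show ?thesis
    by (rule finite_subset) (rule finite_lists_length_le, simp)
qed

section \<open>Branching coefficients of partitions\<close>

text \<open>The factor of a box with arm \<open>a\<close> and leg \<open>l\<close> in Macdonald's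
  product for the inverse norm.\<close>

definition box_factor :: "complex \<Rightarrow> complex \<Rightarrow> nat \<Rightarrow> nat \<Rightarrow> complex" where
  "box_factor q t a l = (1 - q ^ a * t ^ Suc l) / (1 - q ^ Suc a * t ^ l)"

lemma box_factor_swap: "box_factor t q a l = 1 / box_factor q t l a"
  by (simp add: box_factor_def mult.commute)

lemma prod_atLeastLessThan_if:
  fixes F :: "nat \<Rightarrow> 'a::comm_monoid_mult"
  assumes "b \<le> n"
  shows "(\<Prod>c\<in>{a..<b}. F c) = (\<Prod>c<n. if a \<le> c \<and> c < b then F c else 1)"
proof -
  have "{c \<in> {..<n}. a \<le> c \<and> c < b} = {a..<b}" using assms by auto
  then show ?thesis by (simp add: prod.inter_filter[symmetric])
qed

lemma prod_pairs_less_if: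
  fixes F :: "nat \<Rightarrow> nat \<Rightarrow> 'a::comm_monoid_mult"
  shows "(\<Prod>c<L. \<Prod>k<L. if c < k then F c k else 1) = (\<Prod>k<L. \<Prod>c<k. F c k)"
proof -
  have "(\<Prod>c<L. if c < k then F c k else 1) = (\<Prod>c<k. F c k)" if "k < L" for k
  proof -
    have "{c \<in> {..<L}. c < k} = {..<k}" using that by auto
    then show ?thesis by (simp add: prod.inter_filter[symmetric])
  qed
  then show ?thesis by (subst prod.swap) simp
qed

lemma (in macdonald_parameters) swapped: "macdonald_parameters t q"
proof
  show "generic_parameters t q"
    using generic unfolding generic_parameters_def by (metis mult.commute)
qed

context macdonald_parameters
begin

lemma box_factor_nonzero [simp]: "box_factor q t a l \<noteq> 0"
  using generic_neq_one[of a "Suc l"] generic_neq_one[of "Suc a" l] unfolding box_factor_def by auto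

lemma g_Suc_box: "g (Suc m) k = g m k / box_factor q t m k"
  by (simp add: g_Suc box_factor_def)

text \<open>Along a row with fixed leg the box factors are quotients of consecutive values of
  \<open>g\<close>, so the product telescopes.\<close>

lemma prod_box_factor:
  assumes "x \<le> y" "y \<le> r"
  shows "(\<Prod>c\<in>{x..<y}. box_factor q t (r - Suc c) k) = g (r - y) k / g (r - x) k"
  using assms
proof (induction y)
  case (Suc y)
  show ?case
  proof (cases "x = Suc y")
    case False
    then have "x \<le> y" using Suc.prems by simp
    have "r - y = Suc (r - Suc y)" using Suc.prems by simp
    then have "g (r - y) k = g (r - Suc y) k / box_factor q t (r - Suc y) k"
      by (simp add: g_Suc_box)
    then show ?thesis using Suc \<open>x \<le> y\<close> by (simp add: prod.atLeastLessThan_Suc)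
  qed simp
qed simp

lemma f_ratio_g: "f_ratio q t d (q ^ m * t ^ k) = g (m + d) k / g m k"
proof (induction d)
  case 0
  then show ?case by (simp add: f_ratio_def)
next
  case (Suc d)
  have "f_ratio q t (Suc d) (q ^ m * t ^ k) = f_ratio q t d (q ^ m * t ^ k) *
      ((1 - q ^ Suc (m + d) * t ^ k) / (1 - q ^ (m + d) * t ^ Suc k))"
    by (simp add: f_ratio_def power_add mult_ac)
  then show ?case unfolding Suc by (simp add: g_Suc)
qed

text \<open>At \<open>q ^ m * t ^ k\<close> a ratio of \<open>f\<close> is a quotient of two values
  of \<open>g\<close>, so the four \<open>f\<close> in the definition become four \<open>g\<close>.
  Rows after \<open>length mu\<close> contribute 1, because there \<open>mu\<close> and the next row
  of \<open>lam\<close> are both empty.\<close>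

lemma psi_hrow:
  assumes lam: "is_partition lam" and mu: "is_partition mu" and strip: "hstrip lam mu"
    and n: "length mu \<le> n"
  shows "psi q t lam mu = hrow n (rlen lam) (rlen mu)"
proof -
  let ?L = "length mu"
  let ?F = "\<lambda>i j. f_ratio q t (rlen lam i - rlen mu i)
       (q powi (int (rlen mu i) - int (rlen lam (Suc j))) * t ^ (j - i)) /
     f_ratio q t (rlen lam i - rlen mu i)
       (q powi (int (rlen mu i) - int (rlen mu j)) * t ^ (j - i))"
  let ?G = "\<lambda>i j. g (rlen mu i - rlen mu j) (j - i) * g (rlen lam i - rlen lam (Suc j)) (j - i) /
     (g (rlen lam i - rlen mu j) (j - i) * g (rlen mu i - rlen lam (Suc j)) (j - i))"
  have S: "{(i, j). 1 \<le> i \<and> i \<le> j \<and> j \<le> ?L} = (\<lambda>(j, i). (Suc i, Suc j)) ` (SIGMA j:{..<?L}. {..j})"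
  proof (intro subset_antisym subsetI)
    fix x assume "x \<in> {(i, j). 1 \<le> i \<and> i \<le> j \<and> j \<le> ?L}"
    then obtain a b where "x = (a, b)" "1 \<le> a" "a \<le> b" "b \<le> ?L" by auto
    then show "x \<in> (\<lambda>(j, i). (Suc i, Suc j)) ` (SIGMA j:{..<?L}. {..j})"
      by (intro image_eqI[of _ _ "(b - 1, a - 1)"]) auto
  qed auto
  have "psi q t lam mu = (\<Prod>(j, i)\<in>(SIGMA j:{..<?L}. {..j}). ?F i j)"
    unfolding psi_def S
    by (subst prod.reindex) (auto simp: inj_on_def o_def case_prod_beta)
  also have "\<dots> = (\<Prod>j<?L. \<Prod>i\<le>j. ?F i j)"
    by (subst prod.Sigma) auto
  also have "\<dots> = (\<Prod>j<?L. \<Prod>i\<le>j. ?G i j)"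
  proof (intro prod.cong refl)
    fix j i :: nat assume "i \<in> {..j}"
    then have ij: "i \<le> j" by simp
    have 1: "rlen lam (Suc j) \<le> rlen mu j" "rlen mu j \<le> rlen mu i" "rlen mu i \<le> rlen lam i"
      using strip rlen_le_rlen[OF mu ij] by (auto simp: hstrip_def)
    have P: "q powi (int a - int b) = q ^ (a - b)" if "b \<le> a" for a b
      using that by (simp add: of_nat_diff[symmetric] power_int_of_nat del: of_nat_diff)
    have e: "rlen mu i - rlen lam (Suc j) + (rlen lam i - rlen mu i) = rlen lam i - rlen lam (Suc j)"
      "rlen mu i - rlen mu j + (rlen lam i - rlen mu i) = rlen lam i - rlen mu j"
      using 1 by auto
    show "?F i j = ?G i j"
      using 1 by (simp add: P f_ratio_g e) (simp add: mult.commute)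
  qed
  also have "\<dots> = hrow n (rlen lam) (rlen mu)"
    unfolding hrow_def
  proof (rule prod.mono_neutral_left)
    show "\<forall>j\<in>{..<n} - {..<?L}. (\<Prod>i\<le>j. ?G i j) = 1"
    proof
      fix j assume "j \<in> {..<n} - {..<?L}"
      then have "rlen mu j = 0" by simp
      moreover then have "rlen lam (Suc j) = 0" using strip by (metis hstrip_def le_zero_eq)
      ultimately show "(\<Prod>i\<le>j. ?G i j) = 1" by simp
    qed
  qed (use n in auto)
  finally show ?thesis .
qed

text \<open>The columns \<open>c\<close> in the interval are those of height \<open>Suc j\<close> in
  both shapes, that is, the columns that the strip does not meet. This is Macdonald's expression by
  box factors, a form that can be transposed.\<close>

lemma psi_boxes:
  assumes lam: "is_partition lam" and mu: "is_partition mu" and strip: "hstrip lam mu"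
    and n: "length mu \<le> n"
  shows "psi q t lam mu = (\<Prod>j<n. \<Prod>i\<le>j. \<Prod>c\<in>{rlen lam (Suc j)..<rlen mu j}.
     box_factor q t (rlen mu i - Suc c) (j - i) / box_factor q t (rlen lam i - Suc c) (j - i))"
  unfolding psi_hrow[OF assms] hrow_def
proof (intro prod.cong refl)
  fix j i :: nat assume "i \<in> {..j}"
  then have ij: "i \<le> j" by simp
  have 1: "rlen lam (Suc j) \<le> rlen mu j" "rlen mu j \<le> rlen mu i" "rlen mu i \<le> rlen lam i"
    using strip rlen_le_rlen[OF mu ij] by (auto simp: hstrip_def)
  then have "rlen mu j \<le> rlen lam i" by simp
  with 1 show "g (rlen mu i - rlen mu j) (j - i) * g (rlen lam i - rlen lam (Suc j)) (j - i) /
     (g (rlen lam i - rlen mu j) (j - i) * g (rlen mu i - rlen lam (Suc j)) (j - i)) =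
    (\<Prod>c\<in>{rlen lam (Suc j)..<rlen mu j}.
     box_factor q t (rlen mu i - Suc c) (j - i) / box_factor q t (rlen lam i - Suc c) (j - i))"
    by (simp add: prod_dividef prod_box_factor)
qed

lemma prod_box_factor_leg:
  assumes "c < x" "x \<le> y"
  shows "(\<Prod>k\<in>{x..<y}. box_factor q t a (k - c) / box_factor q t a (k - Suc c)) =
    box_factor q t a (y - Suc c) / box_factor q t a (x - Suc c)"
  using assms(2)
proof (induction y)
  case (Suc y)
  show ?case
  proof (cases "x = Suc y")
    case False
    then have "x \<le> y" using Suc.prems by simp
    then show ?thesis using Suc assms(1) by (simp add: prod.atLeastLessThan_Suc)
  qed simp
qed simp

end

text \<open>After transposition only boxes in rows common to both shapes contribute. For such a row
  \<open>c\<close> the quotients of box factors telescope in the leg over the rows \<open>k\<close>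
  that gain a box, and the pair \<open>c < k\<close> contributes \<open>vpair\<close>.\<close>

lemma psi_transpose:
  assumes generic: "generic_parameters q t"
    and lam: "is_partition lam" and mu: "is_partition mu" and strip: "vstrip lam mu"
    and L: "length lam \<le> L"
  shows "psi t q (transpose_partition lam) (transpose_partition mu) =
    macdonald_parameters.vrow q t L (rlen mu) (rlen lam)"
proof -
  interpret macdonald_parameters q t by standard (rule generic)
  let ?n = "max (rlen lam 0) (length (transpose_partition mu))"
  let ?b = "box_factor q t"
  have le: "rlen mu i \<le> rlen lam i" "rlen lam i \<le> Suc (rlen mu i)" for i
    using strip by (auto simp: vstrip_def)
  have cle: "clen mu i \<le> clen lam i" for i
    using hstrip_transpose[OF lam mu] strip by (auto simp: hstrip_def)
  have cL: "clen lam i \<le> L" for i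
    using less_clen_iff[OF lam, of L i] L by (simp add: not_less)
  have c0: "rlen lam c \<le> ?n" for c
    using rlen_le_rlen[OF lam, of 0 c] by simp
  have block: "{clen lam (Suc j)..<clen mu j} = {c. c < L \<and> rlen lam c = Suc j \<and> rlen mu c = Suc j}" for j
  proof (intro subset_antisym subsetI)
    fix c assume "c \<in> {clen lam (Suc j)..<clen mu j}"
    then have *: "\<not> Suc j < rlen lam c" "j < rlen mu c"
      using less_clen_iff[OF lam, of c "Suc j"] less_clen_iff[OF mu, of c j] by auto
    moreover have "c < L" using \<open>c \<in> _\<close> cle[of j] cL[of j] by auto
    ultimately show "c \<in> {c. c < L \<and> rlen lam c = Suc j \<and> rlen mu c = Suc j}"
      using le[of c] by auto
  next
    fix c assume "c \<in> {c. c < L \<and> rlen lam c = Suc j \<and> rlen mu c = Suc j}"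
    then show "c \<in> {clen lam (Suc j)..<clen mu j}"
      using less_clen_iff[OF lam, of c "Suc j"] less_clen_iff[OF mu, of c j] by auto
  qed
  have "psi t q (transpose_partition lam) (transpose_partition mu) =
     (\<Prod>j<?n. \<Prod>i\<le>j. \<Prod>c\<in>{clen lam (Suc j)..<clen mu j}.
       box_factor t q (clen mu i - Suc c) (j - i) / box_factor t q (clen lam i - Suc c) (j - i))"
    by (rule macdonald_parameters.psi_boxes[OF swapped])
       (use is_partition_transpose[OF lam] is_partition_transpose[OF mu] hstrip_transpose[OF lam mu] strip in auto)
  also have "\<dots> = (\<Prod>j<?n. \<Prod>c<L. if Suc j = rlen mu c then
      (if rlen lam c = rlen mu c then \<Prod>i<rlen mu c. ?b (rlen mu c - Suc i) (clen lam i - Suc c) / ?b (rlen mu c - Suc i) (clen mu i - Suc c) else 1) else 1)"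
  proof (rule prod.cong[OF refl])
    fix j
    have "(\<Prod>i\<le>j. \<Prod>c\<in>{clen lam (Suc j)..<clen mu j}.
       box_factor t q (clen mu i - Suc c) (j - i) / box_factor t q (clen lam i - Suc c) (j - i)) =
      (\<Prod>c\<in>{clen lam (Suc j)..<clen mu j}. \<Prod>i\<le>j.
       ?b (j - i) (clen lam i - Suc c) / ?b (j - i) (clen mu i - Suc c))"
      by (subst prod.swap) (simp add: box_factor_swap[of t q])
    also have "\<dots> = (\<Prod>c\<in>{c \<in> {..<L}. rlen lam c = Suc j \<and> rlen mu c = Suc j}. \<Prod>i\<le>j.
       ?b (j - i) (clen lam i - Suc c) / ?b (j - i) (clen mu i - Suc c))"
      unfolding block by simp
    also have "\<dots> = (\<Prod>c<L. if rlen lam c = Suc j \<and> rlen mu c = Suc j then \<Prod>i\<le>j.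
       ?b (j - i) (clen lam i - Suc c) / ?b (j - i) (clen mu i - Suc c) else 1)"
      by (rule prod.inter_filter) simp
    also have "\<dots> = (\<Prod>c<L. if Suc j = rlen mu c then
      (if rlen lam c = rlen mu c then \<Prod>i<rlen mu c. ?b (rlen mu c - Suc i) (clen lam i - Suc c) / ?b (rlen mu c - Suc i) (clen mu i - Suc c) else 1) else 1)"
    proof (rule prod.cong[OF refl])
      fix c
      show "(if rlen lam c = Suc j \<and> rlen mu c = Suc j then \<Prod>i\<le>j.
       ?b (j - i) (clen lam i - Suc c) / ?b (j - i) (clen mu i - Suc c) else 1) =
       (if Suc j = rlen mu c then
      (if rlen lam c = rlen mu c then \<Prod>i<rlen mu c. ?b (rlen mu c - Suc i) (clen lam i - Suc c) / ?b (rlen mu c - Suc i) (clen mu i - Suc c) else 1) else 1)"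
      proof (cases "Suc j = rlen mu c")
        case True
        show ?thesis unfolding True[symmetric] lessThan_Suc_atMost by auto
      qed auto
    qed
    finally show "(\<Prod>i\<le>j. \<Prod>c\<in>{clen lam (Suc j)..<clen mu j}.
       box_factor t q (clen mu i - Suc c) (j - i) / box_factor t q (clen lam i - Suc c) (j - i)) = \<dots>" .
  qed
  also have "\<dots> = (\<Prod>c<L. if rlen lam c = rlen mu c then \<Prod>i<rlen mu c.
      ?b (rlen mu c - Suc i) (clen lam i - Suc c) / ?b (rlen mu c - Suc i) (clen mu i - Suc c) else 1)"
  proof (subst prod.swap, rule prod.cong[OF refl])
    fix c
    show "(\<Prod>j<?n. if Suc j = rlen mu c then
      (if rlen lam c = rlen mu c then \<Prod>i<rlen mu c. ?b (rlen mu c - Suc i) (clen lam i - Suc c) / ?b (rlen mu c - Suc i) (clen mu i - Suc c) else 1) else 1) =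
      (if rlen lam c = rlen mu c then \<Prod>i<rlen mu c.
      ?b (rlen mu c - Suc i) (clen lam i - Suc c) / ?b (rlen mu c - Suc i) (clen mu i - Suc c) else 1)"
    proof (cases "rlen mu c")
      case (Suc r)
      then have "r < ?n" using c0[of c] le(1)[of c] by linarith
      then show ?thesis unfolding Suc by (simp add: prod.delta)
    qed simp
  qed
  also have "\<dots> = (\<Prod>c<L. \<Prod>k<L. if c < k then vpair (rlen mu) (rlen lam) c k else 1)"
  proof (rule prod.cong[OF refl])
    fix c
    show "(if rlen lam c = rlen mu c then \<Prod>i<rlen mu c.
      ?b (rlen mu c - Suc i) (clen lam i - Suc c) / ?b (rlen mu c - Suc i) (clen mu i - Suc c) else 1) =
      (\<Prod>k<L. if c < k then vpair (rlen mu) (rlen lam) c k else 1)"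
    proof (cases "rlen lam c = rlen mu c")
      case False
      then have "vpair (rlen mu) (rlen lam) c k = 1" for k by (auto simp: vpair_def)
      then show ?thesis using False by (auto simp: prod.neutral)
    next
      case eq: True
      let ?s = "\<lambda>i k. ?b (rlen mu c - Suc i) (k - c) / ?b (rlen mu c - Suc i) (k - Suc c)"
      have "(\<Prod>i<rlen mu c. ?b (rlen mu c - Suc i) (clen lam i - Suc c) / ?b (rlen mu c - Suc i) (clen mu i - Suc c)) =
        (\<Prod>i<rlen mu c. \<Prod>k\<in>{clen mu i..<clen lam i}. ?s i k)"
        using less_clen_iff[OF mu, of c] cle by (intro prod.cong refl prod_box_factor_leg[symmetric]) auto
      also have "\<dots> = (\<Prod>i<rlen mu c. \<Prod>k<L. if i = rlen mu k then if rlen lam k = Suc (rlen mu k) then ?s i k else 1 else 1)"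
      proof (rule prod.cong[OF refl])
        fix i
        \<comment> \<open>Column \<open>i\<close> grows exactly by the rows \<open>k\<close> of
          length \<open>i\<close> that gain a box.\<close>
        have "(clen mu i \<le> k \<and> k < clen lam i) \<longleftrightarrow> (i = rlen mu k \<and> rlen lam k = Suc (rlen mu k))" for k
          using less_clen_iff[OF mu, of k i] less_clen_iff[OF lam, of k i] le[of k] by linarith
        then show "(\<Prod>k\<in>{clen mu i..<clen lam i}. ?s i k) =
          (\<Prod>k<L. if i = rlen mu k then if rlen lam k = Suc (rlen mu k) then ?s i k else 1 else 1)"
          unfolding prod_atLeastLessThan_if[OF cL[of i]] by (intro prod.cong refl) auto
      qed
      also have "\<dots> = (\<Prod>k<L. \<Prod>i<rlen mu c. if i = rlen mu k then if rlen lam k = Suc (rlen mu k) then ?s i k else 1 else 1)"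
        by (rule prod.swap)
      also have "\<dots> = (\<Prod>k<L. if c < k then vpair (rlen mu) (rlen lam) c k else 1)"
      proof (rule prod.cong[OF refl])
        fix k
        have "(\<Prod>i<rlen mu c. if i = rlen mu k then if rlen lam k = Suc (rlen mu k) then ?s i k else 1 else 1) =
          (if rlen mu k < rlen mu c \<and> rlen lam k = Suc (rlen mu k) then ?s (rlen mu k) k else 1)"
          by (simp add: prod.delta')
        also have "\<dots> = (if c < k then vpair (rlen mu) (rlen lam) c k else 1)"
        proof (cases "rlen lam k = Suc (rlen mu k)")
          case False
          then show ?thesis by (simp add: vpair_def)
        next
          case k: True
          have "rlen mu k < rlen mu c \<longleftrightarrow> c < k"
          proof
            assume "rlen mu k < rlen mu c"
            then show "c < k" using rlen_le_rlen[OF mu, of k c] by (meson not_less)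
          next
            assume "c < k"
            then show "rlen mu k < rlen mu c" using rlen_le_rlen[OF lam, of c k] eq k by simp
          qed
          moreover have "?s (rlen mu k) k = vpair (rlen mu) (rlen lam) c k" if ck: "c < k" and lt: "rlen mu k < rlen mu c"
          proof -
            obtain d where d: "k = Suc (c + d)" using ck less_imp_Suc_add by blast
            obtain e where e: "rlen mu c = Suc (rlen mu k + e)" using lt less_imp_Suc_add by blast
            show ?thesis using eq k by (simp add: vpair_def e d box_factor_def mult_ac)
          qed
          ultimately show ?thesis using k by auto
        qed
        finally show "(\<Prod>i<rlen mu c. if i = rlen mu k then if rlen lam k = Suc (rlen mu k) then ?s i k else 1 else 1) =
          (if c < k then vpair (rlen mu) (rlen lam) c k else 1)" .
      qed
      finally show ?thesis using eq by simp
    qed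
  qed
  also have "\<dots> = vrow L (rlen mu) (rlen lam)"
    unfolding vrow_def by (rule prod_pairs_less_if)
  finally show ?thesis .
qed

section \<open>The inverse norm and the ratio of the \<open>H\<close>-products\<close>

context macdonald_parameters
begin

text \<open>Macdonald's \<open>b\<close> of a partition, here over the boxes column by column.
  \<open>form_Phat\<close> identifies it as the inverse of the squared norm.\<close>

definition bnorm :: "nat list \<Rightarrow> complex" where
  "bnorm lam = (\<Prod>c<rlen lam 0. \<Prod>i<clen lam c.
     box_factor q t (rlen lam i - Suc c) (clen lam c - Suc i))"

lemma bnorm_nonzero [simp]: "bnorm lam \<noteq> 0"
  by (simp add: bnorm_def)

text \<open>The columns of height \<open>Suc j\<close> are those from
  \<open>rlen lam (Suc j)\<close> to \<open>rlen lam j\<close>. Grouping columns by height and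
  telescoping in the arm turns the product over boxes into one over pairs of rows.\<close>

lemma bnorm_brow:
  assumes lam: "is_partition lam" and n: "length lam \<le> n"
  shows "bnorm lam = brow n (rlen lam)"
proof -
  let ?b = "\<lambda>i c l. box_factor q t (rlen lam i - Suc c) l"
  have cn: "clen lam c \<le> n" for c
    using less_clen_iff[OF lam, of n c] n by (simp add: not_less)
  have "brow n (rlen lam) = (\<Prod>j<n. \<Prod>i\<le>j. \<Prod>c\<in>{rlen lam (Suc j)..<rlen lam j}. ?b i c (j - i))"
    unfolding brow_def using rlen_le_rlen[OF lam] by (intro prod.cong refl prod_box_factor[symmetric]) auto
  also have "\<dots> = (\<Prod>j<n. \<Prod>c<rlen lam 0. if Suc j = clen lam c then \<Prod>i<clen lam c. ?b i c (clen lam c - Suc i) else 1)"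
  proof (rule prod.cong[OF refl])
    fix j
    have iff: "(rlen lam (Suc j) \<le> c \<and> c < rlen lam j) \<longleftrightarrow> Suc j = clen lam c" for c
      using less_clen_iff[OF lam, of j c] less_clen_iff[OF lam, of "Suc j" c] by linarith
    have "(\<Prod>i\<le>j. \<Prod>c\<in>{rlen lam (Suc j)..<rlen lam j}. ?b i c (j - i)) =
      (\<Prod>c\<in>{rlen lam (Suc j)..<rlen lam j}. \<Prod>i\<le>j. ?b i c (j - i))"
      by (rule prod.swap)
    also have "\<dots> = (\<Prod>c<rlen lam 0. if rlen lam (Suc j) \<le> c \<and> c < rlen lam j then \<Prod>i\<le>j. ?b i c (j - i) else 1)"
      using rlen_le_rlen[OF lam, of 0 j] by (intro prod_atLeastLessThan_if) simp
    also have "\<dots> = (\<Prod>c<rlen lam 0. if Suc j = clen lam c then \<Prod>i<clen lam c. ?b i c (clen lam c - Suc i) else 1)"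
    proof (rule prod.cong[OF refl])
      fix c
      show "(if rlen lam (Suc j) \<le> c \<and> c < rlen lam j then \<Prod>i\<le>j. ?b i c (j - i) else 1) =
        (if Suc j = clen lam c then \<Prod>i<clen lam c. ?b i c (clen lam c - Suc i) else 1)"
        unfolding iff
      proof (cases "Suc j = clen lam c")
        case True
        show "(if Suc j = clen lam c then \<Prod>i\<le>j. ?b i c (j - i) else 1) =
          (if Suc j = clen lam c then \<Prod>i<clen lam c. ?b i c (clen lam c - Suc i) else 1)"
          unfolding True[symmetric] lessThan_Suc_atMost by simp
      qed simp
    qed
    finally show "(\<Prod>i\<le>j. \<Prod>c\<in>{rlen lam (Suc j)..<rlen lam j}. ?b i c (j - i)) = \<dots>" .
  qed
  also have "\<dots> = bnorm lam"
    unfolding bnorm_def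
  proof (subst prod.swap, rule prod.cong[OF refl])
    fix c
    show "(\<Prod>j<n. if Suc j = clen lam c then \<Prod>i<clen lam c. ?b i c (clen lam c - Suc i) else 1) =
      (\<Prod>i<clen lam c. ?b i c (clen lam c - Suc i))"
    proof (cases "clen lam c")
      case (Suc r)
      then have "r < n" using cn[of c] by simp
      then show ?thesis unfolding Suc by (simp add: prod.delta)
    qed simp
  qed
  finally show ?thesis ..
qed

end

lemma diagram_columns:
  assumes "is_partition lam"
  shows "diagram lam = (\<lambda>(c, i). (Suc i, Suc c)) ` (SIGMA c:{..<rlen lam 0}. {..<clen lam c})"
proof (intro subset_antisym subsetI)
  fix x assume "x \<in> diagram lam"
  then obtain i c where x: "x = (Suc i, Suc c)" "c < rlen lam i"
    unfolding diagram_def by (cases x, cases "fst x", simp, cases "snd x") auto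
  then have "c < rlen lam 0" "i < clen lam c"
    using rlen_le_rlen[OF assms, of 0 i] less_clen_iff[OF assms] by auto
  with x show "x \<in> (\<lambda>(c, i). (Suc i, Suc c)) ` (SIGMA c:{..<rlen lam 0}. {..<clen lam c})" by force
next
  fix x assume "x \<in> (\<lambda>(c, i). (Suc i, Suc c)) ` (SIGMA c:{..<rlen lam 0}. {..<clen lam c})"
  then obtain i c where "x = (Suc i, Suc c)" "c < rlen lam i"
    using less_clen_iff[OF assms] by auto
  then show "x \<in> diagram lam" by (auto simp: diagram_def rlen_nth split: if_splits)
qed

lemma diagram_rows: "diagram lam = (\<lambda>(i, c). (Suc i, Suc c)) ` (SIGMA i:{..<length lam}. {..<rlen lam i})"
proof (intro subset_antisym subsetI)
  fix x assume "x \<in> diagram lam"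
  then obtain i c where x: "x = (Suc i, Suc c)" "c < rlen lam i" "i < length lam"
    unfolding diagram_def by (cases x, cases "fst x", simp, cases "snd x") auto
  then show "x \<in> (\<lambda>(i, c). (Suc i, Suc c)) ` (SIGMA i:{..<length lam}. {..<rlen lam i})" by force
qed (auto simp: diagram_def)

text \<open>Transposition exchanges arm and leg, so the quotient can be formed box by box; each box
  gives \<open>-t\<close> over its box factor.\<close>

lemma (in macdonald_parameters) H_ratio:
  assumes lam: "is_partition lam"
  shows "H lam q (inverse t) / H (transpose_partition lam) (inverse t) q = (- t) ^ sum_list lam / bnorm lam"
proof -
  let ?C = "rlen lam 0"
  let ?a = "\<lambda>c i. rlen lam i - Suc c" and ?l = "\<lambda>c i. clen lam c - Suc i"
  have len: "length (transpose_partition lam) = ?C"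
    by (simp add: transpose_partition_def del: upt_Suc)
  have 1: "H lam q (inverse t) = (\<Prod>c<?C. \<Prod>i<clen lam c. q ^ Suc (?a c i) - inverse t ^ ?l c i)"
    unfolding H_def diagram_columns[OF lam]
    by (subst prod.reindex) (auto simp: inj_on_def prod.Sigma arm_def leg_def case_prod_beta)
  have 2: "H (transpose_partition lam) (inverse t) q = (\<Prod>c<?C. \<Prod>i<clen lam c. inverse t ^ Suc (?l c i) - q ^ ?a c i)"
    unfolding H_def diagram_rows len
    by (subst prod.reindex) (auto simp: inj_on_def prod.Sigma arm_def leg_def case_prod_beta lam)
  have ratio: "(q ^ Suc a - inverse t ^ l) / (inverse t ^ Suc l - q ^ a) = - t / box_factor q t a l" for a l
  proof -
    have "q ^ a * t ^ Suc l \<noteq> 1" "q ^ Suc a * t ^ l \<noteq> 1" using generic_neq_one by blast+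
    then show ?thesis by (simp add: box_factor_def field_simps)
  qed
  have "H lam q (inverse t) / H (transpose_partition lam) (inverse t) q =
     (\<Prod>c<?C. \<Prod>i<clen lam c. - t / box_factor q t (?a c i) (?l c i))"
    unfolding 1 2 prod_dividef[symmetric] ratio ..
  also have "\<dots> = (\<Prod>c<?C. (- t) ^ clen lam c) / bnorm lam"
    unfolding bnorm_def prod_dividef by simp
  also have "(\<Prod>c<?C. (- t) ^ clen lam c) = (- t) ^ sum_list lam"
    by (simp add: power_sum[symmetric] sum_list_transpose[OF lam, symmetric] sum_list_rlen[of _ ?C] len)
  finally show ?thesis .
qed

section \<open>Commutation relations of the branching matrices\<close>

definition of_rows :: "(nat \<Rightarrow> nat) \<Rightarrow> nat list" where
  "of_rows f = (SOME lam. is_partition lam \<and> rlen lam = f)"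

lemma of_rows:
  assumes "antimono f" "f n = 0"
  shows "is_partition (of_rows f)" "rlen (of_rows f) = f"
  using someI_ex[OF ex_partition[OF assms]] by (auto simp: of_rows_def)

lemma of_rows_rlen: "is_partition lam \<Longrightarrow> of_rows (rlen lam) = lam"
  using someI[of "\<lambda>l. is_partition l \<and> rlen l = rlen lam" lam]
  by (intro partition_eqI) (auto simp: of_rows_def)

text \<open>A finite index set for matrix products. The matrices below vanish outside the relevant
  sizes, so any sufficiently large bound gives the same sum.\<close>

definition partitions_upto :: "nat \<Rightarrow> nat list set" where
  "partitions_upto n = {lam. is_partition lam \<and> sum_list lam \<le> n}"

lemma finite_partitions_upto [simp]: "finite (partitions_upto n)"
  using finite_partitions by (simp add: partitions_upto_def)

context macdonald_parameters
begin

text \<open>\<open>emat\<close> holds the Pieri coefficients; \<open>bmat\<close> and \<open>cmat\<close> will add an ordinary and a super variable.\<close>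

definition bmat :: "nat list \<Rightarrow> nat list \<Rightarrow> complex" where
  "bmat lam mu = (if hstrip lam mu then psi q t lam mu else 0)"

definition emat :: "nat list \<Rightarrow> nat list \<Rightarrow> complex" where
  "emat mu lam = (if vstrip lam mu then psi t q (transpose_partition lam) (transpose_partition mu) else 0)"

definition egraded :: "nat \<Rightarrow> nat list \<Rightarrow> nat list \<Rightarrow> complex" where
  "egraded r mu lam = (if sum_list lam = sum_list mu + r then emat mu lam else 0)"

text \<open>The adjoint of \<open>emat\<close> for the form in which distinct partitions are
  orthogonal and \<open>lam\<close> has squared norm \<open>1 / bnorm lam\<close>.\<close>

definition cmat :: "nat list \<Rightarrow> nat list \<Rightarrow> complex" where
  "cmat lam mu = emat mu lam * bnorm mu / bnorm lam"

lemma bmat_refl [simp]: "is_partition lam \<Longrightarrow> bmat lam lam = 1"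
proof -
  assume lam: "is_partition lam"
  have "psi q t lam lam = 1"
    unfolding psi_hrow[OF lam lam hstrip_refl[OF lam] order_refl] hrow_def
    by (intro prod.neutral ballI) simp
  then show ?thesis using hstrip_refl[OF lam] by (simp add: bmat_def)
qed

lemma emat_refl [simp]: "is_partition lam \<Longrightarrow> emat lam lam = 1"
proof -
  assume lam: "is_partition lam"
  have "psi t q (transpose_partition lam) (transpose_partition lam) = 1"
    unfolding psi_transpose[OF generic lam lam vstrip_refl order_refl] vrow_def
    by (intro prod.neutral ballI) (simp add: vpair_def)
  then show ?thesis using vstrip_refl[of lam] by (simp add: emat_def)
qed

lemma cmat_refl [simp]: "is_partition lam \<Longrightarrow> cmat lam lam = 1"
  by (simp add: cmat_def)

lemma bmat_nonzeroD:
  assumes "bmat lam mu \<noteq> 0"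
  shows "hstrip lam mu" "sum_list mu \<le> sum_list lam"
  using assms hstrip_sum_list by (auto simp: bmat_def split: if_splits)

lemma emat_nonzeroD:
  assumes "emat mu lam \<noteq> 0"
  shows "vstrip lam mu" "sum_list mu \<le> sum_list lam"
  using assms vstrip_sum_list by (auto simp: emat_def split: if_splits)

lemma cmat_nonzeroD:
  assumes "cmat lam mu \<noteq> 0"
  shows "vstrip lam mu" "sum_list mu \<le> sum_list lam"
  using assms emat_nonzeroD by (auto simp: cmat_def)

lemma egraded_0:
  assumes "is_partition mu" "is_partition lam"
  shows "egraded 0 mu lam = (if lam = mu then 1 else 0)"
proof (cases "lam = mu")
  case False
  have "emat mu lam = 0" if "sum_list lam = sum_list mu"
  proof (rule ccontr)
    assume "emat mu lam \<noteq> 0"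
    then have "mu = lam"
      using partition_eq_of_sum_list[of mu lam] assms that emat_nonzeroD[of mu lam]
      by (auto simp: vstrip_def)
    with False show False by simp
  qed
  with False show ?thesis by (simp add: egraded_def)
qed (use assms in \<open>simp add: egraded_def\<close>)

section \<open>Translation between strips and sets of rows\<close>

lemma sum_list_raise:
  assumes "is_partition mu" "length mu \<le> n" "I \<subseteq> {..<n}" "is_partition lam" "rlen lam = raise I (rlen mu)"
  shows "sum_list lam = sum_list mu + card I" "length lam \<le> n"
proof -
  have "rlen lam n = 0" using assms by (auto simp: raise_def)
  then show len: "length lam \<le> n" using rlen_pos_iff[OF assms(4), of n] by simp
  have "sum_list lam = (\<Sum>i<n. rlen mu i) + (\<Sum>i<n. if i \<in> I then 1 else 0)"
    by (simp add: sum_list_rlen[OF len] assms(5) raise_def[abs_def] sum.distrib)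
  also have "(\<Sum>i<n. if i \<in> I then 1 else 0) = card I"
    using assms(3) by (simp add: sum.If_cases Int_absorb1)
  finally show "sum_list lam = sum_list mu + card I" by (simp add: sum_list_rlen[OF assms(2)])
qed

lemma vstrip_raise:
  assumes "vstrip lam mu"
  shows "rlen lam = raise {i. rlen lam i = Suc (rlen mu i)} (rlen mu)"
    and "rlen mu = lower {i. rlen lam i = Suc (rlen mu i)} (rlen lam)"
proof -
  have a: "rlen mu i \<le> rlen lam i" "rlen lam i \<le> Suc (rlen mu i)" for i
    using assms by (auto simp: vstrip_def)
  show "rlen lam = raise {i. rlen lam i = Suc (rlen mu i)} (rlen mu)"
    "rlen mu = lower {i. rlen lam i = Suc (rlen mu i)} (rlen lam)"
    using a by (auto simp: raise_def lower_def fun_eq_iff) (metis le_SucE le_antisym)+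
qed

lemma raise_eq_set: "{i. raise I f i = Suc (f i)} = I"
  by (auto simp: raise_def)

lemma lower_eq_set: "(\<forall>i\<in>J. f i > 0) \<Longrightarrow> {i. f i = Suc (lower J f i)} = J"
  by (auto simp: lower_def)

lemma vstrip_support:
  assumes "vstrip lam mu" "length lam \<le> n"
  shows "{i. rlen lam i = Suc (rlen mu i)} \<subseteq> {..<n}"
  using assms by (auto simp: not_less[symmetric]) (metis Zero_not_Suc le_trans not_less rlen_eq_0)

text \<open>A vertical strip is determined by the rows it lengthens. The horizontal strip over
  \<open>rho\<close> bounds the length of \<open>lam\<close> by \<open>Suc M\<close>, which confines
  these rows to a finite range.\<close>

lemma sum_raise_sets:
  fixes F :: "nat list \<Rightarrow> complex"
  assumes mu: "is_partition mu" and rho: "is_partition rho"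
    and M: "length rho \<le> M" "length mu \<le> Suc M"
    and G: "\<And>lam I. is_partition lam \<Longrightarrow> vstrip lam mu \<Longrightarrow> hstrip lam rho \<Longrightarrow>
      rlen lam = raise I (rlen mu) \<Longrightarrow> F lam = G I"
  shows "(\<Sum>lam | is_partition lam \<and> sum_list lam = sum_list mu + r \<and> vstrip lam mu \<and> hstrip lam rho. F lam) =
    (\<Sum>I | I \<in> raise_sets M (rlen mu) (rlen rho) \<and> card I = r. G I)"
proof (rule sum.reindex_bij_witness[where i = "\<lambda>I. of_rows (raise I (rlen mu))"
      and j = "\<lambda>lam. {i. rlen lam i = Suc (rlen mu i)}"])
  fix lam assume "lam \<in> {lam. is_partition lam \<and> sum_list lam = sum_list mu + r \<and> vstrip lam mu \<and> hstrip lam rho}"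
  then have lam: "is_partition lam" "sum_list lam = sum_list mu + r" "vstrip lam mu" "hstrip lam rho" by auto
  let ?I = "{i. rlen lam i = Suc (rlen mu i)}"
  show eq: "of_rows (raise ?I (rlen mu)) = lam"
    using vstrip_raise(1)[OF lam(3)] of_rows_rlen[OF lam(1)] by metis
  have len: "length lam \<le> Suc M" using hstrip_length[OF lam(4,1) rho] M by simp
  have sub: "?I \<subseteq> {..<Suc M}" by (rule vstrip_support[OF lam(3) len])
  have "card ?I = r" using sum_list_raise[OF mu M(2) sub lam(1) vstrip_raise(1)[OF lam(3)]] lam(2) by simp
  moreover have "?I \<in> raise_sets M (rlen mu) (rlen rho)"
    using sub lam(4) by (auto simp: raise_sets_def hstrip_def vstrip_raise(1)[OF lam(3), symmetric])
  ultimately show "?I \<in> {I. I \<in> raise_sets M (rlen mu) (rlen rho) \<and> card I = r}" by simp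
  show "G ?I = F lam" using G[OF lam(1,3,4) vstrip_raise(1)[OF lam(3)]] by simp
next
  fix I assume "I \<in> {I. I \<in> raise_sets M (rlen mu) (rlen rho) \<and> card I = r}"
  then have I: "I \<subseteq> {..<Suc M}" "card I = r"
    "\<And>i. i < M \<Longrightarrow> rlen rho i \<le> raise I (rlen mu) i \<and> raise I (rlen mu) (Suc i) \<le> rlen rho i"
    by (auto simp: raise_sets_def)
  let ?f = "raise I (rlen mu)"
  have z: "?f i = 0" if "i \<ge> Suc M" for i using that I(1) M(2) by (auto simp: raise_def)
  have step: "?f (Suc i) \<le> ?f i" for i
  proof (cases "i < M")
    case True
    then show ?thesis using I(3)[of i] by simp
  qed (simp add: z)
  have "antimono ?f" unfolding antimono_iff_le_Suc using step by blast
  note of = of_rows[OF this z[OF order_refl]]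
  have "hstrip (of_rows ?f) rho"
    unfolding hstrip_def of
  proof
    fix i
    show "rlen rho i \<le> ?f i \<and> ?f (Suc i) \<le> rlen rho i"
    proof (cases "i < M")
      case False
      then show ?thesis using M(1) z[of "Suc i"] by simp
    qed (use I(3) in auto)
  qed
  moreover have "vstrip (of_rows ?f) mu" unfolding vstrip_def of by (simp add: raise_def)
  moreover have "sum_list (of_rows ?f) = sum_list mu + r"
    using sum_list_raise(1)[OF mu M(2) I(1) of] I(2) by simp
  ultimately show "of_rows ?f \<in> {lam. is_partition lam \<and> sum_list lam = sum_list mu + r \<and> vstrip lam mu \<and> hstrip lam rho}"
    using of by simp
  show "{i. rlen (of_rows ?f) i = Suc (rlen mu i)} = I" unfolding of by (rule raise_eq_set)
qed

lemma sum_lower_sets: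
  fixes F :: "nat list \<Rightarrow> complex"
  assumes mu: "is_partition mu" and rho: "is_partition rho"
    and M: "length rho \<le> M" "length mu \<le> Suc M"
    and G: "\<And>ka J. is_partition ka \<Longrightarrow> vstrip rho ka \<Longrightarrow> hstrip mu ka \<Longrightarrow>
      rlen ka = lower J (rlen rho) \<Longrightarrow> F ka = G J"
  shows "(\<Sum>ka | is_partition ka \<and> sum_list rho = sum_list ka + r \<and> hstrip mu ka \<and> vstrip rho ka. F ka) =
    (\<Sum>J | J \<in> lower_sets M (rlen mu) (rlen rho) \<and> card J = r. G J)"
proof (rule sum.reindex_bij_witness[where i = "\<lambda>J. of_rows (lower J (rlen rho))"
      and j = "\<lambda>ka. {i. rlen rho i = Suc (rlen ka i)}"])
  fix ka assume "ka \<in> {ka. is_partition ka \<and> sum_list rho = sum_list ka + r \<and> hstrip mu ka \<and> vstrip rho ka}"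
  then have ka: "is_partition ka" "sum_list rho = sum_list ka + r" "hstrip mu ka" "vstrip rho ka" by auto
  let ?J = "{i. rlen rho i = Suc (rlen ka i)}"
  show eq: "of_rows (lower ?J (rlen rho)) = ka"
    using vstrip_raise(2)[OF ka(4)] of_rows_rlen[OF ka(1)] by metis
  have sub: "?J \<subseteq> {..<M}" by (rule vstrip_support[OF ka(4) M(1)])
  have lka: "length ka \<le> M" using vstrip_length[OF ka(4) rho ka(1)] M by simp
  have "card ?J = r" using sum_list_raise(1)[OF ka(1) lka sub rho vstrip_raise(1)[OF ka(4)]] ka(2) by simp
  moreover have "?J \<in> lower_sets M (rlen mu) (rlen rho)"
    using sub ka(3) by (auto simp: lower_sets_def hstrip_def vstrip_raise(2)[OF ka(4), symmetric])
  ultimately show "?J \<in> {J. J \<in> lower_sets M (rlen mu) (rlen rho) \<and> card J = r}" by simp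
  show "G ?J = F ka" using G[OF ka(1,4,3) vstrip_raise(2)[OF ka(4)]] by simp
next
  fix J assume "J \<in> {J. J \<in> lower_sets M (rlen mu) (rlen rho) \<and> card J = r}"
  then have J: "J \<subseteq> {..<M}" "card J = r" "\<forall>i\<in>J. rlen rho i > 0"
    "\<And>i. i < M \<Longrightarrow> lower J (rlen rho) i \<le> rlen mu i \<and> rlen mu (Suc i) \<le> lower J (rlen rho) i"
    by (auto simp: lower_sets_def)
  let ?f = "lower J (rlen rho)"
  have z: "?f i = 0" if "i \<ge> M" for i using that M by (auto simp: lower_def)
  have step: "?f (Suc i) \<le> ?f i" for i
  proof (cases "Suc i < M")
    case True
    then show ?thesis using J(4)[of i] J(4)[of "Suc i"] by simp
  qed (simp add: z)
  have "antimono ?f" unfolding antimono_iff_le_Suc using step by blast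
  note of = of_rows[OF this z[OF order_refl]]
  have r: "rlen rho = raise J ?f" using J(3) by (auto simp: raise_def lower_def fun_eq_iff)
  have "hstrip mu (of_rows ?f)"
    unfolding hstrip_def of
  proof
    fix i
    show "?f i \<le> rlen mu i \<and> rlen mu (Suc i) \<le> ?f i"
    proof (cases "i < M")
      case False
      then show ?thesis using M(2) z[of i] by simp
    qed (use J(4) in auto)
  qed
  moreover have "vstrip rho (of_rows ?f)" unfolding vstrip_def of by (auto simp: lower_def)
  moreover have "sum_list rho = sum_list (of_rows ?f) + r"
  proof -
    have "length (of_rows ?f) \<le> M"
      using rlen_pos_iff[OF of(1), of M] z[of M] unfolding of by simp
    from sum_list_raise(1)[OF of(1) this J(1) rho] r J(2) show ?thesis unfolding of by simp
  qed
  ultimately show "of_rows ?f \<in> {ka. is_partition ka \<and> sum_list rho = sum_list ka + r \<and> hstrip mu ka \<and> vstrip rho ka}"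
    using of by simp
  show "{i. rlen rho i = Suc (rlen (of_rows ?f) i)} = J" unfolding of by (rule lower_eq_set[OF J(3)])
qed

text \<open>In coefficients, this is the rule \<open>e_(r+1) + x e_r\<close> for elementary
  functions after adjoining a variable \<open>x\<close>; the power of \<open>x\<close> is dropped
  because sizes determine it.\<close>

lemma bmat_emat_commute:
  assumes mu: "is_partition mu" and rho: "is_partition rho" and K: "sum_list mu + Suc r \<le> K"
  shows "(\<Sum>lam\<in>partitions_upto K. egraded (Suc r) mu lam * bmat lam rho) =
    (\<Sum>ka\<in>partitions_upto K. bmat mu ka * (egraded (Suc r) ka rho + egraded r ka rho))"
proof -
  define M where "M = max (length rho) (length mu)"
  have M: "length rho \<le> M" "length mu \<le> Suc M" by (auto simp: M_def)
  have L: "(\<Sum>lam\<in>partitions_upto K. egraded (Suc r) mu lam * bmat lam rho) =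
    (\<Sum>lam | is_partition lam \<and> sum_list lam = sum_list mu + Suc r \<and> vstrip lam mu \<and> hstrip lam rho.
       emat mu lam * bmat lam rho)"
  proof (rule sum.mono_neutral_cong_right[OF finite_partitions_upto])
    show "{lam. is_partition lam \<and> sum_list lam = sum_list mu + Suc r \<and> vstrip lam mu \<and> hstrip lam rho} \<subseteq> partitions_upto K"
      using K by (auto simp: partitions_upto_def)
  qed (auto simp: egraded_def emat_def bmat_def partitions_upto_def)
  have R: "(\<Sum>ka\<in>partitions_upto K. bmat mu ka * egraded s ka rho) =
    (\<Sum>ka | is_partition ka \<and> sum_list rho = sum_list ka + s \<and> hstrip mu ka \<and> vstrip rho ka.
       bmat mu ka * emat ka rho)" for s
  proof (rule sum.mono_neutral_cong_right[OF finite_partitions_upto])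
    show "{ka. is_partition ka \<and> sum_list rho = sum_list ka + s \<and> hstrip mu ka \<and> vstrip rho ka} \<subseteq> partitions_upto K"
      using K hstrip_sum_list by (fastforce simp: partitions_upto_def)
  qed (auto simp: egraded_def emat_def bmat_def partitions_upto_def)
  show ?thesis
  proof (cases "\<forall>i<M. rlen rho i \<le> Suc (rlen mu i) \<and> rlen mu (Suc i) \<le> rlen rho i")
    case True
    have E1: "emat mu lam * bmat lam rho = hrow M (raise I (rlen mu)) (rlen rho) * vrow (Suc M) (rlen mu) (raise I (rlen mu))"
      if "is_partition lam" "vstrip lam mu" "hstrip lam rho" "rlen lam = raise I (rlen mu)" for lam I
    proof -
      have "length lam \<le> Suc M" using hstrip_length[OF that(3,1) rho] M by simp
      then show ?thesis using that
        by (simp add: emat_def bmat_def psi_transpose[OF generic that(1) mu that(2)] psi_hrow[OF that(1) rho that(3) M(1)])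
    qed
    have E2: "bmat mu ka * emat ka rho = hrow M (rlen mu) (lower J (rlen rho)) * vrow M (lower J (rlen rho)) (rlen rho)"
      if "is_partition ka" "vstrip rho ka" "hstrip mu ka" "rlen ka = lower J (rlen rho)" for ka J
    proof -
      have "length ka \<le> M" using vstrip_length[OF that(2) rho that(1)] M by simp
      then show ?thesis using that
        by (simp add: emat_def bmat_def psi_transpose[OF generic rho that(1,2) M(1)] psi_hrow[OF mu that(1) that(3)])
    qed
    have L': "(\<Sum>lam | is_partition lam \<and> sum_list lam = sum_list mu + Suc r \<and> vstrip lam mu \<and> hstrip lam rho.
       emat mu lam * bmat lam rho) = (\<Sum>I | I \<in> raise_sets M (rlen mu) (rlen rho) \<and> card I = Suc r.
       hrow M (raise I (rlen mu)) (rlen rho) * vrow (Suc M) (rlen mu) (raise I (rlen mu)))"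
      by (rule sum_raise_sets[OF mu rho M E1])
    have R': "(\<Sum>ka | is_partition ka \<and> sum_list rho = sum_list ka + s \<and> hstrip mu ka \<and> vstrip rho ka.
       bmat mu ka * emat ka rho) = (\<Sum>J | J \<in> lower_sets M (rlen mu) (rlen rho) \<and> card J = s.
       hrow M (rlen mu) (lower J (rlen rho)) * vrow M (lower J (rlen rho)) (rlen rho))" for s
      by (rule sum_lower_sets[OF mu rho M E2])
    show ?thesis
      unfolding distrib_left sum.distrib L R L' R'
      using commutation_rows[OF antimono_rlen[OF mu] antimono_rlen[OF rho], of M "Suc r"] True by simp
  next
    \<comment> \<open>Here no intermediate shape exists, neither above nor below, and all three sums
      are empty.\<close>
    case False
    then obtain i where i: "\<not> (rlen rho i \<le> Suc (rlen mu i) \<and> rlen mu (Suc i) \<le> rlen rho i)" by blast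
    have n1: "\<not> (vstrip lam mu \<and> hstrip lam rho)" for lam
    proof
      assume "vstrip lam mu \<and> hstrip lam rho"
      then have "rlen rho i \<le> rlen lam i" "rlen lam i \<le> Suc (rlen mu i)"
        "rlen mu (Suc i) \<le> rlen lam (Suc i)" "rlen lam (Suc i) \<le> rlen rho i"
        by (auto simp: hstrip_def vstrip_def)
      with i show False by linarith
    qed
    have n2: "\<not> (hstrip mu ka \<and> vstrip rho ka)" for ka
    proof
      assume "hstrip mu ka \<and> vstrip rho ka"
      then have "rlen ka i \<le> rlen mu i" "rlen mu (Suc i) \<le> rlen ka i"
        "rlen ka i \<le> rlen rho i" "rlen rho i \<le> Suc (rlen ka i)"
        by (auto simp: hstrip_def vstrip_def)
      with i show False by linarith
    qed
    have "{lam. is_partition lam \<and> sum_list lam = s \<and> vstrip lam mu \<and> hstrip lam rho} = {}"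
      "{ka. is_partition ka \<and> sum_list rho = sum_list ka + s \<and> hstrip mu ka \<and> vstrip rho ka} = {}" for s
      using n1 n2 by auto
    then show ?thesis unfolding distrib_left sum.distrib L R by (simp only: sum.empty add_0_left)
  qed
qed

section \<open>The relation between ordinary and super branching\<close>

lemma sum_wronski_sets:
  fixes F :: "nat list \<Rightarrow> complex"
  assumes lam: "is_partition lam" and rho: "is_partition rho"
    and n: "length lam \<le> n" "length rho \<le> n"
    and G: "\<And>ka I. is_partition ka \<Longrightarrow> vstrip ka rho \<Longrightarrow> hstrip lam ka \<Longrightarrow>
      rlen ka = raise I (rlen rho) \<Longrightarrow> sum_list ka = sum_list rho + card I \<Longrightarrow> F ka = G I"
  shows "(\<Sum>ka | is_partition ka \<and> vstrip ka rho \<and> hstrip lam ka. F ka) =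
    (\<Sum>I\<in>wronski_sets n (rlen lam) (rlen rho). G I)"
proof (rule sum.reindex_bij_witness[where i = "\<lambda>I. of_rows (raise I (rlen rho))"
      and j = "\<lambda>ka. {i. rlen ka i = Suc (rlen rho i)}"])
  fix ka assume "ka \<in> {ka. is_partition ka \<and> vstrip ka rho \<and> hstrip lam ka}"
  then have ka: "is_partition ka" "vstrip ka rho" "hstrip lam ka" by auto
  let ?I = "{i. rlen ka i = Suc (rlen rho i)}"
  show "of_rows (raise ?I (rlen rho)) = ka"
    using vstrip_raise(1)[OF ka(2)] of_rows_rlen[OF ka(1)] by metis
  have "length ka \<le> n" using hstrip_length[OF ka(3) lam ka(1)] n by simp
  then have sub: "?I \<subseteq> {..<n}" by (rule vstrip_support[OF ka(2)])
  then show "?I \<in> wronski_sets n (rlen lam) (rlen rho)"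
    using ka(3) by (auto simp: wronski_sets_def hstrip_def vstrip_raise(1)[OF ka(2), symmetric])
  show "G ?I = F ka"
    using G[OF ka vstrip_raise(1)[OF ka(2)]]
      sum_list_raise(1)[OF rho n(2) sub ka(1) vstrip_raise(1)[OF ka(2)]] by simp
next
  fix I assume "I \<in> wronski_sets n (rlen lam) (rlen rho)"
  then have I: "I \<subseteq> {..<n}"
    "\<And>i. i < n \<Longrightarrow> raise I (rlen rho) i \<le> rlen lam i \<and> rlen lam (Suc i) \<le> raise I (rlen rho) i"
    by (auto simp: wronski_sets_def)
  let ?f = "raise I (rlen rho)"
  have z: "?f i = 0" if "i \<ge> n" for i using that I(1) n(2) by (auto simp: raise_def)
  have step: "?f (Suc i) \<le> ?f i" for i
  proof (cases "Suc i < n")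
    case True
    then show ?thesis using I(2)[of i] I(2)[of "Suc i"] by simp
  qed (simp add: z)
  have "antimono ?f" unfolding antimono_iff_le_Suc using step by blast
  note of = of_rows[OF this z[OF order_refl]]
  have "hstrip lam (of_rows ?f)"
    unfolding hstrip_def of
  proof
    fix i
    show "?f i \<le> rlen lam i \<and> rlen lam (Suc i) \<le> ?f i"
    proof (cases "i < n")
      case False
      then show ?thesis using n(1) z[of i] by simp
    qed (use I(2) in auto)
  qed
  moreover have "vstrip (of_rows ?f) rho" unfolding vstrip_def of by (simp add: raise_def)
  ultimately show "of_rows ?f \<in> {ka. is_partition ka \<and> vstrip ka rho \<and> hstrip lam ka}"
    using of by simp
  show "{i. rlen (of_rows ?f) i = Suc (rlen rho i)} = I" unfolding of by (rule raise_eq_set)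
qed

text \<open>Adding the ordinary variable \<open>-q/t\<close> and the super variable
  \<open>1\<close>, or \<open>-1/t\<close> and \<open>1/t\<close>, has the same effect on power
  sums: \<open>(-q/t)^n - (-1/t)^n = (-1)^n (1 - q^n)/(1 - t^n) (1 - t^(-n))\<close>. The exponents
  of \<open>t\<close> are negative where the coefficient is nonzero or vanish, so that
  \<open>t powi _\<close> is a power of the variable \<open>1/t\<close>.\<close>

lemma bmat_cmat_relation:
  assumes lam: "is_partition lam" and rho: "is_partition rho" and K: "sum_list lam \<le> K"
  shows "(\<Sum>ka\<in>partitions_upto K. bmat lam ka * (- (q / t)) powi (int (sum_list lam) - int (sum_list ka)) * cmat ka rho) =
    (\<Sum>ka\<in>partitions_upto K. bmat lam ka * (- (1 / t)) powi (int (sum_list lam) - int (sum_list ka)) *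
      (t powi (int (sum_list rho) - int (sum_list ka)) * cmat ka rho))"
proof -
  let ?S = "{ka. is_partition ka \<and> vstrip ka rho \<and> hstrip lam ka}"
  let ?x = "\<lambda>ka. (- (q / t)) powi (int (sum_list lam) - int (sum_list ka))"
  let ?y = "\<lambda>ka. (- (1 / t)) powi (int (sum_list lam) - int (sum_list ka)) * t powi (int (sum_list rho) - int (sum_list ka))"
  have sub: "?S \<subseteq> partitions_upto K"
    using K hstrip_sum_list by (fastforce simp: partitions_upto_def)
  have "(\<Sum>ka\<in>?S. bmat lam ka * cmat ka rho * (?x ka - ?y ka)) = 0"
  proof (cases "\<forall>i. rlen rho i \<le> rlen lam i \<and> rlen lam (Suc i) \<le> Suc (rlen rho i)")
    case False
    then have "?S = {}" by (auto simp: hstrip_def vstrip_def) (meson order_trans)+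
    then show ?thesis by (simp only: sum.empty)
  next
    case compat: True
    define n where "n = max (length lam) (length rho)"
    have n: "length lam \<le> n" "length rho \<le> n" by (auto simp: n_def)
    define d where "d = sum_list lam - sum_list rho"
    have "sum_list rho \<le> sum_list lam" using compat by (intro sum_list_mono_rlen) auto
    then have d: "sum_list lam = sum_list rho + d" by (simp add: d_def)
    let ?c = "bnorm rho * (- 1) ^ d / t ^ d"
    have T: "bmat lam ka * cmat ka rho * (?x ka - ?y ka) = ?c * ((- 1) ^ card I *
      (hrow n (rlen lam) (raise I (rlen rho)) / brow n (raise I (rlen rho)) * vrow n (rlen rho) (raise I (rlen rho))) *
      (q ^ d * (t / q) ^ card I - 1))"
      if ka: "is_partition ka" "vstrip ka rho" "hstrip lam ka" "rlen ka = raise I (rlen rho)"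
        "sum_list ka = sum_list rho + card I" for ka I
    proof -
      have len: "length ka \<le> n" using hstrip_length[OF ka(3) lam ka(1)] n by simp
      have "card I \<le> d" using hstrip_sum_list[OF ka(3)] ka(5) d by simp
      then obtain e where e: "d = card I + e" using le_Suc_ex by blast
      have x: "?x ka = (- (q / t)) ^ e" and y: "?y ka = (- (1 / t)) ^ e / t ^ card I"
        by (simp_all add: d ka(5) e power_int_minus divide_inverse)
      have "?x ka - ?y ka = (- 1) ^ d / t ^ d * ((- 1) ^ card I * (q ^ d * (t / q) ^ card I - 1))"
      proof -
        have P: "(- (q / t)) ^ e = (- 1) ^ e * q ^ e / t ^ e" "(- (1 / t)) ^ e = (- 1) ^ e / t ^ e"
          by (simp_all add: power_minus[of "q / t"] power_minus[of "1 / t"] power_divide)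
        show ?thesis unfolding x y P by (simp add: e power_add power_divide field_simps)
      qed
      moreover have "bmat lam ka * cmat ka rho = bnorm rho *
          (hrow n (rlen lam) (raise I (rlen rho)) / brow n (raise I (rlen rho)) * vrow n (rlen rho) (raise I (rlen rho)))"
        using ka(2,3) by (simp add: bmat_def cmat_def emat_def psi_hrow[OF lam ka(1,3) len]
          psi_transpose[OF generic ka(1) rho ka(2) len] bnorm_brow[OF ka(1) len] ka(4))
      ultimately show ?thesis by (simp only: divide_inverse mult_ac)
    qed
    have zero: "rlen rho n = 0" "rlen lam n = 0" using n by auto
    have "(\<Sum>ka\<in>?S. bmat lam ka * cmat ka rho * (?x ka - ?y ka)) =
      (\<Sum>I\<in>wronski_sets n (rlen lam) (rlen rho). ?c * ((- 1) ^ card I *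
      (hrow n (rlen lam) (raise I (rlen rho)) / brow n (raise I (rlen rho)) * vrow n (rlen rho) (raise I (rlen rho))) *
      (q ^ d * (t / q) ^ card I - 1)))"
      by (rule sum_wronski_sets[OF lam rho n T])
    also have "\<dots> = 0"
      unfolding sum_distrib_left[symmetric]
      using wronski_rows[OF antimono_rlen[OF rho] antimono_rlen[OF lam] zero, of d] compat d
      by (simp add: sum_list_rlen[OF n(1)] sum_list_rlen[OF n(2)])
    finally show ?thesis .
  qed
  also have "(\<Sum>ka\<in>?S. bmat lam ka * cmat ka rho * (?x ka - ?y ka)) =
     (\<Sum>ka\<in>partitions_upto K. bmat lam ka * cmat ka rho * (?x ka - ?y ka))"
    by (rule sum.mono_neutral_left[OF finite_partitions_upto sub])
       (auto simp: partitions_upto_def bmat_def cmat_def emat_def)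
  finally show ?thesis by (simp add: algebra_simps sum_subtractf)
qed

text \<open>Coefficients of the series with \<open>\<Phi>(u) / \<Phi>(u / t) = (1 - u / t) / (1 - q u / t)\<close>.\<close>

fun Phi :: "nat \<Rightarrow> complex" where
  "Phi 0 = 1"
| "Phi (Suc r) = (q / t - 1 / t ^ Suc r) / (1 - 1 / t ^ Suc r) * Phi r"

text \<open>The coefficient of \<open>u ^ Suc r\<close> in
  \<open>(1 - q u / t) \<Phi>(u) = (1 - u / t) \<Phi>(u / t)\<close>.\<close>

lemma Phi_recurrence: "Phi (Suc r) - q / t * Phi r = (Phi (Suc r) - Phi r) / t ^ Suc r"
proof -
  have "t ^ Suc r \<noteq> 1" using generic_neq_one[of 0 "Suc r"] by simp
  then have nz: "1 - 1 / t ^ Suc r \<noteq> 0" by (simp add: field_simps)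
  have solve: "a - x * p = (a - p) * y" if "a = (x - y) / (1 - y) * p" "1 - y \<noteq> 0" for a x y p :: complex
  proof -
    have "a * (1 - y) = (x - y) * p" using that by simp
    then show ?thesis by (simp add: algebra_simps)
  qed
  have "Phi (Suc r) - q / t * Phi r = (Phi (Suc r) - Phi r) * (1 / t ^ Suc r)"
    by (rule solve[OF Phi.simps(2) nz])
  then show ?thesis by simp
qed

declare Phi.simps(2) [simp del]

text \<open>The relation between \<open>cmat\<close> and \<open>bmat\<close> determines \<open>cmat\<close> recursively; both sides below
  satisfy the recursion that results from it by the commutation of \<open>bmat\<close> with \<open>emat\<close>.\<close>

lemma emat_cmat_commute:
  assumes "is_partition mu" "is_partition rho" "sum_list mu + r \<le> K" "sum_list rho \<le> K"
  shows "(\<Sum>lam\<in>partitions_upto K. egraded r mu lam * cmat lam rho) =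
    (\<Sum>i\<le>r. Phi (r - i) * (\<Sum>ka\<in>partitions_upto K. cmat mu ka * egraded i ka rho))"
  using assms
proof (induction r arbitrary: mu)
  case 0
  have "(\<Sum>lam\<in>partitions_upto K. egraded 0 mu lam * cmat lam rho) =
      (\<Sum>lam\<in>partitions_upto K. if lam = mu then cmat lam rho else 0)"
    using 0 by (intro sum.cong refl) (auto simp: egraded_0 partitions_upto_def)
  moreover have "(\<Sum>ka\<in>partitions_upto K. cmat mu ka * egraded 0 ka rho) =
      (\<Sum>ka\<in>partitions_upto K. if ka = rho then cmat mu ka else 0)"
    using 0 by (intro sum.cong refl) (auto simp: egraded_0 partitions_upto_def)
  moreover have "mu \<in> partitions_upto K" "rho \<in> partitions_upto K"
    using 0 by (auto simp: partitions_upto_def)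
  ultimately show ?case by simp
next
  case (Suc r)
  define S where "S = partitions_upto K"
  have finS [simp]: "finite S" by (simp add: S_def)
  have part: "is_partition lam" if "lam \<in> S" for lam using that by (simp add: S_def partitions_upto_def)
  define x where "x = - (q / t)"
  define y where "y = - (1 / t)"
  have xy: "x \<noteq> 0" "y \<noteq> 0" by (auto simp: x_def y_def)
  let ?sz = "\<lambda>l :: nat list. int (sum_list l)"
  \<comment> \<open>\<open>B z\<close> adds the ordinary variable \<open>z\<close> and
    \<open>E r\<close> applies the Pieri matrix, both to functions on partitions.
    \<open>\<tau>\<close> replaces the super variable \<open>1\<close> by \<open>1/t\<close>; its
    index \<open>s\<close> compensates for the degree that \<open>E s\<close> adds.\<close>
  define B where "B = (\<lambda>x f mu. \<Sum>ka\<in>S. bmat mu ka * x powi (?sz mu - ?sz ka) * f ka :: complex)"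
  define E where "E = (\<lambda>r f mu. \<Sum>lam\<in>S. egraded r mu lam * f lam :: complex)"
  define \<tau> where "\<tau> = (\<lambda>s f ka. t powi (?sz rho - ?sz ka - int s) * f ka :: complex)"
  define C where "C = (\<lambda>lam. cmat lam rho)"
  define c where "c = (\<lambda>i mu. \<Sum>ka\<in>S. cmat mu ka * egraded i ka rho)"
  define W where "W = (\<lambda>r mu. \<Sum>i\<le>r. Phi (r - i) * c i mu)"
  have B_add: "B z (\<lambda>ka. f ka + h ka) mu = B z f mu + B z h mu" for z f h mu
    by (simp add: B_def algebra_simps sum.distrib)
  have B_diff: "B z (\<lambda>ka. f ka - h ka) mu = B z f mu - B z h mu" for z f h mu
    by (simp add: B_def algebra_simps sum_subtractf)
  have B_sum: "B z (\<lambda>ka. \<Sum>i\<in>A. a i * f i ka) mu = (\<Sum>i\<in>A. a i * B z (f i) mu)" for z mu A and a :: "'z \<Rightarrow> complex" and f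
    unfolding B_def by (simp only: sum_distrib_left) (subst sum.swap, simp only: mult_ac)
  have comm: "B z (E (Suc r) f) mu + z * B z (E r f) mu = E (Suc r) (B z f) mu"
    if mu: "is_partition mu" "sum_list mu + Suc r \<le> K" and z: "z \<noteq> 0" for z f mu
  proof -
    have 1: "B z (E s f) mu = (\<Sum>lam\<in>S. (\<Sum>ka\<in>S. bmat mu ka * egraded s ka lam) * (z powi (?sz mu + int s - ?sz lam) * f lam))" for s
    proof -
      have "B z (E s f) mu = (\<Sum>ka\<in>S. \<Sum>lam\<in>S. bmat mu ka * z powi (?sz mu - ?sz ka) * (egraded s ka lam * f lam))"
        by (simp add: B_def E_def sum_distrib_left)
      also have "\<dots> = (\<Sum>ka\<in>S. \<Sum>lam\<in>S. bmat mu ka * egraded s ka lam * (z powi (?sz mu + int s - ?sz lam) * f lam))"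
        by (intro sum.cong refl) (auto simp: egraded_def)
      also have "\<dots> = (\<Sum>lam\<in>S. (\<Sum>ka\<in>S. bmat mu ka * egraded s ka lam) * (z powi (?sz mu + int s - ?sz lam) * f lam))"
        by (subst sum.swap) (simp only: sum_distrib_right)
      finally show ?thesis .
    qed
    have "z * B z (E r f) mu = (\<Sum>lam\<in>S. (\<Sum>ka\<in>S. bmat mu ka * egraded r ka lam) * (z powi (?sz mu + int (Suc r) - ?sz lam) * f lam))"
    proof -
      have "z powi (?sz mu + int (Suc r) - ?sz lam) = z * z powi (?sz mu + int r - ?sz lam)" for lam
      proof -
        have "z powi (1 + k) = z * z powi k" for k using z by (simp add: power_int_add)
        moreover have "?sz mu + int (Suc r) - ?sz lam = 1 + (?sz mu + int r - ?sz lam)" by simp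
        ultimately show ?thesis by (simp only:)
      qed
      then show ?thesis unfolding 1 sum_distrib_left by (simp only: mult_ac)
    qed
    then have "B z (E (Suc r) f) mu + z * B z (E r f) mu = (\<Sum>lam\<in>S.
      (\<Sum>ka\<in>S. bmat mu ka * (egraded (Suc r) ka lam + egraded r ka lam)) * (z powi (?sz mu + int (Suc r) - ?sz lam) * f lam))"
      unfolding 1[of "Suc r"] by (simp only: distrib_left sum.distrib distrib_right)
    also have "\<dots> = (\<Sum>lam\<in>S. (\<Sum>ka\<in>S. egraded (Suc r) mu ka * bmat ka lam) * (z powi (?sz mu + int (Suc r) - ?sz lam) * f lam))"
      using bmat_emat_commute[OF mu(1) _ mu(2)] part by (intro sum.cong refl) (simp add: S_def)
    also have "\<dots> = (\<Sum>ka\<in>S. \<Sum>lam\<in>S. egraded (Suc r) mu ka * (bmat ka lam * z powi (?sz ka - ?sz lam) * f lam))"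
      unfolding sum_distrib_right by (subst sum.swap) (auto simp: egraded_def add_ac intro!: sum.cong)
    also have "\<dots> = E (Suc r) (B z f) mu" by (simp add: E_def B_def sum_distrib_left)
    finally show ?thesis .
  qed
  have rel: "B x (\<lambda>lam. cmat lam ka) mu = B y (\<lambda>lam. t powi (?sz ka - ?sz lam) * cmat lam ka) mu"
    if "mu \<in> S" "ka \<in> S" for mu ka
    using bmat_cmat_relation[of mu ka K] that by (simp add: B_def x_def y_def S_def partitions_upto_def)
  have relC: "B x C mu = B y (\<tau> 0 C) mu" if "mu \<in> S" for mu
    using rel[OF that, of rho] Suc.prems by (simp add: C_def \<tau>_def S_def partitions_upto_def)
  have E\<tau>: "E s (\<tau> 0 f) mu = \<tau> s (E s f) mu" for s f mu
  proof -
    have "egraded s mu lam * (t powi (?sz rho - ?sz lam) * f lam) = t powi (?sz rho - ?sz mu - int s) * (egraded s mu lam * f lam)" for lam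
      by (simp add: egraded_def algebra_simps)
    then show ?thesis unfolding E_def \<tau>_def sum_distrib_left by (simp only: of_nat_0 diff_zero)
  qed
  have relc: "B x (c i) mu = B y (\<tau> i (c i)) mu" if "mu \<in> S" for mu i
  proof -
    have c: "c i = (\<lambda>mu. \<Sum>ka\<in>S. egraded i ka rho * cmat mu ka)" by (simp add: c_def mult.commute)
    have "B x (c i) mu = (\<Sum>ka\<in>S. egraded i ka rho * B x (\<lambda>mu. cmat mu ka) mu)"
      unfolding c B_sum ..
    also have "\<dots> = (\<Sum>ka\<in>S. egraded i ka rho * B y (\<lambda>lam. t powi (?sz ka - ?sz lam) * cmat lam ka) mu)"
      using rel[OF that] by simp
    also have "\<dots> = B y (\<lambda>mu. \<Sum>ka\<in>S. egraded i ka rho * (t powi (?sz ka - ?sz mu) * cmat mu ka)) mu"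
      unfolding B_sum ..
    also have "(\<lambda>mu. \<Sum>ka\<in>S. egraded i ka rho * (t powi (?sz ka - ?sz mu) * cmat mu ka)) = \<tau> i (c i)"
      unfolding \<tau>_def c sum_distrib_left by (intro ext sum.cong refl) (auto simp: egraded_def)
    finally show ?thesis .
  qed
  have \<tau>W: "\<tau> s (W s) = (\<lambda>mu. \<Sum>i\<le>s. (Phi (s - i) / t ^ (s - i)) * \<tau> i (c i) mu)" for s
  proof
    fix mu
    have "t powi (?sz rho - ?sz mu - int s) = t powi (?sz rho - ?sz mu - int i) / t ^ (s - i)" if "i \<le> s" for i
    proof -
      have "?sz rho - ?sz mu - int s = (?sz rho - ?sz mu - int i) - int (s - i)" using that by simp
      then show ?thesis by (simp only: power_int_diff[OF disjI1[OF t_nonzero]] power_int_of_nat)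
    qed
    then show "\<tau> s (W s) mu = (\<Sum>i\<le>s. (Phi (s - i) / t ^ (s - i)) * \<tau> i (c i) mu)"
      unfolding \<tau>_def W_def sum_distrib_left by (intro sum.cong refl) simp
  qed
  \<comment> \<open>By the recurrence of \<open>Phi\<close>, the expected right side
    \<open>W\<close> satisfies the same relation that \<open>E\<close> applied to \<open>C\<close>
    satisfies by commutation.\<close>
  have BW: "B x (W (Suc r)) mu + x * B x (W r) mu = B y (\<tau> (Suc r) (W (Suc r))) mu + y * B y (\<tau> r (W r)) mu"
    if "mu \<in> S" for mu
  proof -
    define \<beta> where "\<beta> = (\<lambda>i. B x (c i) mu)"
    have 1: "B x (W s) mu = (\<Sum>i\<le>s. Phi (s - i) * \<beta> i)" for s
      unfolding W_def B_sum \<beta>_def ..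
    have 2: "B y (\<tau> s (W s)) mu = (\<Sum>i\<le>s. (Phi (s - i) / t ^ (s - i)) * \<beta> i)" for s
      unfolding \<tau>W B_sum \<beta>_def relc[OF that] ..
    have "(\<Sum>i\<le>r. Phi (Suc r - i) * \<beta> i) + x * (\<Sum>i\<le>r. Phi (r - i) * \<beta> i) =
      (\<Sum>i\<le>r. (Phi (Suc r - i) / t ^ (Suc r - i)) * \<beta> i) + y * (\<Sum>i\<le>r. (Phi (r - i) / t ^ (r - i)) * \<beta> i)"
      unfolding sum_distrib_left sum.distrib[symmetric]
    proof (rule sum.cong[OF refl])
      fix i assume "i \<in> {..r}"
      then have s: "Suc r - i = Suc (r - i)" by auto
      have "Phi (Suc (r - i)) + x * Phi (r - i) = Phi (Suc (r - i)) / t ^ Suc (r - i) + y * (Phi (r - i) / t ^ (r - i))"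
        using Phi_recurrence[of "r - i"] by (simp add: x_def y_def diff_divide_distrib)
      then show "Phi (Suc r - i) * \<beta> i + x * (Phi (r - i) * \<beta> i) =
         Phi (Suc r - i) / t ^ (Suc r - i) * \<beta> i + y * (Phi (r - i) / t ^ (r - i) * \<beta> i)"
        unfolding s mult.assoc[symmetric] distrib_right[symmetric] by simp
    qed
    then show ?thesis unfolding 1 2 by simp
  qed
  have IH: "E r C ka = W r ka" if "is_partition ka" "sum_list ka + r \<le> K" for ka
    using Suc.IH[OF that(1) Suc.prems(2) that(2) Suc.prems(4)] by (simp add: E_def C_def W_def c_def S_def)
  define Z where "Z = (\<lambda>ka. E (Suc r) C ka - W (Suc r) ka)"
  have BZ: "B x Z mu = B y (\<tau> (Suc r) Z) mu" if mu: "is_partition mu" "sum_list mu + Suc r \<le> K" for mu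
  proof -
    have muS: "mu \<in> S" using mu by (simp add: S_def partitions_upto_def)
    have BE: "B z (E r f) mu = B z (g f) mu" if "\<And>ka. ka \<in> S \<Longrightarrow> sum_list ka \<le> sum_list mu \<Longrightarrow> E r f ka = g f ka" for z f g
      unfolding B_def by (intro sum.cong refl) (use that bmat_nonzeroD(2) in fastforce)
    have EC: "B z (E r C) mu = B z (W r) mu" for z
      using BE[of C "\<lambda>_. W r" z] IH part mu(2) by fastforce
    have E\<tau>C: "B z (\<tau> r (E r C)) mu = B z (\<tau> r (W r)) mu" for z
    proof -
      have "\<tau> r (E r C) ka = \<tau> r (W r) ka" if "ka \<in> S" "sum_list ka \<le> sum_list mu" for ka
        using IH[of ka] part[OF that(1)] that(2) mu(2) by (simp add: \<tau>_def)
      then show ?thesis unfolding B_def by (intro sum.cong refl) (use bmat_nonzeroD(2) in fastforce)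
    qed
    have "B x (E (Suc r) C) mu + x * B x (W r) mu = E (Suc r) (B x C) mu"
      using comm[OF mu xy(1), of C] EC by simp
    also have "\<dots> = E (Suc r) (B y (\<tau> 0 C)) mu"
      unfolding E_def using relC by (intro sum.cong refl) simp
    also have "\<dots> = B y (\<tau> (Suc r) (E (Suc r) C)) mu + y * B y (\<tau> r (W r)) mu"
      unfolding comm[OF mu xy(2), symmetric] E\<tau>C[symmetric] by (simp add: E\<tau>[abs_def])
    finally have 1: "B x (E (Suc r) C) mu + x * B x (W r) mu =
        B y (\<tau> (Suc r) (E (Suc r) C)) mu + y * B y (\<tau> r (W r)) mu" .
    have "B x (E (Suc r) C) mu - B x (W (Suc r)) mu =
        (B x (E (Suc r) C) mu + x * B x (W r) mu) - (B x (W (Suc r)) mu + x * B x (W r) mu)" by simp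
    also have "\<dots> = B y (\<tau> (Suc r) (E (Suc r) C)) mu - B y (\<tau> (Suc r) (W (Suc r))) mu"
      unfolding 1 BW[OF muS] by simp
    finally have "B x (E (Suc r) C) mu - B x (W (Suc r)) mu =
        B y (\<tau> (Suc r) (E (Suc r) C)) mu - B y (\<tau> (Suc r) (W (Suc r))) mu" .
    moreover have "\<tau> (Suc r) Z = (\<lambda>ka. \<tau> (Suc r) (E (Suc r) C) ka - \<tau> (Suc r) (W (Suc r)) ka)"
      by (simp add: \<tau>_def Z_def right_diff_distrib)
    ultimately show ?thesis unfolding Z_def B_diff by (simp add: B_diff)
  qed
  \<comment> \<open>By induction on the size only the diagonal terms of \<open>B\<close> survive.
    They give \<open>Z mu = t powi k * Z mu\<close> with \<open>k\<close> the difference of degrees,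
    hence \<open>Z mu = 0\<close> for \<open>k \<noteq> 0\<close> by genericity.\<close>
  have "Z mu = 0" if "is_partition mu" "sum_list mu + Suc r \<le> K" for mu
    using that
  proof (induction "sum_list mu" arbitrary: mu rule: less_induct)
    case less
    have muS: "mu \<in> S" using less.prems by (simp add: S_def partitions_upto_def)
    have other: "bmat mu ka * u * Z ka = 0" if "ka \<in> S - {mu}" for ka u
    proof (cases "bmat mu ka = 0")
      case False
      note b = bmat_nonzeroD[OF False]
      have "sum_list ka \<noteq> sum_list mu"
        using partition_eq_of_sum_list[of ka mu] b(1) part[of ka] that less.prems(1) by (auto simp: hstrip_def)
      then show ?thesis using less.hyps[of ka] b(2) part[of ka] that less.prems(2) by auto
    qed simp
    have "(\<Sum>ka\<in>S - {mu}. bmat mu ka * x powi (?sz mu - ?sz ka) * Z ka) = 0"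
      by (rule sum.neutral) (use other in blast)
    then have "B x Z mu = Z mu"
      unfolding B_def sum.remove[OF finS muS] using less.prems by simp
    moreover have "B y (\<tau> (Suc r) Z) mu = t powi (?sz rho - ?sz mu - int (Suc r)) * Z mu"
    proof -
      have other': "bmat mu ka * u * (v * Z ka) = 0" if "ka \<in> S - {mu}" for ka u v
        using other[OF that, of "u * v"] by (simp add: mult.assoc)
      have "(\<Sum>ka\<in>S - {mu}. bmat mu ka * y powi (?sz mu - ?sz ka) *
          (t powi (?sz rho - ?sz ka - int (Suc r)) * Z ka)) = 0"
        by (rule sum.neutral) (use other' in blast)
      then show ?thesis unfolding B_def sum.remove[OF finS muS] \<tau>_def
        using less.prems by simp
    qed
    ultimately have eq: "Z mu = t powi (?sz rho - ?sz mu - int (Suc r)) * Z mu"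
      using BZ[OF less.prems] by simp
    show ?case
    proof (cases "sum_list rho = sum_list mu + Suc r")
      case False
      then have "?sz rho - ?sz mu - int (Suc r) \<noteq> 0" by linarith
      then have "t powi (?sz rho - ?sz mu - int (Suc r)) \<noteq> 1"
        using generic unfolding generic_parameters_def by (metis mult_1 power_int_0_right)
      with eq show ?thesis by simp
    next
      \<comment> \<open>For \<open>k = 0\<close> the relation is vacuous and both sides are
        computed: equality of sizes leaves only \<open>lam = rho\<close> on the left and
        \<open>ka = mu\<close> on the right, where the diagonal entries are 1.\<close>
      case True
      have rhoS: "rho \<in> S" using Suc.prems by (simp add: S_def partitions_upto_def)
      have other': "egraded (Suc r) mu lam * C lam = 0" if "lam \<in> S - {rho}" for lam
      proof (cases "sum_list lam = sum_list mu + Suc r \<and> cmat lam rho \<noteq> 0")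
        case t: True
        then have "rho = lam"
          using partition_eq_of_sum_list[of rho lam] cmat_nonzeroD[of lam rho] Suc.prems part[of lam] that True
          by (auto simp: vstrip_def)
        with that show ?thesis by simp
      qed (auto simp: egraded_def C_def)
      have "(\<Sum>lam\<in>S - {rho}. egraded (Suc r) mu lam * C lam) = 0"
        by (rule sum.neutral) (use other' in blast)
      then have "E (Suc r) C mu = egraded (Suc r) mu rho"
        unfolding E_def sum.remove[OF finS rhoS] using Suc.prems by (simp add: C_def)
      moreover have ci: "c i mu = (if i = Suc r then egraded (Suc r) mu rho else 0)" if "i \<le> Suc r" for i
      proof -
        have other'': "cmat mu ka * egraded i ka rho = 0" if "ka \<in> S - {mu}" for ka
        proof (cases "sum_list rho = sum_list ka + i \<and> cmat mu ka \<noteq> 0")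
          case t: True
          then have "sum_list ka \<le> sum_list mu" using cmat_nonzeroD by blast
          then have "sum_list ka = sum_list mu" using t True \<open>i \<le> Suc r\<close> by simp
          then have "ka = mu"
            using partition_eq_of_sum_list[of ka mu] cmat_nonzeroD[of mu ka] part[of ka] that less.prems(1) t
            by (auto simp: vstrip_def)
          with that show ?thesis by simp
        qed (auto simp: egraded_def)
        have "(\<Sum>ka\<in>S - {mu}. cmat mu ka * egraded i ka rho) = 0"
          by (rule sum.neutral) (use other'' in blast)
        then have "c i mu = egraded i mu rho"
          unfolding c_def sum.remove[OF finS muS] using less.prems by simp
        then show ?thesis using True by (auto simp: egraded_def)
      qed
      moreover have "W (Suc r) mu = egraded (Suc r) mu rho"
      proof -
        have "W (Suc r) mu = (\<Sum>i\<le>Suc r. if i = Suc r then egraded (Suc r) mu rho else 0)"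
          unfolding W_def by (intro sum.cong refl) (simp add: ci)
        then show ?thesis by simp
      qed
      ultimately show ?thesis by (simp add: Z_def)
    qed
  qed
  from this[OF Suc.prems(1,3)] show ?case
    by (simp add: Z_def E_def C_def W_def c_def S_def)
qed

end

section \<open>Evaluation of polynomials in the power sums\<close>

text \<open>The ring of symmetric functions is modelled by the polynomial ring whose variable \<open>k\<close> stands
  for the power sum of degree \<open>k + 1\<close>.\<close>

lemma poly_mapping_sum_singles:
  fixes a :: "'a \<Rightarrow>\<^sub>0 'b::comm_monoid_add"
  shows "a = (\<Sum>m\<in>Poly_Mapping.keys a. Poly_Mapping.single m (Poly_Mapping.lookup a m))"
proof (rule poly_mapping_eqI)
  fix k
  have "(\<Sum>m\<in>Poly_Mapping.keys a. Poly_Mapping.lookup (Poly_Mapping.single m (Poly_Mapping.lookup a m)) k) =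
    (\<Sum>m\<in>Poly_Mapping.keys a. if m = k then Poly_Mapping.lookup a m else 0)"
    by (intro sum.cong refl) (simp add: lookup_single when_def)
  then show "Poly_Mapping.lookup a k = Poly_Mapping.lookup
      (\<Sum>m\<in>Poly_Mapping.keys a. Poly_Mapping.single m (Poly_Mapping.lookup a m)) k"
    by (simp add: lookup_sum in_keys_iff)
qed

lemma poly_mapping_additive_induct [case_names zero single add]:
  fixes a :: "'a \<Rightarrow>\<^sub>0 'b::comm_monoid_add"
  assumes "P 0" "\<And>m x. P (Poly_Mapping.single m x)" "\<And>a b. P a \<Longrightarrow> P b \<Longrightarrow> P (a + b)"
  shows "P a"
proof -
  have "P (\<Sum>m\<in>A. Poly_Mapping.single m (f m))" if "finite A" for A and f :: "'a \<Rightarrow> 'b"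
    using that by (induction rule: finite_induct) (auto intro: assms)
  then show ?thesis using poly_mapping_sum_singles[of a] by (metis finite_keys)
qed

lemma single_eq_polyconst_mult: "Poly_Mapping.single m c = polyconst c * Poly_Mapping.single m 1"
  by (simp add: polyconst_def mult_single)

definition mon :: "(nat \<Rightarrow> 'r::comm_ring_1) \<Rightarrow> (nat \<Rightarrow>\<^sub>0 nat) \<Rightarrow> 'r" where
  "mon r m = (\<Prod>k\<in>Poly_Mapping.keys m. r k ^ Poly_Mapping.lookup m k)"

lemma mon_superset:
  assumes "finite A" "Poly_Mapping.keys m \<subseteq> A"
  shows "mon r m = (\<Prod>k\<in>A. r k ^ Poly_Mapping.lookup m k)"
  unfolding mon_def using assms by (intro prod.mono_neutral_left) (auto simp: in_keys_iff)

lemma mon_0 [simp]: "mon r 0 = 1"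
  by (simp add: mon_def)

lemma mon_single [simp]: "mon r (Poly_Mapping.single k n) = r k ^ n"
  by (simp add: mon_def)

lemma mon_add: "mon r (m + n) = mon r m * mon r n"
proof -
  let ?A = "Poly_Mapping.keys m \<union> Poly_Mapping.keys n"
  have "mon r (m + n) = (\<Prod>k\<in>?A. r k ^ Poly_Mapping.lookup (m + n) k)"
    by (rule mon_superset) (use keys_add[of m n] in auto)
  moreover have "mon r m = (\<Prod>k\<in>?A. r k ^ Poly_Mapping.lookup m k)"
    "mon r n = (\<Prod>k\<in>?A. r k ^ Poly_Mapping.lookup n k)"
    by (auto intro: mon_superset)
  ultimately show ?thesis by (simp add: lookup_add power_add prod.distrib)
qed

text \<open>Scalars are carried into the target ring by \<open>c\<close>. The targets are
  polynomials for evaluation in variables, the complex numbers for constant terms, and power series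
  over polynomials for adjoints.\<close>

locale scalar_hom =
  fixes c :: "complex \<Rightarrow> 'r::comm_ring_1"
  assumes c_add: "c (x + y) = c x + c y" and c_mult: "c (x * y) = c x * c y" and c_1: "c 1 = 1"
begin

lemma c_0: "c 0 = 0"
  using c_add[of 0 0] by simp

lemma c_minus: "c (- x) = - c x"
  using c_add[of x "- x"] c_0 by (simp add: eq_neg_iff_add_eq_0 add.commute)

lemma c_sum: "c (sum f A) = (\<Sum>x\<in>A. c (f x))"
  by (induction A rule: infinite_finite_induct) (auto simp: c_0 c_add)

lemma c_of_nat: "c (of_nat n) = of_nat n"
  by (induction n) (auto simp: c_0 c_add c_1)

lemma c_power: "c (x ^ n) = c x ^ n"
  by (induction n) (auto simp: c_1 c_mult)

definition lift :: "(nat \<Rightarrow> 'r) \<Rightarrow> polynomial \<Rightarrow> 'r" where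
  "lift r a = (\<Sum>m\<in>Poly_Mapping.keys a. c (Poly_Mapping.lookup a m) * mon r m)"

lemma lift_0 [simp]: "lift r 0 = 0"
  by (simp add: lift_def)

lemma lift_single [simp]: "lift r (Poly_Mapping.single m x) = c x * mon r m"
  by (simp add: lift_def c_0)

lemma lift_add: "lift r (a + b) = lift r a + lift r b"
  unfolding lift_def by (rule setsum_keys_plus_distrib) (simp_all add: c_0 c_add algebra_simps)

lemma lift_1 [simp]: "lift r 1 = 1"
  using lift_single[of r 0 1] by (simp add: c_1)

lemma lift_mult: "lift r (a * b) = lift r a * lift r b"
proof (induction a rule: poly_mapping_additive_induct)
  case (single m x)
  show ?case
  proof (induction b rule: poly_mapping_additive_induct)
    case (single n y)
    then show ?case by (simp add: mult_single c_mult mon_add mult_ac)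
  qed (simp_all add: lift_add algebra_simps)
qed (simp_all add: lift_add algebra_simps)

lemma lift_minus: "lift r (- a) = - lift r a"
  using lift_add[of r a "- a"] by (simp add: eq_neg_iff_add_eq_0 add.commute)

lemma lift_diff: "lift r (a - b) = lift r a - lift r b"
  using lift_add[of r a "- b"] by (simp add: lift_minus)

lemma lift_sum: "lift r (sum f A) = (\<Sum>x\<in>A. lift r (f x))"
  by (induction A rule: infinite_finite_induct) (auto simp: lift_add)

lemma lift_power: "lift r (a ^ n) = lift r a ^ n"
  by (induction n) (auto simp: lift_mult)

lemma lift_polyconst [simp]: "lift r (polyconst x) = c x"
  by (simp add: polyconst_def)

lemma lift_polyvar [simp]: "lift r (polyvar k) = r k"
  by (simp add: polyvar_def c_1)

end

interpretation polyconst: scalar_hom polyconst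
  by standard (auto simp: polyconst_def single_add mult_single)

interpretation complex_scalars: scalar_hom "\<lambda>x. x :: complex"
  by standard auto

interpretation fps_scalars: scalar_hom "\<lambda>x. fps_const (polyconst x)"
  by standard (simp_all add: polyconst.c_add polyconst.c_mult polyconst.c_1)

section \<open>Newton's identities\<close>

text \<open>\<open>p k\<close> is the power sum of degree \<open>k + 1\<close> and \<open>e r\<close> the elementary symmetric function.\<close>

definition newton :: "(nat \<Rightarrow> 'r::comm_ring_1) \<Rightarrow> (nat \<Rightarrow> 'r) \<Rightarrow> bool" where
  "newton p e \<longleftrightarrow> e 0 = 1 \<and>
     (\<forall>r. of_nat (Suc r) * e (Suc r) = (\<Sum>k\<le>r. (- 1) ^ k * p k * e (r - k)))"

text \<open>The identities say that the generating series of \<open>e\<close> has the alternating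
  generating series of \<open>p\<close> as its logarithmic derivative.\<close>

lemma newton_fps: "newton p e \<longleftrightarrow> e 0 = 1 \<and>
    fps_deriv (Abs_fps e) = Abs_fps (\<lambda>k. (- 1) ^ k * p k) * Abs_fps e"
  by (auto simp: newton_def fps_eq_iff fps_mult_nth atLeast0AtMost)

text \<open>Joining two sets of variables multiplies the generating series of \<open>e\<close>, and
  logarithmic derivatives add.\<close>

lemma newton_mult:
  assumes "newton p e" "newton p' e'"
  shows "newton (\<lambda>k. p k + p' k) (\<lambda>r. \<Sum>i\<le>r. e i * e' (r - i))"
proof -
  have E: "Abs_fps (\<lambda>r. \<Sum>i\<le>r. e i * e' (r - i)) = Abs_fps e * Abs_fps e'"
    by (simp add: fps_eq_iff fps_mult_nth atLeast0AtMost)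
  have N: "Abs_fps (\<lambda>k. (- 1) ^ k * (p k + p' k)) = Abs_fps (\<lambda>k. (- 1) ^ k * p k) + Abs_fps (\<lambda>k. (- 1) ^ k * p' k)"
    by (simp add: fps_eq_iff algebra_simps)
  show ?thesis using assms unfolding newton_fps E N fps_deriv_mult by (simp add: algebra_simps)
qed

lemma newton_one: "newton (\<lambda>k. 0) (\<lambda>r. if r = 0 then 1 else 0)"
  by (simp add: newton_def)

lemma newton_variable: "newton (\<lambda>k. x ^ Suc k) (\<lambda>r. if r = 0 then 1 else if r = 1 then x else 0)"
proof -
  have "(\<Sum>k\<le>r. (- 1) ^ k * x ^ Suc k * (if r - k = 0 then 1 else if r - k = 1 then x else 0)) =
      (if r = 0 then x else 0)" for r
  proof (cases r)
    case (Suc s)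
    have "(\<Sum>k\<le>s. (- 1) ^ k * x ^ Suc k * (if Suc s - k = 0 then 1 else if Suc s - k = 1 then x else 0)) =
      (\<Sum>k\<le>s. if k = s then (- 1) ^ s * x ^ Suc s * x else 0)"
      by (intro sum.cong refl) (auto simp: Suc_diff_le)
    then show ?thesis by (simp add: Suc mult_ac)
  qed simp
  then show ?thesis unfolding newton_def by simp
qed

text \<open>Newton's identities solved for the elementary functions inside the polynomial ring of
  the power sums; division by \<open>Suc r\<close> is available over the complex numbers.\<close>

fun ehat :: "nat \<Rightarrow> polynomial" where
  "ehat 0 = 1"
| "ehat (Suc r) = polyconst (1 / of_nat (Suc r)) * (\<Sum>k\<le>r. (- 1) ^ k * polyvar k * ehat (r - k))"

declare ehat.simps(2) [simp del]

lemma (in scalar_hom) lift_ehat: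
  assumes "newton p e"
  shows "lift p (ehat r) = e r"
proof (induction r rule: less_induct)
  case (less r)
  show ?case
  proof (cases r)
    case 0
    then show ?thesis using assms by (simp add: newton_def)
  next
    case (Suc s)
    have "lift p (ehat r) = c (1 / of_nat (Suc s)) * (\<Sum>k\<le>s. (- 1) ^ k * p k * e (s - k))"
      unfolding Suc ehat.simps(2) using less Suc
      by (simp add: lift_mult lift_sum lift_power lift_minus)
    also have "\<dots> = c (1 / of_nat (Suc s)) * (c (of_nat (Suc s)) * e (Suc s))"
      using assms by (simp add: newton_def c_of_nat del: of_nat_Suc)
    also have "\<dots> = c (1 / of_nat (Suc s) * of_nat (Suc s)) * e (Suc s)"
      by (simp only: c_mult mult.assoc)
    also have "\<dots> = e r" using Suc by (simp add: c_1 del: of_nat_Suc)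
    finally show ?thesis .
  qed
qed

lemma newton_ehat: "newton polyvar ehat"
proof -
  have "of_nat (Suc r) * ehat (Suc r) = (\<Sum>k\<le>r. (- 1) ^ k * polyvar k * ehat (r - k))" for r
  proof -
    have "of_nat (Suc r) * ehat (Suc r) = polyconst (of_nat (Suc r) * (1 / of_nat (Suc r))) *
        (\<Sum>k\<le>r. (- 1) ^ k * polyvar k * ehat (r - k))"
      unfolding ehat.simps(2) polyconst.c_mult polyconst.c_of_nat by (simp only: mult.assoc)
    then show ?thesis by (simp add: polyconst.c_1 del: of_nat_Suc)
  qed
  then show ?thesis by (simp add: newton_def)
qed

context macdonald_parameters
begin

definition kappa :: "nat \<Rightarrow> complex" where
  "kappa k = (1 - q ^ k) / (1 - t ^ k)"

text \<open>\<open>sc\<close> substitutes \<open>u / t\<close>. The functional equation of the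
  series \<open>P\<close> gives an equation for its logarithmic derivative \<open>N\<close>, and the
  series \<open>G\<close> of the \<open>kappa\<close> satisfies the same one. The solution is unique
  since \<open>1 - 1 / t ^ Suc k\<close> is nonzero.\<close>

lemma newton_Phi_complex: "newton (\<lambda>k. (- 1) ^ k * kappa (Suc k)) Phi"
proof -
  let ?sc = "\<lambda>f. Abs_fps (\<lambda>n. fps_nth f n / t ^ n)"
  let ?a = "q / t" and ?b = "1 / t"
  let ?A = "1 - fps_const ?a * fps_X" and ?B = "1 - fps_const ?b * fps_X"
  define P where "P = Abs_fps Phi"
  define G where "G = Abs_fps (\<lambda>k. kappa (Suc k))"
  have P0: "fps_nth P 0 = 1" by (simp add: P_def)
  define N where "N = fps_deriv P / P"
  have N: "fps_deriv P = N * P" unfolding N_def using P0 by (simp add: fps_divide_unit)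
      (simp add: mult.assoc inverse_mult_eq_1)
  have sc_mult: "?sc (f * g) = ?sc f * ?sc g" for f g
    by (rule fps_ext) (auto simp: fps_mult_nth sum_divide_distrib power_add[symmetric] intro!: sum.cong)
  have sc_deriv: "fps_deriv (?sc f) = fps_const ?b * ?sc (fps_deriv f)" for f
    by (rule fps_ext) simp
  have eq: "?A * P = ?B * ?sc P"
  proof (rule fps_ext)
    fix n
    show "fps_nth (?A * P) n = fps_nth (?B * ?sc P) n"
    proof (cases n)
      case (Suc r)
      then show ?thesis using Phi_recurrence[of r]
        by (simp add: left_diff_distrib mult.assoc P_def diff_divide_distrib)
    qed simp
  qed
  have scP: "?sc P \<noteq> 0" using P0 by (auto simp: fps_eq_iff intro!: exI[of _ 0])
  have logd: "?A * ?B * (N - fps_const ?b * ?sc N) = fps_const (?a - ?b)"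
  proof -
    have dA: "fps_deriv ?A = - fps_const ?a" "fps_deriv ?B = - fps_const ?b" by simp_all
    have "- fps_const ?a * P + ?A * (N * P) = - fps_const ?b * ?sc P + ?B * (fps_const ?b * (?sc N * ?sc P))"
      using arg_cong[OF eq, of fps_deriv] unfolding fps_deriv_mult dA N sc_deriv sc_mult
      by (simp add: algebra_simps)
    then have "?A * (- fps_const ?a * P + ?A * (N * P)) =
        ?A * (- fps_const ?b * ?sc P + ?B * (fps_const ?b * (?sc N * ?sc P)))" by simp
    then have "- fps_const ?a * (?A * P) + ?A * (N * (?A * P)) =
        ?A * (- fps_const ?b * ?sc P + ?B * (fps_const ?b * (?sc N * ?sc P)))"
      by (simp only: distrib_left mult_ac)
    then have "?sc P * (- fps_const ?a * ?B + ?A * (N * ?B)) =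
       ?sc P * (?A * (- fps_const ?b + ?B * (fps_const ?b * ?sc N)))"
      unfolding eq by (simp only: distrib_left mult_ac)
    then have "- fps_const ?a * ?B + ?A * (N * ?B) = ?A * (- fps_const ?b + ?B * (fps_const ?b * ?sc N))"
      using scP by (simp only: mult_cancel_left) simp
    moreover have "(1 - a * x) * (1 - b * x) * (n - b * s) = a - b"
      if "- a * (1 - b * x) + (1 - a * x) * (n * (1 - b * x)) = (1 - a * x) * (- b + (1 - b * x) * (b * s))"
      for a b x n s :: "complex fps"
    proof -
      have "(1 - a * x) * (1 - b * x) * (n - b * s) =
          (- a * (1 - b * x) + (1 - a * x) * (n * (1 - b * x))) + a * (1 - b * x) - (1 - a * x) * (1 - b * x) * (b * s)"
        by (simp add: algebra_simps)
      also have "\<dots> = a - b" unfolding that by (simp add: algebra_simps)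
      finally show ?thesis .
    qed
    moreover have "fps_const (?a - ?b) = fps_const ?a - fps_const ?b" by simp
    ultimately show ?thesis by presburger
  qed
  have G': "?A * ?B * (G - fps_const ?b * ?sc G) = fps_const (?a - ?b)"
  proof -
    \<comment> \<open>The combination is a difference of two geometric series, with ratios
      \<open>q / t\<close> and \<open>1 / t\<close>; multiplication by \<open>A\<close> and
      \<open>B\<close> clears them.\<close>
    have gk: "fps_nth (G - fps_const ?b * ?sc G) k = ?a ^ Suc k - ?b ^ Suc k" for k
    proof -
      have "t ^ Suc k \<noteq> 1" using generic_neq_one[of 0 "Suc k"] by simp
      moreover have "(1 - Q) / (1 - T) - (1 - Q) / (1 - T) / T = Q / T - 1 / T" if "T \<noteq> 1" "T \<noteq> 0" for Q T :: complex
      proof -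
        have "(1 - Q) / (1 - T) - (1 - Q) / (1 - T) / T = (1 - Q) * ((T - 1) / ((1 - T) * T))"
          using that by (simp add: divide_simps) (simp add: algebra_simps)
        also have "(T - 1) / ((1 - T) * T) = - 1 / T"
          using that by (simp add: divide_simps)
        finally show ?thesis by (simp add: algebra_simps diff_divide_distrib)
      qed
      ultimately have "kappa (Suc k) - kappa (Suc k) / t ^ Suc k = ?a ^ Suc k - ?b ^ Suc k"
        by (simp add: kappa_def power_divide del: power_Suc)
      then have "kappa (Suc k) - ?b * (kappa (Suc k) / t ^ k) = ?a ^ Suc k - ?b ^ Suc k"
        by (simp add: mult.commute)
      then show ?thesis by (simp add: G_def)
    qed
    have A: "?A * Abs_fps (\<lambda>k. x * ?a ^ k) = fps_const x" for x
    proof (rule fps_ext)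
      fix n show "fps_nth (?A * Abs_fps (\<lambda>k. x * ?a ^ k)) n = fps_nth (fps_const x) n"
        by (cases n) (simp_all add: left_diff_distrib mult.assoc)
    qed
    have B: "?B * Abs_fps (\<lambda>k. x * ?b ^ k) = fps_const x" for x
    proof (rule fps_ext)
      fix n show "fps_nth (?B * Abs_fps (\<lambda>k. x * ?b ^ k)) n = fps_nth (fps_const x) n"
        by (cases n) (simp_all add: left_diff_distrib mult.assoc)
    qed
    have "G - fps_const ?b * ?sc G = Abs_fps (\<lambda>k. ?a * ?a ^ k) - Abs_fps (\<lambda>k. ?b * ?b ^ k)"
      by (rule fps_ext, subst gk) simp
    moreover have "x * y * (u - v) = y * (x * u) - x * (y * v)" for x y u v :: "complex fps"
      by (simp add: algebra_simps)
    ultimately have "?A * ?B * (G - fps_const ?b * ?sc G) =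
      ?B * (?A * Abs_fps (\<lambda>k. ?a * ?a ^ k)) - ?A * (?B * Abs_fps (\<lambda>k. ?b * ?b ^ k))"
      by simp
    also have "\<dots> = fps_const (?a - ?b)"
      unfolding A B by (simp add: algebra_simps fps_const_sub[symmetric] del: fps_const_sub)
    finally show ?thesis .
  qed
  have "?A \<noteq> 0" "?B \<noteq> 0" by (auto simp: fps_eq_iff intro!: exI[of _ 0])
  then have "N - fps_const ?b * ?sc N = G - fps_const ?b * ?sc G"
    using logd G' by (metis (no_types, lifting) mult_cancel_left mult_eq_0_iff)
  then have *: "fps_nth N k * (1 - 1 / t ^ Suc k) = fps_nth G k * (1 - 1 / t ^ Suc k)" for k
    unfolding fps_eq_iff by (auto simp: algebra_simps dest: spec[of _ k])
  have "N = G"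
  proof (rule fps_ext)
    fix k
    have "t ^ Suc k \<noteq> 1" using generic_neq_one[of 0 "Suc k"] by simp
    then have "1 - 1 / t ^ Suc k \<noteq> 0" by (simp add: field_simps)
    then show "fps_nth N k = fps_nth G k" using *[of k] by (simp only: mult_cancel_right) simp
  qed
  moreover have "(\<lambda>k. (- 1) ^ k * ((- 1) ^ k * kappa (Suc k))) = (\<lambda>k. kappa (Suc k))"
    by (auto simp: mult.assoc[symmetric] power_add[symmetric] mult_2[symmetric])
  ultimately show ?thesis using N unfolding newton_fps by (simp add: P_def G_def)
qed

lemma newton_Phi:
  assumes "scalar_hom c"
  shows "newton (\<lambda>k. c ((- 1) ^ k * kappa (Suc k)) * z ^ Suc k) (\<lambda>r. c (Phi r) * z ^ r)"
proof -
  interpret scalar_hom c by (rule assms)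
  have "of_nat (Suc r) * (c (Phi (Suc r)) * z ^ Suc r) =
    (\<Sum>k\<le>r. (- 1) ^ k * (c ((- 1) ^ k * kappa (Suc k)) * z ^ Suc k) * (c (Phi (r - k)) * z ^ (r - k)))" for r
  proof -
    have "of_nat (Suc r) * (c (Phi (Suc r)) * z ^ Suc r) = c (of_nat (Suc r) * Phi (Suc r)) * z ^ Suc r"
      by (simp only: c_mult c_of_nat mult.assoc)
    also have "of_nat (Suc r) * Phi (Suc r) = (\<Sum>k\<le>r. (- 1) ^ k * ((- 1) ^ k * kappa (Suc k)) * Phi (r - k))"
      using newton_Phi_complex by (simp add: newton_def)
    also have "c \<dots> * z ^ Suc r = (\<Sum>k\<le>r. (- 1) ^ k * (c ((- 1) ^ k * kappa (Suc k)) * z ^ Suc k) * (c (Phi (r - k)) * z ^ (r - k)))"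
      unfolding c_sum sum_distrib_right
    proof (rule sum.cong[OF refl])
      fix k assume "k \<in> {..r}"
      then have "Suc r = Suc k + (r - k)" by simp
      then have "z ^ Suc r = z ^ Suc k * z ^ (r - k)" by (simp only: power_add)
      then show "c ((- 1) ^ k * ((- 1) ^ k * kappa (Suc k)) * Phi (r - k)) * z ^ Suc r =
        (- 1) ^ k * (c ((- 1) ^ k * kappa (Suc k)) * z ^ Suc k) * (c (Phi (r - k)) * z ^ (r - k))"
        by (simp add: c_mult c_power c_minus c_1 mult_ac)
    qed
    finally show ?thesis .
  qed
  then show ?thesis by (simp add: newton_def c_1)
qed

end

section \<open>Families satisfying the Pieri rule\<close>

lemma partitions_upto_0 [simp]: "partitions_upto 0 = {[]}"
  by (auto simp: partitions_upto_def is_partition_def) (metis gr0I list.set_intros(1) neq_Nil_conv)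

lemma length_le_sum_list: "is_partition lam \<Longrightarrow> length lam \<le> sum_list lam"
proof -
  have "0 \<notin> set mu \<Longrightarrow> length mu \<le> sum_list mu" for mu :: "nat list"
    by (induction mu) auto
  then show "is_partition lam \<Longrightarrow> length lam \<le> sum_list lam" by (auto simp: is_partition_def)
qed

context macdonald_parameters
begin

definition drop_column :: "nat list \<Rightarrow> nat list" where
  "drop_column lam = of_rows (\<lambda>i. rlen lam i - 1)"

lemma drop_column:
  assumes "is_partition lam"
  shows "is_partition (drop_column lam)" "rlen (drop_column lam) i = rlen lam i - 1"
    "rlen lam = raise {..<length lam} (rlen (drop_column lam))"
    "length (drop_column lam) \<le> length lam"
    "sum_list lam = sum_list (drop_column lam) + length lam"
    "vstrip lam (drop_column lam)"
proof -
  let ?f = "\<lambda>i. rlen lam i - 1"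
  have "antimono ?f"
    using rlen_le_rlen[OF assms] by (auto intro!: antimonoI diff_le_mono)
  note of = of_rows[OF this, of "length lam"]
  show 1: "is_partition (drop_column lam)" "rlen (drop_column lam) i = rlen lam i - 1" for i
    using of by (simp_all add: drop_column_def)
  show 2: "rlen lam = raise {..<length lam} (rlen (drop_column lam))"
    using rlen_pos_iff[OF assms] by (auto simp: fun_eq_iff raise_def 1)
  show 3: "length (drop_column lam) \<le> length lam"
    using rlen_pos_iff[OF 1(1), of "length lam"] 1(2) by simp
  show "sum_list lam = sum_list (drop_column lam) + length lam"
    using sum_list_raise(1)[OF 1(1) 3 order_refl assms 2] by simp
  show "vstrip lam (drop_column lam)" by (auto simp: vstrip_def 1)
qed

text \<open>Adding a vertical strip of size \<open>length lam\<close> to \<open>drop_column lam\<close> yields \<open>lam\<close> and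
  partitions with more parts, with coefficient one for \<open>lam\<close> itself. So the Pieri rule determines a
  family of elements recursively.\<close>

lemma vstrip_drop_column:
  assumes lam: "is_partition lam" and ka: "is_partition ka" and v: "vstrip ka (drop_column lam)"
    and s: "sum_list ka = sum_list lam" and len: "length ka \<le> length lam"
  shows "ka = lam"
proof (rule partition_eq_of_sum_list[OF _ s ka lam])
  fix i
  show "rlen ka i \<le> rlen lam i"
  proof (cases "i < length lam")
    case True
    then show ?thesis using v rlen_pos_iff[OF lam, of i] drop_column(2)[OF lam, of i]
      by (auto simp: vstrip_def) (metis Suc_pred)
  next
    case False
    then show ?thesis using len by simp
  qed
qed

text \<open>The lengthened rows are the topmost ones. No unchanged row lies above a lengthened one,
  so all pair factors are 1.\<close>

lemma emat_drop_column [simp]: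
  assumes "is_partition lam"
  shows "emat (drop_column lam) lam = 1"
proof -
  note d = drop_column[OF assms]
  have "vpair (rlen (drop_column lam)) (rlen lam) i k = 1" if "i < k" for i k
    using that rlen_le_rlen[OF assms, of i k] d(2)[of i] d(2)[of k] by (auto simp: vpair_def)
  then show ?thesis
    using d(6) by (simp add: emat_def psi_transpose[OF generic assms d(1,6) order_refl] vrow_def)
qed

definition longer :: "nat list \<Rightarrow> nat list set" where
  "longer lam = {ka. is_partition ka \<and> sum_list ka = sum_list lam \<and> length lam < length ka}"

lemma finite_longer [simp]: "finite (longer lam)"
  by (rule finite_subset[OF _ finite_partitions_upto[of "sum_list lam"]])
     (auto simp: longer_def partitions_upto_def)

text \<open>\<open>drop_column\<close> has smaller size, and the shapes in \<open>longer lam\<close>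
  have the same size and more parts, so the recursion ends. Only one case of the Pieri rule is built
  in; the full rule follows later, from evaluations in finitely many variables.\<close>

function Phat :: "nat list \<Rightarrow> polynomial" where
  "Phat lam = (if lam = [] \<or> \<not> is_partition lam then 1
     else ehat (length lam) * Phat (drop_column lam) -
       (\<Sum>ka\<in>longer lam. polyconst (emat (drop_column lam) ka) * Phat ka))"
  by auto
termination
proof (relation "measures [sum_list, \<lambda>lam. sum_list lam - length lam]", goal_cases)
  case (2 lam)
  then show ?case using drop_column(5)[of lam] by auto
next
  case (3 lam ka)
  then show ?case using length_le_sum_list[of ka] by (auto simp: longer_def)
qed simp

declare Phat.simps [simp del]

lemma Phat_Nil [simp]: "Phat [] = 1"
  by (simp add: Phat.simps)

lemma Phat_induct [consumes 1, case_names Nil step]: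
  assumes "is_partition lam"
    and "P []"
    and "\<And>lam. is_partition lam \<Longrightarrow> lam \<noteq> [] \<Longrightarrow> P (drop_column lam) \<Longrightarrow>
      (\<And>ka. ka \<in> longer lam \<Longrightarrow> P ka) \<Longrightarrow> P lam"
  shows "P lam"
  using assms(1)
proof (induction lam rule: Phat.induct)
  case (1 lam)
  show ?case
  proof (cases "lam = []")
    case False
    show ?thesis
    proof (rule assms(3)[OF 1(3) False])
      show "P (drop_column lam)" using 1(1,3) False drop_column(1) by blast
      show "P ka" if "ka \<in> longer lam" for ka
        using 1(2)[of ka] 1(3) False that by (auto simp: longer_def)
    qed
  qed (use assms(2) in simp)
qed

text \<open>The bound \<open>K\<close> is arbitrary because \<open>egraded\<close> confines the sum
  to partitions of size \<open>sum_list mu + r\<close>; this freedom allows one index set for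
  several products.\<close>

definition pieri :: "(complex \<Rightarrow> 'r::comm_ring_1) \<Rightarrow> (nat \<Rightarrow> 'r) \<Rightarrow> (nat list \<Rightarrow> 'r) \<Rightarrow> bool" where
  "pieri c e Q \<longleftrightarrow> Q [] = 1 \<and> (\<forall>mu r K. is_partition mu \<longrightarrow> sum_list mu + r \<le> K \<longrightarrow>
     e r * Q mu = (\<Sum>lam\<in>partitions_upto K. c (egraded r mu lam) * Q lam))"

lemma pieri_drop_column:
  assumes "scalar_hom c" "pieri c e Q" and lam: "is_partition lam"
  shows "Q lam = e (length lam) * Q (drop_column lam) -
    (\<Sum>ka\<in>longer lam. c (emat (drop_column lam) ka) * Q ka)"
proof -
  interpret scalar_hom c by (rule assms)
  note d = drop_column[OF lam]
  let ?S = "partitions_upto (sum_list lam)"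
  have lamS: "lam \<in> ?S" using lam by (simp add: partitions_upto_def)
  have lo: "longer lam \<subseteq> ?S - {lam}" by (auto simp: longer_def partitions_upto_def)
  have "e (length lam) * Q (drop_column lam) = (\<Sum>ka\<in>?S. c (egraded (length lam) (drop_column lam) ka) * Q ka)"
    using assms(2) d by (simp add: pieri_def)
  also have "\<dots> = Q lam + (\<Sum>ka\<in>?S - {lam}. c (egraded (length lam) (drop_column lam) ka) * Q ka)"
    unfolding sum.remove[OF finite_partitions_upto lamS] by (simp add: egraded_def d(5)[symmetric] lam c_1)
  also have "(\<Sum>ka\<in>?S - {lam}. c (egraded (length lam) (drop_column lam) ka) * Q ka) =
    (\<Sum>ka\<in>longer lam. c (emat (drop_column lam) ka) * Q ka)"
  proof (rule sum.mono_neutral_cong_right)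
    show "\<forall>ka\<in>?S - {lam} - longer lam. c (egraded (length lam) (drop_column lam) ka) * Q ka = 0"
    proof
      fix ka assume ka: "ka \<in> ?S - {lam} - longer lam"
      have "egraded (length lam) (drop_column lam) ka = 0"
      proof (rule ccontr)
        assume nz: "egraded (length lam) (drop_column lam) ka \<noteq> 0"
        then have s: "sum_list ka = sum_list lam" and "emat (drop_column lam) ka \<noteq> 0"
          using d(5) by (auto simp: egraded_def split: if_splits)
        then have "vstrip ka (drop_column lam)" using emat_nonzeroD by blast
        then show False using vstrip_drop_column[OF lam _ _ s] ka s
          by (auto simp: longer_def partitions_upto_def)
      qed
      then show "c (egraded (length lam) (drop_column lam) ka) * Q ka = 0" by (simp add: c_0)
    qed
  qed (use lo in \<open>auto simp: longer_def egraded_def d(5)[symmetric]\<close>)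
  finally show ?thesis by simp
qed

text \<open>The image of \<open>ehat\<close> is forced by Newton's identities, after which both
  sides obey the recursion of \<open>Phat\<close>. This comparison serves for polynomials in
  finitely many variables, constant terms, the adjoints of \<open>ehat\<close>, and the final
  identity.\<close>

lemma lift_Phat:
  assumes c: "scalar_hom c" and Q: "pieri c e Q" and e: "newton p e" and lam: "is_partition lam"
  shows "scalar_hom.lift c p (Phat lam) = Q lam"
proof -
  interpret scalar_hom c by (rule c)
  from lam show ?thesis
  proof (induction lam rule: Phat_induct)
    case Nil
    then show ?case using Q by (simp add: pieri_def)
  next
    case (step lam)
    then have "lift p (Phat lam) = e (length lam) * Q (drop_column lam) -
        (\<Sum>ka\<in>longer lam. c (emat (drop_column lam) ka) * Q ka)"
      by (subst Phat.simps) (simp add: lift_diff lift_mult lift_sum lift_ehat[OF e])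
    then show ?case using pieri_drop_column[OF c Q step(1)] by simp
  qed
qed

lemma pieri_e0: "scalar_hom c \<Longrightarrow> pieri c e Q \<Longrightarrow> e 0 = 1"
proof -
  assume c: "scalar_hom c" and Q: "pieri c e Q"
  interpret scalar_hom c by (rule c)
  have "e 0 * Q [] = (\<Sum>lam\<in>partitions_upto 0. c (egraded 0 [] lam) * Q lam)"
    using Q unfolding pieri_def by (metis add.right_neutral is_partition_Nil order_refl sum_list.Nil)
  then show "e 0 = 1" using Q by (simp add: pieri_def egraded_0 c_1)
qed

section \<open>Adjoining an ordinary or a super variable to a Pieri family\<close>

definition bstep :: "(complex \<Rightarrow> 'r::comm_ring_1) \<Rightarrow> 'r \<Rightarrow> (nat list \<Rightarrow> 'r) \<Rightarrow> nat list \<Rightarrow> 'r" where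
  "bstep c x Q lam = (\<Sum>mu\<in>partitions_upto (sum_list lam).
     c (bmat lam mu) * x ^ (sum_list lam - sum_list mu) * Q mu)"

definition cstep :: "(complex \<Rightarrow> 'r::comm_ring_1) \<Rightarrow> 'r \<Rightarrow> (nat list \<Rightarrow> 'r) \<Rightarrow> nat list \<Rightarrow> 'r" where
  "cstep c z Q lam = (\<Sum>mu\<in>partitions_upto (sum_list lam).
     c (cmat lam mu) * z ^ (sum_list lam - sum_list mu) * Q mu)"

lemma bstep_upto:
  assumes "scalar_hom c" "sum_list lam \<le> K"
  shows "bstep c x Q lam = (\<Sum>mu\<in>partitions_upto K. c (bmat lam mu) * x ^ (sum_list lam - sum_list mu) * Q mu)"
proof -
  interpret scalar_hom c by (rule assms)
  show ?thesis unfolding bstep_def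
  proof (rule sum.mono_neutral_left[OF finite_partitions_upto])
    show "\<forall>mu\<in>partitions_upto K - partitions_upto (sum_list lam).
        c (bmat lam mu) * x ^ (sum_list lam - sum_list mu) * Q mu = 0"
    proof
      fix mu assume "mu \<in> partitions_upto K - partitions_upto (sum_list lam)"
      then have "bmat lam mu = 0" using bmat_nonzeroD(2)[of lam mu] by (auto simp: partitions_upto_def)
      then show "c (bmat lam mu) * x ^ (sum_list lam - sum_list mu) * Q mu = 0" by (simp add: c_0)
    qed
  qed (use assms in \<open>auto simp: partitions_upto_def\<close>)
qed

lemma cstep_upto:
  assumes "scalar_hom c" "sum_list lam \<le> K"
  shows "cstep c x Q lam = (\<Sum>mu\<in>partitions_upto K. c (cmat lam mu) * x ^ (sum_list lam - sum_list mu) * Q mu)"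
proof -
  interpret scalar_hom c by (rule assms)
  show ?thesis unfolding cstep_def
  proof (rule sum.mono_neutral_left[OF finite_partitions_upto])
    show "\<forall>mu\<in>partitions_upto K - partitions_upto (sum_list lam).
        c (cmat lam mu) * x ^ (sum_list lam - sum_list mu) * Q mu = 0"
    proof
      fix mu assume "mu \<in> partitions_upto K - partitions_upto (sum_list lam)"
      then have "cmat lam mu = 0" using cmat_nonzeroD(2)[of lam mu] by (auto simp: partitions_upto_def)
      then show "c (cmat lam mu) * x ^ (sum_list lam - sum_list mu) * Q mu = 0" by (simp add: c_0)
    qed
  qed (use assms in \<open>auto simp: partitions_upto_def\<close>)
qed

text \<open>\<open>bmat_emat_commute\<close> with each entry weighted by a power of
  \<open>x\<close>. The exponents match because \<open>egraded\<close> is homogeneous: their total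
  depends only on \<open>mu\<close>, \<open>r\<close> and the last shape.\<close>

lemma pieri_bstep:
  assumes c: "scalar_hom c" and Q: "pieri c e Q"
  shows "pieri c (\<lambda>r. e r + (if r = 0 then 0 else x * e (r - 1))) (bstep c x Q)"
proof -
  interpret scalar_hom c by (rule c)
  have "(e r + (if r = 0 then 0 else x * e (r - 1))) * bstep c x Q mu =
      (\<Sum>lam\<in>partitions_upto K. c (egraded r mu lam) * bstep c x Q lam)"
    if mu: "is_partition mu" and K: "sum_list mu + r \<le> K" for mu r K
  proof (cases r)
    case 0
    have muS: "mu \<in> partitions_upto K" using mu K by (simp add: partitions_upto_def)
    have "(\<Sum>lam\<in>partitions_upto K. c (egraded r mu lam) * bstep c x Q lam) =
        (\<Sum>lam\<in>partitions_upto K. if lam = mu then bstep c x Q mu else 0)"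
      using mu 0 by (intro sum.cong refl) (auto simp: egraded_0 partitions_upto_def c_0 c_1)
    also have "\<dots> = bstep c x Q mu" using muS by simp
    finally show ?thesis using 0 pieri_e0[OF c Q] by simp
  next
    case (Suc s)
    define S where "S = partitions_upto K"
    have part: "is_partition l" if "l \<in> S" for l using that by (simp add: S_def partitions_upto_def)
    let ?sz = "sum_list :: nat list \<Rightarrow> nat"
    have P: "e i * Q v = (\<Sum>k\<in>S. c (egraded i v k) * Q k)" if "v \<in> S" "?sz v \<le> ?sz mu" "i \<le> r" for i v
      using Q that K part[OF that(1)] by (simp add: pieri_def S_def)
    have T: "x ^ d * (\<Sum>v\<in>S. c (bmat mu v) * x ^ (?sz mu - ?sz v) * (e i * Q v)) =
        (\<Sum>k\<in>S. c (\<Sum>v\<in>S. bmat mu v * egraded i v k) * x ^ (?sz mu + r - ?sz k) * Q k)"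
      if "d + i = r" for d i
    proof -
      have "x ^ d * (\<Sum>v\<in>S. c (bmat mu v) * x ^ (?sz mu - ?sz v) * (e i * Q v)) =
         (\<Sum>v\<in>S. \<Sum>k\<in>S. c (bmat mu v * egraded i v k) * x ^ (?sz mu + r - ?sz k) * Q k)"
        unfolding sum_distrib_left
      proof (rule sum.cong[OF refl])
        fix v assume v: "v \<in> S"
        show "x ^ d * (c (bmat mu v) * x ^ (?sz mu - ?sz v) * (e i * Q v)) =
          (\<Sum>k\<in>S. c (bmat mu v * egraded i v k) * x ^ (?sz mu + r - ?sz k) * Q k)"
        proof (cases "bmat mu v = 0")
          case False
          then have sz: "?sz v \<le> ?sz mu" by (rule bmat_nonzeroD)
          have E: "x ^ d * x ^ (?sz mu - ?sz v) * c (egraded i v k) = x ^ (?sz mu + r - ?sz k) * c (egraded i v k)" for k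
          proof (cases "?sz k = ?sz v + i")
            case True
            then have "?sz mu + r - ?sz k = d + (?sz mu - ?sz v)" using sz that by simp
            then show ?thesis by (simp add: power_add)
          qed (simp add: egraded_def c_0)
          have "x ^ d * (c (bmat mu v) * x ^ (?sz mu - ?sz v) * (e i * Q v)) =
            (\<Sum>k\<in>S. c (bmat mu v) * (x ^ d * x ^ (?sz mu - ?sz v) * c (egraded i v k)) * Q k)"
            unfolding P[OF v sz, of i, OF trans_le_add2[OF order_refl, of i d, unfolded that]] sum_distrib_left
            by (simp only: mult_ac)
          also have "\<dots> = (\<Sum>k\<in>S. c (bmat mu v * egraded i v k) * x ^ (?sz mu + r - ?sz k) * Q k)"
            unfolding E by (simp only: c_mult mult_ac)
          finally show ?thesis .
        qed (simp add: c_0)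
      qed
      also have "\<dots> = (\<Sum>k\<in>S. c (\<Sum>v\<in>S. bmat mu v * egraded i v k) * x ^ (?sz mu + r - ?sz k) * Q k)"
        by (subst sum.swap) (simp only: c_sum sum_distrib_right)
      finally show ?thesis .
    qed
    have muK: "?sz mu \<le> K" using K by simp
    have "(e r + (if r = 0 then 0 else x * e (r - 1))) * bstep c x Q mu =
      x ^ 0 * (\<Sum>v\<in>S. c (bmat mu v) * x ^ (?sz mu - ?sz v) * (e r * Q v)) +
      x ^ 1 * (\<Sum>v\<in>S. c (bmat mu v) * x ^ (?sz mu - ?sz v) * (e s * Q v))"
      unfolding bstep_upto[OF c muK] S_def[symmetric] using Suc
      by (simp add: distrib_left distrib_right sum_distrib_left sum.distrib mult_ac)
    also have "\<dots> = (\<Sum>k\<in>S. c (\<Sum>v\<in>S. bmat mu v * egraded r v k) * x ^ (?sz mu + r - ?sz k) * Q k) +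
        (\<Sum>k\<in>S. c (\<Sum>v\<in>S. bmat mu v * egraded s v k) * x ^ (?sz mu + r - ?sz k) * Q k)"
      using Suc by (subst (1 2) T) simp_all
    also have "\<dots> = (\<Sum>k\<in>S. c (\<Sum>v\<in>S. bmat mu v * (egraded r v k + egraded s v k)) * x ^ (?sz mu + r - ?sz k) * Q k)"
      by (simp only: distrib_left sum.distrib c_add distrib_right)
    also have "\<dots> = (\<Sum>k\<in>S. c (\<Sum>lam\<in>S. egraded r mu lam * bmat lam k) * x ^ (?sz mu + r - ?sz k) * Q k)"
      using bmat_emat_commute[OF mu _ K[unfolded Suc]] part by (intro sum.cong refl) (simp add: S_def Suc)
    also have "\<dots> = (\<Sum>lam\<in>S. \<Sum>k\<in>S. c (egraded r mu lam) * (c (bmat lam k) * x ^ (?sz lam - ?sz k) * Q k))"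
      unfolding c_sum sum_distrib_right
      by (subst sum.swap) (auto simp: egraded_def c_0 c_mult mult_ac intro!: sum.cong)
    also have "\<dots> = (\<Sum>lam\<in>S. c (egraded r mu lam) * bstep c x Q lam)"
      using bstep_upto[OF c, of _ K x Q]
      by (intro sum.cong refl) (simp add: S_def partitions_upto_def sum_distrib_left)
    finally show ?thesis by (simp add: S_def)
  qed
  moreover have "bstep c x Q [] = 1" using Q by (simp add: bstep_def c_1 pieri_def)
  ultimately show ?thesis by (simp add: pieri_def)
qed

text \<open>The same argument with \<open>emat_cmat_commute\<close>; convolution with
  \<open>Phi\<close> multiplies the generating series of \<open>e\<close> by that of the super
  variable.\<close>

lemma pieri_cstep:
  assumes c: "scalar_hom c" and Q: "pieri c e Q"
  shows "pieri c (\<lambda>r. \<Sum>i\<le>r. e i * (c (Phi (r - i)) * x ^ (r - i))) (cstep c x Q)"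
proof -
  interpret scalar_hom c by (rule c)
  have "(\<Sum>i\<le>r. e i * (c (Phi (r - i)) * x ^ (r - i))) * cstep c x Q mu =
      (\<Sum>lam\<in>partitions_upto K. c (egraded r mu lam) * cstep c x Q lam)"
    if mu: "is_partition mu" and K: "sum_list mu + r \<le> K" for mu r K
  proof -
    define S where "S = partitions_upto K"
    have part: "is_partition l" "sum_list l \<le> K" if "l \<in> S" for l using that by (auto simp: S_def partitions_upto_def)
    let ?sz = "sum_list :: nat list \<Rightarrow> nat"
    have T: "x ^ d * (\<Sum>v\<in>S. c (cmat mu v) * x ^ (?sz mu - ?sz v) * (e i * Q v)) =
        (\<Sum>k\<in>S. c (\<Sum>v\<in>S. cmat mu v * egraded i v k) * x ^ (?sz mu + r - ?sz k) * Q k)"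
      if "d + i = r" for d i
    proof -
      have "x ^ d * (\<Sum>v\<in>S. c (cmat mu v) * x ^ (?sz mu - ?sz v) * (e i * Q v)) =
         (\<Sum>v\<in>S. \<Sum>k\<in>S. c (cmat mu v * egraded i v k) * x ^ (?sz mu + r - ?sz k) * Q k)"
        unfolding sum_distrib_left
      proof (rule sum.cong[OF refl])
        fix v assume v: "v \<in> S"
        show "x ^ d * (c (cmat mu v) * x ^ (?sz mu - ?sz v) * (e i * Q v)) =
          (\<Sum>k\<in>S. c (cmat mu v * egraded i v k) * x ^ (?sz mu + r - ?sz k) * Q k)"
        proof (cases "cmat mu v = 0")
          case False
          then have sz: "?sz v \<le> ?sz mu" by (rule cmat_nonzeroD)
          have P: "e i * Q v = (\<Sum>k\<in>S. c (egraded i v k) * Q k)"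
            using Q that K part[OF v] sz by (simp add: pieri_def S_def)
          have E: "x ^ d * x ^ (?sz mu - ?sz v) * c (egraded i v k) = x ^ (?sz mu + r - ?sz k) * c (egraded i v k)" for k
          proof (cases "?sz k = ?sz v + i")
            case True
            then have "?sz mu + r - ?sz k = d + (?sz mu - ?sz v)" using sz that by simp
            then show ?thesis by (simp add: power_add)
          qed (simp add: egraded_def c_0)
          have "x ^ d * (c (cmat mu v) * x ^ (?sz mu - ?sz v) * (e i * Q v)) =
            (\<Sum>k\<in>S. c (cmat mu v) * (x ^ d * x ^ (?sz mu - ?sz v) * c (egraded i v k)) * Q k)"
            unfolding P sum_distrib_left by (simp only: mult_ac)
          also have "\<dots> = (\<Sum>k\<in>S. c (cmat mu v * egraded i v k) * x ^ (?sz mu + r - ?sz k) * Q k)"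
            unfolding E by (simp only: c_mult mult_ac)
          finally show ?thesis .
        qed (simp add: c_0)
      qed
      also have "\<dots> = (\<Sum>k\<in>S. c (\<Sum>v\<in>S. cmat mu v * egraded i v k) * x ^ (?sz mu + r - ?sz k) * Q k)"
        by (subst sum.swap) (simp only: c_sum sum_distrib_right)
      finally show ?thesis .
    qed
    have muK: "?sz mu \<le> K" using K by simp
    have "(\<Sum>i\<le>r. e i * (c (Phi (r - i)) * x ^ (r - i))) * cstep c x Q mu =
      (\<Sum>i\<le>r. c (Phi (r - i)) * (x ^ (r - i) * (\<Sum>v\<in>S. c (cmat mu v) * x ^ (?sz mu - ?sz v) * (e i * Q v))))"
      unfolding cstep_upto[OF c muK] S_def[symmetric] sum_distrib_left sum_distrib_right
      by (subst sum.swap) (simp only: mult_ac)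
    also have "\<dots> = (\<Sum>i\<le>r. \<Sum>k\<in>S. c (Phi (r - i) * (\<Sum>v\<in>S. cmat mu v * egraded i v k)) * x ^ (?sz mu + r - ?sz k) * Q k)"
    proof (rule sum.cong[OF refl])
      fix i assume "i \<in> {..r}"
      then have "r - i + i = r" by simp
      show "c (Phi (r - i)) * (x ^ (r - i) * (\<Sum>v\<in>S. c (cmat mu v) * x ^ (?sz mu - ?sz v) * (e i * Q v))) =
        (\<Sum>k\<in>S. c (Phi (r - i) * (\<Sum>v\<in>S. cmat mu v * egraded i v k)) * x ^ (?sz mu + r - ?sz k) * Q k)"
        unfolding T[OF \<open>r - i + i = r\<close>] c_mult sum_distrib_left[where r = "c (Phi (r - i))"]
        by (simp only: mult_ac)
    qed
    also have "\<dots> = (\<Sum>k\<in>S. c (\<Sum>i\<le>r. Phi (r - i) * (\<Sum>v\<in>S. cmat mu v * egraded i v k)) * x ^ (?sz mu + r - ?sz k) * Q k)"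
      by (subst sum.swap) (simp only: c_sum sum_distrib_right)
    also have "\<dots> = (\<Sum>k\<in>S. c (\<Sum>lam\<in>S. egraded r mu lam * cmat lam k) * x ^ (?sz mu + r - ?sz k) * Q k)"
      using emat_cmat_commute[OF mu _ K] part by (intro sum.cong refl) (simp add: S_def)
    also have "\<dots> = (\<Sum>lam\<in>S. \<Sum>k\<in>S. c (egraded r mu lam) * (c (cmat lam k) * x ^ (?sz lam - ?sz k) * Q k))"
      unfolding c_sum sum_distrib_right
      by (subst sum.swap) (auto simp: egraded_def c_0 c_mult mult_ac intro!: sum.cong)
    also have "\<dots> = (\<Sum>lam\<in>S. c (egraded r mu lam) * cstep c x Q lam)"
      using cstep_upto[OF c, of _ K x Q]
      by (intro sum.cong refl) (simp add: S_def partitions_upto_def sum_distrib_left)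
    finally show ?thesis by (simp add: S_def)
  qed
  moreover have "cstep c x Q [] = 1" using Q by (simp add: cstep_def c_1 pieri_def)
  ultimately show ?thesis by (simp add: pieri_def)
qed

lemma pieri_one:
  assumes "scalar_hom c"
  shows "pieri c (\<lambda>r. if r = 0 then 1 else 0) (\<lambda>lam. if lam = [] then 1 else 0)"
proof -
  interpret scalar_hom c by (rule assms)
  have "(if r = 0 then 1 else 0) * (if mu = [] then 1 else 0) =
      (\<Sum>lam\<in>partitions_upto K. c (egraded r mu lam) * (if lam = [] then 1 else 0))"
    if "is_partition mu" for mu r K
  proof -
    have "[] \<in> partitions_upto K" by (simp add: partitions_upto_def)
    then have "(\<Sum>lam\<in>partitions_upto K. c (egraded r mu lam) * (if lam = [] then 1 else 0)) = c (egraded r mu [])"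
      by (simp add: sum.delta' if_distrib cong: if_cong)
    also have "\<dots> = (if r = 0 then 1 else 0) * (if mu = [] then 1 else 0)"
    proof (cases "r = 0")
      case True
      then show ?thesis using that by (simp add: egraded_0 c_0 c_1)
    qed (simp add: egraded_def c_0)
    finally show ?thesis ..
  qed
  then show ?thesis by (simp add: pieri_def)
qed

end

section \<open>Symmetric functions as polynomials in the power sums\<close>

lemma lookup_mult_sum:
  fixes f g :: polynomial
  shows "Poly_Mapping.lookup (f * g) m =
    (\<Sum>(a, b)\<in>{(a, b). a + b = m}. Poly_Mapping.lookup f a * Poly_Mapping.lookup g b)"
proof (induction f rule: poly_mapping_additive_induct)
  case (single k x)
  show ?case
  proof (induction g rule: poly_mapping_additive_induct)
    case (single l y)
    have "(\<Sum>(a, b)\<in>{(a, b). a + b = m}. Poly_Mapping.lookup (Poly_Mapping.single k x) a *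
        Poly_Mapping.lookup (Poly_Mapping.single l y) b) =
      (\<Sum>p\<in>{(a, b). a + b = m}. if p = (k, l) then x * y else 0)"
      by (intro sum.cong refl) (auto simp: lookup_single when_def split: if_splits)
    then show ?case
      using finite_series_mult_index[of m] by (simp add: mult_single lookup_single when_def)
  qed (simp_all add: lookup_add algebra_simps sum.distrib case_prod_beta)
qed (simp_all add: lookup_add algebra_simps sum.distrib case_prod_beta)

lemma lookup_mult_series: "Poly_Mapping.lookup (f * g) = series_mult (Poly_Mapping.lookup f) (Poly_Mapping.lookup (g :: polynomial))"
  by (simp add: fun_eq_iff lookup_mult_sum series_mult_def)

lemma polyvar_power: "polyvar k ^ n = Poly_Mapping.single (Poly_Mapping.single k n) 1"
  by (induction n) (simp_all add: polyvar_def mult_single single_add[symmetric] flip: single_one)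

lemma mon_polyvar: "mon polyvar m = Poly_Mapping.single m 1"
proof (induction m rule: poly_mapping_additive_induct)
  case (add a b)
  then show ?case by (simp add: mon_add mult_single)
qed (simp_all add: polyvar_power)

lemma polynomial_induct [case_names const var add mult]:
  fixes a :: polynomial
  assumes "\<And>x. P (polyconst x)" "\<And>k. P (polyvar k)" "\<And>a b. P a \<Longrightarrow> P b \<Longrightarrow> P (a + b)"
    "\<And>a b. P a \<Longrightarrow> P b \<Longrightarrow> P (a * b)"
  shows "P a"
proof (induction a rule: poly_mapping_additive_induct)
  case zero
  then show ?case using assms(1)[of 0] by (simp add: polyconst.c_0)
next
  case (single m x)
  have pow: "P (a ^ n)" if "P a" for a n
    using that by (induction n) (use assms(1)[of 1] assms(4) in \<open>auto simp: polyconst.c_1\<close>)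
  have "P (\<Prod>k\<in>A. polyvar k ^ Poly_Mapping.lookup m k)" if "finite A" for A
    using that by induction (use assms(1)[of 1] assms(2,4) pow in \<open>auto simp: polyconst.c_1\<close>)
  then have "P (mon polyvar m)" by (simp add: mon_def)
  then show ?case using assms(1,4) single_eq_polyconst_mult[of m x] mon_polyvar[of m] by metis
qed (rule assms(3))

definition psum :: "nat \<Rightarrow> nat \<Rightarrow> polynomial" where
  "psum n k = (\<Sum>i<n. polyvar i ^ Suc k)"

abbreviation evn :: "nat \<Rightarrow> polynomial \<Rightarrow> polynomial" where
  "evn n \<equiv> polyconst.lift (psum n)"

lemmas evn_simps = polyconst.lift_add polyconst.lift_mult polyconst.lift_polyconst polyconst.lift_polyvar

lemma degree_add_nat: "Poly_Mapping.degree (a + b :: nat \<Rightarrow>\<^sub>0 nat) = max (Poly_Mapping.degree a) (Poly_Mapping.degree b)"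
proof -
  have "Poly_Mapping.keys (a + b) = Poly_Mapping.keys a \<union> Poly_Mapping.keys b"
    by (auto simp: in_keys_iff lookup_add)
  then have "Poly_Mapping.degree (a + b) = Max (insert 0 (Suc ` Poly_Mapping.keys a) \<union> insert 0 (Suc ` Poly_Mapping.keys b))"
    by (simp add: Poly_Mapping.degree_def image_Un)
  then show ?thesis unfolding Poly_Mapping.degree_def by (subst (asm) Max_Un) auto
qed

lemma lookup_evn_stable:
  "Poly_Mapping.degree m \<le> n \<Longrightarrow> n \<le> n' \<Longrightarrow>
    Poly_Mapping.lookup (evn n' a) m = Poly_Mapping.lookup (evn n a) m"
proof (induction a arbitrary: m rule: polynomial_induct)
  case (var k)
  have "Poly_Mapping.lookup (polyvar i ^ Suc k) m = 0" if "i \<ge> n" for i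
  proof -
    have "m \<noteq> Poly_Mapping.single i (Suc k)"
      using that var(1) by (auto simp: degree_single_not_zero)
    then show ?thesis by (simp add: polyvar_power lookup_single when_def del: power_Suc)
  qed
  then have "(\<Sum>i<n'. Poly_Mapping.lookup (polyvar i ^ Suc k) m) = (\<Sum>i<n. Poly_Mapping.lookup (polyvar i ^ Suc k) m)"
    using var(2) by (intro sum.mono_neutral_right) auto
  then show ?case by (simp add: psum_def lookup_sum del: power_Suc)
next
  case (mult a b)
  show ?case unfolding evn_simps lookup_mult_sum
    by (intro sum.cong refl) (use mult in \<open>auto simp: degree_add_nat\<close>)
qed (simp_all add: evn_simps lookup_add)

text \<open>\<open>Poly_Mapping.degree m\<close> exceeds the largest variable of \<open>m\<close> by
  one, so all variables of \<open>m\<close> are present; by \<open>lookup_evn_stable\<close> further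
  variables leave the coefficient unchanged.\<close>

definition ev :: "polynomial \<Rightarrow> series" where
  "ev a m = Poly_Mapping.lookup (evn (Poly_Mapping.degree m) a) m"

lemma ev_eq: "Poly_Mapping.degree m \<le> n \<Longrightarrow> ev a m = Poly_Mapping.lookup (evn n a) m"
  unfolding ev_def by (rule lookup_evn_stable[symmetric]) simp_all

lemma ev_mult: "ev (a * b) = series_mult (ev a) (ev b)"
proof
  fix m
  show "ev (a * b) m = series_mult (ev a) (ev b) m"
    unfolding ev_def[of "a * b"] evn_simps lookup_mult_series series_mult_def
    by (intro sum.cong refl) (auto simp: degree_add_nat ev_eq[symmetric])
qed

lemma ev_add: "ev (a + b) = series_add (ev a) (ev b)"
  by (simp add: fun_eq_iff ev_def evn_simps lookup_add series_add_def)

lemma lookup_polyconst_mult: "Poly_Mapping.lookup (polyconst x * f) m = x * Poly_Mapping.lookup f m"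
proof (induction f rule: poly_mapping_additive_induct)
  case (add a b)
  then show ?case by (simp add: algebra_simps lookup_add)
qed (simp_all add: polyconst_def mult_single lookup_single when_def)

lemma ev_scale: "ev (polyconst x * a) = series_scale x (ev a)"
  by (simp add: fun_eq_iff ev_def evn_simps lookup_polyconst_mult series_scale_def)

lemma ev_one: "ev 1 = series_one"
  by (auto simp: fun_eq_iff ev_def polyconst.lift_1 lookup_one when_def series_one_def)

lemma ev_polyvar: "ev (polyvar k) = power_sum (Suc k)"
proof
  fix m
  have "ev (polyvar k) m = (\<Sum>i<Poly_Mapping.degree m. if m = Poly_Mapping.single i (Suc k) then 1 else 0)"
    by (auto simp: ev_def evn_simps psum_def lookup_sum polyvar_power lookup_single when_def simp del: power_Suc intro!: sum.cong)
  also have "\<dots> = (if \<exists>i. m = Poly_Mapping.single i (Suc k) then 1 else 0)"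
  proof (cases "\<exists>i. m = Poly_Mapping.single i (Suc k)")
    case True
    then obtain i where m: "m = Poly_Mapping.single i (Suc k)" by blast
    have "m = Poly_Mapping.single j (Suc k) \<longleftrightarrow> j = i" for j
      using m by (metis keys_single nat.distinct(1) singleton_inject)
    moreover have "i < Poly_Mapping.degree m" using m by (simp add: degree_single_not_zero)
    ultimately show ?thesis using True by simp
  qed auto
  finally show "ev (polyvar k) m = power_sum (Suc k) m" by (simp add: power_sum_def)
qed

lemma total_degree_add: "total_degree (a + b) = total_degree a + total_degree b"
proof -
  let ?A = "Poly_Mapping.keys a \<union> Poly_Mapping.keys b"
  have "total_degree m = (\<Sum>i\<in>?A. Poly_Mapping.lookup m i)" if "Poly_Mapping.keys m \<subseteq> ?A" for m
    unfolding total_degree_def using that by (intro sum.mono_neutral_left) (auto simp: in_keys_iff)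
  from this[of a] this[of b] this[of "a + b"] show ?thesis
    using keys_add[of a b] by (simp add: lookup_add sum.distrib)
qed

lemma lookup_map_key: "inj f \<Longrightarrow> Poly_Mapping.lookup (Poly_Mapping.map_key f p) k = Poly_Mapping.lookup p (f k)"
  by (simp add: map_key.rep_eq)

lemma map_key_inverse:
  fixes \<pi> :: "nat \<Rightarrow> nat" and m :: "nat \<Rightarrow>\<^sub>0 nat"
  assumes "bij \<pi>"
  shows "Poly_Mapping.map_key \<pi> (Poly_Mapping.map_key (inv_into UNIV \<pi>) m) = m"
    "Poly_Mapping.map_key (inv_into UNIV \<pi>) (Poly_Mapping.map_key \<pi> m) = m"
  using assms bij_imp_bij_inv[OF assms]
  by (auto intro!: poly_mapping_eqI simp: lookup_map_key bij_is_inj bij_is_surj surj_f_inv_f inv_f_f)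

lemma series_add_symmetric: "f \<in> symmetric_functions \<Longrightarrow> g \<in> symmetric_functions \<Longrightarrow> series_add f g \<in> symmetric_functions"
proof -
  assume "f \<in> symmetric_functions" "g \<in> symmetric_functions"
  then obtain d d' where *: "\<forall>m. f m \<noteq> 0 \<longrightarrow> total_degree m \<le> d" "\<forall>m. g m \<noteq> 0 \<longrightarrow> total_degree m \<le> d'"
    "\<forall>\<pi> m. bij \<pi> \<longrightarrow> f (Poly_Mapping.map_key \<pi> m) = f m" "\<forall>\<pi> m. bij \<pi> \<longrightarrow> g (Poly_Mapping.map_key \<pi> m) = g m"
    by (auto simp: symmetric_functions_def)
  then have "\<forall>m. f m + g m \<noteq> 0 \<longrightarrow> total_degree m \<le> max d d'" by (metis add_0 max.coboundedI1 max.coboundedI2)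
  with * show ?thesis by (auto simp: symmetric_functions_def series_add_def)
qed

lemma series_scale_symmetric: "f \<in> symmetric_functions \<Longrightarrow> series_scale x f \<in> symmetric_functions"
  by (auto simp: symmetric_functions_def series_scale_def)

lemma series_mult_symmetric:
  assumes "f \<in> symmetric_functions" "g \<in> symmetric_functions"
  shows "series_mult f g \<in> symmetric_functions"
proof -
  from assms obtain d d' where *: "\<And>m. f m \<noteq> 0 \<Longrightarrow> total_degree m \<le> d" "\<And>m. g m \<noteq> 0 \<Longrightarrow> total_degree m \<le> d'"
    "\<And>\<pi> m. bij \<pi> \<Longrightarrow> f (Poly_Mapping.map_key \<pi> m) = f m" "\<And>\<pi> m. bij \<pi> \<Longrightarrow> g (Poly_Mapping.map_key \<pi> m) = g m"
    by (auto simp: symmetric_functions_def)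
  have "total_degree m \<le> d + d'" if nz: "series_mult f g m \<noteq> 0" for m
  proof -
    obtain p where "p \<in> {(a, b). a + b = m}" "(case p of (a, b) \<Rightarrow> f a * g b) \<noteq> 0"
      using nz unfolding series_mult_def by (rule sum.not_neutral_contains_not_neutral)
    then obtain a b where "a + b = m" "f a * g b \<noteq> 0" by auto
    then show ?thesis using *(1)[of a] *(2)[of b] total_degree_add[of a b] by auto
  qed
  moreover have "series_mult f g (Poly_Mapping.map_key \<pi> m) = series_mult f g m" if "bij \<pi>" for \<pi> m
  proof -
    let ?h = "\<lambda>\<pi> (a, b). (Poly_Mapping.map_key \<pi> a, Poly_Mapping.map_key \<pi> b)"
    have inj: "inj \<pi>" "inj (inv_into UNIV \<pi>)" using that bij_imp_bij_inv[OF that] by (auto simp: bij_is_inj)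
    show ?thesis unfolding series_mult_def
      by (rule sum.reindex_bij_witness[where i = "?h \<pi>" and j = "?h (inv_into UNIV \<pi>)"])
         (auto simp: map_key_inverse[OF that] map_key_plus[OF inj(1), symmetric] map_key_plus[OF inj(2), symmetric]
           *(3,4)[OF bij_imp_bij_inv[OF that]])
  qed
  ultimately show ?thesis by (auto simp: symmetric_functions_def)
qed

lemma series_one_symmetric: "series_one \<in> symmetric_functions"
proof -
  have "Poly_Mapping.map_key \<pi> m = 0 \<longleftrightarrow> m = 0" if "bij \<pi>"
    for \<pi> :: "nat \<Rightarrow> nat" and m :: "nat \<Rightarrow>\<^sub>0 nat"
    using map_key_inverse(2)[OF that, of m] map_key_zero[OF bij_is_inj[OF that]]
      map_key_zero[OF bij_is_inj[OF bij_imp_bij_inv[OF that]]] by metis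
  then show ?thesis by (auto simp: symmetric_functions_def series_one_def total_degree_def)
qed

lemma power_sum_symmetric: "power_sum r \<in> symmetric_functions"
proof -
  have s: "Poly_Mapping.map_key \<pi> (Poly_Mapping.single i r) = Poly_Mapping.single (inv_into UNIV \<pi> i) r" if "bij \<pi>" for \<pi> i
    by (rule poly_mapping_eqI) (use that in \<open>auto simp: lookup_map_key bij_is_inj lookup_single
      when_def bij_is_surj surj_f_inv_f inv_f_f\<close>)
  have "(\<exists>i. Poly_Mapping.map_key \<pi> m = Poly_Mapping.single i r) \<longleftrightarrow> (\<exists>i. m = Poly_Mapping.single i r)" if "bij \<pi>"
    for \<pi> :: "nat \<Rightarrow> nat" and m :: "nat \<Rightarrow>\<^sub>0 nat"
  proof
    assume "\<exists>i. Poly_Mapping.map_key \<pi> m = Poly_Mapping.single i r"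
    then show "\<exists>i. m = Poly_Mapping.single i r"
      using s[OF bij_imp_bij_inv[OF that]] map_key_inverse(2)[OF that, of m] by metis
  next
    assume "\<exists>i. m = Poly_Mapping.single i r"
    then show "\<exists>i. Poly_Mapping.map_key \<pi> m = Poly_Mapping.single i r" using s[OF that] by auto
  qed
  moreover have "total_degree (Poly_Mapping.single i r) \<le> r" for i by (simp add: total_degree_def)
  ultimately show ?thesis unfolding symmetric_functions_def power_sum_def
    by (auto intro!: exI[of _ r] split: if_splits)
qed

lemma ev_symmetric: "ev a \<in> symmetric_functions"
proof (induction a rule: polynomial_induct)
  case (const x)
  then show ?case using ev_scale[of x 1] series_scale_symmetric[OF series_one_symmetric] by (simp add: ev_one)
qed (simp_all add: ev_polyvar power_sum_symmetric ev_add series_add_symmetric ev_mult series_mult_symmetric)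

section \<open>Algebraic independence of the power sums\<close>

definition exps :: "(nat \<Rightarrow>\<^sub>0 nat) \<Rightarrow> nat multiset" where
  "exps m = image_mset (Poly_Mapping.lookup m) (mset_set (Poly_Mapping.keys m))"

definition mono_exp :: "nat list \<Rightarrow> (nat \<Rightarrow>\<^sub>0 nat)" where
  "mono_exp lam = Poly_Mapping.nth lam"

lemma exps_0 [simp]: "exps 0 = {#}"
  by (simp add: exps_def)

lemma size_exps: "size (exps m) = card (Poly_Mapping.keys m)"
  by (simp add: exps_def)

lemma exps_add_single:
  assumes "i \<notin> Poly_Mapping.keys m" "r > 0"
  shows "exps (m + Poly_Mapping.single i r) = add_mset r (exps m)"
proof -
  have k: "Poly_Mapping.keys (m + Poly_Mapping.single i r) = insert i (Poly_Mapping.keys m)"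
    using assms(2) by (auto simp: in_keys_iff lookup_add lookup_single when_def split: if_splits)
  have "image_mset (Poly_Mapping.lookup (m + Poly_Mapping.single i r)) (mset_set (Poly_Mapping.keys m)) =
      image_mset (Poly_Mapping.lookup m) (mset_set (Poly_Mapping.keys m))"
    using assms(1) by (intro image_mset_cong) (auto simp: lookup_add lookup_single when_def)
  then show ?thesis using assms(1) by (simp add: exps_def k lookup_add in_keys_iff)
qed

lemma lookup_mono_exp [simp]: "Poly_Mapping.lookup (mono_exp lam) i = rlen lam i"
  by (simp add: mono_exp_def nth_default_def rlen_nth)

lemma exps_mono_exp:
  assumes "0 \<notin> set lam"
  shows "exps (mono_exp lam) = mset lam"
  using assms
proof (induction lam rule: rev_induct)
  case Nil
  then show ?case by (simp add: mono_exp_def)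
next
  case (snoc x lam)
  have e: "mono_exp (lam @ [x]) = mono_exp lam + Poly_Mapping.single (length lam) x"
    by (rule poly_mapping_eqI) (auto simp: lookup_add lookup_single when_def rlen_nth nth_append)
  have "length lam \<notin> Poly_Mapping.keys (mono_exp lam)" by (simp add: in_keys_iff)
  then show ?case unfolding e using snoc by (subst exps_add_single) auto
qed

lemma lookup_var_power_mult:
  "Poly_Mapping.lookup (polyvar i ^ r * f) m =
    (if r \<le> Poly_Mapping.lookup m i then Poly_Mapping.lookup f (m - Poly_Mapping.single i r) else 0)"
proof -
  have eq: "a + b = m \<and> a = Poly_Mapping.single i r \<longleftrightarrow>
      r \<le> Poly_Mapping.lookup m i \<and> a = Poly_Mapping.single i r \<and> b = m - Poly_Mapping.single i r" for a b
  proof safe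
    assume "r \<le> Poly_Mapping.lookup m i"
    then show "Poly_Mapping.single i r + (m - Poly_Mapping.single i r) = m"
      by (intro poly_mapping_eqI) (auto simp: lookup_add lookup_minus lookup_single when_def)
  qed (auto simp: lookup_add)
  have "Poly_Mapping.lookup (polyvar i ^ r * f) m =
     (\<Sum>(a, b)\<in>{(a, b). a + b = m}. if a = Poly_Mapping.single i r then Poly_Mapping.lookup f b else 0)"
    unfolding lookup_mult_sum polyvar_power
    by (intro sum.cong refl) (auto simp: lookup_single when_def)
  also have "\<dots> = (\<Sum>p\<in>{(a, b). a + b = m}. if r \<le> Poly_Mapping.lookup m i \<and>
     p = (Poly_Mapping.single i r, m - Poly_Mapping.single i r) then Poly_Mapping.lookup f (m - Poly_Mapping.single i r) else 0)"
    by (intro sum.cong refl) (use eq in \<open>auto split: if_splits\<close>)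
  also have "\<dots> = (if r \<le> Poly_Mapping.lookup m i then Poly_Mapping.lookup f (m - Poly_Mapping.single i r) else 0)"
    using eq finite_series_mult_index[of m] by (auto simp: sum.delta)
  finally show ?thesis .
qed

text \<open>A monomial of the product of the power sums with degrees \<open>K\<close> has fewer variables than factors
  unless its exponents are \<open>K\<close>. This makes different products of power sums independent. The
  coefficients are natural numbers, so that no cancellation occurs.\<close>

definition triangular :: "nat \<Rightarrow> nat multiset \<Rightarrow> polynomial \<Rightarrow> bool" where
  "triangular n K f \<longleftrightarrow> (\<forall>m. (\<exists>j::nat. Poly_Mapping.lookup f m = of_nat j) \<and>
     (Poly_Mapping.lookup f m \<noteq> 0 \<longrightarrow> size (exps m) < size K \<or> exps m = K) \<and>
     (exps m = K \<longrightarrow> Poly_Mapping.degree m \<le> n \<longrightarrow> Poly_Mapping.lookup f m \<noteq> 0))"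

lemma triangular_one: "triangular n {#} 1"
proof -
  have "m = 0" if "exps m = {#}" for m
    using that size_exps[of m] by simp
  then show ?thesis by (auto simp: triangular_def lookup_one when_def)
qed

text \<open>A power of a variable either meets a new variable and adds its own exponent, or enlarges
  an exponent already present and leaves the number of variables unchanged. In the latter case there
  are fewer variables than factors.\<close>

lemma triangular_psum_mult:
  assumes f: "triangular n K f"
  shows "triangular n (add_mset (Suc k) K) (psum n k * f)"
proof -
  let ?r = "Suc k"
  let ?t = "\<lambda>m i. if ?r \<le> Poly_Mapping.lookup m i then Poly_Mapping.lookup f (m - Poly_Mapping.single i ?r) else 0"
  have L: "Poly_Mapping.lookup (psum n k * f) m = (\<Sum>i<n. ?t m i)" for m
    unfolding psum_def sum_distrib_right lookup_sum lookup_var_power_mult ..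
  have "\<exists>c. \<forall>m. Poly_Mapping.lookup f m = of_nat (c m)"
    using f unfolding triangular_def by metis
  then obtain c :: "_ \<Rightarrow> nat" where c: "\<And>m. Poly_Mapping.lookup f m = of_nat (c m)" by blast
  let ?s = "\<lambda>m i. if ?r \<le> Poly_Mapping.lookup m i then c (m - Poly_Mapping.single i ?r) else 0"
  have L': "Poly_Mapping.lookup (psum n k * f) m = of_nat (\<Sum>i<n. ?s m i)" for m
    unfolding L by (auto simp: c intro!: sum.cong)
  have split: "m = (m - Poly_Mapping.single i ?r) + Poly_Mapping.single i ?r" if "?r \<le> Poly_Mapping.lookup m i" for m i
    using that by (intro poly_mapping_eqI) (auto simp: lookup_add lookup_minus lookup_single when_def)
  have "size (exps m) < size (add_mset ?r K) \<or> exps m = add_mset ?r K"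
    if nz: "Poly_Mapping.lookup (psum n k * f) m \<noteq> 0" for m
  proof -
    obtain i where "?t m i \<noteq> 0" using nz unfolding L by (rule sum.not_neutral_contains_not_neutral)
    then have i: "?r \<le> Poly_Mapping.lookup m i" "Poly_Mapping.lookup f (m - Poly_Mapping.single i ?r) \<noteq> 0"
      by (auto split: if_splits)
    let ?m = "m - Poly_Mapping.single i ?r"
    have le: "size (exps ?m) < size K \<or> exps ?m = K" using f i(2) by (auto simp: triangular_def)
    show ?thesis
    proof (cases "i \<in> Poly_Mapping.keys ?m")
      case False
      then have "exps m = add_mset ?r (exps ?m)"
        using exps_add_single[of i ?m ?r] split[OF i(1)] by simp
      then show ?thesis using le by auto
    next
      case True
      then have "Poly_Mapping.keys m = Poly_Mapping.keys ?m"
        using split[OF i(1)] by (auto simp: in_keys_iff lookup_minus lookup_single when_def)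
      then have "size (exps m) = size (exps ?m)" by (simp add: size_exps)
      then show ?thesis using le by auto
    qed
  qed
  moreover have "Poly_Mapping.lookup (psum n k * f) m \<noteq> 0"
    if m: "exps m = add_mset ?r K" "Poly_Mapping.degree m \<le> n" for m
  proof -
    have "?r \<in># exps m" using m(1) by simp
    then obtain i where i: "i \<in> Poly_Mapping.keys m" "Poly_Mapping.lookup m i = ?r"
      by (auto simp: exps_def)
    let ?m = "m - Poly_Mapping.single i ?r"
    have "i \<notin> Poly_Mapping.keys ?m" using i by (simp add: in_keys_iff lookup_minus)
    then have "exps m = add_mset ?r (exps ?m)"
      using exps_add_single[of i ?m ?r] split[of m i] i(2) by simp
    then have "exps ?m = K" using m(1) by simp
    moreover have "Poly_Mapping.degree ?m \<le> n"
      using degree_add_nat[of ?m "Poly_Mapping.single i ?r"] split[of m i] i(2) m(2) by simp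
    ultimately have "Poly_Mapping.lookup f ?m \<noteq> 0" using f unfolding triangular_def by blast
    then have "c ?m \<noteq> 0" using c[of ?m] by simp
    moreover have "i < n" using in_keys_less_degree[OF i(1)] m(2) by simp
    ultimately have "?s m i \<noteq> 0" "i \<in> {..<n}" using i(2) by auto
    moreover have "?s m i \<le> (\<Sum>i<n. ?s m i)" by (rule member_le_sum) (use \<open>i < n\<close> in simp_all)
    ultimately have "(\<Sum>i<n. ?s m i) \<noteq> 0" by linarith
    then show ?thesis unfolding L' of_nat_eq_0_iff .
  qed
  moreover have "\<exists>j::nat. Poly_Mapping.lookup (psum n k * f) m = of_nat j" for m using L' by blast
  ultimately show ?thesis unfolding triangular_def by simp
qed

definition psum_parts :: "(nat \<Rightarrow>\<^sub>0 nat) \<Rightarrow> nat multiset" where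
  "psum_parts m = (\<Sum>k\<in>Poly_Mapping.keys m. replicate_mset (Poly_Mapping.lookup m k) (Suc k))"

lemma count_psum_parts: "count (psum_parts m) (Suc k) = Poly_Mapping.lookup m k"
proof -
  have "count (psum_parts m) (Suc k) = (\<Sum>j\<in>Poly_Mapping.keys m. if j = k then Poly_Mapping.lookup m k else 0)"
    unfolding psum_parts_def count_sum by (intro sum.cong refl) auto
  then show ?thesis by (simp add: in_keys_iff)
qed

lemma psum_parts_inject: "psum_parts m = psum_parts m' \<Longrightarrow> m = m'"
  by (rule poly_mapping_eqI) (metis count_psum_parts)

lemma triangular_mon: "triangular n (psum_parts m) (mon (psum n) m)"
proof -
  have pow: "triangular n (replicate_mset j (Suc k) + K) (psum n k ^ j * f)" if "triangular n K f" for j k K f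
    using that by (induction j) (auto dest: triangular_psum_mult simp: mult.assoc)
  have "triangular n (\<Sum>k\<in>A. replicate_mset (Poly_Mapping.lookup m k) (Suc k)) (\<Prod>k\<in>A. psum n k ^ Poly_Mapping.lookup m k)"
    if "finite A" for A
    using that by induction (auto simp: triangular_one intro: pow)
  then show ?thesis by (simp add: psum_parts_def mon_def)
qed

lemma zero_notin_psum_parts: "0 \<notin># psum_parts m"
  by (simp add: not_in_iff psum_parts_def count_sum)

text \<open>Take a product of power sums in \<open>a\<close> with the greatest number of factors,
  and the monomial whose exponents are their degrees. By triangularity no other product in
  \<open>a\<close> contains this monomial, so its coefficient cannot cancel.\<close>

lemma ev_eq_0_imp:
  assumes "ev a = (\<lambda>_. 0)"
  shows "a = 0"
proof (rule ccontr)
  assume "a \<noteq> 0"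
  then have ne: "Poly_Mapping.keys a \<noteq> {}" by (metis in_keys_iff empty_iff lookup_zero poly_mapping_eqI)
  define M where "M = Max ((\<lambda>m. size (psum_parts m)) ` Poly_Mapping.keys a)"
  have "M \<in> (\<lambda>m. size (psum_parts m)) ` Poly_Mapping.keys a" unfolding M_def using ne by (intro Max_in) auto
  then obtain m where m: "m \<in> Poly_Mapping.keys a" "size (psum_parts m) = M" by blast
  have le: "size (psum_parts m') \<le> M" if "m' \<in> Poly_Mapping.keys a" for m'
    unfolding M_def using that by (intro Max_ge) auto
  obtain lam where lam: "mset lam = psum_parts m" using ex_mset by blast
  define e where "e = mono_exp lam"
  have e: "exps e = psum_parts m"
    unfolding e_def using lam zero_notin_psum_parts[of m] by (subst exps_mono_exp) (auto simp flip: set_mset_mset)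
  let ?n = "Poly_Mapping.degree e"
  have tri: "triangular ?n (psum_parts m') (mon (psum ?n) m')" for m' by (rule triangular_mon)
  have "ev a e = (\<Sum>m'\<in>Poly_Mapping.keys a. Poly_Mapping.lookup a m' * Poly_Mapping.lookup (mon (psum ?n) m') e)"
    by (simp add: ev_def polyconst.lift_def lookup_sum lookup_polyconst_mult)
  also have "\<dots> = (\<Sum>m'\<in>Poly_Mapping.keys a. if m' = m then Poly_Mapping.lookup a m * Poly_Mapping.lookup (mon (psum ?n) m) e else 0)"
  proof (rule sum.cong[OF refl])
    fix m' assume "m' \<in> Poly_Mapping.keys a"
    then have "\<not> size (exps e) < size (psum_parts m')" using le[of m'] m(2) e by simp
    then have "Poly_Mapping.lookup (mon (psum ?n) m') e = 0" if "m' \<noteq> m"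
      using tri[of m'] psum_parts_inject[of m m'] that e by (auto simp: triangular_def)
    then show "Poly_Mapping.lookup a m' * Poly_Mapping.lookup (mon (psum ?n) m') e =
      (if m' = m then Poly_Mapping.lookup a m * Poly_Mapping.lookup (mon (psum ?n) m) e else 0)" by auto
  qed
  also have "\<dots> = Poly_Mapping.lookup a m * Poly_Mapping.lookup (mon (psum ?n) m) e"
    using m(1) by simp
  also have "\<dots> \<noteq> 0" using tri[of m] e m(1) by (auto simp: triangular_def in_keys_iff)
  finally show False using assms by simp
qed

lemma ev_diff: "ev (a - b) m = ev a m - ev b m"
  by (simp add: ev_def polyconst.lift_diff lookup_minus)

lemma ev_inject: "ev a = ev b \<Longrightarrow> a = b"
  using ev_eq_0_imp[of "a - b"] by (simp add: fun_eq_iff ev_diff)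

section \<open>Monomial expansion\<close>

lemma partition_mset_eqI:
  assumes "is_partition lam" "is_partition mu" "mset lam = mset mu"
  shows "lam = mu"
proof -
  have "sorted (rev l)" if "is_partition l" for l
    using that by (auto simp: is_partition_def sorted_wrt_rev)
  then have "rev l = sorted_list_of_multiset (mset l)" if "is_partition l" for l
    using that by (metis mset_rev sorted_list_of_multiset_mset sorted_sort_id)
  then show ?thesis using assms by (metis rev_rev_ident)
qed

text \<open>Symmetry is expressed by permutations of all variables. A bijection between finite sets
  extends to one, since both complements are countably infinite.\<close>

lemma ex_bij_extension:
  assumes A: "finite A" and B: "finite B" and f: "bij_betw f A B"
  shows "\<exists>\<pi> :: nat \<Rightarrow> nat. bij \<pi> \<and> (\<forall>i\<in>A. \<pi> i = f i)"
proof -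
  have inf: "infinite (- A)" "infinite (- B)"
    using A B by (metis Compl_UNIV_eq finite_compl infinite_UNIV_nat double_complement finite_Un Compl_partition)+
  define g where "g = from_nat_into (- B) \<circ> to_nat_on (- A)"
  have g: "bij_betw g (- A) (- B)" unfolding g_def
    by (rule bij_betw_trans[OF to_nat_on_infinite bij_betw_from_nat_into]) (use inf in auto)
  define \<pi> where "\<pi> i = (if i \<in> A then f i else g i)" for i
  have "bij_betw \<pi> A B" using f by (subst bij_betw_cong[of A \<pi> f]) (auto simp: \<pi>_def)
  moreover have "bij_betw \<pi> (- A) (- B)" using g by (subst bij_betw_cong[of "- A" \<pi> g]) (auto simp: \<pi>_def)
  ultimately have "bij_betw \<pi> (A \<union> - A) (B \<union> - B)" by (rule bij_betw_combine) auto
  then have "bij \<pi>" by simp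
  then show ?thesis by (auto simp: \<pi>_def)
qed

lemma ex_partition_exps:
  obtains lam \<pi> where "is_partition lam" "mset lam = exps m" "bij \<pi>"
    "Poly_Mapping.map_key \<pi> m = mono_exp lam"
proof -
  let ?f = "Poly_Mapping.lookup m"
  define ks where "ks = rev (sort_key ?f (sorted_list_of_set (Poly_Mapping.keys m)))"
  define lam where "lam = map ?f ks"
  have ks: "distinct ks" "set ks = Poly_Mapping.keys m" by (auto simp: ks_def distinct_sort)
  have "sorted_wrt (\<ge>) lam"
    by (simp add: lam_def ks_def rev_map[symmetric] sorted_wrt_rev)
  moreover have "0 \<notin> set lam" using ks(2) by (auto simp: lam_def in_keys_iff)
  ultimately have lam: "is_partition lam" by (simp add: is_partition_def)
  have "mset ks = mset_set (Poly_Mapping.keys m)" using ks mset_set_set by metis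
  then have ms: "mset lam = exps m" by (simp add: lam_def exps_def)
  have "bij_betw ((!) ks) {..<length ks} (Poly_Mapping.keys m)"
    using bij_betw_nth[OF ks(1), of "{..<length ks}" "Poly_Mapping.keys m"] ks(2) by simp
  then obtain \<pi> :: "nat \<Rightarrow> nat" where \<pi>: "bij \<pi>" "\<And>i. i < length ks \<Longrightarrow> \<pi> i = ks ! i"
    using ex_bij_extension[of "{..<length ks}" "Poly_Mapping.keys m" "(!) ks"] by auto
  have "Poly_Mapping.map_key \<pi> m = mono_exp lam"
  proof (rule poly_mapping_eqI)
    fix i
    show "Poly_Mapping.lookup (Poly_Mapping.map_key \<pi> m) i = Poly_Mapping.lookup (mono_exp lam) i"
    proof (cases "i < length ks")
      case True
      then show ?thesis using \<pi> by (simp add: lookup_map_key bij_is_inj rlen_nth lam_def)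
    next
      case False
      have "\<pi> i \<notin> Poly_Mapping.keys m"
      proof
        assume "\<pi> i \<in> Poly_Mapping.keys m"
        then obtain j where "j < length ks" "\<pi> i = \<pi> j"
          using ks(2) \<pi>(2) by (metis in_set_conv_nth)
        then show False using False bij_is_inj[OF \<pi>(1)] by (auto dest: injD)
      qed
      then show ?thesis using \<pi> False by (simp add: lookup_map_key bij_is_inj rlen_nth lam_def in_keys_iff)
    qed
  qed
  with that lam ms \<pi>(1) show ?thesis by blast
qed

lemma symmetric_value:
  assumes f: "f \<in> symmetric_functions" and lam: "is_partition lam" "mset lam = exps m"
  shows "f m = f (mono_exp lam)"
proof -
  obtain mu \<pi> where "is_partition mu" "mset mu = exps m" "bij \<pi>" "Poly_Mapping.map_key \<pi> m = mono_exp mu"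
    by (rule ex_partition_exps)
  moreover then have "mu = lam" using lam by (intro partition_mset_eqI) auto
  ultimately have "f (Poly_Mapping.map_key \<pi> m) = f m" "Poly_Mapping.map_key \<pi> m = mono_exp lam"
    using f unfolding symmetric_functions_def by blast+
  then show ?thesis by simp
qed

lemma total_degree_exps: "total_degree m = sum_mset (exps m)"
  by (simp add: total_degree_def exps_def sum_unfold_sum_mset)

lemma monomial_symmetric_exps: "monomial_symmetric lam m = (if exps m = mset lam then 1 else 0)"
  by (simp add: monomial_symmetric_def exps_def)

lemma symmetric_monomial_expansion:
  assumes f: "f \<in> symmetric_functions" and d: "\<And>m. f m \<noteq> 0 \<Longrightarrow> total_degree m \<le> d"
  shows "f m = (\<Sum>mu\<in>partitions_upto d. f (mono_exp mu) * monomial_symmetric mu m)"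
proof -
  obtain lam where lam: "is_partition lam" "mset lam = exps m" by (rule ex_partition_exps)
  have "monomial_symmetric mu m = (if mu = lam then 1 else 0)" if "mu \<in> partitions_upto d" for mu
  proof -
    have "is_partition mu" using that by (simp add: partitions_upto_def)
    then have "mset mu = mset lam \<longleftrightarrow> mu = lam" using partition_mset_eqI[of mu lam] lam(1) by blast
    then show ?thesis by (simp add: monomial_symmetric_exps eq_commute flip: lam(2))
  qed
  then have "(\<Sum>mu\<in>partitions_upto d. f (mono_exp mu) * monomial_symmetric mu m) =
      (\<Sum>mu\<in>partitions_upto d. if mu = lam then f (mono_exp lam) else 0)"
    by (intro sum.cong refl) auto
  also have "\<dots> = (if lam \<in> partitions_upto d then f (mono_exp lam) else 0)"
    by (rule sum.delta) simp
  also have "\<dots> = f m"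
  proof (cases "lam \<in> partitions_upto d")
    case True
    then show ?thesis using symmetric_value[OF f lam] by simp
  next
    case False
    moreover have "sum_mset (exps m) = sum_list lam" by (metis lam(2) sum_mset_sum_list)
    ultimately have "total_degree m > d"
      using lam(1) by (simp add: total_degree_exps partitions_upto_def)
    then show ?thesis using d[of m] False by auto
  qed
  finally show ?thesis ..
qed

lemma sum_part_rlen: "(\<Sum>i=1..k. part lam i) = (\<Sum>i<k. rlen lam i)"
  by (induction k) auto

lemma dominated_rlen: "dominated mu lam \<longleftrightarrow> sum_list mu = sum_list lam \<and>
    (\<forall>k. (\<Sum>i<k. rlen mu i) \<le> (\<Sum>i<k. rlen lam i))"
  unfolding dominated_def sum_part_rlen ..

lemma dominated_antisym:
  assumes "dominated mu lam" "dominated lam mu" "is_partition lam" "is_partition mu"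
  shows "mu = lam"
proof (rule partition_eqI)
  fix i
  have "(\<Sum>i<k. rlen mu i) = (\<Sum>i<k. rlen lam i)" for k
    using assms(1,2) by (auto simp: dominated_rlen intro: antisym)
  from this[of i] this[of "Suc i"] show "rlen mu i = rlen lam i" by simp
qed (use assms in auto)

text \<open>A natural number that grows strictly along dominance and so permits induction along this
  partial order.\<close>

definition dominance_rank :: "nat list \<Rightarrow> nat" where
  "dominance_rank lam = (\<Sum>k\<le>sum_list lam. \<Sum>i<k. rlen lam i)"

lemma dominance_rank_less:
  assumes dom: "dominated mu lam" and ne: "mu \<noteq> lam" and part: "is_partition lam" "is_partition mu"
  shows "dominance_rank mu < dominance_rank lam"
proof -
  have s: "sum_list mu = sum_list lam" and le: "\<And>k. (\<Sum>i<k. rlen mu i) \<le> (\<Sum>i<k. rlen lam i)"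
    using dom by (auto simp: dominated_rlen)
  obtain k where k: "(\<Sum>i<k. rlen mu i) < (\<Sum>i<k. rlen lam i)"
    using dominated_antisym[OF dom _ part] ne s le unfolding dominated_rlen by (metis not_less)
  have "k \<le> sum_list lam"
  proof (rule ccontr)
    assume "\<not> k \<le> sum_list lam"
    then have "length mu \<le> k" "length lam \<le> k"
      using length_le_sum_list[OF part(1)] length_le_sum_list[OF part(2)] s by auto
    then show False using k s by (simp add: sum_list_rlen[symmetric])
  qed
  then show ?thesis unfolding dominance_rank_def s
    using le k by (intro sum_strict_mono_ex1) auto
qed

section \<open>Branching polynomials and triangularity\<close>

context macdonald_parameters
begin

text \<open>The Macdonald polynomial in the variables \<open>0, \<dots>, n - 1\<close>, by branching.\<close>

fun fam :: "nat \<Rightarrow> nat list \<Rightarrow> polynomial" where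
  "fam 0 = (\<lambda>lam. if lam = [] then 1 else 0)"
| "fam (Suc n) = bstep polyconst (polyvar n) (fam n)"

fun elem :: "nat \<Rightarrow> nat \<Rightarrow> polynomial" where
  "elem 0 = (\<lambda>r. if r = 0 then 1 else 0)"
| "elem (Suc n) = (\<lambda>r. elem n r + (if r = 0 then 0 else polyvar n * elem n (r - 1)))"

lemma newton_add_variable:
  assumes "newton p e"
  shows "newton (\<lambda>k. p k + x ^ Suc k) (\<lambda>r. e r + (if r = 0 then 0 else x * e (r - 1)))"
proof -
  have "(\<Sum>i\<le>r. e i * (if r - i = 0 then 1 else if r - i = 1 then x else 0)) =
      e r + (if r = 0 then 0 else x * e (r - 1))" for r
  proof (cases r)
    case (Suc s)
    have "(\<Sum>i\<le>s. e i * (if Suc s - i = 0 then 1 else if Suc s - i = 1 then x else 0)) =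
        (\<Sum>i\<le>s. if i = s then e s * x else 0)"
      by (intro sum.cong refl) (auto simp: Suc_diff_le)
    then show ?thesis by (simp add: Suc mult.commute)
  qed simp
  then show ?thesis using newton_mult[OF assms newton_variable[of x]] by simp
qed

lemma newton_elem: "newton (psum n) (elem n)"
proof (induction n)
  case 0
  have "psum 0 = (\<lambda>k. 0)" by (simp add: psum_def fun_eq_iff)
  then show ?case using newton_one by simp
next
  case (Suc n)
  have "psum (Suc n) = (\<lambda>k. psum n k + polyvar n ^ Suc k)" by (simp add: psum_def fun_eq_iff)
  then show ?case using newton_add_variable[OF Suc, of "polyvar n"] by simp
qed

lemma pieri_fam: "pieri polyconst (elem n) (fam n)"
proof (induction n)
  case 0
  then show ?case using pieri_one[OF polyconst.scalar_hom_axioms] by simp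
next
  case (Suc n)
  then show ?case using pieri_bstep[OF polyconst.scalar_hom_axioms Suc, of "polyvar n"] by simp
qed

lemma evn_Phat: "is_partition lam \<Longrightarrow> evn n (Phat lam) = fam n lam"
  by (rule lift_Phat[OF polyconst.scalar_hom_axioms pieri_fam newton_elem])

text \<open>In each finite number of variables \<open>Phat\<close> becomes \<open>fam\<close>, which
  satisfies the whole Pieri rule by construction. The evaluations together separate polynomials in
  the power sums.\<close>

lemma pieri_Phat: "pieri polyconst ehat Phat"
proof -
  have "ehat r * Phat mu = (\<Sum>lam\<in>partitions_upto K. polyconst (egraded r mu lam) * Phat lam)"
    if mu: "is_partition mu" and K: "sum_list mu + r \<le> K" for mu r K
  proof (rule ev_inject)
    have "evn n (ehat r * Phat mu) = evn n (\<Sum>lam\<in>partitions_upto K. polyconst (egraded r mu lam) * Phat lam)" for n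
    proof -
      have "evn n (\<Sum>lam\<in>partitions_upto K. polyconst (egraded r mu lam) * Phat lam) =
        (\<Sum>lam\<in>partitions_upto K. polyconst (egraded r mu lam) * fam n lam)"
        unfolding polyconst.lift_sum
        by (intro sum.cong refl) (simp add: evn_simps evn_Phat partitions_upto_def)
      also have "\<dots> = elem n r * fam n mu" using pieri_fam[of n] mu K by (simp add: pieri_def)
      also have "\<dots> = evn n (ehat r * Phat mu)"
        using mu by (simp add: evn_simps evn_Phat polyconst.lift_ehat[OF newton_elem])
      finally show ?thesis ..
    qed
    then show "ev (ehat r * Phat mu) = ev (\<Sum>lam\<in>partitions_upto K. polyconst (egraded r mu lam) * Phat lam)"
      by (simp add: ev_def fun_eq_iff)
  qed
  then show ?thesis by (simp add: pieri_def)
qed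

lemma ev_Phat: "is_partition lam \<Longrightarrow> Poly_Mapping.degree m \<le> n \<Longrightarrow> ev (Phat lam) m = Poly_Mapping.lookup (fam n lam) m"
  using ev_eq evn_Phat by simp

lemma lookup_fam_Suc:
  "Poly_Mapping.lookup (fam (Suc n) lam) m = (\<Sum>mu\<in>partitions_upto (sum_list lam).
     bmat lam mu * (if sum_list lam - sum_list mu \<le> Poly_Mapping.lookup m n
       then Poly_Mapping.lookup (fam n mu) (m - Poly_Mapping.single n (sum_list lam - sum_list mu)) else 0))"
  by (simp only: fam.simps bstep_def lookup_sum mult.assoc lookup_polyconst_mult lookup_var_power_mult)

text \<open>The exponents of the first \<open>n\<close> variables come from an inner shape
  \<open>mu\<close>, whose rows are at most those of \<open>lam\<close>; the last strip only
  completes the total degree. The exponents need not be decreasing.\<close>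

lemma fam_nonzeroD:
  assumes "is_partition lam" "Poly_Mapping.lookup (fam n lam) m \<noteq> 0"
  shows "Poly_Mapping.keys m \<subseteq> {..<n} \<and> length lam \<le> n \<and> (\<Sum>i<n. Poly_Mapping.lookup m i) = sum_list lam \<and>
    (\<forall>k. (\<Sum>i<k. Poly_Mapping.lookup m i) \<le> (\<Sum>i<k. rlen lam i))"
  using assms
proof (induction n arbitrary: lam m)
  case 0
  then show ?case by (auto simp: lookup_one when_def split: if_splits)
next
  case (Suc n)
  obtain mu where mu: "mu \<in> partitions_upto (sum_list lam)"
    "bmat lam mu * (if sum_list lam - sum_list mu \<le> Poly_Mapping.lookup m n
       then Poly_Mapping.lookup (fam n mu) (m - Poly_Mapping.single n (sum_list lam - sum_list mu)) else 0) \<noteq> 0"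
    using Suc.prems(2) unfolding lookup_fam_Suc by (rule sum.not_neutral_contains_not_neutral)
  define d where "d = sum_list lam - sum_list mu"
  define m' where "m' = m - Poly_Mapping.single n d"
  have b: "bmat lam mu \<noteq> 0" and dn: "d \<le> Poly_Mapping.lookup m n" and f: "Poly_Mapping.lookup (fam n mu) m' \<noteq> 0"
    using mu(2) by (auto simp: d_def m'_def split: if_splits)
  have pm: "is_partition mu" and s: "sum_list lam = sum_list mu + d" using mu(1) by (auto simp: partitions_upto_def d_def)
  have h: "hstrip lam mu" using bmat_nonzeroD[OF b] by simp
  note IH = Suc.IH[OF pm f]
  have l: "Poly_Mapping.lookup m i = Poly_Mapping.lookup m' i + (if i = n then d else 0)" for i
    using dn by (auto simp: m'_def lookup_minus lookup_single when_def)
  have m'0: "Poly_Mapping.lookup m' i = 0" if "i \<ge> n" for i using IH that by (auto simp: in_keys_iff subset_iff)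
  have len: "length lam \<le> Suc n" using hstrip_length[OF h Suc.prems(1) pm] IH by simp
  have sum_m: "(\<Sum>i<k. Poly_Mapping.lookup m i) = (\<Sum>i<k. Poly_Mapping.lookup m' i) + (if n < k then d else 0)" for k
    by (simp add: l sum.distrib)
  have sum_m': "(\<Sum>i<k. Poly_Mapping.lookup m' i) = sum_list mu" if "k \<ge> n" for k
  proof -
    have "(\<Sum>i<k. Poly_Mapping.lookup m' i) = (\<Sum>i<n. Poly_Mapping.lookup m' i)"
      using that m'0 by (intro sum.mono_neutral_right) auto
    then show ?thesis using IH by simp
  qed
  have "(\<Sum>i<k. Poly_Mapping.lookup m i) \<le> (\<Sum>i<k. rlen lam i)" for k
  proof (cases "n < k")
    case True
    then have "(\<Sum>i<k. rlen lam i) = sum_list lam" using len by (subst sum_list_rlen[of lam k]) auto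
    then show ?thesis using True sum_m[of k] sum_m'[of k] s by simp
  next
    case False
    then have "(\<Sum>i<k. Poly_Mapping.lookup m i) \<le> (\<Sum>i<k. rlen mu i)" using sum_m[of k] IH by simp
    also have "\<dots> \<le> (\<Sum>i<k. rlen lam i)" using h by (intro sum_mono) (simp add: hstrip_def)
    finally show ?thesis .
  qed
  moreover have "Poly_Mapping.keys m \<subseteq> {..<Suc n}"
  proof (rule subsetI, rule ccontr)
    fix i assume i: "i \<in> Poly_Mapping.keys m" "i \<notin> {..<Suc n}"
    then have "Poly_Mapping.lookup m i = 0" using l[of i] m'0[of i] by simp
    then show False using i(1) by (simp add: in_keys_iff)
  qed
  moreover have "(\<Sum>i<Suc n. Poly_Mapping.lookup m i) = sum_list lam" using sum_m[of "Suc n"] sum_m'[of "Suc n"] s by simp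
  ultimately show ?case using len by simp
qed

text \<open>The last exponent prescribes a strip of size \<open>rlen lam n\<close>, and the inner
  shape may have at most \<open>n\<close> rows. So exactly row \<open>n\<close> is removed, a strip
  of branching weight 1.\<close>

lemma fam_leading:
  assumes "is_partition lam" "length lam \<le> n"
  shows "Poly_Mapping.lookup (fam n lam) (mono_exp lam) = 1"
  using assms
proof (induction n arbitrary: lam)
  case 0
  then show ?case by (simp add: mono_exp_def)
next
  case (Suc n)
  define mu where "mu = take n lam"
  have rmu: "rlen mu i = (if i < n then rlen lam i else 0)" for i by (auto simp: mu_def rlen_nth)
  have pm: "is_partition mu" using Suc.prems(1)
    by (auto simp: mu_def is_partition_def sorted_wrt_take dest: in_set_takeD)
  have lmu: "length mu \<le> n" by (simp add: mu_def)
  have s: "sum_list lam = sum_list mu + rlen lam n"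
    by (simp add: sum_list_rlen[OF Suc.prems(2)] sum_list_rlen[OF lmu] rmu)
  have h: "hstrip lam mu"
    unfolding hstrip_def
  proof
    fix i show "rlen mu i \<le> rlen lam i \<and> rlen lam (Suc i) \<le> rlen mu i"
      using rlen_le_rlen[OF Suc.prems(1), of i "Suc i"] Suc.prems(2) by (auto simp: rmu)
  qed
  have b: "bmat lam mu = 1"
  proof -
    have "hrow n (rlen lam) (rlen mu) = 1"
      unfolding hrow_def by (intro prod.neutral ballI) (auto simp: rmu)
    then show ?thesis using h by (simp add: bmat_def psi_hrow[OF Suc.prems(1) pm h lmu])
  qed
  have m: "mono_exp lam - Poly_Mapping.single n (rlen lam n) = mono_exp mu"
    using Suc.prems(2) by (intro poly_mapping_eqI) (auto simp: lookup_minus lookup_single when_def rmu)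
  have "Poly_Mapping.lookup (fam (Suc n) lam) (mono_exp lam) = (\<Sum>ka\<in>partitions_upto (sum_list lam).
      if ka = mu then 1 else 0)"
    unfolding lookup_fam_Suc
  proof (rule sum.cong[OF refl])
    fix ka assume ka: "ka \<in> partitions_upto (sum_list lam)"
    let ?d = "sum_list lam - sum_list ka"
    let ?t = "bmat lam ka * (if ?d \<le> Poly_Mapping.lookup (mono_exp lam) n
       then Poly_Mapping.lookup (fam n ka) (mono_exp lam - Poly_Mapping.single n ?d) else 0)"
    show "?t = (if ka = mu then 1 else 0)"
    proof (cases "ka = mu")
      case True
      have "?d = rlen lam n" using True s by simp
      then show ?thesis using True b Suc.IH[OF pm lmu] m by simp
    next
      case False
      have "?t = 0"
      proof (rule ccontr)
        assume "?t \<noteq> 0"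
        then have nz: "bmat lam ka \<noteq> 0" "?d \<le> rlen lam n"
          "Poly_Mapping.lookup (fam n ka) (mono_exp lam - Poly_Mapping.single n ?d) \<noteq> 0"
          by (auto split: if_splits)
        have pk: "is_partition ka" "sum_list ka \<le> sum_list lam" using ka by (auto simp: partitions_upto_def)
        note D = fam_nonzeroD[OF pk(1) nz(3)]
        then have "n \<notin> Poly_Mapping.keys (mono_exp lam - Poly_Mapping.single n ?d)" by auto
        then have "?d = rlen lam n" using nz(2) by (simp add: in_keys_iff lookup_minus)
        then have "sum_list ka = sum_list mu" using s pk(2) by simp
        moreover have "rlen ka i \<le> rlen mu i" for i
          using bmat_nonzeroD(1)[OF nz(1)] D by (auto simp: rmu hstrip_def)
        ultimately show False using partition_eq_of_sum_list[of ka mu] pk pm False by simp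
      qed
      then show ?thesis using False by simp
    qed
  qed
  also have "\<dots> = (if mu \<in> partitions_upto (sum_list lam) then 1 else 0)"
    by (rule sum.delta) simp
  also have "\<dots> = 1" using pm s by (simp add: partitions_upto_def)
  finally show ?case .
qed

lemma ev_Phat_leading: "is_partition lam \<Longrightarrow> ev (Phat lam) (mono_exp lam) = 1"
  using ev_Phat[of lam "mono_exp lam" "max (length lam) (Poly_Mapping.degree (mono_exp lam))"] fam_leading by simp

lemma ev_Phat_nonzeroD:
  assumes lam: "is_partition lam" and nz: "ev (Phat lam) m \<noteq> 0"
  shows "total_degree m = sum_list lam"
    and "is_partition mu \<Longrightarrow> m = mono_exp mu \<Longrightarrow> dominated mu lam"
proof -
  define n where "n = Poly_Mapping.degree m"
  have "Poly_Mapping.lookup (fam n lam) m \<noteq> 0" using nz ev_Phat[OF lam, of m n] by (simp add: n_def)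
  note D = fam_nonzeroD[OF lam this]
  show t: "total_degree m = sum_list lam"
  proof -
    have "total_degree m = (\<Sum>i<n. Poly_Mapping.lookup m i)"
      unfolding total_degree_def using D by (intro sum.mono_neutral_left) (auto simp: in_keys_iff)
    then show ?thesis using D by simp
  qed
  assume mu: "is_partition mu" "m = mono_exp mu"
  have "sum_list mu = total_degree m"
    using mu exps_mono_exp[of mu] by (simp add: total_degree_exps is_partition_def sum_mset_sum_list)
  then show "dominated mu lam" using D t mu(2) by (simp add: dominated_rlen)
qed

lemma ev_Phat_triangular:
  assumes lam: "is_partition lam"
  shows "ev (Phat lam) m = monomial_symmetric lam m +
    (\<Sum>mu\<in>{mu. is_partition mu \<and> dominated mu lam \<and> mu \<noteq> lam}. ev (Phat lam) (mono_exp mu) * monomial_symmetric mu m)"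
proof -
  let ?S = "partitions_upto (sum_list lam)" and ?D = "{mu. is_partition mu \<and> dominated mu lam \<and> mu \<noteq> lam}"
  let ?t = "\<lambda>mu. ev (Phat lam) (mono_exp mu) * monomial_symmetric mu m"
  have lamS: "lam \<in> ?S" using lam by (simp add: partitions_upto_def)
  have "ev (Phat lam) m = (\<Sum>mu\<in>?S. ?t mu)"
    by (rule symmetric_monomial_expansion[OF ev_symmetric]) (use ev_Phat_nonzeroD(1)[OF lam] in auto)
  also have "\<dots> = ?t lam + (\<Sum>mu\<in>?S - {lam}. ?t mu)"
    by (rule sum.remove[OF finite_partitions_upto lamS])
  also have "(\<Sum>mu\<in>?S - {lam}. ?t mu) = (\<Sum>mu\<in>?D. ?t mu)"
  proof (rule sum.mono_neutral_right)
    show "?D \<subseteq> ?S - {lam}" by (auto simp: dominated_def partitions_upto_def)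
    show "\<forall>mu\<in>?S - {lam} - ?D. ?t mu = 0"
    proof
      fix mu assume "mu \<in> ?S - {lam} - ?D"
      then have "\<not> dominated mu lam" "is_partition mu" by (auto simp: partitions_upto_def)
      then have "ev (Phat lam) (mono_exp mu) = 0" using ev_Phat_nonzeroD(2)[OF lam] by blast
      then show "?t mu = 0" by simp
    qed
  qed simp
  finally show ?thesis using ev_Phat_leading[OF lam] by simp
qed

lemma ev_sum: "ev (sum f A) m = (\<Sum>x\<in>A. ev (f x) m)"
  by (simp add: ev_def polyconst.lift_sum lookup_sum)

lemma ev_polyconst_mult: "ev (polyconst x * a) m = x * ev a m"
  by (simp add: ev_scale series_scale_def)

text \<open>The triangular expansion of \<open>Phat\<close> is inverted by induction along
  dominance. This shows that the power sums generate all symmetric functions.\<close>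

lemma monomial_symmetric_in_range_ev:
  assumes "is_partition lam"
  shows "\<exists>a. ev a = monomial_symmetric lam"
  using assms
proof (induction "dominance_rank lam" arbitrary: lam rule: less_induct)
  case less
  let ?D = "{mu. is_partition mu \<and> dominated mu lam \<and> mu \<noteq> lam}"
  have "\<forall>mu\<in>?D. \<exists>a. ev a = monomial_symmetric mu"
    using less dominance_rank_less by blast
  then obtain a where a: "\<And>mu. mu \<in> ?D \<Longrightarrow> ev (a mu) = monomial_symmetric mu" by metis
  have "ev (Phat lam - (\<Sum>mu\<in>?D. polyconst (ev (Phat lam) (mono_exp mu)) * a mu)) m = monomial_symmetric lam m" for m
  proof -
    have "ev (\<Sum>mu\<in>?D. polyconst (ev (Phat lam) (mono_exp mu)) * a mu) m =
      (\<Sum>mu\<in>?D. ev (Phat lam) (mono_exp mu) * monomial_symmetric mu m)"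
      unfolding ev_sum ev_polyconst_mult by (intro sum.cong refl) (simp add: a)
    then show ?thesis using ev_Phat_triangular[OF less.prems, of m] by (simp add: ev_diff)
  qed
  then show ?case by blast
qed

lemma range_ev: "range ev = symmetric_functions"
proof
  show "range ev \<subseteq> symmetric_functions" using ev_symmetric by auto
  show "symmetric_functions \<subseteq> range ev"
  proof
    fix f assume f: "f \<in> symmetric_functions"
    then obtain d where d: "\<And>m. f m \<noteq> 0 \<Longrightarrow> total_degree m \<le> d" by (auto simp: symmetric_functions_def)
    have "\<forall>mu\<in>partitions_upto d. \<exists>a. ev a = monomial_symmetric mu"
      using monomial_symmetric_in_range_ev by (auto simp: partitions_upto_def)
    then obtain a where a: "\<And>mu. mu \<in> partitions_upto d \<Longrightarrow> ev (a mu) = monomial_symmetric mu" by metis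
    have "ev (\<Sum>mu\<in>partitions_upto d. polyconst (f (mono_exp mu)) * a mu) m = f m" for m
      unfolding ev_sum ev_polyconst_mult
      by (subst symmetric_monomial_expansion[OF f d], assumption) (intro sum.cong refl, simp add: a)
    then have "ev (\<Sum>mu\<in>partitions_upto d. polyconst (f (mono_exp mu)) * a mu) = f" by blast
    then show "f \<in> range ev" by (metis rangeI)
  qed
qed

end

section \<open>The scalar product\<close>

lemma fps_const_sum: "fps_const (sum f A) = (\<Sum>x\<in>A. fps_const (f x))"
  by (induction A rule: infinite_finite_induct) (auto simp flip: fps_const_add)

context macdonald_parameters
begin

definition zvar :: "nat \<Rightarrow> complex" where
  "zvar k = of_nat (Suc k) * kappa (Suc k)"

text \<open>Macdonald's \<open>z(q, t)\<close> of a product of power sums, in terms of its exponents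
  instead of its list of degrees; \<open>znorm_pexp\<close> compares the two.\<close>

definition znorm :: "(nat \<Rightarrow>\<^sub>0 nat) \<Rightarrow> complex" where
  "znorm m = (\<Prod>k\<in>Poly_Mapping.keys m. zvar k ^ Poly_Mapping.lookup m k * fact (Poly_Mapping.lookup m k))"

lemma znorm_superset:
  assumes "finite A" "Poly_Mapping.keys m \<subseteq> A"
  shows "znorm m = (\<Prod>k\<in>A. zvar k ^ Poly_Mapping.lookup m k * fact (Poly_Mapping.lookup m k))"
  unfolding znorm_def using assms by (intro prod.mono_neutral_left) (auto simp: in_keys_iff)

lemma znorm_0 [simp]: "znorm 0 = 1"
  by (simp add: znorm_def)

lemma znorm_add_single:
  "znorm (m + Poly_Mapping.single k 1) = of_nat (Suc (Poly_Mapping.lookup m k)) * zvar k * znorm m"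
proof -
  let ?A = "insert k (Poly_Mapping.keys m)" and ?m = "m + Poly_Mapping.single k 1"
  have A: "finite ?A" "Poly_Mapping.keys m \<subseteq> ?A" "Poly_Mapping.keys ?m \<subseteq> ?A"
    using keys_add[of m "Poly_Mapping.single k 1"] by auto
  have "(\<Prod>j\<in>?A - {k}. zvar j ^ Poly_Mapping.lookup ?m j * fact (Poly_Mapping.lookup ?m j)) =
      (\<Prod>j\<in>?A - {k}. zvar j ^ Poly_Mapping.lookup m j * fact (Poly_Mapping.lookup m j))"
    by (intro prod.cong refl) (simp add: lookup_add lookup_single when_def)
  then show ?thesis
    unfolding znorm_superset[OF A(1,2)] znorm_superset[OF A(1,3)]
      prod.remove[OF A(1), of k, OF insertI1]
    by (simp add: lookup_add algebra_simps)
qed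

definition form :: "polynomial \<Rightarrow> polynomial \<Rightarrow> complex" where
  "form a b = (\<Sum>m\<in>Poly_Mapping.keys a. Poly_Mapping.lookup a m * Poly_Mapping.lookup b m * znorm m)"

lemma form_single: "form (Poly_Mapping.single m x) (Poly_Mapping.single n y) = (if m = n then x * y * znorm m else 0)"
  by (auto simp: form_def lookup_single when_def)

lemma form_add_left: "form (a + b) c = form a c + form b c"
  unfolding form_def by (rule setsum_keys_plus_distrib) (simp_all add: algebra_simps)

lemma form_add_right: "form a (b + c) = form a b + form a c"
  by (simp add: form_def lookup_add algebra_simps sum.distrib)

lemma form_0_left [simp]: "form 0 b = 0"
  by (simp add: form_def)

lemma form_0_right [simp]: "form a 0 = 0"
  by (simp add: form_def)

lemma form_commute: "form a b = form b a"
proof (induction a rule: poly_mapping_additive_induct)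
  case (single m x)
  show ?case
    by (induction b rule: poly_mapping_additive_induct) (auto simp: form_single form_add_left form_add_right)
qed (simp_all add: form_add_left form_add_right)

lemma form_scale_right: "form a (polyconst x * b) = x * form a b"
  by (simp add: form_def lookup_polyconst_mult sum_distrib_left mult.left_commute mult.assoc)

lemma form_scale_left: "form (polyconst x * a) b = x * form a b"
  using form_scale_right form_commute by metis

lemma form_sum_right: "form a (sum f A) = (\<Sum>x\<in>A. form a (f x))"
  by (induction A rule: infinite_finite_induct) (auto simp: form_add_right)

lemma form_sum_left: "form (sum f A) b = (\<Sum>x\<in>A. form (f x) b)"
  by (induction A rule: infinite_finite_induct) (auto simp: form_add_left)

lemma form_diff_left: "form (a - b) c = form a c - form b c"
  using form_add_left[of "a - b" b c] by simp

lemma form_1_left: "form 1 b = Poly_Mapping.lookup b 0"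
  using znorm_0 by (simp add: form_def flip: single_one)

text \<open>\<open>zvar k\<close> times the derivative with respect to the variable
  \<open>k\<close>. The truncated subtraction is harmless, since the coefficient vanishes together
  with the exponent.\<close>

definition adj :: "nat \<Rightarrow> polynomial \<Rightarrow> polynomial" where
  "adj k b = (\<Sum>n\<in>Poly_Mapping.keys b. Poly_Mapping.single (n - Poly_Mapping.single k 1)
     (Poly_Mapping.lookup b n * of_nat (Poly_Mapping.lookup n k) * zvar k))"

lemma adj_0 [simp]: "adj k 0 = 0"
  by (simp add: adj_def)

lemma adj_single: "adj k (Poly_Mapping.single n y) =
    Poly_Mapping.single (n - Poly_Mapping.single k 1) (y * of_nat (Poly_Mapping.lookup n k) * zvar k)"
  by (simp add: adj_def)

lemma adj_add: "adj k (a + b) = adj k a + adj k b"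
  unfolding adj_def by (rule setsum_keys_plus_distrib) (simp_all add: algebra_simps single_add)

lemma adj_sum: "adj k (sum f A) = (\<Sum>x\<in>A. adj k (f x))"
  by (induction A rule: infinite_finite_induct) (auto simp: adj_add)

lemma adj_polyconst [simp]: "adj k (polyconst x) = 0"
  by (simp add: polyconst_def adj_single)

lemma adj_polyvar: "adj k (polyvar j) = (if j = k then polyconst (zvar k) else 0)"
  by (simp add: polyvar_def adj_single lookup_single when_def polyconst_def)

lemma adj_mult: "adj k (a * b) = adj k a * b + a * adj k b"
proof (induction a rule: poly_mapping_additive_induct)
  case (single m x)
  show ?case
  proof (induction b rule: poly_mapping_additive_induct)
    case (single n y)
    let ?e = "Poly_Mapping.single k (1 :: nat)"
    have m: "Poly_Mapping.single (m + n - ?e) (x * of_nat (Poly_Mapping.lookup m k) * zvar k * y) =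
        Poly_Mapping.single (m - ?e + n) (x * of_nat (Poly_Mapping.lookup m k) * zvar k * y)"
    proof (cases "Poly_Mapping.lookup m k = 0")
      case False
      then have "m + n - ?e = m - ?e + n"
        by (intro poly_mapping_eqI) (auto simp: lookup_add lookup_minus lookup_single when_def)
      then show ?thesis by simp
    qed simp
    have n: "Poly_Mapping.single (m + n - ?e) (x * (y * of_nat (Poly_Mapping.lookup n k) * zvar k)) =
        Poly_Mapping.single (m + (n - ?e)) (x * (y * of_nat (Poly_Mapping.lookup n k) * zvar k))"
    proof (cases "Poly_Mapping.lookup n k = 0")
      case False
      then have "m + n - ?e = m + (n - ?e)"
        by (intro poly_mapping_eqI) (auto simp: lookup_add lookup_minus lookup_single when_def)
      then show ?thesis by simp
    qed simp
    show ?case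
      unfolding mult_single adj_single m[symmetric] n[symmetric]
      by (simp add: single_add[symmetric] lookup_add algebra_simps)
  qed (simp_all add: adj_add algebra_simps)
qed (simp_all add: adj_add algebra_simps)

lemma form_polyvar_mult: "form (polyvar k * a) b = form a (adj k b)"
proof (induction a rule: poly_mapping_additive_induct)
  case (single m x)
  show ?case
  proof (induction b rule: poly_mapping_additive_induct)
    case (single n y)
    let ?e = "Poly_Mapping.single k (1 :: nat)"
    show ?case
    proof (cases "Poly_Mapping.lookup n k = 0")
      case True
      moreover have "Poly_Mapping.lookup (?e + m) k \<noteq> 0" by (simp add: lookup_add)
      ultimately have "?e + m \<noteq> n" by metis
      then show ?thesis using True by (simp add: polyvar_def mult_single adj_single form_single)
    next
      case False
      then have "?e + m = n \<longleftrightarrow> m = n - ?e"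
        by (force simp: poly_mapping_eq_iff fun_eq_iff lookup_add lookup_minus lookup_single when_def)
      moreover have "znorm n = of_nat (Poly_Mapping.lookup n k) * zvar k * znorm m" if "?e + m = n"
        using znorm_add_single[of m k] that by (auto simp: add.commute lookup_add)
      ultimately show ?thesis by (auto simp: polyvar_def mult_single adj_single form_single)
    qed
  qed (simp_all add: adj_add form_add_right)
qed (simp_all add: form_add_left algebra_simps)

section \<open>Adjoints of multiplication by the elementary functions\<close>

definition signed_kappa :: "nat \<Rightarrow> complex" where
  "signed_kappa k = (- 1) ^ k * kappa (Suc k)"

text \<open>Up to the factor in \<open>adj\<close>, this is the classical derivative of
  \<open>e_r\<close> with respect to \<open>p_n\<close>, namely
  \<open>(-1)^(n-1) e_(r-n) / n\<close>, obtained by applying the derivation to Newton's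
  identity.\<close>

lemma adj_ehat: "adj k (ehat r) = (if k < r then polyconst (signed_kappa k) * ehat (r - Suc k) else 0)"
proof (induction r rule: less_induct)
  case (less r)
  show ?case
  proof (cases r)
    case 0
    then show ?thesis using adj_polyconst[of k 1] by (simp add: polyconst.c_1)
  next
    case (Suc s)
    have N: "polyconst (of_nat (Suc u)) * ehat (Suc u) = (\<Sum>j\<le>u. polyconst ((- 1) ^ j) * (polyvar j * ehat (u - j)))" for u
      using newton_ehat by (simp add: newton_def polyconst.c_of_nat polyconst.c_power polyconst.c_minus polyconst.c_1 mult.assoc del: of_nat_Suc)
    have ac: "adj k (polyconst x * a) = polyconst x * adj k a" for x a by (simp add: adj_mult)
    have "polyconst (of_nat (Suc s)) * adj k (ehat (Suc s)) =
        (\<Sum>j\<le>s. polyconst ((- 1) ^ j) * (adj k (polyvar j) * ehat (s - j) + polyvar j * adj k (ehat (s - j))))"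
      unfolding ac[symmetric] N by (simp only: adj_sum ac adj_mult[of k "polyvar _"])
    also have "\<dots> = (\<Sum>j\<le>s. if j = k then polyconst ((- 1) ^ k * zvar k) * ehat (s - k) else 0) +
        (\<Sum>j\<le>s. if k < s - j then polyconst (signed_kappa k) * (polyconst ((- 1) ^ j) * (polyvar j * ehat (s - j - Suc k))) else 0)"
      unfolding sum.distrib[symmetric]
    proof (intro sum.cong refl)
      fix j assume "j \<in> {..s}"
      then have "s - j < r" using Suc by simp
      then show "polyconst ((- 1) ^ j) * (adj k (polyvar j) * ehat (s - j) + polyvar j * adj k (ehat (s - j))) =
        (if j = k then polyconst ((- 1) ^ k * zvar k) * ehat (s - k) else 0) +
        (if k < s - j then polyconst (signed_kappa k) * (polyconst ((- 1) ^ j) * (polyvar j * ehat (s - j - Suc k))) else 0)"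
        by (simp add: less adj_polyvar polyconst.c_mult algebra_simps)
    qed
    also have "\<dots> = (if k \<le> s then polyconst (of_nat (Suc s)) * (polyconst (signed_kappa k) * ehat (s - k)) else 0)"
    proof (cases "k \<le> s")
      case True
      have "(\<Sum>j\<le>s. if k < s - j then polyconst (signed_kappa k) * (polyconst ((- 1) ^ j) * (polyvar j * ehat (s - j - Suc k))) else 0) =
          polyconst (signed_kappa k) * (polyconst (of_nat (s - k)) * ehat (s - k))"
      proof (cases "k = s")
        case True
        then show ?thesis by (auto simp: polyconst.c_0 intro!: sum.neutral)
      next
        case False
        then obtain u where u: "s - k = Suc u" using \<open>k \<le> s\<close> by (metis Suc_diff_Suc le_neq_implies_less)
        have "(\<Sum>j\<le>s. if k < s - j then polyconst (signed_kappa k) * (polyconst ((- 1) ^ j) * (polyvar j * ehat (s - j - Suc k))) else 0) =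
          (\<Sum>j\<le>u. polyconst (signed_kappa k) * (polyconst ((- 1) ^ j) * (polyvar j * ehat (u - j))))"
        proof (rule sum.mono_neutral_cong_right)
          fix j assume "j \<in> {..u}"
          moreover from this have "s - j - Suc k = u - j" using u by simp
          ultimately show "(if k < s - j then polyconst (signed_kappa k) * (polyconst ((- 1) ^ j) * (polyvar j * ehat (s - j - Suc k))) else 0) =
            polyconst (signed_kappa k) * (polyconst ((- 1) ^ j) * (polyvar j * ehat (u - j)))" using u by simp
        qed (use u in auto)
        then show ?thesis unfolding u N sum_distrib_left .
      qed
      moreover have "(- 1) ^ k * zvar k = of_nat (Suc k) * signed_kappa k" by (simp add: zvar_def signed_kappa_def)
      \<comment> \<open>The share \<open>Suc k\<close> comes from the differentiated power sum, the
        share \<open>s - k\<close> from Newton's identity for \<open>ehat (s - k)\<close>.\<close>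
      moreover have "of_nat (Suc s) = of_nat (Suc k) + (of_nat (s - k) :: complex)"
        using True by (simp flip: of_nat_add)
      ultimately show ?thesis using True
        by (simp only: if_True polyconst.c_mult polyconst.c_add distrib_right distrib_left sum.delta finite_atMost atMost_iff mult_ac)
    qed (auto intro!: sum.neutral)
    finally have "polyconst (1 / of_nat (Suc s)) * (polyconst (of_nat (Suc s)) * adj k (ehat (Suc s))) =
      polyconst (1 / of_nat (Suc s)) * (if k \<le> s then polyconst (of_nat (Suc s)) * (polyconst (signed_kappa k) * ehat (s - k)) else 0)" by simp
    moreover have inv: "polyconst (1 / of_nat (Suc s)) * (polyconst (of_nat (Suc s)) * a) = a" for a
      by (simp only: mult.assoc[symmetric] polyconst.c_mult[symmetric]) (simp add: polyconst.c_1 del: of_nat_Suc)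
    ultimately have "adj k (ehat (Suc s)) = (if k \<le> s then polyconst (signed_kappa k) * ehat (s - k) else 0)"
      by (cases "k \<le> s") (simp_all only: inv if_True if_False mult_zero_right)
    then show ?thesis using Suc by (simp add: less_Suc_eq_le)
  qed
qed

text \<open>The coefficients of this homomorphism are the adjoints of multiplication by \<open>ehat\<close>.\<close>

abbreviation ehat_adjoint :: "polynomial \<Rightarrow> polynomial fps" where
  "ehat_adjoint \<equiv> fps_scalars.lift (\<lambda>k. fps_const (polyvar k) + fps_const (polyconst (signed_kappa k)) * fps_X ^ Suc k)"

text \<open>The property is propagated through multiplication of \<open>b\<close> by a power sum.
  The adjoint of that multiplication is a derivation, and its actions on \<open>ehat r\<close> and
  on \<open>a\<close> match the two summands in the image of the power sum.\<close>

lemma form_ehat_mult: "form (ehat r * a) b = form a (fps_nth (ehat_adjoint b) r)"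
proof -
  define R where "R b \<longleftrightarrow> (\<forall>r a. form (ehat r * a) b = form a (fps_nth (ehat_adjoint b) r))" for b
  have one: "R 1"
    unfolding R_def
  proof (intro allI)
    fix r a
    show "form (ehat r * a) 1 = form a (fps_nth (ehat_adjoint 1) r)"
    proof (cases r)
      case (Suc s)
      have "adj k 1 = 0" for k using adj_polyconst[of k 1] by (simp add: polyconst.c_1)
      then have "form (polyvar k * b) 1 = 0" for k b by (simp add: form_polyvar_mult)
      then have "form (polyconst ((- 1) ^ k) * (polyvar k * b)) 1 = 0" for k b by (simp add: form_scale_left)
      then have z: "form ((- 1) ^ k * polyvar k * b) 1 = 0" for k b
        by (simp add: polyconst.c_power polyconst.c_minus polyconst.c_1 mult.assoc)
      have "form (ehat r * a) 1 = 1 / of_nat (Suc s) * (\<Sum>k\<le>s. form ((- 1) ^ k * polyvar k * (ehat (s - k) * a)) 1)"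
        unfolding Suc ehat.simps(2) mult.assoc form_scale_left sum_distrib_right form_sum_left ..
      then show ?thesis using Suc by (simp add: z fps_scalars.lift_1)
    qed (simp add: fps_scalars.lift_1)
  qed
  have scale: "R (polyconst x * b)" if "R b" for x b
    using that by (simp add: R_def form_scale_right fps_scalars.lift_mult)
  have var: "R (polyvar k * b)" if "R b" for k b
    unfolding R_def
  proof (intro allI)
    fix r a
    have "form (ehat r * a) (polyvar k * b) = form (adj k (ehat r * a)) b"
      by (simp only: form_commute[of "ehat r * a"] form_polyvar_mult form_commute[of b])
    also have "\<dots> = form (adj k (ehat r) * a) b + form (ehat r * adj k a) b"
      by (simp add: adj_mult form_add_left)
    also have "form (adj k (ehat r) * a) b =
        (if k < r then signed_kappa k * form a (fps_nth (ehat_adjoint b) (r - Suc k)) else 0)"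
      using that by (simp add: adj_ehat R_def mult.assoc form_scale_left)
    also have "form (ehat r * adj k a) b = form a (polyvar k * fps_nth (ehat_adjoint b) r)"
    proof -
      have "form (ehat r * adj k a) b = form (fps_nth (ehat_adjoint b) r) (adj k a)"
        using that form_commute[of "adj k a"] by (simp add: R_def)
      then show ?thesis by (simp only: form_polyvar_mult[symmetric] form_commute[of a])
    qed
    also have "(if k < r then signed_kappa k * form a (fps_nth (ehat_adjoint b) (r - Suc k)) else 0) + \<dots> =
        form a (fps_nth (ehat_adjoint (polyvar k * b)) r)"
      by (simp add: fps_scalars.lift_mult distrib_right mult.assoc fps_X_power_mult_nth form_add_right
         form_scale_right del: power_Suc)
    finally show "form (ehat r * a) (polyvar k * b) = form a (fps_nth (ehat_adjoint (polyvar k * b)) r)" .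
  qed
  have add: "R (b + b')" if "R b" "R b'" for b b'
    using that by (simp add: R_def form_add_right fps_scalars.lift_add)
  have "\<forall>b'. R b' \<longrightarrow> R (b * b')"
    by (induction b rule: polynomial_induct) (auto simp: scale var add distrib_right mult.assoc)
  then have "R b" using one by (metis mult.right_neutral)
  then show ?thesis by (simp add: R_def)
qed

text \<open>\<open>ehat_adjoint\<close> changes the power sums as the adjunction of the super
  variable \<open>fps_X\<close> does, so the comparison principle gives one
  \<open>cstep\<close>.\<close>

lemma ehat_adjoint_Phat:
  assumes "is_partition mu"
  shows "fps_nth (ehat_adjoint (Phat mu)) r = (\<Sum>ka\<in>partitions_upto (sum_list mu).
    if sum_list mu - sum_list ka = r then polyconst (cmat mu ka) * Phat ka else 0)"
proof -
  let ?c = "\<lambda>x. fps_const (polyconst x)"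
  have "newton (\<lambda>k. fps_const (polyvar k)) (\<lambda>r. fps_const (ehat r))"
  proof -
    have "of_nat (Suc r) * fps_const (ehat (Suc r)) =
        (\<Sum>k\<le>r. (- 1) ^ k * fps_const (polyvar k) * fps_const (ehat (r - k)))" for r
    proof -
      have "of_nat (Suc r) * fps_const (ehat (Suc r)) = fps_const (of_nat (Suc r) * ehat (Suc r))"
        by (simp only: fps_const_mult[symmetric] fps_of_nat)
      also have "\<dots> = (\<Sum>k\<le>r. fps_const ((- 1) ^ k * polyvar k * ehat (r - k)))"
        using newton_ehat by (simp add: newton_def fps_const_sum)
      also have "\<dots> = (\<Sum>k\<le>r. (- 1) ^ k * fps_const (polyvar k) * fps_const (ehat (r - k)))"
        by (intro sum.cong refl)
           (simp add: fps_const_mult[symmetric] fps_const_power[symmetric] fps_const_neg[symmetric]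
             del: fps_const_mult fps_const_power fps_const_neg)
      finally show ?thesis .
    qed
    then show ?thesis by (simp add: newton_def)
  qed
  from newton_mult[OF this newton_Phi[OF fps_scalars.scalar_hom_axioms, of fps_X]]
  have n: "newton (\<lambda>k. fps_const (polyvar k) + ?c (signed_kappa k) * fps_X ^ Suc k)
      (\<lambda>r. \<Sum>i\<le>r. fps_const (ehat i) * (?c (Phi (r - i)) * fps_X ^ (r - i)))"
    by (simp add: signed_kappa_def)
  have "pieri ?c (\<lambda>r. fps_const (ehat r)) (\<lambda>lam. fps_const (Phat lam))"
    using pieri_Phat unfolding pieri_def
    by (simp add: fps_const_mult[symmetric] fps_const_sum[symmetric] del: fps_const_mult) (simp add: fps_const_sum)
  from pieri_cstep[OF fps_scalars.scalar_hom_axioms this, of fps_X]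
  have "ehat_adjoint (Phat mu) = cstep ?c fps_X (\<lambda>lam. fps_const (Phat lam)) mu"
    by (rule lift_Phat[OF fps_scalars.scalar_hom_axioms _ n assms])
  then have "fps_nth (ehat_adjoint (Phat mu)) r = (\<Sum>ka\<in>partitions_upto (sum_list mu).
      fps_nth (?c (cmat mu ka) * (fps_X ^ (sum_list mu - sum_list ka) * fps_const (Phat ka))) r)"
    by (simp only: cstep_def fps_sum_nth mult.assoc)
  also have "\<dots> = (\<Sum>ka\<in>partitions_upto (sum_list mu).
      if sum_list mu - sum_list ka = r then polyconst (cmat mu ka) * Phat ka else 0)"
    by (intro sum.cong refl) (auto simp: fps_X_power_mult_nth)
  finally show ?thesis .
qed

text \<open>The constant term is the evaluation at vanishing power sums, that is, in no variables at
  all.\<close>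

lemma lookup_Phat_0: "is_partition mu \<Longrightarrow> Poly_Mapping.lookup (Phat mu) 0 = (if mu = [] then 1 else 0)"
proof -
  have z: "complex_scalars.lift (\<lambda>k. 0) a = Poly_Mapping.lookup a 0" for a
  proof (induction a rule: poly_mapping_additive_induct)
    case (single m x)
    have "mon (\<lambda>k. 0 :: complex) m = (if m = 0 then 1 else 0)"
    proof (cases "m = 0")
      case False
      then obtain k where "Poly_Mapping.lookup m k \<noteq> 0" by (metis poly_mapping_eqI lookup_zero)
      then show ?thesis using False by (auto simp: mon_def in_keys_iff)
    qed simp
    then show ?case by (simp add: lookup_single when_def)
  qed (simp_all add: complex_scalars.lift_add lookup_add)
  assume "is_partition mu"
  from lift_Phat[OF complex_scalars.scalar_hom_axioms pieri_one[OF complex_scalars.scalar_hom_axioms] newton_one this]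
  show ?thesis by (simp add: z)
qed

text \<open>Pair the recursion for \<open>Phat lam\<close> with \<open>Phat mu\<close>. The leading
  product gives \<open>emat (drop_column lam) mu / bnorm mu\<close>, because the norm of the dropped
  shape cancels in \<open>cmat\<close>; the subtracted terms remove the \<open>mu\<close> with more
  parts than \<open>lam\<close>. Of the remaining shapes only \<open>lam\<close> is a vertical strip
  over \<open>drop_column lam\<close>.\<close>

lemma form_Phat:
  assumes "is_partition lam" "is_partition mu"
  shows "form (Phat lam) (Phat mu) = (if lam = mu then 1 / bnorm lam else 0)"
  using assms
proof (induction lam arbitrary: mu rule: Phat_induct)
  case Nil
  then show ?case by (simp add: form_1_left lookup_Phat_0 bnorm_def)
next
  case (step lam)
  let ?n = "length lam" and ?d = "drop_column lam"
  note d = drop_column[OF step.hyps(1)]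
  have n: "?n > 0" using step.hyps by simp
  have "form (ehat ?n * Phat ?d) (Phat mu) = (\<Sum>ka\<in>partitions_upto (sum_list mu).
      if sum_list mu - sum_list ka = ?n then cmat mu ka * form (Phat ?d) (Phat ka) else 0)"
    unfolding form_ehat_mult ehat_adjoint_Phat[OF step.prems] form_sum_right
    by (intro sum.cong refl) (simp add: form_scale_right)
  also have "\<dots> = (\<Sum>ka\<in>partitions_upto (sum_list mu).
      if ka = ?d then (if sum_list mu - sum_list ?d = ?n then cmat mu ?d / bnorm ?d else 0) else 0)"
    by (intro sum.cong refl) (auto simp: step.IH(1) partitions_upto_def)
  also have "\<dots> = (if sum_list mu = sum_list lam then emat ?d mu / bnorm mu else 0)"
  proof -
    have "sum_list mu - sum_list ?d = ?n \<and> ?d \<in> partitions_upto (sum_list mu) \<longleftrightarrow> sum_list mu = sum_list lam"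
      using d n by (auto simp: partitions_upto_def)
    then show ?thesis using bnorm_nonzero[of ?d] by (auto simp: sum.delta[OF finite_partitions_upto] cmat_def)
  qed
  finally have 1: "form (ehat ?n * Phat ?d) (Phat mu) = (if sum_list mu = sum_list lam then emat ?d mu / bnorm mu else 0)" .
  have "form (\<Sum>ka\<in>longer lam. polyconst (emat ?d ka) * Phat ka) (Phat mu) =
      (\<Sum>ka\<in>longer lam. if ka = mu then emat ?d mu / bnorm mu else 0)"
    unfolding form_sum_left form_scale_left
    by (intro sum.cong refl) (use step.IH(2)[OF _ step.prems] in auto)
  then have 2: "form (\<Sum>ka\<in>longer lam. polyconst (emat ?d ka) * Phat ka) (Phat mu) =
      (if mu \<in> longer lam then emat ?d mu / bnorm mu else 0)"
    by (simp add: sum.delta[OF finite_longer])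
  have "Phat lam = ehat ?n * Phat ?d - (\<Sum>ka\<in>longer lam. polyconst (emat ?d ka) * Phat ka)"
    using step.hyps by (subst Phat.simps) simp
  then have *: "form (Phat lam) (Phat mu) = (if sum_list mu = sum_list lam \<and> \<not> ?n < length mu then emat ?d mu / bnorm mu else 0)"
    using step.prems by (simp only: form_diff_left 1 2) (simp add: longer_def)
  show ?case
  proof (cases "lam = mu")
    case True
    then show ?thesis using * step.hyps by simp
  next
    case False
    then have "emat ?d mu = 0" if "sum_list mu = sum_list lam" "\<not> ?n < length mu"
      using that vstrip_drop_column[OF step.hyps(1) step.prems] emat_nonzeroD(1)[of ?d mu] by auto
    then show ?thesis using * False by auto
  qed
qed

end

section \<open>Macdonald functions and the Sergeev--Veselov homomorphism\<close>

definition pexp :: "nat list \<Rightarrow> (nat \<Rightarrow>\<^sub>0 nat)" where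
  "pexp lam = (\<Sum>r\<leftarrow>lam. Poly_Mapping.single (r - 1) 1)"

lemma lookup_pexp: "0 \<notin> set lam \<Longrightarrow> Poly_Mapping.lookup (pexp lam) k = count_list lam (Suc k)"
proof (induction lam)
  case (Cons r lam)
  then have "r - 1 = k \<longleftrightarrow> r = Suc k" by auto
  with Cons show ?case by (simp add: pexp_def lookup_add lookup_single when_def)
qed (simp add: pexp_def)

lemma ev_pexp: "0 \<notin> set lam \<Longrightarrow> ev (Poly_Mapping.single (pexp lam) 1) = power_sum_partition lam"
proof (induction lam)
  case (Cons r lam)
  have "Poly_Mapping.single (pexp (r # lam)) 1 = polyvar (r - 1) * (Poly_Mapping.single (pexp lam) 1 :: polynomial)"
    by (simp add: pexp_def polyvar_def mult_single)
  then show ?case using Cons by (simp add: ev_mult ev_polyvar power_sum_partition_def)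
qed (simp add: pexp_def power_sum_partition_def ev_one)

lemma pexp_inject:
  assumes "is_partition lam" "is_partition mu" "pexp lam = pexp mu"
  shows "lam = mu"
proof (rule partition_mset_eqI[OF assms(1,2)])
  have z: "0 \<notin> set lam" "0 \<notin> set mu" using assms by (auto simp: is_partition_def)
  show "mset lam = mset mu"
  proof (rule multiset_eqI)
    fix r
    show "count (mset lam) r = count (mset mu) r"
    proof (cases r)
      case 0
      then show ?thesis using z count_mset_0_iff by metis
    next
      case (Suc k)
      then show ?thesis using lookup_pexp[OF z(1)] lookup_pexp[OF z(2)] assms(3) by (simp add: count_mset)
    qed
  qed
qed

lemma ex_pexp: "\<exists>lam. is_partition lam \<and> pexp lam = m"
proof -
  define lam where "lam = rev (sorted_list_of_multiset (psum_parts m))"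
  have "sorted_wrt (\<ge>) lam" by (simp add: lam_def sorted_wrt_rev)
  moreover have z: "0 \<notin> set lam" using zero_notin_psum_parts by (simp add: lam_def)
  moreover have "pexp lam = m"
  proof (rule poly_mapping_eqI)
    fix k
    have "mset lam = psum_parts m" by (simp add: lam_def)
    then show "Poly_Mapping.lookup (pexp lam) k = Poly_Mapping.lookup m k"
      unfolding lookup_pexp[OF z] by (metis count_mset count_psum_parts)
  qed
  ultimately show ?thesis by (auto simp: is_partition_def)
qed

lemma prod_list_count:
  fixes f :: "'a \<Rightarrow> 'b::comm_monoid_mult"
  assumes "finite A" "set l \<subseteq> A"
  shows "(\<Prod>r\<leftarrow>l. f r) = (\<Prod>r\<in>A. f r ^ count_list l r)"
  using assms(2)
proof (induction l)
  case (Cons x l)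
  have "(\<Prod>r\<in>A. f r ^ count_list (x # l) r) = (\<Prod>r\<in>A. (if r = x then f x else 1) * f r ^ count_list l r)"
    by (intro prod.cong refl) auto
  also have "\<dots> = f x * (\<Prod>r\<leftarrow>l. f r)"
    using Cons assms(1) by (simp add: prod.distrib prod.delta)
  finally show ?case by simp
qed simp

context macdonald_parameters
begin

lemma znorm_pexp:
  assumes "0 \<notin> set lam"
  shows "znorm (pexp lam) = macdonald_norm q t lam"
proof -
  have k: "set lam = Suc ` Poly_Mapping.keys (pexp lam)"
  proof -
    have "r \<in> set lam \<longleftrightarrow> r \<in> Suc ` Poly_Mapping.keys (pexp lam)" for r
      using assms by (cases r) (auto simp: in_keys_iff lookup_pexp[OF assms] count_list_0_iff)
    then show ?thesis by blast
  qed
  have "macdonald_norm q t lam = (\<Prod>r\<in>set lam. of_nat (r ^ count_list lam r * fact (count_list lam r)) *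
      kappa r ^ count_list lam r)"
    by (simp add: macdonald_norm_def kappa_def prod_list_count[of "set lam" lam] prod.distrib)
  also have "\<dots> = znorm (pexp lam)"
    unfolding k znorm_def
    by (subst prod.reindex) (auto simp: zvar_def lookup_pexp[OF assms] power_mult_distrib mult_ac intro!: prod.cong)
  finally show ?thesis ..
qed

section \<open>Existence and uniqueness of the bilinear form\<close>

definition unev :: "series \<Rightarrow> polynomial" where
  "unev f = (SOME a. ev a = f)"

lemma unev_ev [simp]: "unev (ev a) = a"
  by (metis (mono_tags, lifting) unev_def ev_inject someI)

lemma ev_unev [simp]: "f \<in> symmetric_functions \<Longrightarrow> ev (unev f) = f"
  using range_ev by (metis rangeE unev_ev)

lemma unev_hom:
  assumes "f \<in> symmetric_functions" "h \<in> symmetric_functions"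
  shows "unev (series_add f h) = unev f + unev h" "unev (series_mult f h) = unev f * unev h"
    "unev (series_scale c f) = polyconst c * unev f"
  by (metis assms ev_add ev_mult ev_scale ev_unev unev_ev)+

definition form_properties :: "(series \<times> series \<Rightarrow> complex) \<Rightarrow> bool" where
  "form_properties B \<longleftrightarrow> B \<in> extensional (symmetric_functions \<times> symmetric_functions) \<and>
     (\<forall>f\<in>symmetric_functions. \<forall>g\<in>symmetric_functions. \<forall>h\<in>symmetric_functions. \<forall>c.
        B (series_add f g, h) = B (f, h) + B (g, h) \<and>
        B (h, series_add f g) = B (h, f) + B (h, g) \<and>
        B (series_scale c f, h) = c * B (f, h) \<and>
        B (h, series_scale c f) = c * B (h, f)) \<and>
     (\<forall>lam mu. is_partition lam \<longrightarrow> is_partition mu \<longrightarrow>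
        B (power_sum_partition lam, power_sum_partition mu) =
          (if lam = mu then macdonald_norm q t lam else 0))"

text \<open>Bilinearity reduces the claim to monomials in the power sums, which are exactly the
  products indexed by partitions. Hence the specification admits at most one form.\<close>

lemma form_properties_ev:
  assumes "form_properties B"
  shows "B (ev a, ev b) = form a b"
proof -
  have add: "B (ev (a + a'), ev b) = B (ev a, ev b) + B (ev a', ev b)"
    "B (ev b, ev (a + a')) = B (ev b, ev a) + B (ev b, ev a')" for a a' b
    using assms ev_symmetric unfolding form_properties_def ev_add by blast+
  have scale: "B (ev (polyconst x * a), ev b) = x * B (ev a, ev b)"
    "B (ev b, ev (polyconst x * a)) = x * B (ev b, ev a)" for x a b
    using assms ev_symmetric unfolding form_properties_def ev_scale by blast+
  have z: "B (ev 0, ev b) = 0" "B (ev b, ev 0) = 0" for b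
    using scale(1)[of 0 0 b] scale(2)[of b 0 0] by simp_all
  have base: "B (ev (Poly_Mapping.single m 1), ev (Poly_Mapping.single n 1)) = form (Poly_Mapping.single m 1) (Poly_Mapping.single n 1)" for m n
  proof -
    obtain lam mu where lm: "is_partition lam" "pexp lam = m" "is_partition mu" "pexp mu = n"
      using ex_pexp by metis
    then have p: "0 \<notin> set lam" "0 \<notin> set mu" by (auto simp: is_partition_def)
    have "m = n \<longleftrightarrow> lam = mu" using pexp_inject[of lam mu] lm by auto
    moreover have "B (power_sum_partition lam, power_sum_partition mu) = (if lam = mu then macdonald_norm q t lam else 0)"
      using assms lm by (simp add: form_properties_def)
    ultimately show ?thesis
      using znorm_pexp[OF p(1)] ev_pexp[OF p(1)] ev_pexp[OF p(2)] lm(2,4) by (simp add: form_single)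
  qed
  show ?thesis
  proof (induction a rule: poly_mapping_additive_induct)
    case (single m x)
    show ?case
    proof (induction b rule: poly_mapping_additive_induct)
      case (single n y)
      show ?case
        unfolding single_eq_polyconst_mult[of m x] single_eq_polyconst_mult[of n y]
        by (simp only: scale form_scale_left form_scale_right base)
    qed (simp_all add: z add form_add_right)
  qed (simp_all add: z add form_add_left)
qed

lemma macdonald_form_ev: "macdonald_form q t (ev a, ev b) = form a b"
proof -
  let ?S = "symmetric_functions \<times> symmetric_functions"
  let ?B = "restrict (\<lambda>(f, g). form (unev f) (unev g)) ?S"
  have pp: "power_sum_partition lam \<in> symmetric_functions" "unev (power_sum_partition lam) = Poly_Mapping.single (pexp lam) 1"
    if "is_partition lam" for lam
  proof -
    have "power_sum_partition lam = ev (Poly_Mapping.single (pexp lam) 1)"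
      using that ev_pexp[of lam] by (simp add: is_partition_def)
    then show "power_sum_partition lam \<in> symmetric_functions" "unev (power_sum_partition lam) = Poly_Mapping.single (pexp lam) 1"
      by (simp_all add: ev_symmetric)
  qed
  have P: "form_properties ?B"
    unfolding form_properties_def
  proof (intro conjI ballI allI impI)
    fix lam mu assume lm: "is_partition lam" "is_partition mu"
    then have "0 \<notin> set lam" by (simp add: is_partition_def)
    then show "?B (power_sum_partition lam, power_sum_partition mu) = (if lam = mu then macdonald_norm q t lam else 0)"
      using pexp_inject[OF lm] lm by (auto simp: pp form_single znorm_pexp)
  qed (simp_all add: series_add_symmetric series_scale_symmetric unev_hom form_add_left form_add_right
      form_scale_left form_scale_right)
  have "macdonald_form q t = (THE B. form_properties B)"
    by (simp only: macdonald_form_def form_properties_def)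
  moreover have "form_properties (THE B. form_properties B)"
  proof (rule theI[where P = form_properties and a = ?B, OF P])
    fix B assume B: "form_properties B"
    show "B = ?B"
    proof (rule extensionalityI[of _ ?S])
      fix z assume "z \<in> ?S"
      then show "B z = ?B z"
        using form_properties_ev[OF B] by (auto simp flip: range_ev)
    qed (use B in \<open>auto simp: form_properties_def\<close>)
  qed
  ultimately show ?thesis by (simp only: form_properties_ev)
qed

section \<open>Existence and uniqueness of the Macdonald family\<close>

definition P_properties :: "(nat list \<Rightarrow> series) \<Rightarrow> bool" where
  "P_properties P \<longleftrightarrow> P \<in> extensional {lam. is_partition lam} \<and>
     (\<forall>lam. is_partition lam \<longrightarrow>
        (\<exists>u :: nat list \<Rightarrow> complex. P lam = (\<lambda>m. monomial_symmetric lam m +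
           (\<Sum>mu\<in>{mu. is_partition mu \<and> dominated mu lam \<and> mu \<noteq> lam}.
              u mu * monomial_symmetric mu m)))) \<and>
     (\<forall>lam mu. is_partition lam \<longrightarrow> is_partition mu \<longrightarrow> lam \<noteq> mu \<longrightarrow>
        macdonald_form q t (P lam, P mu) = 0)"

abbreviation below :: "nat list \<Rightarrow> nat list set" where
  "below lam \<equiv> {mu. is_partition mu \<and> dominated mu lam \<and> mu \<noteq> lam}"

definition spanned :: "nat list \<Rightarrow> polynomial \<Rightarrow> bool" where
  "spanned lam a \<longleftrightarrow> (\<exists>v. a = (\<Sum>ka\<in>below lam. polyconst (v ka) * Phat ka))"

lemma spanned_add: "spanned lam a \<Longrightarrow> spanned lam b \<Longrightarrow> spanned lam (a + b)"
proof -
  assume "spanned lam a" "spanned lam b"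
  then obtain v w where "a = (\<Sum>ka\<in>below lam. polyconst (v ka) * Phat ka)"
    "b = (\<Sum>ka\<in>below lam. polyconst (w ka) * Phat ka)" by (auto simp: spanned_def)
  then have "a + b = (\<Sum>ka\<in>below lam. polyconst (v ka + w ka) * Phat ka)"
    by (simp add: polyconst.c_add distrib_right sum.distrib)
  then show ?thesis unfolding spanned_def by (intro exI[of _ "\<lambda>ka. v ka + w ka"])
qed

lemma spanned_scale: "spanned lam a \<Longrightarrow> spanned lam (polyconst x * a)"
proof -
  assume "spanned lam a"
  then obtain v where "a = (\<Sum>ka\<in>below lam. polyconst (v ka) * Phat ka)" by (auto simp: spanned_def)
  then have "polyconst x * a = (\<Sum>ka\<in>below lam. polyconst (x * v ka) * Phat ka)"
    by (simp add: polyconst.c_mult sum_distrib_left mult.assoc)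
  then show ?thesis unfolding spanned_def by (intro exI[of _ "\<lambda>ka. x * v ka"])
qed

lemma spanned_0: "spanned lam 0"
  unfolding spanned_def by (rule exI[of _ "\<lambda>_. 0"]) (simp add: polyconst.c_0)

lemma spanned_sum: "(\<And>x. x \<in> A \<Longrightarrow> spanned lam (f x)) \<Longrightarrow> spanned lam (sum f A)"
  by (induction A rule: infinite_finite_induct) (auto intro: spanned_add spanned_0)

lemma spanned_diff: "spanned lam a \<Longrightarrow> spanned lam b \<Longrightarrow> spanned lam (a - b)"
  using spanned_add[OF _ spanned_scale[of lam b "- 1"], of a] by (simp add: polyconst.c_minus polyconst.c_1)

lemma spanned_Phat:
  assumes "ka \<in> below lam"
  shows "spanned lam (Phat ka)"
proof -
  have "(\<Sum>mu\<in>below lam. polyconst (if mu = ka then 1 else 0) * Phat mu) = (\<Sum>mu\<in>below lam. if mu = ka then Phat ka else 0)"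
    by (intro sum.cong refl) (simp add: polyconst.c_0 polyconst.c_1)
  also have "\<dots> = Phat ka" unfolding sum.delta[OF finite_dominated] using assms by (rule if_P)
  finally have "Phat ka = (\<Sum>mu\<in>below lam. polyconst (if mu = ka then 1 else 0) * Phat mu)" ..
  then show ?thesis unfolding spanned_def by (intro exI[of _ "\<lambda>mu. if mu = ka then 1 else 0"])
qed

lemma below_trans:
  assumes "is_partition lam" "mu \<in> below lam" "ka \<in> below mu"
  shows "ka \<in> below lam"
proof -
  have "dominated ka lam" using assms unfolding mem_Collect_eq dominated_rlen by (metis order_trans)
  moreover have "ka \<noteq> lam" using assms dominated_antisym[of lam mu] by auto
  ultimately show ?thesis using assms by auto
qed

lemma monomial_symmetric_symmetric: "is_partition mu \<Longrightarrow> monomial_symmetric mu \<in> symmetric_functions"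
  using monomial_symmetric_in_range_ev ev_symmetric by metis

lemma unev_expansion:
  assumes "is_partition lam"
  assumes "f \<in> symmetric_functions"
    "\<And>m. f m = monomial_symmetric lam m + (\<Sum>mu\<in>below lam. u mu * monomial_symmetric mu m)"
  shows "unev f = unev (monomial_symmetric lam) + (\<Sum>mu\<in>below lam. polyconst (u mu) * unev (monomial_symmetric mu))"
proof (rule ev_inject, rule ext)
  fix m
  have "ev (\<Sum>mu\<in>below lam. polyconst (u mu) * unev (monomial_symmetric mu)) m = (\<Sum>mu\<in>below lam. u mu * monomial_symmetric mu m)"
    unfolding ev_sum ev_polyconst_mult by (intro sum.cong refl) (simp add: monomial_symmetric_symmetric)
  then show "ev (unev f) m = ev (unev (monomial_symmetric lam) + (\<Sum>mu\<in>below lam. polyconst (u mu) * unev (monomial_symmetric mu))) m"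
    using assms by (simp add: ev_add series_add_def monomial_symmetric_symmetric)
qed

lemma spanned_monomial_symmetric:
  assumes lam: "is_partition lam" and "mu \<in> below lam"
  shows "spanned lam (unev (monomial_symmetric mu))"
  using assms(2)
proof (induction "dominance_rank mu" arbitrary: mu rule: less_induct)
  case less
  then have mu: "is_partition mu" by simp
  have sub: "spanned lam (unev (monomial_symmetric ka))" if "ka \<in> below mu" for ka
    using less.hyps[OF _ below_trans[OF lam less.prems that]] dominance_rank_less[of ka mu] that mu by auto
  have "Phat mu = unev (monomial_symmetric mu) +
      (\<Sum>ka\<in>below mu. polyconst (ev (Phat mu) (mono_exp ka)) * unev (monomial_symmetric ka))"
    using unev_expansion[OF mu ev_symmetric ev_Phat_triangular[OF mu]] by simp
  then have "unev (monomial_symmetric mu) = Phat mu -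
      (\<Sum>ka\<in>below mu. polyconst (ev (Phat mu) (mono_exp ka)) * unev (monomial_symmetric ka))"
    by (simp add: algebra_simps)
  then show ?case
    using spanned_diff[OF spanned_Phat[OF less.prems] spanned_sum[of "below mu"]] spanned_scale sub by simp
qed

text \<open>A candidate and \<open>Phat lam\<close> share the leading monomial function, so their
  difference is a combination of the \<open>Phat mu\<close> with \<open>mu\<close> below
  \<open>lam\<close>. By induction it is orthogonal to each of these, and their squared norms are
  nonzero.\<close>

lemma P_properties_unique:
  assumes P: "P_properties P" and "is_partition lam"
  shows "P lam = ev (Phat lam)"
  using assms(2)
proof (induction "dominance_rank lam" arbitrary: lam rule: less_induct)
  case less
  note lam = less.prems
  obtain u where u: "P lam = (\<lambda>m. monomial_symmetric lam m + (\<Sum>mu\<in>below lam. u mu * monomial_symmetric mu m))"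
    using P lam unfolding P_properties_def by blast
  define a where "a = unev (monomial_symmetric lam) + (\<Sum>mu\<in>below lam. polyconst (u mu) * unev (monomial_symmetric mu))"
  have eva: "ev a = P lam"
  proof
    fix m
    have "ev (\<Sum>mu\<in>below lam. polyconst (u mu) * unev (monomial_symmetric mu)) m = (\<Sum>mu\<in>below lam. u mu * monomial_symmetric mu m)"
      unfolding ev_sum ev_polyconst_mult by (intro sum.cong refl) (simp add: monomial_symmetric_symmetric)
    then show "ev a m = P lam m"
      using lam by (simp add: u a_def ev_add series_add_def monomial_symmetric_symmetric)
  qed
  define b where "b = (\<Sum>ka\<in>below lam. polyconst (ev (Phat lam) (mono_exp ka)) * unev (monomial_symmetric ka))"
  have "Phat lam = unev (monomial_symmetric lam) + b"
    using unev_expansion[OF lam ev_symmetric ev_Phat_triangular[OF lam]] by (simp add: b_def)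
  then have "a - Phat lam = (\<Sum>mu\<in>below lam. polyconst (u mu) * unev (monomial_symmetric mu)) - b"
    by (simp add: a_def)
  then have "spanned lam (a - Phat lam)"
    using spanned_diff[OF spanned_sum[of "below lam"] spanned_sum[of "below lam"]] spanned_scale
      spanned_monomial_symmetric[OF lam] by (simp add: b_def)
  then obtain v where v: "a - Phat lam = (\<Sum>ka\<in>below lam. polyconst (v ka) * Phat ka)" by (auto simp: spanned_def)
  have "v mu = 0" if mu: "mu \<in> below lam" for mu
  proof -
    have pm: "is_partition mu" "mu \<noteq> lam" using mu by auto
    have "P mu = ev (Phat mu)" using less.hyps dominance_rank_less[of mu lam] mu lam by auto
    then have "form a (Phat mu) = macdonald_form q t (P lam, P mu)" by (simp add: macdonald_form_ev flip: eva)
    also have "\<dots> = 0" using P lam pm unfolding P_properties_def by blast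
    finally have "form (a - Phat lam) (Phat mu) = 0" using lam pm by (simp add: form_diff_left form_Phat)
    moreover have "form (a - Phat lam) (Phat mu) = (\<Sum>ka\<in>below lam. if ka = mu then v mu / bnorm mu else 0)"
      unfolding v form_sum_left form_scale_left by (intro sum.cong refl) (use pm form_Phat in auto)
    ultimately show ?thesis unfolding sum.delta[OF finite_dominated] using mu by simp
  qed
  then have "a = Phat lam" using v by (simp add: polyconst.c_0)
  then show ?case using eva by simp
qed

lemma macdonald_P_Phat: "is_partition lam \<Longrightarrow> macdonald_P q t lam = ev (Phat lam)"
proof -
  let ?P = "restrict (\<lambda>lam. ev (Phat lam)) {lam. is_partition lam}"
  have P: "P_properties ?P"
    unfolding P_properties_def
  proof (intro conjI allI impI)
    fix lam assume lam: "is_partition lam"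
    show "\<exists>u. ?P lam = (\<lambda>m. monomial_symmetric lam m + (\<Sum>mu\<in>below lam. u mu * monomial_symmetric mu m))"
    proof (intro exI ext)
      fix m
      have "?P lam m = ev (Phat lam) m" using lam by simp
      then show "?P lam m = monomial_symmetric lam m +
          (\<Sum>mu\<in>below lam. ev (Phat lam) (mono_exp mu) * monomial_symmetric mu m)"
        by (rule trans[OF _ ev_Phat_triangular[OF lam]])
    qed
  qed (simp_all add: macdonald_form_ev form_Phat)
  have "macdonald_P q t = (THE P. P_properties P)"
    by (simp only: macdonald_P_def P_properties_def)
  moreover have "P_properties (THE P. P_properties P)"
  proof (rule theI[where P = P_properties and a = ?P, OF P])
    fix P' assume P': "P_properties P'"
    show "P' = ?P"
      by (rule extensionalityI[of _ "{lam. is_partition lam}"])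
         (use P' P_properties_unique[OF P'] in \<open>auto simp: P_properties_def\<close>)
  qed
  ultimately have "P_properties (macdonald_P q t)" by (simp only:)
  then show "is_partition lam \<Longrightarrow> macdonald_P q t lam = ev (Phat lam)" by (rule P_properties_unique)
qed

section \<open>Existence and uniqueness of the Sergeev--Veselov homomorphism\<close>

definition super_psum :: "nat \<Rightarrow> nat \<Rightarrow> nat \<Rightarrow> polynomial" where
  "super_psum N M k = (\<Sum>i=1..N. polyvar i ^ Suc k) +
     polyconst ((1 - q ^ Suc k) / (1 - inverse t ^ Suc k)) * (\<Sum>j=1..M. polyvar (N + j) ^ Suc k)"

definition sv_properties :: "nat \<Rightarrow> nat \<Rightarrow> (series \<Rightarrow> polynomial) \<Rightarrow> bool" where
  "sv_properties N M \<phi> \<longleftrightarrow> \<phi> \<in> extensional symmetric_functions \<and>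
     (\<forall>f\<in>symmetric_functions. \<forall>g\<in>symmetric_functions.
        \<phi> (series_add f g) = \<phi> f + \<phi> g \<and> \<phi> (series_mult f g) = \<phi> f * \<phi> g) \<and>
     (\<forall>c. \<forall>f\<in>symmetric_functions. \<phi> (series_scale c f) = polyconst c * \<phi> f) \<and>
     \<phi> series_one = 1 \<and>
     (\<forall>r\<ge>1. \<phi> (power_sum r) = (\<Sum>i=1..N. polyvar i ^ r) +
        polyconst ((1 - q ^ r) / (1 - inverse t ^ r)) * (\<Sum>j=1..M. polyvar (N + j) ^ r))"

lemma sv_properties_ev:
  assumes "sv_properties N M \<phi>"
  shows "\<phi> (ev a) = polyconst.lift (super_psum N M) a"
proof (induction a rule: polynomial_induct)
  case (const x)
  have "ev (polyconst x) = series_scale x series_one" using ev_scale[of x 1] by (simp add: ev_one)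
  then show ?case using assms series_one_symmetric by (simp add: sv_properties_def)
next
  case (var k)
  have "1 \<le> Suc k" by simp
  then show ?case using assms unfolding sv_properties_def super_psum_def ev_polyvar polyconst.lift_polyvar by blast
next
  case (add a b)
  then show ?case using assms by (simp add: sv_properties_def ev_add ev_symmetric polyconst.lift_add)
next
  case (mult a b)
  then show ?case using assms by (simp add: sv_properties_def ev_mult ev_symmetric polyconst.lift_mult)
qed

lemma sv_hom_ev: "sv_hom N M q t (ev a) = polyconst.lift (super_psum N M) a"
proof -
  let ?\<phi> = "restrict (\<lambda>f. polyconst.lift (super_psum N M) (unev f)) symmetric_functions"
  have one: "unev series_one = 1" using unev_ev[of 1] by (simp only: ev_one)
  have P: "sv_properties N M ?\<phi>"
    unfolding sv_properties_def
  proof (intro conjI ballI allI impI)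
    fix r :: nat assume "1 \<le> r"
    then obtain k where r: "r = Suc k" by (cases r) auto
    have "unev (power_sum r) = polyvar k" using unev_ev[of "polyvar k"] by (simp only: ev_polyvar r)
    then show "?\<phi> (power_sum r) = (\<Sum>i=1..N. polyvar i ^ r) +
        polyconst ((1 - q ^ r) / (1 - inverse t ^ r)) * (\<Sum>j=1..M. polyvar (N + j) ^ r)"
      unfolding r by (simp only: restrict_apply power_sum_symmetric if_True polyconst.lift_polyvar super_psum_def)
  qed (simp_all add: series_add_symmetric series_mult_symmetric series_scale_symmetric series_one_symmetric
      unev_hom polyconst.lift_add polyconst.lift_mult one)
  have "sv_hom N M q t = (THE \<phi>. sv_properties N M \<phi>)"
    by (simp only: sv_hom_def sv_properties_def)
  moreover have "sv_properties N M (THE \<phi>. sv_properties N M \<phi>)"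
  proof (rule theI[where P = "sv_properties N M" and a = ?\<phi>, OF P])
    fix \<phi> assume \<phi>: "sv_properties N M \<phi>"
    show "\<phi> = ?\<phi>"
    proof (rule extensionalityI[of _ symmetric_functions])
      fix f assume f: "f \<in> symmetric_functions"
      then show "\<phi> f = ?\<phi> f" using sv_properties_ev[OF \<phi>, of "unev f"] by simp
    qed (use \<phi> in \<open>auto simp: sv_properties_def\<close>)
  qed
  ultimately show ?thesis by (simp only: sv_properties_ev)
qed

lemma super_macdonald_lift:
  "is_partition lam \<Longrightarrow> super_macdonald N M q t lam = polyconst.lift (super_psum N M) (Phat lam)"
  by (simp add: super_macdonald_def macdonald_P_Phat sv_hom_ev)

end

section \<open>Quantum corner polynomials by branching\<close>

lemma Suc_in_diagram [simp]: "(Suc i, Suc j) \<in> diagram lam \<longleftrightarrow> j < rlen lam i"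
  by (auto simp: diagram_def rlen_nth)

lemma zero_notin_diagram [simp]: "(0, j) \<notin> diagram lam" "(i, 0) \<notin> diagram lam"
  by (auto simp: diagram_def)

lemma in_diagramE:
  assumes "s \<in> diagram lam"
  obtains i j where "s = (Suc i, Suc j)" "j < rlen lam i"
  using assms by (cases s; cases "fst s"; cases "snd s") auto

lemma diagram_subset_iff: "diagram mu \<subseteq> diagram lam \<longleftrightarrow> (\<forall>i. rlen mu i \<le> rlen lam i)"
proof
  assume sub: "diagram mu \<subseteq> diagram lam"
  have "j < rlen lam i" if "j < rlen mu i" for i j
    using subsetD[OF sub, of "(Suc i, Suc j)"] that by simp
  then show "\<forall>i. rlen mu i \<le> rlen lam i" by (meson not_less order_refl)
next
  assume le: "\<forall>i. rlen mu i \<le> rlen lam i"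
  show "diagram mu \<subseteq> diagram lam"
    using le by (auto elim!: in_diagramE) (meson less_le_trans)
qed

lemma shape_diagram:
  assumes "is_partition mu"
  shows "shape (diagram mu) = mu"
  unfolding shape_def
proof (rule the_equality)
  fix la assume la: "is_partition la \<and> diagram la = diagram mu"
  then have "rlen la i = rlen mu i" for i
    using diagram_subset_iff[of la mu] diagram_subset_iff[of mu la] by (simp add: antisym)
  then show "la = mu" using la assms by (intro partition_eqI) auto
qed (use assms in simp)

lemma card_diagram: "card (diagram lam) = sum_list lam"
proof -
  have "card (diagram lam) = card (SIGMA i:{..<length lam}. {..<rlen lam i})"
    unfolding diagram_rows by (intro card_image) (auto simp: inj_on_def)
  then show ?thesis by (simp add: sum_list_rlen[of lam "length lam"])
qed

lemma ex_partition_of_diagram: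
  assumes S: "S \<subseteq> diagram lam"
    and down: "\<And>i j i' j'. (Suc i, Suc j) \<in> S \<Longrightarrow> i' \<le> i \<Longrightarrow> j' \<le> j \<Longrightarrow> (Suc i', Suc j') \<in> S"
  shows "\<exists>mu. is_partition mu \<and> diagram mu = S"
proof -
  define r where "r i = card {j. (Suc i, Suc j) \<in> S}" for i
  have fin: "finite {j. (Suc i, Suc j) \<in> S}" for i
    by (rule finite_subset[of _ "{..<rlen lam i}"]) (use S in \<open>auto dest!: subsetD\<close>)
  have r: "(Suc i, Suc j) \<in> S \<longleftrightarrow> j < r i" for i j
  proof
    assume "(Suc i, Suc j) \<in> S"
    then have "{..j} \<subseteq> {j. (Suc i, Suc j) \<in> S}" using down[of i j i] by auto
    from card_mono[OF fin this] show "j < r i" by (simp add: r_def)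
  next
    assume j: "j < r i"
    show "(Suc i, Suc j) \<in> S"
    proof (rule ccontr)
      assume n: "(Suc i, Suc j) \<notin> S"
      have "{j. (Suc i, Suc j) \<in> S} \<subseteq> {..<j}"
      proof
        fix k assume "k \<in> {j. (Suc i, Suc j) \<in> S}"
        then show "k \<in> {..<j}" using down[of i k i j] n by (cases "j \<le> k") auto
      qed
      from card_mono[OF _ this] show False using j by (simp add: r_def)
    qed
  qed
  have "antimono r"
  proof (rule antimonoI)
    fix i i' :: nat assume "i \<le> i'"
    have "j < r i" if "j < r i'" for j
      using down[of i' j i j] that \<open>i \<le> i'\<close> by (simp flip: r)
    then show "r i' \<le> r i" by (meson not_less order_refl)
  qed
  moreover have "r (length lam) = 0"
  proof -
    have "{j. (Suc (length lam), Suc j) \<in> S} = {}" using S by (auto dest!: subsetD)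
    then show ?thesis by (simp add: r_def)
  qed
  ultimately obtain mu where mu: "is_partition mu" "rlen mu = r" using ex_partition by blast
  have D: "diagram mu = S"
  proof (intro subset_antisym subsetI)
    fix s assume "s \<in> diagram mu"
    then show "s \<in> S" using mu(2) r by (auto elim!: in_diagramE)
  next
    fix s assume "s \<in> S"
    moreover from this obtain i j where "s = (Suc i, Suc j)" using S by (auto elim!: in_diagramE)
    ultimately show "s \<in> diagram mu" using mu(2) r by simp
  qed
  show ?thesis using mu(1) D by blast
qed

section \<open>Fillings as chains of strips\<close>

definition decreasing :: "nat \<Rightarrow> (nat \<times> nat) set \<Rightarrow> (nat \<times> nat \<Rightarrow> nat) \<Rightarrow> bool" where
  "decreasing N D T \<longleftrightarrow>
     (\<forall>i j j'. (i, j) \<in> D \<longrightarrow> (i, j') \<in> D \<longrightarrow> j < j' \<longrightarrow>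
        T (i, j) \<ge> T (i, j') \<and> (N < T (i, j) \<longrightarrow> N < T (i, j') \<longrightarrow> T (i, j) > T (i, j'))) \<and>
     (\<forall>i i' j. (i, j) \<in> D \<longrightarrow> (i', j) \<in> D \<longrightarrow> i < i' \<longrightarrow>
        T (i, j) \<ge> T (i', j) \<and> (T (i, j) \<le> N \<longrightarrow> T (i', j) \<le> N \<longrightarrow> T (i, j) > T (i', j)))"

lemma decreasing_rowD:
  assumes "decreasing N D T" "(i, j) \<in> D" "(i, j') \<in> D" "j < j'"
  shows "T (i, j') \<le> T (i, j)" "N < T (i, j) \<Longrightarrow> N < T (i, j') \<Longrightarrow> T (i, j') < T (i, j)"
  using assms unfolding decreasing_def by blast+

lemma decreasing_columnD:
  assumes "decreasing N D T" "(i, j) \<in> D" "(i', j) \<in> D" "i < i'"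
  shows "T (i', j) \<le> T (i, j)" "T (i, j) \<le> N \<Longrightarrow> T (i', j) \<le> N \<Longrightarrow> T (i', j) < T (i, j)"
  using assms unfolding decreasing_def by blast+

text \<open>A variable lower bound \<open>k\<close> for the entries lets the smallest entry be
  peeled off: removing the boxes with entry \<open>k\<close> leaves a filling with bound
  \<open>Suc k\<close>.\<close>

definition fillings :: "nat \<Rightarrow> nat \<Rightarrow> nat \<Rightarrow> nat list \<Rightarrow> (nat \<times> nat \<Rightarrow> nat) set" where
  "fillings N L k lam = {T \<in> diagram lam \<rightarrow>\<^sub>E {k..L}. decreasing N (diagram lam) T}"

lemma RSSYTT_eq_fillings: "RSSYTT N M lam = fillings N (N + M) 1 lam"
  by (simp only: RSSYTT_def fillings_def decreasing_def)

lemma finite_fillings [simp]: "finite (fillings N L k lam)"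
  unfolding fillings_def by (rule finite_subset[of _ "diagram lam \<rightarrow>\<^sub>E {k..L}"]) (auto intro: finite_PiE finite_diagram)

definition strip :: "nat \<Rightarrow> nat \<Rightarrow> nat list \<Rightarrow> nat list \<Rightarrow> bool" where
  "strip N k lam mu \<longleftrightarrow> (if k \<le> N then hstrip lam mu else vstrip lam mu)"

lemma strip_rlen: "strip N k lam mu \<Longrightarrow> rlen mu i \<le> rlen lam i"
  by (auto simp: strip_def hstrip_def vstrip_def split: if_splits)

lemma decreasing_le:
  assumes lam: "is_partition lam" and T: "decreasing N (diagram lam) T"
    and "j < rlen lam i" "i' \<le> i" "j' \<le> j"
  shows "T (Suc i, Suc j) \<le> T (Suc i', Suc j')"
proof -
  have r: "j < rlen lam i'" using rlen_le_rlen[OF lam \<open>i' \<le> i\<close>] assms by simp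
  have "T (Suc i, Suc j) \<le> T (Suc i', Suc j)"
    using T assms(3,4) r
    by (cases "i' = i") (simp_all add: decreasing_columnD)
  also have "\<dots> \<le> T (Suc i', Suc j')"
    using T assms(5) r
    by (cases "j' = j") (simp_all add: decreasing_rowD)
  finally show ?thesis .
qed

lemma nu_filling:
  assumes lam: "is_partition lam" and T: "decreasing N (diagram lam) T"
  shows "is_partition (nu lam T k)" "diagram (nu lam T k) = {s \<in> diagram lam. k \<le> T s}"
proof -
  have "\<exists>mu. is_partition mu \<and> diagram mu = {s \<in> diagram lam. k \<le> T s}"
  proof (rule ex_partition_of_diagram[of _ lam])
    fix i j i' j' assume "(Suc i, Suc j) \<in> {s \<in> diagram lam. k \<le> T s}" and le: "i' \<le> i" "j' \<le> j"
    then have *: "j < rlen lam i" "k \<le> T (Suc i, Suc j)" by auto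
    then have "j' < rlen lam i'" using rlen_le_rlen[OF lam le(1)] le(2) by simp
    then show "(Suc i', Suc j') \<in> {s \<in> diagram lam. k \<le> T s}"
      using decreasing_le[OF lam T *(1) le] *(2) by simp
  qed auto
  then obtain mu where mu: "is_partition mu" "diagram mu = {s \<in> diagram lam. k \<le> T s}" by blast
  then have "nu lam T k = mu" using shape_diagram[OF mu(1)] by (simp add: nu_def)
  with mu show "is_partition (nu lam T k)" "diagram (nu lam T k) = {s \<in> diagram lam. k \<le> T s}" by auto
qed

lemma less_rlen_nu:
  assumes "is_partition lam" "decreasing N (diagram lam) T"
  shows "j < rlen (nu lam T k) i \<longleftrightarrow> j < rlen lam i \<and> k \<le> T (Suc i, Suc j)"
proof -
  have "(Suc i, Suc j) \<in> diagram (nu lam T k) \<longleftrightarrow> (Suc i, Suc j) \<in> {s \<in> diagram lam. k \<le> T s}"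
    by (simp only: nu_filling[OF assms])
  then show ?thesis by simp
qed

lemma nat_le_by_less: "(\<And>j. j < a \<Longrightarrow> j < b) \<Longrightarrow> a \<le> (b :: nat)"
  by (meson not_less order_refl)

text \<open>The removed boxes all carry the entry \<open>k\<close>. Strictness allows at most one of
  them in a column if \<open>k\<close> is ordinary, and at most one in a row if \<open>k\<close> is
  super.\<close>

lemma strip_nu:
  assumes lam: "is_partition lam" and T: "decreasing N (diagram lam) T"
  shows "strip N k (nu lam T k) (nu lam T (Suc k))"
proof -
  note l = less_rlen_nu[OF lam T]
  have le: "rlen (nu lam T (Suc k)) i \<le> rlen (nu lam T k) i" for i
    by (rule nat_le_by_less) (simp add: l)
  show ?thesis
  proof (cases "k \<le> N")
    case True
    have "rlen (nu lam T k) (Suc i) \<le> rlen (nu lam T (Suc k)) i" for i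
    proof (rule nat_le_by_less)
      fix j assume "j < rlen (nu lam T k) (Suc i)"
      then have j: "j < rlen lam (Suc i)" "k \<le> T (Suc (Suc i), Suc j)" by (auto simp: l)
      then have j': "j < rlen lam i" using rlen_le_rlen[OF lam, of i "Suc i"] by simp
      have "T (Suc i, Suc j) \<noteq> k"
      proof
        assume eq: "T (Suc i, Suc j) = k"
        moreover have "T (Suc (Suc i), Suc j) \<le> T (Suc i, Suc j)"
          by (rule decreasing_le[OF lam T j(1)]) auto
        ultimately have "T (Suc (Suc i), Suc j) < T (Suc i, Suc j)"
          using T j(1) j' True by (intro decreasing_columnD(2)[OF T]) auto
        then show False using eq j(2) by simp
      qed
      moreover have "T (Suc (Suc i), Suc j) \<le> T (Suc i, Suc j)"
        by (rule decreasing_le[OF lam T j(1)]) auto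
      ultimately show "j < rlen (nu lam T (Suc k)) i" using j' j by (simp add: l)
    qed
    then show ?thesis using True le by (simp add: strip_def hstrip_def)
  next
    case False
    have "rlen (nu lam T k) i \<le> Suc (rlen (nu lam T (Suc k)) i)" for i
    proof (rule ccontr)
      let ?j = "rlen (nu lam T (Suc k)) i"
      assume "\<not> rlen (nu lam T k) i \<le> Suc ?j"
      then have "Suc ?j < rlen (nu lam T k) i" "?j < rlen (nu lam T k) i" by auto
      then have j: "Suc ?j < rlen lam i" "k \<le> T (Suc i, Suc (Suc ?j))" "?j < rlen lam i" "k \<le> T (Suc i, Suc ?j)"
        unfolding l by auto
      have "\<not> ?j < ?j" by simp
      then have "T (Suc i, Suc ?j) = k" using j unfolding l by auto
      moreover have "T (Suc i, Suc (Suc ?j)) \<le> T (Suc i, Suc ?j)"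
        by (rule decreasing_le[OF lam T j(1)]) auto
      ultimately have eq: "T (Suc i, Suc ?j) = k" "T (Suc i, Suc (Suc ?j)) = k" using j by auto
      have "(Suc i, Suc ?j) \<in> diagram lam" "(Suc i, Suc (Suc ?j)) \<in> diagram lam" "Suc ?j < Suc (Suc ?j)" using j by auto
      moreover have "N < T (Suc i, Suc ?j)" "N < T (Suc i, Suc (Suc ?j))" using eq False by auto
      ultimately have "T (Suc i, Suc (Suc ?j)) < T (Suc i, Suc ?j)" by (intro decreasing_rowD(2)[OF T])
      then show False using eq by simp
    qed
    then show ?thesis using False le by (simp add: strip_def vstrip_def)
  qed
qed

lemma nu_first:
  assumes "is_partition lam" "T \<in> fillings N L k lam"
  shows "nu lam T k = lam"
proof -
  have "{s \<in> diagram lam. k \<le> T s} = diagram lam" using assms(2) by (auto simp: fillings_def PiE_iff)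
  then show ?thesis using shape_diagram[OF assms(1)] by (simp add: nu_def)
qed

lemma nu_beyond:
  assumes "T \<in> fillings N L k lam" "L < l"
  shows "nu lam T l = []"
proof -
  have "{s \<in> diagram lam. l \<le> T s} = diagram []"
    using assms by (force simp: fillings_def PiE_iff diagram_def[of "[]"])
  then show ?thesis using shape_diagram[of "[]"] by (simp add: nu_def)
qed

definition extend :: "nat \<Rightarrow> nat list \<Rightarrow> nat list \<Rightarrow> (nat \<times> nat \<Rightarrow> nat) \<Rightarrow> (nat \<times> nat \<Rightarrow> nat)" where
  "extend k lam mu T = (\<lambda>s\<in>diagram lam. if s \<in> diagram mu then T s else k)"

lemma restrict_filling:
  assumes lam: "is_partition lam" and T: "T \<in> fillings N L k lam" and mu: "mu = nu lam T (Suc k)"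
  shows "restrict T (diagram mu) \<in> fillings N L (Suc k) mu" "extend k lam mu (restrict T (diagram mu)) = T"
    "Suc k \<le> l \<Longrightarrow> nu mu (restrict T (diagram mu)) l = nu lam T l"
proof -
  have dec: "decreasing N (diagram lam) T" using T by (simp add: fillings_def)
  note d = nu_filling[OF lam dec]
  have sub: "diagram mu \<subseteq> diagram lam" unfolding mu d by auto
  have "decreasing N (diagram mu) (restrict T (diagram mu))"
    using dec sub unfolding decreasing_def by (auto simp: subset_iff)
  moreover have "restrict T (diagram mu) \<in> diagram mu \<rightarrow>\<^sub>E {Suc k..L}"
    using T unfolding mu d by (auto simp: fillings_def PiE_iff)
  ultimately show "restrict T (diagram mu) \<in> fillings N L (Suc k) mu" by (simp add: fillings_def)
  show "extend k lam mu (restrict T (diagram mu)) = T"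
  proof (rule extensionalityI[of _ "diagram lam"])
    fix s assume s: "s \<in> diagram lam"
    then have "k \<le> T s" using T by (auto simp: fillings_def PiE_iff)
    then show "extend k lam mu (restrict T (diagram mu)) s = T s"
      using s unfolding extend_def mu d by auto
  qed (use T in \<open>auto simp: extend_def fillings_def PiE_iff\<close>)
  assume "Suc k \<le> l"
  then have "{s \<in> diagram mu. l \<le> restrict T (diagram mu) s} = {s \<in> diagram lam. l \<le> T s}"
    unfolding mu d by auto
  then show "nu mu (restrict T (diagram mu)) l = nu lam T l" by (simp add: nu_def)
qed

text \<open>The boxes of \<open>mu\<close> carry entries above \<open>k\<close>, so only strictness
  among the new boxes is at stake. The strip condition keeps these apart in columns for ordinary
  \<open>k\<close> and in rows for super \<open>k\<close>.\<close>

lemma extend_filling: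
  assumes lam: "is_partition lam" and mu: "is_partition mu" and T: "T \<in> fillings N L (Suc k) mu"
    and strip: "strip N k lam mu" and k: "k \<le> L"
  shows "extend k lam mu T \<in> fillings N L k lam" "nu lam (extend k lam mu T) (Suc k) = mu"
    "restrict (extend k lam mu T) (diagram mu) = T"
proof -
  let ?E = "extend k lam mu T"
  have sub: "diagram mu \<subseteq> diagram lam" using strip_rlen[OF strip] diagram_subset_iff by simp
  have dec: "decreasing N (diagram mu) T" using T by (simp add: fillings_def)
  have Tk: "Suc k \<le> T s" "T s \<le> L" if "s \<in> diagram mu" for s using T that by (auto simp: fillings_def PiE_iff)
  have E: "?E s = (if s \<in> diagram mu then T s else k)" if "s \<in> diagram lam" for s
    using that by (simp add: extend_def)
  have Ek: "k \<le> ?E s" if "s \<in> diagram lam" for s using E[OF that] Tk(1)[of s] by auto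
  have rows: "?E (i, j) \<ge> ?E (i, j') \<and> (N < ?E (i, j) \<longrightarrow> N < ?E (i, j') \<longrightarrow> ?E (i, j) > ?E (i, j'))"
    if ij: "(i, j) \<in> diagram lam" and ij': "(i, j') \<in> diagram lam" and "j < j'" for i j j'
  proof -
    obtain a b c where s: "i = Suc a" "j = Suc b" "j' = Suc c" "b < c" "c < rlen lam a"
      using ij ij' \<open>j < j'\<close> by (auto elim!: in_diagramE)
    show ?thesis
    proof (cases "(i, j') \<in> diagram mu")
      case True
      then have ij_mu: "(i, j) \<in> diagram mu" using s by simp
      have "T (i, j) \<ge> T (i, j') \<and> (N < T (i, j) \<longrightarrow> N < T (i, j') \<longrightarrow> T (i, j) > T (i, j'))"
        using dec ij_mu True \<open>j < j'\<close> unfolding decreasing_def by blast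
      then show ?thesis using E[OF ij] E[OF ij'] True ij_mu by simp
    next
      case False
      then have e: "?E (i, j') = k" using E[OF ij'] by simp
      have "k < ?E (i, j)" if "N < k"
      proof -
        have "rlen lam a \<le> Suc (rlen mu a)" using strip that by (simp add: strip_def vstrip_def)
        then have "(i, j) \<in> diagram mu" using s by simp
        then show ?thesis using E[OF ij] Tk(1)[of "(i, j)"] by simp
      qed
      then show ?thesis using e Ek[OF ij] by simp
    qed
  qed
  have cols: "?E (i, j) \<ge> ?E (i', j) \<and> (?E (i, j) \<le> N \<longrightarrow> ?E (i', j) \<le> N \<longrightarrow> ?E (i, j) > ?E (i', j))"
    if ij: "(i, j) \<in> diagram lam" and ij': "(i', j) \<in> diagram lam" and "i < i'" for i i' j
  proof -
    obtain a b c where s: "i = Suc a" "i' = Suc b" "j = Suc c" "a < b" "c < rlen lam b"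
      using ij ij' \<open>i < i'\<close> by (auto elim!: in_diagramE)
    show ?thesis
    proof (cases "(i', j) \<in> diagram mu")
      case True
      then have ij_mu: "(i, j) \<in> diagram mu" using s rlen_le_rlen[OF mu, of a b] by simp
      have "T (i, j) \<ge> T (i', j) \<and> (T (i, j) \<le> N \<longrightarrow> T (i', j) \<le> N \<longrightarrow> T (i, j) > T (i', j))"
        using dec ij_mu True \<open>i < i'\<close> unfolding decreasing_def by blast
      then show ?thesis using E[OF ij] E[OF ij'] True ij_mu by simp
    next
      case False
      then have e: "?E (i', j) = k" using E[OF ij'] by simp
      have "k < ?E (i, j)" if "k \<le> N"
      proof -
        have "rlen lam (Suc a) \<le> rlen mu a" using strip that by (simp add: strip_def hstrip_def)
        then have "(i, j) \<in> diagram mu" using s rlen_le_rlen[OF lam, of "Suc a" b] by simp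
        then show ?thesis using E[OF ij] Tk(1)[of "(i, j)"] by simp
      qed
      then show ?thesis using e Ek[OF ij] by simp
    qed
  qed
  have "decreasing N (diagram lam) ?E" unfolding decreasing_def using rows cols by blast
  moreover have "?E \<in> diagram lam \<rightarrow>\<^sub>E {k..L}"
  proof (rule PiE_I)
    fix s assume "s \<in> diagram lam"
    then show "?E s \<in> {k..L}" using E Ek Tk(2)[of s] k by auto
  qed (simp add: extend_def)
  ultimately show "?E \<in> fillings N L k lam" by (simp add: fillings_def)
  have "{s \<in> diagram lam. Suc k \<le> ?E s} = diagram mu"
    using sub E Tk(1) by (auto split: if_splits)
  then show "nu lam ?E (Suc k) = mu" using shape_diagram[OF mu] by (simp add: nu_def)
  show "restrict ?E (diagram mu) = T"
  proof (rule extensionalityI[of _ "diagram mu"])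
    fix s assume "s \<in> diagram mu"
    then show "restrict ?E (diagram mu) s = T s" using E[OF subsetD[OF sub]] by simp
  qed (use T in \<open>auto simp: fillings_def PiE_iff\<close>)
qed

section \<open>Weights of fillings and the final comparison\<close>

context macdonald_parameters
begin

text \<open>The power of \<open>-t\<close> on a super level is its share of the ratio of the
  \<open>H\<close>-products; it makes \<open>-t y\<close> the super variable in the sense of
  \<open>cstep\<close>.\<close>

definition level_coeff :: "nat \<Rightarrow> nat \<Rightarrow> nat list \<Rightarrow> nat list \<Rightarrow> complex" where
  "level_coeff N k lam mu = (if k \<le> N then bmat lam mu
     else cmat lam mu * (- t) ^ (sum_list lam - sum_list mu))"

lemma level_coeff_nonzeroD: "level_coeff N k lam mu \<noteq> 0 \<Longrightarrow> strip N k lam mu"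
  using bmat_nonzeroD(1) cmat_nonzeroD(1) by (auto simp: level_coeff_def strip_def split: if_splits)

definition filling_weight :: "nat \<Rightarrow> nat \<Rightarrow> nat \<Rightarrow> nat list \<Rightarrow> (nat \<times> nat \<Rightarrow> nat) \<Rightarrow> polynomial" where
  "filling_weight N L k lam T =
     polyconst (\<Prod>j=k..L. level_coeff N j (nu lam T j) (nu lam T (Suc j))) * (\<Prod>s\<in>diagram lam. polyvar (T s))"

definition filling_sum :: "nat \<Rightarrow> nat \<Rightarrow> nat \<Rightarrow> nat list \<Rightarrow> polynomial" where
  "filling_sum N L k lam = (\<Sum>T\<in>fillings N L k lam. filling_weight N L k lam T)"

lemma filling_weight_step:
  assumes lam: "is_partition lam" and T: "T \<in> fillings N L k lam" and mu: "mu = nu lam T (Suc k)" and k: "k \<le> L"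
  shows "filling_weight N L k lam T = polyconst (level_coeff N k lam mu) *
    polyvar k ^ (sum_list lam - sum_list mu) * filling_weight N L (Suc k) mu (restrict T (diagram mu))"
proof -
  let ?R = "restrict T (diagram mu)"
  note r = restrict_filling[OF lam T mu]
  have dec: "decreasing N (diagram lam) T" using T by (simp add: fillings_def)
  note d = nu_filling[OF lam dec]
  have sub: "diagram mu \<subseteq> diagram lam" unfolding mu d by auto
  have pm: "is_partition mu" unfolding mu by (rule d)
  have "(\<Prod>j=k..L. level_coeff N j (nu lam T j) (nu lam T (Suc j))) = level_coeff N k lam mu *
      (\<Prod>j=Suc k..L. level_coeff N j (nu lam T j) (nu lam T (Suc j)))"
    using k nu_first[OF lam T] by (simp add: prod.atLeast_Suc_atMost mu)
  also have "(\<Prod>j=Suc k..L. level_coeff N j (nu lam T j) (nu lam T (Suc j))) =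
      (\<Prod>j=Suc k..L. level_coeff N j (nu mu ?R j) (nu mu ?R (Suc j)))"
    by (intro prod.cong refl) (simp add: r(3))
  finally have 1: "(\<Prod>j=k..L. level_coeff N j (nu lam T j) (nu lam T (Suc j))) = level_coeff N k lam mu *
      (\<Prod>j=Suc k..L. level_coeff N j (nu mu ?R j) (nu mu ?R (Suc j)))" .
  have "(\<Prod>s\<in>diagram lam - diagram mu. polyvar (T s)) = (\<Prod>s\<in>diagram lam - diagram mu. polyvar k)"
  proof (rule prod.cong[OF refl])
    fix s assume "s \<in> diagram lam - diagram mu"
    then have "k \<le> T s" "\<not> Suc k \<le> T s" using T unfolding mu d by (auto simp: fillings_def PiE_iff)
    then show "polyvar (T s) = polyvar k" by (simp add: not_less_eq_eq)
  qed
  also have "\<dots> = polyvar k ^ (sum_list lam - sum_list mu)"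
    using card_Diff_subset[OF finite_diagram sub] by (simp add: card_diagram)
  finally have 2: "(\<Prod>s\<in>diagram lam - diagram mu. polyvar (T s)) = polyvar k ^ (sum_list lam - sum_list mu)" .
  have 3: "(\<Prod>s\<in>diagram mu. polyvar (T s)) = (\<Prod>s\<in>diagram mu. polyvar (?R s))"
    by (intro prod.cong refl) simp
  show ?thesis
    unfolding filling_weight_def 1 polyconst.c_mult prod.subset_diff[OF sub finite_diagram] 2 3 by (simp only: mult_ac)
qed

text \<open>A filling corresponds to the shape of its entries above \<open>k\<close> together with a
  filling of that shape. Shapes that are not inner shapes of a strip have coefficient zero, so the
  sum may run over all partitions of bounded size.\<close>

lemma filling_sum_step:
  assumes lam: "is_partition lam" and k: "k \<le> L"
  shows "filling_sum N L k lam = (\<Sum>mu\<in>partitions_upto (sum_list lam).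
    polyconst (level_coeff N k lam mu) * polyvar k ^ (sum_list lam - sum_list mu) * filling_sum N L (Suc k) mu)"
proof -
  define A where "A = {mu \<in> partitions_upto (sum_list lam). strip N k lam mu}"
  have finA: "finite A" by (simp add: A_def)
  let ?h = "\<lambda>mu T. polyconst (level_coeff N k lam mu) * polyvar k ^ (sum_list lam - sum_list mu) * filling_weight N L (Suc k) mu T"
  have "(\<Sum>mu\<in>partitions_upto (sum_list lam).
      polyconst (level_coeff N k lam mu) * polyvar k ^ (sum_list lam - sum_list mu) * filling_sum N L (Suc k) mu) =
      (\<Sum>mu\<in>A. polyconst (level_coeff N k lam mu) * polyvar k ^ (sum_list lam - sum_list mu) * filling_sum N L (Suc k) mu)"
  proof (rule sum.mono_neutral_right[OF finite_partitions_upto])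
    show "A \<subseteq> partitions_upto (sum_list lam)" by (simp add: A_def)
    show "\<forall>mu\<in>partitions_upto (sum_list lam) - A.
        polyconst (level_coeff N k lam mu) * polyvar k ^ (sum_list lam - sum_list mu) * filling_sum N L (Suc k) mu = 0"
    proof
      fix mu assume "mu \<in> partitions_upto (sum_list lam) - A"
      then have "level_coeff N k lam mu = 0" using level_coeff_nonzeroD unfolding A_def by blast
      then show "polyconst (level_coeff N k lam mu) * polyvar k ^ (sum_list lam - sum_list mu) * filling_sum N L (Suc k) mu = 0"
        by (simp add: polyconst.c_0)
    qed
  qed
  also have "\<dots> = (\<Sum>mu\<in>A. \<Sum>T\<in>fillings N L (Suc k) mu. ?h mu T)"
    by (simp only: filling_sum_def sum_distrib_left)
  also have "\<dots> = (\<Sum>(mu, T)\<in>Sigma A (fillings N L (Suc k)). ?h mu T)"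
    by (rule sum.Sigma) (simp_all add: finA)
  also have "\<dots> = (\<Sum>T\<in>fillings N L k lam. filling_weight N L k lam T)"
  proof (rule sum.reindex_bij_witness[where
        i = "\<lambda>T. (nu lam T (Suc k), restrict T (diagram (nu lam T (Suc k))))" and j = "\<lambda>(mu, T). extend k lam mu T"])
    fix z assume "z \<in> Sigma A (fillings N L (Suc k))"
    then obtain mu T where z: "z = (mu, T)" "is_partition mu" "strip N k lam mu" "T \<in> fillings N L (Suc k) mu"
      by (auto simp: A_def partitions_upto_def)
    note e = extend_filling[OF lam z(2,4,3) k]
    show "(nu lam (case z of (mu, T) \<Rightarrow> extend k lam mu T) (Suc k),
        restrict (case z of (mu, T) \<Rightarrow> extend k lam mu T) (diagram (nu lam (case z of (mu, T) \<Rightarrow> extend k lam mu T) (Suc k)))) = z"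
      by (simp add: z(1) e)
    show "(case z of (mu, T) \<Rightarrow> extend k lam mu T) \<in> fillings N L k lam"
      by (simp add: z(1) e)
    show "filling_weight N L k lam (case z of (mu, T) \<Rightarrow> extend k lam mu T) = (case z of (mu, T) \<Rightarrow> ?h mu T)"
      using filling_weight_step[OF lam e(1) e(2)[symmetric] k] by (simp add: z(1) e(3))
  next
    fix T assume T: "T \<in> fillings N L k lam"
    let ?mu = "nu lam T (Suc k)"
    have dec: "decreasing N (diagram lam) T" using T by (simp add: fillings_def)
    have st: "strip N k lam ?mu" using strip_nu[OF lam dec, of k] nu_first[OF lam T] by simp
    note r = restrict_filling[OF lam T refl]
    show "(case (?mu, restrict T (diagram ?mu)) of (mu, T) \<Rightarrow> extend k lam mu T) = T"
      using r(2) by simp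
    have "?mu \<in> A"
      unfolding A_def partitions_upto_def
      using st nu_filling(1)[OF lam dec] sum_list_mono_rlen[OF strip_rlen[OF st]] by simp
    then show "(?mu, restrict T (diagram ?mu)) \<in> Sigma A (fillings N L (Suc k))"
      using r(1) by simp
  qed
  finally show ?thesis by (simp add: filling_sum_def)
qed

lemma filling_sum_beyond:
  assumes "is_partition lam"
  shows "filling_sum N L (Suc L) lam = (if lam = [] then 1 else 0)"
proof (cases "lam = []")
  case True
  have "diagram [] = {}" by (simp add: diagram_def)
  then have "fillings N L (Suc L) [] = {\<lambda>_. undefined}" by (auto simp: fillings_def decreasing_def)
  then show ?thesis using True \<open>diagram [] = {}\<close> by (simp add: filling_sum_def filling_weight_def polyconst.c_1)
next
  case False
  then have "card (diagram lam) \<noteq> 0"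
    unfolding card_diagram using length_le_sum_list[OF assms] by (metis le_zero_eq length_0_conv)
  then have "diagram lam \<noteq> {}" by auto
  then have "fillings N L (Suc L) lam = {}" by (auto simp: fillings_def PiE_iff)
  then show ?thesis using False by (simp add: filling_sum_def)
qed

lemma pieri_cong:
  assumes "pieri c e Q" "\<And>lam. is_partition lam \<Longrightarrow> Q' lam = Q lam"
  shows "pieri c e Q'"
proof -
  have "(\<Sum>lam\<in>partitions_upto K. c (egraded r mu lam) * Q' lam) = (\<Sum>lam\<in>partitions_upto K. c (egraded r mu lam) * Q lam)"
    for r mu K
    by (intro sum.cong refl) (simp add: partitions_upto_def assms(2))
  then show ?thesis using assms unfolding pieri_def by simp
qed

definition level_psum :: "nat \<Rightarrow> nat \<Rightarrow> nat \<Rightarrow> polynomial" where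
  "level_psum N k m = (if k \<le> N then polyvar k ^ Suc m
     else polyconst ((1 - q ^ Suc m) / (1 - inverse t ^ Suc m)) * polyvar k ^ Suc m)"

text \<open>For \<open>z = -t x\<close> the term \<open>(-1)^(n-1) (1 - q^n)/(1 - t^n) z^n\<close>
  becomes \<open>(1 - q^n)/(1 - t^(-n)) x^n\<close>, the contribution that the homomorphism
  prescribes.\<close>

lemma newton_super_variable:
  "newton (\<lambda>m. polyconst ((1 - q ^ Suc m) / (1 - inverse t ^ Suc m)) * x ^ Suc m)
     (\<lambda>r. polyconst (Phi r) * (polyconst (- t) * x) ^ r)"
proof -
  have "polyconst ((- 1) ^ m * kappa (Suc m)) * (polyconst (- t) * x) ^ Suc m =
      polyconst ((1 - q ^ Suc m) / (1 - inverse t ^ Suc m)) * x ^ Suc m" for m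
  proof -
    define T where "T = t ^ Suc m"
    have T: "T \<noteq> 0" using t_nonzero by (simp add: T_def)
    have "(- 1) ^ m * kappa (Suc m) * (- t) ^ Suc m = - (kappa (Suc m) * T)"
    proof -
      have "(- 1) ^ m * (- t) ^ Suc m = - T" by (simp add: T_def power_minus[of t] flip: power_add mult_2)
      then show ?thesis by (metis (no_types, lifting) mult.assoc mult.commute mult_minus_right)
    qed
    also have "\<dots> = - ((1 - q ^ Suc m) / (1 - T) * T)" by (simp add: kappa_def T_def)
    also have "\<dots> = (1 - q ^ Suc m) / (1 - inverse T)"
    proof -
      have "1 - inverse T = - ((1 - T) / T)" using T by (simp add: field_simps)
      then show ?thesis
        by (simp only: minus_divide_right[symmetric] divide_divide_eq_right times_divide_eq_left)
    qed
    finally have "(- 1) ^ m * kappa (Suc m) * (- t) ^ Suc m = (1 - q ^ Suc m) / (1 - inverse t ^ Suc m)"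
      by (simp only: T_def power_inverse)
    then show ?thesis
      by (simp only: power_mult_distrib polyconst.c_power[symmetric] mult.assoc[symmetric] polyconst.c_mult[symmetric])
  qed
  then show ?thesis using newton_Phi[OF polyconst.scalar_hom_axioms, of "polyconst (- t) * x"] by (simp only:)
qed

text \<open>Downward induction on the smallest admissible entry, starting with no entries. The
  elementary functions \<open>e\<close> stay implicit, as Newton's identities tie them to the power
  sums.\<close>

lemma pieri_filling_sum:
  assumes "k \<le> Suc L"
  shows "\<exists>e. pieri polyconst e (filling_sum N L k) \<and> newton (\<lambda>m. \<Sum>j=k..L. level_psum N j m) e"
  using assms
proof (induction k rule: inc_induct)
  case base
  have "pieri polyconst (\<lambda>r. if r = 0 then 1 else 0) (filling_sum N L (Suc L))"
    by (rule pieri_cong[OF pieri_one[OF polyconst.scalar_hom_axioms]]) (rule filling_sum_beyond)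
  then show ?case using newton_one by auto
next
  case (step k)
  then obtain e where e: "pieri polyconst e (filling_sum N L (Suc k))" "newton (\<lambda>m. \<Sum>j=Suc k..L. level_psum N j m) e"
    by blast
  have k: "k \<le> L" using step by simp
  have s: "(\<lambda>m. \<Sum>j=k..L. level_psum N j m) = (\<lambda>m. (\<Sum>j=Suc k..L. level_psum N j m) + level_psum N k m)"
    using k by (simp add: fun_eq_iff sum.atLeast_Suc_atMost add.commute)
  show ?case
  proof (cases "k \<le> N")
    case True
    have "pieri polyconst (\<lambda>r. e r + (if r = 0 then 0 else polyvar k * e (r - 1))) (filling_sum N L k)"
      by (rule pieri_cong[OF pieri_bstep[OF polyconst.scalar_hom_axioms e(1)]])
         (simp add: bstep_def filling_sum_step[OF _ k] level_coeff_def True)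
    moreover have "newton (\<lambda>m. \<Sum>j=k..L. level_psum N j m) (\<lambda>r. e r + (if r = 0 then 0 else polyvar k * e (r - 1)))"
      using newton_add_variable[OF e(2), of "polyvar k"] True by (simp only: s level_psum_def[of N k] if_True)
    ultimately show ?thesis by blast
  next
    case False
    let ?e = "\<lambda>r. \<Sum>i\<le>r. e i * (polyconst (Phi (r - i)) * (polyconst (- t) * polyvar k) ^ (r - i))"
    have "pieri polyconst ?e (filling_sum N L k)"
      by (rule pieri_cong[OF pieri_cstep[OF polyconst.scalar_hom_axioms e(1)]])
         (simp add: cstep_def filling_sum_step[OF _ k] level_coeff_def False power_mult_distrib
           polyconst.c_mult polyconst.c_power mult.assoc)
    moreover have "newton (\<lambda>m. \<Sum>j=k..L. level_psum N j m) ?e"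
      using newton_mult[OF e(2) newton_super_variable[of "polyvar k"]] False by (simp only: s level_psum_def[of N k] if_False)
    ultimately show ?thesis by blast
  qed
qed

lemma sum_level_psum: "(\<Sum>j=1..N + M. level_psum N j m) = super_psum N M m"
proof -
  have "(\<Sum>j=1..N + M. level_psum N j m) = (\<Sum>j=1..N. level_psum N j m) + (\<Sum>j=N+1..N + M. level_psum N j m)"
    by (rule sum.ub_add_nat) simp
  also have "(\<Sum>j=N+1..N + M. level_psum N j m) = (\<Sum>j=1..M. level_psum N (N + j) m)"
    using sum.shift_bounds_cl_nat_ivl[of "\<lambda>j. level_psum N j m" 1 N M] by (simp add: add.commute)
  finally show ?thesis by (simp add: level_psum_def super_psum_def sum_distrib_left)
qed

lemma prod_ratio:
  fixes f :: "nat \<Rightarrow> complex"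
  assumes "a \<le> Suc b" "\<And>k. f k \<noteq> 0"
  shows "(\<Prod>k=a..b. f (Suc k) / f k) = f (Suc b) / f a"
  using assms(1)
proof (induction b)
  case 0
  then show ?case using assms(2) by (cases a) auto
next
  case (Suc b)
  show ?case
  proof (cases "a \<le> Suc b")
    case True
    then show ?thesis using Suc.IH assms(2) by simp
  next
    case False
    then have "a = Suc (Suc b)" using Suc.prems by simp
    then show ?thesis using assms(2) by simp
  qed
qed

text \<open>The norms in \<open>cmat\<close> and the powers of \<open>-t\<close> telescope over the
  super levels, from the super shape to the empty shape. Their value at the super shape is the ratio
  of the \<open>H\<close>-products.\<close>

lemma quantum_corner_weight:
  assumes lam: "is_partition lam" and T: "T \<in> fillings N (N + M) 1 lam"
  shows "psi_super N M t q lam T * psi_ordinary N q t lam T *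
    (H (super_shape N lam T) q (inverse t) / H (transpose_partition (super_shape N lam T)) (inverse t) q) =
    (\<Prod>j=1..N + M. level_coeff N j (nu lam T j) (nu lam T (Suc j)))"
proof -
  have dec: "decreasing N (diagram lam) T" using T by (simp add: fillings_def)
  let ?nu = "nu lam T"
  define F where "F k = bnorm (?nu k) / (- t) ^ sum_list (?nu k)" for k
  have F0: "F k \<noteq> 0" for k using t_nonzero by (simp add: F_def)
  have st: "strip N k (?nu k) (?nu (Suc k))" for k by (rule strip_nu[OF lam dec])
  have "(\<Prod>j=1..N + M. level_coeff N j (?nu j) (?nu (Suc j))) =
      (\<Prod>j=1..N. level_coeff N j (?nu j) (?nu (Suc j))) * (\<Prod>j=N+1..N + M. level_coeff N j (?nu j) (?nu (Suc j)))"
    by (rule prod.ub_add_nat) simp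
  also have "(\<Prod>j=1..N. level_coeff N j (?nu j) (?nu (Suc j))) = psi_ordinary N q t lam T"
    unfolding psi_ordinary_def by (intro prod.cong refl) (use st in \<open>simp add: level_coeff_def bmat_def strip_def\<close>)
  also have "(\<Prod>j=N+1..N + M. level_coeff N j (?nu j) (?nu (Suc j))) =
      (\<Prod>j=N+1..N + M. psi t q (transpose_partition (?nu j)) (transpose_partition (?nu (j + 1))) * (F (Suc j) / F j))"
  proof (rule prod.cong[OF refl])
    fix j assume "j \<in> {N + 1..N + M}"
    then have j: "\<not> j \<le> N" by simp
    then have v: "vstrip (?nu j) (?nu (Suc j))" using st[of j] by (simp add: strip_def)
    have "(- t) ^ sum_list (?nu j) = (- t) ^ (sum_list (?nu j) - sum_list (?nu (Suc j))) * (- t) ^ sum_list (?nu (Suc j))"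
      using vstrip_sum_list[OF v] by (simp flip: power_add)
    then have "bnorm (?nu (Suc j)) / bnorm (?nu j) * (- t) ^ (sum_list (?nu j) - sum_list (?nu (Suc j))) = F (Suc j) / F j"
      using t_nonzero by (simp add: F_def)
    then show "level_coeff N j (?nu j) (?nu (Suc j)) =
        psi t q (transpose_partition (?nu j)) (transpose_partition (?nu (j + 1))) * (F (Suc j) / F j)"
      using j v by (simp add: level_coeff_def cmat_def emat_def mult.assoc flip: times_divide_eq_right)
  qed
  also have "\<dots> = psi_super N M t q lam T * (F (Suc (N + M)) / F (N + 1))"
    unfolding prod.distrib psi_super_def by (subst prod_ratio) (auto simp: F0)
  also have "F (Suc (N + M)) = 1"
    unfolding F_def by (simp add: nu_beyond[OF T] bnorm_def)
  also have "1 / F (N + 1) = H (super_shape N lam T) q (inverse t) / H (transpose_partition (super_shape N lam T)) (inverse t) q"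
  proof -
    have "super_shape N lam T = ?nu (N + 1)" by (simp add: super_shape_def nu_def Suc_le_eq)
    then show ?thesis using H_ratio[OF nu_filling(1)[OF lam dec]] by (simp add: F_def)
  qed
  finally show ?thesis by (simp add: mult_ac)
qed

lemma quantum_corner_filling_sum:
  "is_partition lam \<Longrightarrow> quantum_corner N M q t lam = filling_sum N (N + M) 1 lam"
  unfolding quantum_corner_def RSSYTT_eq_fillings filling_sum_def filling_weight_def
  by (intro sum.cong refl) (simp only: quantum_corner_weight)

lemma quantum_corner_super_macdonald:
  assumes "is_partition lam"
  shows "quantum_corner N M q t lam = super_macdonald N M q t lam"
proof -
  have "1 \<le> Suc (N + M)" by simp
  from pieri_filling_sum[OF this, of N] obtain e where
    e: "pieri polyconst e (filling_sum N (N + M) 1)" "newton (\<lambda>m. super_psum N M m) e"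
    unfolding sum_level_psum by blast
  show ?thesis
    unfolding quantum_corner_filling_sum[OF assms] super_macdonald_lift[OF assms]
    by (rule lift_Phat[OF polyconst.scalar_hom_axioms e assms, symmetric])
qed

end

theorem proposition3p22:
  fixes q t :: complex and N M :: nat and lam :: "nat list"
  assumes "generic_parameters q t"
    and "(N, M) \<noteq> (0, 0)"
    and "is_partition lam"
  shows "quantum_corner N M q t lam = super_macdonald N M q t lam"
  using assms macdonald_parameters.quantum_corner_super_macdonald by (simp add: macdonald_parameters_def)

end
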